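(* Let $\Omega\subset\mathbb{C}^n$ be a bounded pseudoconvex domain with smooth boundary. Then the Diederich--Fornæss index of $\Omega$ equals the Diederich--Fornæss index of the hypersurface $\partial\Omega$ (both indices are defined in the context).
   Context: **Defining functions and the index of a domain.** A defining function of $\Omega$ is a real function $\rho$ which is $C^2$ on a neighborhood of $\overline\Omega$, with $\Omega=\{z\in\mathbb{C}^n:\rho(z)<0\}$ and $\nabla\rho\neq0$ on $\partial\Omega$. A number $0<\tau_\rho<1$ is a Diederich--Fornæss exponent if there is a defining function $\rho$ of $\Omega$ such that $-(-\rho)^{\tau_\rho}$ is plurisubharmonic in $\Omega$. The Diederich--Fornæss index of the domain $\Omega$ is $\sup\tau_\rho$, the supremum being taken over all defining functions of $\Omega$ (and all such exponents). **Notation.** $g$ is the Euclidean metric of $\mathbb{C}^n=\mathbb{R}^{2n}$, extended to complexified tangent vectors to be linear in the first and conjugate-linear in the second argument, so $g(\partial_{z_j},\partial_{z_k})=\tfrac12\delta_{jk}$. $\nabla_X$ is the flat covariant derivative (complex-linear in $X$), and $\nabla f$ is the real gradient of a real function $f$, with norm $\|\nabla f\|=2\big(\sum_j|\partial f/\partial z_j|^2\big)^{1/2}$. $\mathrm{Hess}_f(X,Y)=g(\nabla_X\nabla f,Y)$; for $(1,0)$ vectors $X=\sum X_j\partial_{z_j}$, $Y=\sum Y_k\partial_{z_k}$ this is $\sum_{j,k}\frac{\partial^2 f}{\partial z_j\partial\bar z_k}X_j\overline{Y_k}$. For a smooth defining function $r$, $$N_r=\Big(\sum_j\Big|\frac{\partial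 r}{\partial z_j}\Big|^2\Big)^{-1/2}\sum_{j}\frac{\partial r}{\partial\bar z_j}\frac{\partial}{\partial z_j},\qquad N_rr=\frac{\|\nabla r\|}{2}.$$ If $N_r=\sum_k N_k\partial_{z_k}$ and $L=\sum_i L_i\partial_{z_i}$, then $g(\nabla_L\nabla_{N_r}\nabla r,L)=\sum_{i,j}L_i\,\frac{\partial}{\partial z_i}\Big(\sum_kN_k\frac{\partial^2r}{\partial z_k\partial\bar z_j}\Big)\overline{L_j}$. **The index of a hypersurface.** Let $\Pi=\partial\Omega$ be the smooth bounded pseudoconvex hypersurface, and let $r$ be a smooth defining function for it. Let $\Sigma\subset\Pi$ be the set of points at which the Levi form is degenerate. For a smooth $(1,0)$ tangent vector field $L$ on $\Pi$ (possibly vanishing at some points) put $\Sigma_L=\{p\in\Pi:\mathrm{Hess}_r(L,L)=0\text{ at }p\}$. For a smooth real function $\psi$ defined on a neighborhood of $\Sigma$ in $\Pi$, let $\eta_\psi\in(0,1)$ be a number such that, for all smooth $(1,0)$ tangent vector fields $L$ on $\Pi$, the following holds on $\Sigma_L$: $$\Big(\frac1{1-\eta_\psi}-1\Big)\big|(\overline L\psi)(N_rr)+\mathrm{Hess}_r(N_r,L)\big|^2+\frac{\|\nabla r\|}2\Big(\frac{\|\nabla r\|}2\mathrm{Hess}_\psi(L,L)+g(\nabla_L\nabla_{N_r}\nabla r,L)+\|\nabla r\|\,L\Big(\frac1{\|\nabla r\|}\Big)\mathrm{Hess}_r(N_r,L)\Big)\le0.$$ The Diederich--Fornæss index of $\Pi$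 is $\sup_\psi\eta_\psi$, over all such $\psi$ and $\eta_\psi$. (Here $\mathrm{Hess}_\psi(L,L)$ is computed from any smooth extension of $\psi$ to an open set of $\mathbb{C}^n$; at points of $\Sigma_L$ the value does not depend on the extension.) *)

theory Defs
  imports "HOL-Analysis.Analysis"
begin

text \<open>
  Complex Euclidean space of dimension n is \<^typ>\<open>complex ^ 'n\<close>, and differentiability is always
  real (Frechet) differentiability.  Differentiability classes are only used on open sets.
\<close>

primrec Ck_on :: "nat \<Rightarrow> 'a::real_normed_vector set \<Rightarrow> ('a \<Rightarrow> 'b::real_normed_vector) \<Rightarrow> bool" where
  "Ck_on 0 U f \<longleftrightarrow> continuous_on U f"
| "Ck_on (Suc k) U f \<longleftrightarrow>
     (\<forall>x\<in>U. f differentiable (at x)) \<and> (\<forall>v. Ck_on k U (\<lambda>x. frechet_derivative f (at x) v))"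

definition smooth_on :: "'a::real_normed_vector set \<Rightarrow> ('a \<Rightarrow> 'b::real_normed_vector) \<Rightarrow> bool" where
  "smooth_on U f \<longleftrightarrow> (\<forall>k. Ck_on k U f)"

text \<open>
  \<open>F\<close> is a smooth extension of \<open>f\<close>, a function on \<open>S\<close>, to the open neighbourhood \<open>U\<close> of \<open>p\<close>;
  a function on a (relatively open subset of a) hypersurface is smooth if it has such local
  extensions.
\<close>

definition smooth_extension_at ::
  "'a::real_normed_vector set \<Rightarrow> ('a \<Rightarrow> 'b::real_normed_vector) \<Rightarrow> 'a \<Rightarrow> 'a set \<Rightarrow> ('a \<Rightarrow> 'b) \<Rightarrow> bool" where
  "smooth_extension_at S f p U F \<longleftrightarrow>
     open U \<and> p \<in> U \<and> smooth_on U F \<and> (\<forall>q\<in>U \<inter> S. F q = f q)"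

definition smooth_on_subset ::
  "'a::real_normed_vector set \<Rightarrow> ('a \<Rightarrow> 'b::real_normed_vector) \<Rightarrow> bool" where
  "smooth_on_subset S f \<longleftrightarrow> (\<forall>p\<in>S. \<exists>U F. smooth_extension_at S f p U F)"

definition d_z :: "'n::finite \<Rightarrow> (complex ^ 'n \<Rightarrow> complex) \<Rightarrow> complex ^ 'n \<Rightarrow> complex" where
  "d_z j f p = (frechet_derivative f (at p) (axis j 1)
      - \<i> * frechet_derivative f (at p) (axis j \<i>)) / 2"

definition d_zbar :: "'n::finite \<Rightarrow> (complex ^ 'n \<Rightarrow> complex) \<Rightarrow> complex ^ 'n \<Rightarrow> complex" where
  "d_zbar j f p = (frechet_derivative f (at p) (axis j 1)
      + \<i> * frechet_derivative f (at p) (axis j \<i>)) / 2"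

abbreviation cplx :: "('a \<Rightarrow> real) \<Rightarrow> 'a \<Rightarrow> complex" where
  "cplx f \<equiv> (\<lambda>w. complex_of_real (f w))"

definition gradient :: "('a::euclidean_space \<Rightarrow> real) \<Rightarrow> 'a \<Rightarrow> 'a" where
  "gradient f p = (\<Sum>b\<in>Basis. frechet_derivative f (at p) b *\<^sub>R b)"

text \<open>
  A \<open>(1,0)\<close> vector is represented by its coefficients with respect to the \<open>\<partial>/\<partial>z\<^sub>j\<close>.
  \<open>vec10 X f p\<close> is \<open>X f\<close> at \<open>p\<close>, and \<open>vec01 X f p\<close> is the conjugate vector applied to \<open>f\<close>.
\<close>

definition vec10 :: "complex ^ 'n \<Rightarrow> (complex ^ 'n \<Rightarrow> complex) \<Rightarrow> complex ^ 'n \<Rightarrow> complex" where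
  "vec10 X f p = (\<Sum>j\<in>UNIV. X $ j * d_z j f p)"

definition vec01 :: "complex ^ 'n \<Rightarrow> (complex ^ 'n \<Rightarrow> complex) \<Rightarrow> complex ^ 'n \<Rightarrow> complex" where
  "vec01 X f p = (\<Sum>j\<in>UNIV. cnj (X $ j) * d_zbar j f p)"

definition Hess ::
  "(complex ^ 'n \<Rightarrow> real) \<Rightarrow> complex ^ 'n \<Rightarrow> complex ^ 'n \<Rightarrow> complex ^ 'n \<Rightarrow> complex" where
  "Hess f p X Y =
     (\<Sum>j\<in>UNIV. \<Sum>k\<in>UNIV. d_z j (d_zbar k (cplx f)) p * X $ j * cnj (Y $ k))"

definition plurisubharmonic_on :: "(complex ^ 'n) set \<Rightarrow> (complex ^ 'n \<Rightarrow> real) \<Rightarrow> bool" where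
  "plurisubharmonic_on \<Omega> u \<longleftrightarrow>
     (\<forall>a\<in>\<Omega>. \<forall>c>u a. eventually (\<lambda>z. u z < c) (at a within \<Omega>)) \<and>
     (\<forall>a w. (\<forall>\<zeta>. cmod \<zeta> \<le> 1 \<longrightarrow> a + \<zeta> *s w \<in> \<Omega>) \<longrightarrow>
        set_integrable lborel {0..2 * pi} (\<lambda>\<theta>. u (a + cis \<theta> *s w)) \<and>
        u a \<le> (1 / (2 * pi)) * (LINT \<theta>:{0..2 * pi}|lborel. u (a + cis \<theta> *s w)))"

definition defining_function :: "(complex ^ 'n) set \<Rightarrow> (complex ^ 'n \<Rightarrow> real) \<Rightarrow> bool" where
  "defining_function \<Omega> \<rho> \<longleftrightarrow>
     (\<exists>U. open U \<and> closure \<Omega> \<subseteq> U \<and> Ck_on 2 U \<rho> \<and> \<Omega> = {z \<in> U. \<rho> z < 0}) \<and>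
     (\<forall>p\<in>frontier \<Omega>. gradient \<rho> p \<noteq> 0)"

definition smooth_defining_function :: "(complex ^ 'n) set \<Rightarrow> (complex ^ 'n \<Rightarrow> real) \<Rightarrow> bool" where
  "smooth_defining_function \<Omega> r \<longleftrightarrow>
     (\<exists>U. open U \<and> closure \<Omega> \<subseteq> U \<and> smooth_on U r \<and> \<Omega> = {z \<in> U. r z < 0}) \<and>
     (\<forall>p\<in>frontier \<Omega>. gradient r p \<noteq> 0)"

definition DF_exponents :: "(complex ^ 'n) set \<Rightarrow> real set" where
  "DF_exponents \<Omega> = {\<tau>. 0 < \<tau> \<and> \<tau> < 1 \<and>
     (\<exists>\<rho>. defining_function \<Omega> \<rho> \<and> plurisubharmonic_on \<Omega> (\<lambda>z. - ((- \<rho> z) powr \<tau>)))}"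

definition DF_index :: "(complex ^ 'n) set \<Rightarrow> real" where
  "DF_index \<Omega> = Sup (DF_exponents \<Omega>)"

text \<open>
  In what follows \<open>M\<close> is the hypersurface \<open>frontier \<Omega>\<close> and \<open>r\<close> a smooth defining function.
  The Levi form of \<open>M\<close> at \<open>p\<close> is \<open>Hess r p\<close> restricted to \<open>tangent10 r p\<close>.
\<close>

definition tangent10 :: "(complex ^ 'n \<Rightarrow> real) \<Rightarrow> complex ^ 'n \<Rightarrow> (complex ^ 'n) set" where
  "tangent10 r p = {X. vec10 X (cplx r) p = 0}"

definition levi_pseudoconvex :: "(complex ^ 'n) set \<Rightarrow> (complex ^ 'n \<Rightarrow> real) \<Rightarrow> bool" where
  "levi_pseudoconvex M r \<longleftrightarrow> (\<forall>p\<in>M. \<forall>X\<in>tangent10 r p. 0 \<le> Re (Hess r p X X))"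

definition levi_degenerate_set ::
  "(complex ^ 'n) set \<Rightarrow> (complex ^ 'n \<Rightarrow> real) \<Rightarrow> (complex ^ 'n) set" where
  "levi_degenerate_set M r =
     {p \<in> M. \<exists>X\<in>tangent10 r p. X \<noteq> 0 \<and> (\<forall>Y\<in>tangent10 r p. Hess r p X Y = 0)}"

definition normal_field :: "(complex ^ 'n \<Rightarrow> real) \<Rightarrow> complex ^ 'n \<Rightarrow> complex ^ 'n" where
  "normal_field r p = (\<chi> k. d_zbar k (cplx r) p
      / complex_of_real (sqrt (\<Sum>j\<in>UNIV. (cmod (d_z j (cplx r) p))\<^sup>2)))"

definition tangent_field ::
  "(complex ^ 'n) set \<Rightarrow> (complex ^ 'n \<Rightarrow> real) \<Rightarrow> (complex ^ 'n \<Rightarrow> complex ^ 'n) \<Rightarrow> bool" where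
  "tangent_field M r L \<longleftrightarrow> smooth_on_subset M L \<and> (\<forall>p\<in>M. L p \<in> tangent10 r p)"

definition null_set ::
  "(complex ^ 'n) set \<Rightarrow> (complex ^ 'n \<Rightarrow> real) \<Rightarrow> (complex ^ 'n \<Rightarrow> complex ^ 'n) \<Rightarrow> (complex ^ 'n) set" where
  "null_set M r L = {p \<in> M. Hess r p (L p) (L p) = 0}"

text \<open>\<open>g (\<nabla>\<^sub>X \<nabla>\<^sub>N \<nabla>r, X)\<close> at \<open>p\<close>, with \<open>N = normal_field r\<close>.\<close>

definition third_order_term :: "(complex ^ 'n \<Rightarrow> real) \<Rightarrow> complex ^ 'n \<Rightarrow> complex ^ 'n \<Rightarrow> complex" where
  "third_order_term r p X =
     (\<Sum>i\<in>UNIV. \<Sum>j\<in>UNIV. X $ i *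
        d_z i (\<lambda>w. \<Sum>k\<in>UNIV. normal_field r w $ k * d_z k (d_zbar j (cplx r)) w) p * cnj (X $ j))"

text \<open>
  The second summand is real whenever \<open>M\<close> is pseudoconvex and the null condition
  \<open>Hess r p X X = 0\<close> holds for the tangent vector \<open>X\<close> at \<open>p\<close>; \<open>Re\<close> only serves to make it a
  term of type \<^typ>\<open>real\<close>.
\<close>

definition DF_inequality_at ::
  "(complex ^ 'n \<Rightarrow> real) \<Rightarrow> (complex ^ 'n \<Rightarrow> real) \<Rightarrow> real \<Rightarrow> complex ^ 'n \<Rightarrow> complex ^ 'n \<Rightarrow> bool" where
  "DF_inequality_at r \<psi> \<eta> p X \<longleftrightarrow>
     (let N = normal_field r p; G = norm (gradient r p) in
       (1 / (1 - \<eta>) - 1)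
           * (cmod (vec01 X (cplx \<psi>) p * vec10 N (cplx r) p + Hess r p N X))\<^sup>2
       + G / 2 * Re (complex_of_real (G / 2) * Hess \<psi> p X X
           + third_order_term r p X
           + complex_of_real G * vec10 X (cplx (\<lambda>w. 1 / norm (gradient r w))) p * Hess r p N X)
       \<le> 0)"

text \<open>
  \<open>\<psi>\<close> only matters on the relatively open set \<open>V\<close>; its derivatives at a point are those of any
  smooth extension \<open>F\<close> to an open set.  At points where \<open>L\<close> vanishes the inequality reads
  \<open>0 \<le> 0\<close>; if \<open>M\<close> is pseudoconvex, the Levi form is degenerate at the other points of
  \<open>null_set M r L\<close>, so these lie in \<open>V\<close>.
\<close>

definition hypersurface_DF_exponents ::
  "(complex ^ 'n) set \<Rightarrow> (complex ^ 'n \<Rightarrow> real) \<Rightarrow> real set" where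
  "hypersurface_DF_exponents M r = {\<eta>. 0 < \<eta> \<and> \<eta> < 1 \<and>
     (\<exists>V \<psi>. openin (top_of_set M) V \<and> levi_degenerate_set M r \<subseteq> V \<and> smooth_on_subset V \<psi> \<and>
        (\<forall>L. tangent_field M r L \<longrightarrow>
           (\<forall>p\<in>null_set M r L. \<forall>U F. smooth_extension_at V \<psi> p U F \<longrightarrow>
              DF_inequality_at r F \<eta> p (L p))))}"

definition hypersurface_DF_index ::
  "(complex ^ 'n) set \<Rightarrow> (complex ^ 'n \<Rightarrow> real) \<Rightarrow> real" where
  "hypersurface_DF_index M r = Sup (hypersurface_DF_exponents M r)"

end

theory Submission
  imports Defs
begin

text \<open>Let \<open>\<nu> = N\<^sub>r / (N\<^sub>r r)\<close>. A defining function \<open>\<rho>\<close> of \<open>\<Omega>\<close> is written as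
  \<open>r \<sqdot> exp \<psi>\<close> in \<open>\<Omega>\<close>. Up to a positive factor, the complex Hessian of \<open>-(-\<rho>)\<^sup>\<tau>\<close> is then a form
  in \<open>r\<close> and \<open>\<psi>\<close> which, evaluated at \<open>L + \<delta> \<omega> \<nu>\<close> with \<open>\<delta> = -r\<close> and \<open>L\<close> tangent to the level set of
  \<open>r\<close>, is a quadratic polynomial in \<open>\<omega> \<in> \<complex>\<close>. Minimising over \<open>\<omega>\<close> and letting \<open>\<delta> \<rightarrow> 0\<close> yields the negative
  of the form that defines the index of the hypersurface.

  If \<open>-(-\<rho>)\<^sup>\<tau>\<close> is plurisubharmonic then \<open>\<psi>\<close> need not extend smoothly to the boundary, so it is
  pulled back from the interior by a small shift along \<open>-\<nu>\<close>; its first derivatives converge there, and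
  its second derivatives are \<open>o(1/\<delta>)\<close>. Lowering the exponent and subtracting \<open>\<kappa> |z|\<^sup>2\<close> makes the
  inequality strict, so that it survives first the shift and then a smoothing of \<open>\<psi>\<close>.

  Conversely, if the hypersurface form is strictly negative for \<open>\<psi>\<close>, then a compactness argument shows
  that \<open>-(-r exp \<psi>)\<^sup>\<tau>\<close> is plurisubharmonic in a collar of the boundary, and composing it with
  a convex function that is constant far from the boundary makes it plurisubharmonic in all of \<open>\<Omega>\<close>.\<close>

text \<open>The hypersurface form sees tangent vectors only, plurisubharmonicity sees all vectors.
  They meet through a scaling: at depth \<delta> a null vector \<open>L\<close> gives
  \<open>hess r z L / \<delta>\<close> of order 1, and a normal component of size \<delta> \<omega>
  contributes to the same order, so neither can be neglected. Two obstacles shape the rest. First, a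
  defining function is only of class C2, so a priori the second derivatives of \<psi> are too large
  near \<open>M\<close>; they are \<open>o(1/\<delta>)\<close> because at each point of
  \<open>M\<close> a multiple of r agrees with \<rho> up to tangential second derivatives. This is
  just enough, since the pull-back and the passage to \<open>L + \<delta> \<omega> \<nu>\<close>
  change vectors by order \<delta>. Second, the Levi form is nonnegative on \<open>M\<close> but
  need not be on the level sets inside \<Omega>. In the converse direction an interior tangent
  vector is therefore carried along \<nu> to \<open>M\<close>, and the first-order change of
  \<open>hess r\<close> on the way produces the third-order term. Strictness is bought with a little
  of the exponent, so the two sets of exponents are compared up to an arbitrarily small loss, which
  suffices for their suprema.\<close>

section \<open>Directional derivatives\<close>

text \<open>The direction comes first, so that \<open>dd v f\<close> is again a function and higher
  derivatives iterate as \<open>dd w (dd v f)\<close>; \<open>Ck_on\<close> differentiates along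
  fixed directions in the same way.\<close>

definition dd :: "'a::real_normed_vector \<Rightarrow> ('a \<Rightarrow> 'b::real_normed_vector) \<Rightarrow> 'a \<Rightarrow> 'b" where
  "dd v f x = frechet_derivative f (at x) v"

lemma Ck_on_Suc_dd:
  "Ck_on (Suc k) U f \<longleftrightarrow> (\<forall>x\<in>U. f differentiable (at x)) \<and> (\<forall>v. Ck_on k U (dd v f))"
  by (simp add: dd_def[abs_def])

declare Ck_on.simps(2)[simp del]

lemma dd_eqI: "(f has_derivative f') (at x) \<Longrightarrow> dd v f x = f' v"
  unfolding dd_def by (metis frechet_derivative_at)

lemma has_derivative_dd: "f differentiable (at x) \<Longrightarrow> (f has_derivative (\<lambda>v. dd v f x)) (at x)"
  unfolding dd_def by (simp add: frechet_derivative_works[symmetric])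

lemma linear_dd: "f differentiable (at x) \<Longrightarrow> linear (\<lambda>v. dd v f x)"
  using has_derivative_dd has_derivative_linear by blast

lemma dd_add: "f differentiable (at x) \<Longrightarrow> dd (v + w) f x = dd v f x + dd w f x"
  using linear_add[OF linear_dd] .

lemma dd_diff: "f differentiable (at x) \<Longrightarrow> dd (v - w) f x = dd v f x - dd w f x"
  using linear_diff[OF linear_dd] .

lemma dd_minus: "f differentiable (at x) \<Longrightarrow> dd (- v) f x = - dd v f x"
  using linear_neg[OF linear_dd] .

lemma dd_scaleR: "f differentiable (at x) \<Longrightarrow> dd (c *\<^sub>R v) f x = c *\<^sub>R dd v f x"
  using linear_scale[OF linear_dd] .

lemma dd_zero: "f differentiable (at x) \<Longrightarrow> dd 0 f x = 0"
  using linear_0[OF linear_dd] .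

lemma dd_sum: "f differentiable (at x) \<Longrightarrow> dd (\<Sum>i\<in>I. g i) f x = (\<Sum>i\<in>I. dd (g i) f x)"
  using linear_sum[OF linear_dd] .

lemma dd_Basis:
  fixes f :: "'a::euclidean_space \<Rightarrow> 'b::real_normed_vector"
  assumes "f differentiable (at x)"
  shows "dd v f x = (\<Sum>b\<in>Basis. (v \<bullet> b) *\<^sub>R dd b f x)"
proof -
  have "dd v f x = dd (\<Sum>b\<in>Basis. (v \<bullet> b) *\<^sub>R b) f x" by (simp add: euclidean_representation)
  then show ?thesis by (simp add: dd_sum dd_scaleR assms)
qed

text \<open>Which maps are derivatives at x depends only on the germ of the function, so the choice
  operator inside \<open>frechet_derivative\<close> picks the same map for both, even at points
  where no derivative exists.\<close>

lemma frechet_derivative_cong_open: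
  assumes "open U" "x \<in> U" "\<And>y. y \<in> U \<Longrightarrow> f y = g y"
  shows "frechet_derivative f (at x) = frechet_derivative g (at x)"
proof -
  have "(f has_derivative f') (at x) \<longleftrightarrow> (g has_derivative f') (at x)" for f'
    using assms has_derivative_transform_within_open[of f f' x UNIV U g]
      has_derivative_transform_within_open[of g f' x UNIV U f] by auto
  then show ?thesis unfolding frechet_derivative_def by simp
qed

lemma dd_cong_open:
  "open U \<Longrightarrow> x \<in> U \<Longrightarrow> (\<And>y. y \<in> U \<Longrightarrow> f y = g y) \<Longrightarrow> dd v f x = dd v g x"
  unfolding dd_def using frechet_derivative_cong_open by metis

lemma differentiable_cong_open:
  assumes "open U" "x \<in> U" "\<And>y. y \<in> U \<Longrightarrow> f y = g y" "f differentiable (at x)"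
  shows "g differentiable (at x)"
  using assms has_derivative_transform_within_open[of f _ x UNIV U g]
  unfolding differentiable_def by blast

section \<open>Stability of the classes \<open>Ck_on\<close>\<close>

lemma Ck_on_subset: "Ck_on k U f \<Longrightarrow> V \<subseteq> U \<Longrightarrow> Ck_on k V f"
  by (induction k arbitrary: f) (auto simp: Ck_on_Suc_dd intro: continuous_on_subset)

lemma Ck_on_cong_open:
  assumes "open U" "\<And>y. y \<in> U \<Longrightarrow> f y = g y" "Ck_on k U f"
  shows "Ck_on k U g"
  using assms(2,3)
proof (induction k arbitrary: f g)
  case 0
  then show ?case by (simp cong: continuous_on_cong)
next
  case (Suc k)
  have 1: "g differentiable at x" if "x \<in> U" for x
    using differentiable_cong_open[OF assms(1) that Suc.prems(1)] Suc.prems(2) that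
    by (auto simp: Ck_on_Suc_dd)
  have "Ck_on k U (dd v g)" for v
    using Suc.IH[of "dd v f" "dd v g"] Suc.prems dd_cong_open[OF assms(1) _ Suc.prems(1)]
    by (auto simp: Ck_on_Suc_dd)
  then show ?case using 1 by (auto simp: Ck_on_Suc_dd)
qed

lemma Ck_on_SucD: "Ck_on (Suc k) U f \<Longrightarrow> Ck_on k U f"
proof (induction k arbitrary: f)
  case 0
  then show ?case
    by (auto simp: Ck_on_Suc_dd continuous_at_imp_continuous_on differentiable_imp_continuous_within)
next
  case (Suc k)
  then show ?case using Ck_on_Suc_dd by metis
qed

lemma Ck_on_le: "Ck_on k U f \<Longrightarrow> j \<le> k \<Longrightarrow> Ck_on j U f"
  by (induction k) (auto simp del: Ck_on.simps(2) simp: le_Suc_eq dest: Ck_on_SucD)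

lemma Ck_on_imp_continuous_on: "Ck_on k U f \<Longrightarrow> continuous_on U f"
  using Ck_on_le[of k U f 0] by simp

lemma Ck_on_imp_differentiable: "Ck_on k U f \<Longrightarrow> 0 < k \<Longrightarrow> x \<in> U \<Longrightarrow> f differentiable (at x)"
  by (cases k) (auto simp: Ck_on_Suc_dd)

lemma Ck_on_dd: "Ck_on (Suc k) U f \<Longrightarrow> Ck_on k U (dd v f)"
  by (simp add: Ck_on_Suc_dd)

text \<open>For functions given by different formulas on overlapping open sets, such as extensions
  by zero and the defining function constructed at the end.\<close>

lemma Ck_on_local:
  assumes "\<And>x. x \<in> U \<Longrightarrow> \<exists>V. open V \<and> x \<in> V \<and> Ck_on k V f"
  shows "Ck_on k U f"
  using assms
proof (induction k arbitrary: f)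
  case 0
  then show ?case
    by (metis Ck_on.simps(1) continuous_at_imp_continuous_on continuous_on_eq_continuous_at)
next
  case (Suc k)
  have "f differentiable at x" if "x \<in> U" for x
    using Suc.prems[OF that] by (auto simp: Ck_on_Suc_dd)
  moreover have "Ck_on k U (dd v f)" for v
  proof (rule Suc.IH)
    fix x assume "x \<in> U"
    from Suc.prems[OF this] obtain V where "open V" "x \<in> V" "Ck_on (Suc k) V f" by blast
    then show "\<exists>V. open V \<and> x \<in> V \<and> Ck_on k V (dd v f)"
      by (intro exI[of _ V]) (simp add: Ck_on_dd)
  qed
  ultimately show ?case by (auto simp: Ck_on_Suc_dd)
qed

lemma Ck_on_const: "Ck_on k U (\<lambda>x. c)"
proof (induction k arbitrary: c)
  case (Suc k)
  have "dd v (\<lambda>x. c) = (\<lambda>x. 0)" for v :: 'a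
    unfolding dd_def by simp
  then show ?case using Suc by (simp add: Ck_on_Suc_dd del: Ck_on.simps(2))
qed simp

lemma Ck_on_bounded_linear: "bounded_linear f \<Longrightarrow> Ck_on k U f"
proof (cases k)
  case (Suc j)
  assume f: "bounded_linear f"
  have "dd v f = (\<lambda>x. f v)" for v
    using dd_eqI[OF bounded_linear_imp_has_derivative[OF f]] by auto
  then show ?thesis using f Suc
    by (simp add: Ck_on_Suc_dd Ck_on_const bounded_linear_imp_differentiable del: Ck_on.simps(2))
qed (auto intro: linear_continuous_on)

lemma Ck_on_linear_compose:
  assumes "bounded_linear L" "open U" "Ck_on k U f"
  shows "Ck_on k U (\<lambda>x. L (f x))"
  using assms(3)
proof (induction k arbitrary: f)
  case 0
  then show ?case using bounded_linear.continuous_on[OF assms(1)] by simp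
next
  case (Suc k)
  have d: "((\<lambda>x. L (f x)) has_derivative (\<lambda>v. L (dd v f x))) (at x)" if "x \<in> U" for x
    using bounded_linear.has_derivative[OF assms(1) has_derivative_dd] Suc.prems that
    by (auto simp: Ck_on_Suc_dd)
  then have "L (dd v f x) = dd v (\<lambda>x. L (f x)) x" if "x \<in> U" for x v
    by (simp add: dd_eqI[OF d[OF that]])
  moreover have "Ck_on k U (\<lambda>x. L (dd v f x))" for v
    using Suc by (auto simp: Ck_on_Suc_dd)
  ultimately have "Ck_on k U (dd v (\<lambda>x. L (f x)))" for v
    by (rule Ck_on_cong_open[OF assms(2)])
  then show ?case using d by (auto simp: Ck_on_Suc_dd differentiable_def)
qed

lemma Ck_on_add:
  assumes "open U" "Ck_on k U f" "Ck_on k U g"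
  shows "Ck_on k U (\<lambda>x. f x + g x)"
  using assms(2,3)
proof (induction k arbitrary: f g)
  case 0
  then show ?case by (auto intro: continuous_on_add)
next
  case (Suc k)
  have d: "((\<lambda>x. f x + g x) has_derivative (\<lambda>v. dd v f x + dd v g x)) (at x)" if "x \<in> U" for x
    using Suc.prems that by (auto simp: Ck_on_Suc_dd intro!: has_derivative_add has_derivative_dd)
  then have "dd v f x + dd v g x = dd v (\<lambda>x. f x + g x) x" if "x \<in> U" for x v
    by (simp add: dd_eqI[OF d[OF that]])
  moreover have "Ck_on k U (\<lambda>x. dd v f x + dd v g x)" for v
    using Suc by (auto simp: Ck_on_Suc_dd)
  ultimately have "Ck_on k U (dd v (\<lambda>x. f x + g x))" for v
    by (rule Ck_on_cong_open[OF assms(1)])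
  then show ?case using d by (auto simp: Ck_on_Suc_dd differentiable_def)
qed

lemma Ck_on_sum:
  assumes "open U" "\<And>i. i \<in> I \<Longrightarrow> Ck_on k U (f i)"
  shows "Ck_on k U (\<lambda>x. \<Sum>i\<in>I. f i x)"
  using assms(2)
  by (induction I rule: infinite_finite_induct) (auto simp: Ck_on_const Ck_on_add assms(1))

lemma Ck_on_bilinear:
  assumes "bounded_bilinear B" "open U" "Ck_on k U f" "Ck_on k U g"
  shows "Ck_on k U (\<lambda>x. B (f x) (g x))"
  using assms(3,4)
proof (induction k arbitrary: f g)
  case 0
  then show ?case using bounded_bilinear.continuous_on[OF assms(1)] by simp
next
  case (Suc k)
  have d: "((\<lambda>x. B (f x) (g x)) has_derivative (\<lambda>v. B (f x) (dd v g x) + B (dd v f x) (g x))) (at x)"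
    if "x \<in> U" for x
    using Suc.prems that
    by (auto simp: Ck_on_Suc_dd intro!: bounded_bilinear.FDERIV[OF assms(1)] has_derivative_dd)
  then have "B (f x) (dd v g x) + B (dd v f x) (g x) = dd v (\<lambda>x. B (f x) (g x)) x" if "x \<in> U" for x v
    by (simp add: dd_eqI[OF d[OF that]])
  moreover have "Ck_on k U (\<lambda>x. B (f x) (dd v g x) + B (dd v f x) (g x))" for v
    using Suc by (intro Ck_on_add assms(2) Suc.IH) (auto dest: Ck_on_SucD Ck_on_dd simp del: Ck_on.simps(2))
  ultimately have "Ck_on k U (dd v (\<lambda>x. B (f x) (g x)))" for v
    by (rule Ck_on_cong_open[OF assms(2)])
  then show ?case using d by (auto simp: Ck_on_Suc_dd differentiable_def)
qed

lemmas Ck_on_mult = Ck_on_bilinear[OF bounded_bilinear_mult]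
lemmas Ck_on_scaleR = Ck_on_bilinear[OF bounded_bilinear_scaleR]
lemmas Ck_on_inner = Ck_on_bilinear[OF bounded_bilinear_inner]
lemmas Ck_on_minus = Ck_on_linear_compose[OF bounded_linear_minus[OF bounded_linear_ident]]

lemma Ck_on_diff:
  assumes "open U" "Ck_on k U f" "Ck_on k U g"
  shows "Ck_on k U (\<lambda>x. f x - g x)"
  using Ck_on_add[OF assms(1,2) Ck_on_minus[OF assms(1,3)]] by simp

lemma Ck_on_cmult: "open U \<Longrightarrow> Ck_on k U f \<Longrightarrow> Ck_on k U (\<lambda>x. c * f x)" for f :: "_ \<Rightarrow> real"
  by (rule Ck_on_linear_compose[OF bounded_linear_mult_right])

lemma Ck_on_ident: "Ck_on k U (\<lambda>x. x)"
  by (rule Ck_on_bounded_linear) (rule bounded_linear_ident)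

text \<open>A single differentiation, with the regularity of \<open>g' (f x)\<close> left as a
  hypothesis. In this form it serves for \<open>inverse\<close>, \<open>ln\<close> and
  \<open>exp\<close> at every order and also for powers of a positive part, whose regularity is
  finite.\<close>

lemma Ck_on_compose_real:
  fixes f :: "'a::real_normed_vector \<Rightarrow> real"
  assumes "open U" "\<And>x. x \<in> U \<Longrightarrow> (g has_real_derivative g' (f x)) (at (f x))"
    "Ck_on (Suc k) U f" "Ck_on k U (\<lambda>x. g' (f x))"
  shows "Ck_on (Suc k) U (\<lambda>x. g (f x))"
proof -
  have d: "((\<lambda>x. g (f x)) has_derivative (\<lambda>v. g' (f x) * dd v f x)) (at x)" if "x \<in> U" for x
  proof -
    have "(f has_derivative (\<lambda>v. dd v f x)) (at x)"
      using assms(3) that by (auto simp: Ck_on_Suc_dd intro!: has_derivative_dd)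
    from has_derivative_compose[OF this] assms(2)[OF that] show ?thesis
      by (simp add: has_field_derivative_def)
  qed
  then have "g' (f x) * dd v f x = dd v (\<lambda>x. g (f x)) x" if "x \<in> U" for x v
    by (simp add: dd_eqI[OF d[OF that]])
  moreover have "Ck_on k U (\<lambda>x. g' (f x) * dd v f x)" for v
    using assms by (intro Ck_on_mult) (auto simp: Ck_on_Suc_dd)
  ultimately have "Ck_on k U (dd v (\<lambda>x. g (f x)))" for v
    by (rule Ck_on_cong_open[OF assms(1)])
  then show ?thesis using d by (auto simp: Ck_on_Suc_dd differentiable_def)
qed

text \<open>The derivative of the composition is taken in a direction that moves with the point,
  while \<open>Ck_on\<close> controls fixed directions. Expanding the moving direction in
  \<open>Basis\<close> reduces it to products of functions of class k.\<close>

lemma Ck_on_compose: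
  fixes f :: "'b::euclidean_space \<Rightarrow> 'c::real_normed_vector" and g :: "'a::real_normed_vector \<Rightarrow> 'b"
  assumes "open U" "g ` U \<subseteq> W" "Ck_on k W f" "Ck_on k U g"
  shows "Ck_on k U (\<lambda>x. f (g x))"
  using assms(3,4)
proof (induction k arbitrary: f)
  case 0
  then show ?case using continuous_on_compose2[of W f U g] assms(2) by simp
next
  case (Suc k)
  have d: "((\<lambda>x. f (g x)) has_derivative (\<lambda>v. dd (dd v g x) f (g x))) (at x)" if "x \<in> U" for x
    using Suc.prems that assms(2)
    by (auto simp: Ck_on_Suc_dd intro!: has_derivative_compose[of g _ x UNIV f] has_derivative_dd)
  have e: "(\<Sum>b\<in>Basis. (dd v g x \<bullet> b) *\<^sub>R dd b f (g x)) = dd v (\<lambda>x. f (g x)) x" if "x \<in> U" for x v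
    using dd_eqI[OF d[OF that]] dd_Basis[of f "g x" "dd v g x"] Suc.prems that assms(2)
    by (auto simp: Ck_on_Suc_dd)
  have "Ck_on k U (\<lambda>x. \<Sum>b\<in>Basis. (dd v g x \<bullet> b) *\<^sub>R dd b f (g x))" for v
  proof (intro Ck_on_sum Ck_on_scaleR assms(1))
    show "Ck_on k U (\<lambda>x. dd v g x \<bullet> b)" for b
      by (rule Ck_on_linear_compose[OF bounded_linear_inner_left assms(1)])
        (use Suc.prems in \<open>auto simp: Ck_on_Suc_dd\<close>)
    show "Ck_on k U (\<lambda>x. dd b f (g x))" for b
      by (rule Suc.IH) (use Suc.prems Ck_on_SucD in \<open>auto simp: Ck_on_Suc_dd\<close>)
  qed
  then have "Ck_on k U (dd v (\<lambda>x. f (g x)))" for v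
    by (intro Ck_on_cong_open[OF assms(1) e]) auto
  then show ?case using d by (auto simp: Ck_on_Suc_dd differentiable_def)
qed

text \<open>Continuity in point and direction together. \<open>Ck_on 1\<close> supplies it for each
  fixed direction, and the expansion over the finite \<open>Basis\<close> makes it joint.\<close>

lemma dd_tendsto:
  fixes f :: "'a::euclidean_space \<Rightarrow> 'b::real_normed_vector"
  assumes "open U" "p \<in> U" "Ck_on 1 U f" "(a \<longlongrightarrow> p) F" "(b \<longlongrightarrow> v) F"
  shows "((\<lambda>n. dd (b n) f (a n)) \<longlongrightarrow> dd v f p) F"
proof -
  have ev: "\<forall>\<^sub>F n in F. a n \<in> U" using topological_tendstoD assms(1,2,4) by metis
  have c: "((\<lambda>n. dd e f (a n)) \<longlongrightarrow> dd e f p) F" for e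
  proof (rule isCont_tendsto_compose[OF _ assms(4)])
    have "continuous_on U (dd e f)" using assms(3) by (simp add: Ck_on_Suc_dd[of 0, simplified])
    then show "isCont (dd e f) p" using assms(1,2) continuous_on_eq_continuous_at by blast
  qed
  have "((\<lambda>n. \<Sum>e\<in>Basis. (b n \<bullet> e) *\<^sub>R dd e f (a n)) \<longlongrightarrow> (\<Sum>e\<in>Basis. (v \<bullet> e) *\<^sub>R dd e f p)) F"
    by (intro tendsto_intros c assms)
  moreover have "\<forall>\<^sub>F n in F. (\<Sum>e\<in>Basis. (b n \<bullet> e) *\<^sub>R dd e f (a n)) = dd (b n) f (a n)"
    using ev by eventually_elim (simp add: dd_Basis[symmetric] Ck_on_imp_differentiable[OF assms(3)])
  ultimately show ?thesis
    using Lim_transform_eventually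
    by (fastforce simp: dd_Basis[symmetric] Ck_on_imp_differentiable[OF assms(3) _ assms(2)])
qed

section \<open>Second-order Taylor expansion and limits of difference quotients\<close>

lemma line_has_real_derivative:
  assumes "f differentiable (at (a + s *\<^sub>R c))"
  shows "((\<lambda>s. f (a + s *\<^sub>R c)) has_real_derivative dd c f (a + s *\<^sub>R c)) (at s)"
proof -
  have "((\<lambda>s. f (a + s *\<^sub>R c)) has_derivative (\<lambda>h. dd (h *\<^sub>R c) f (a + s *\<^sub>R c))) (at s)"
    using has_derivative_compose[of "\<lambda>s. a + s *\<^sub>R c" "\<lambda>h. h *\<^sub>R c" s UNIV f,
      OF _ has_derivative_dd[OF assms]]
    by (rule meta_mp) (auto intro!: derivative_eq_intros)
  then show ?thesis
    by (simp add: has_field_derivative_def dd_scaleR[OF assms] mult.commute[of _ "dd c f _"])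
qed

lemma convex_line_mem:
  assumes "convex S" "a \<in> S" "a + c \<in> S" "0 \<le> s" "s \<le> 1"
  shows "a + s *\<^sub>R c \<in> S"
proof -
  have "(1 - s) *\<^sub>R a + s *\<^sub>R (a + c) \<in> S" using assms by (simp add: convex_alt)
  then show ?thesis by (simp add: algebra_simps)
qed

lemma mvt_line:
  fixes f :: "'a::real_normed_vector \<Rightarrow> real"
  assumes "convex S" "a \<in> S" "a + c \<in> S" "Ck_on 1 S f"
  obtains s where "0 < s" "s < 1" "f (a + c) = f a + dd c f (a + s *\<^sub>R c)"
proof -
  have "\<exists>s. 0 < s \<and> s < 1 \<and> f (a + 1 *\<^sub>R c) - f (a + 0 *\<^sub>R c) = (1 - 0) * dd c f (a + s *\<^sub>R c)"
    using assms convex_line_mem[OF assms(1-3)] Ck_on_imp_differentiable[OF assms(4)]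
    by (intro MVT2) (auto intro!: line_has_real_derivative)
  then show ?thesis using that by (auto simp: algebra_simps)
qed

lemma taylor2_line:
  fixes f :: "'a::real_normed_vector \<Rightarrow> real"
  assumes "convex S" "a \<in> S" "a + c \<in> S" "Ck_on 2 S f"
  obtains s where "0 < s" "s < 1" "f (a + c) = f a + dd c f a + dd c (dd c f) (a + s *\<^sub>R c) / 2"
proof -
  \<comment> \<open>\<open>Maclaurin\<close> takes the successive derivatives of
    \<open>s \<mapsto> f (a + s *\<^sub>R c)\<close> as one family indexed by the order; all orders
    above 1 share the last branch.\<close>
  define D where "D m s = (if m = 0 then f (a + s *\<^sub>R c) else if m = 1 then dd c f (a + s *\<^sub>R c)
     else dd c (dd c f) (a + s *\<^sub>R c))" for m :: nat and s
  have 1: "Ck_on 1 S (dd c f)" using assms(4) Ck_on_dd[of 1] by (simp add: numeral_2_eq_2)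
  have "DERIV (D m) t :> D (Suc m) t" if "m < 2" "0 \<le> t" "t \<le> 1" for m t
  proof -
    have t: "a + t *\<^sub>R c \<in> S" using convex_line_mem[OF assms(1-3)] that by auto
    from that consider "m = 0" | "m = 1" by linarith
    then show ?thesis
      using line_has_real_derivative[OF Ck_on_imp_differentiable[OF assms(4) _ t]]
        line_has_real_derivative[OF Ck_on_imp_differentiable[OF 1 _ t]]
      by cases (simp_all add: D_def[abs_def])
  qed
  moreover have D0: "D 0 = (\<lambda>s. f (a + s *\<^sub>R c))" by (auto simp: D_def)
  ultimately have "\<exists>t>0. t < 1 \<and> f (a + 1 *\<^sub>R c) = (\<Sum>m<2. D m 0 / fact m * 1 ^ m) + D 2 t / fact 2 * 1 ^ 2"
    using D0 by (intro Maclaurin) auto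
  then show ?thesis using that by (auto simp: D_def lessThan_nat_numeral numeral_2_eq_2)
qed

text \<open>Both mixed derivatives are limits of the second difference of f over the parallelogram
  with sides \<open>t *\<^sub>R v\<close> and \<open>t *\<^sub>R w\<close>, divided by
  \<open>t\<^sup>2\<close>. The quotient is symmetric in v and w, and two mean value theorems turn
  it into a mixed derivative at a nearby point.\<close>

lemma dd_commute:
  fixes f :: "'a::euclidean_space \<Rightarrow> real"
  assumes "open U" "p \<in> U" "Ck_on 2 U f"
  shows "dd v (dd w f) p = dd w (dd v f) p"
proof -
  obtain e where e: "e > 0" "ball p e \<subseteq> U" using assms open_contains_ball by blast
  have C2: "Ck_on 2 (ball p e) f" using Ck_on_subset assms(3) e by blast
  have C1: "Ck_on 1 (ball p e) (dd v f)" for v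
    using C2 Ck_on_dd[of 1] by (simp add: numeral_2_eq_2)
  have lim: "((\<lambda>t. (f (p + t *\<^sub>R v + t *\<^sub>R w) - f (p + t *\<^sub>R v) - f (p + t *\<^sub>R w) + f p) / t\<^sup>2)
      \<longlongrightarrow> dd w (dd v f) p) (at_right 0)" for v w
  proof -
    \<comment> \<open>For \<open>t * c < e\<close> the whole parallelogram lies in
      \<open>ball p e\<close>; the summand 1 keeps c positive when v and w vanish.\<close>
    define c where "c = norm v + norm w + 1"
    have c: "c > 0" by (simp add: c_def add_nonneg_pos)
    have "\<forall>\<^sub>F t in at_right 0. 0 < t \<and> t < e / c"
      using e c eventually_at_right_real[of 0 "e/c"] by (auto elim: eventually_mono)
    then have "\<forall>\<^sub>F t in at_right 0. \<exists>q. dist q p \<le> t * c \<and>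
       (f (p + t *\<^sub>R v + t *\<^sub>R w) - f (p + t *\<^sub>R v) - f (p + t *\<^sub>R w) + f p) / t\<^sup>2 = dd w (dd v f) q"
    proof eventually_elim
      case (elim t)
      define g where "g y = f (y + t *\<^sub>R w) - f y" for y
      have tc: "t * c < e" using elim c by (simp add: field_simps)
      have mem: "p + x *\<^sub>R v + y *\<^sub>R w \<in> ball p e" if "0 \<le> x" "x \<le> t" "0 \<le> y" "y \<le> t" for x y
      proof -
        have "norm (x *\<^sub>R v + y *\<^sub>R w) \<le> x * norm v + y * norm w"
          using norm_triangle_ineq[of "x *\<^sub>R v" "y *\<^sub>R w"] that by simp
        also have "\<dots> \<le> t * norm v + t * norm w" using that by (intro add_mono mult_right_mono) auto
        also have "\<dots> \<le> t * c" using elim by (simp add: c_def algebra_simps)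
        finally have "dist (p + (x *\<^sub>R v + y *\<^sub>R w)) p < e" using tc by (simp add: dist_norm)
        then show ?thesis by (simp add: dist_commute add.assoc)
      qed
      have dgl: "((\<lambda>s. g (p + s *\<^sub>R v)) has_real_derivative
         dd v f (p + s *\<^sub>R v + t *\<^sub>R w) - dd v f (p + s *\<^sub>R v)) (at s)" if "0 \<le> s" "s \<le> t" for s
      proof -
        have "f differentiable (at ((p + t *\<^sub>R w) + s *\<^sub>R v))" "f differentiable (at (p + s *\<^sub>R v))"
          using Ck_on_imp_differentiable[OF C2] mem[of s t] mem[of s 0] that elim
          by (auto simp: algebra_simps)
        from DERIV_diff[OF line_has_real_derivative[OF this(1)] line_has_real_derivative[OF this(2)]]
        show ?thesis by (simp add: g_def algebra_simps)
      qed
      have "\<exists>s. 0 < s \<and> s < t \<and> g (p + t *\<^sub>R v) - g (p + 0 *\<^sub>R v) =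
          (t - 0) * (dd v f (p + s *\<^sub>R v + t *\<^sub>R w) - dd v f (p + s *\<^sub>R v))"
        by (intro MVT2) (use dgl elim in auto)
      then obtain s where s: "0 < s" "s < t" "g (p + t *\<^sub>R v) - g (p + 0 *\<^sub>R v) =
          (t - 0) * (dd v f (p + s *\<^sub>R v + t *\<^sub>R w) - dd v f (p + s *\<^sub>R v))"
        by blast
      have ms: "p + s *\<^sub>R v \<in> ball p e" "p + s *\<^sub>R v + t *\<^sub>R w \<in> ball p e"
        using mem[of s 0] mem[of s t] s elim by auto
      obtain u where u: "0 < u" "u < 1" "dd v f (p + s *\<^sub>R v + t *\<^sub>R w) =
          dd v f (p + s *\<^sub>R v) + dd (t *\<^sub>R w) (dd v f) (p + s *\<^sub>R v + u *\<^sub>R (t *\<^sub>R w))"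
        by (rule mvt_line[OF convex_ball ms C1[of v]])
      define q where "q = p + s *\<^sub>R v + (u * t) *\<^sub>R w"
      have ut: "0 \<le> u * t" "u * t \<le> t" using u elim by (auto simp: mult_left_le_one_le)
      have q: "q \<in> ball p e" unfolding q_def using mem[of s "u * t"] s ut by auto
      have "dist q p \<le> t * c"
      proof -
        have "dist q p \<le> s * norm v + (u * t) * norm w"
          using norm_triangle_ineq[of "s *\<^sub>R v" "(u * t) *\<^sub>R w"] s u elim
          by (simp add: q_def dist_norm add.assoc abs_mult)
        also have "\<dots> \<le> t * norm v + t * norm w" using s ut by (intro add_mono mult_right_mono) auto
        also have "\<dots> \<le> t * c" using elim by (simp add: c_def algebra_simps)
        finally show ?thesis .
      qed
      moreover have "f (p + t *\<^sub>R v + t *\<^sub>R w) - f (p + t *\<^sub>R v) - f (p + t *\<^sub>R w) + f p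
          = t\<^sup>2 * dd w (dd v f) q"
        using s(3) u(3) dd_scaleR[OF Ck_on_imp_differentiable[OF C1 _ q]]
        by (simp add: g_def q_def power2_eq_square algebra_simps)
      ultimately show ?case using elim by (intro exI[of _ q]) auto
    qed
    then obtain q where q: "\<forall>\<^sub>F t in at_right 0. dist (q t) p \<le> t * c \<and>
       (f (p + t *\<^sub>R v + t *\<^sub>R w) - f (p + t *\<^sub>R v) - f (p + t *\<^sub>R w) + f p) / t\<^sup>2 = dd w (dd v f) (q t)"
      unfolding eventually_ex by blast
    have "((\<lambda>t. t * c) \<longlongrightarrow> 0 * c) (at_right 0)" by (intro tendsto_intros)
    then have t0: "((\<lambda>t. t * c) \<longlongrightarrow> 0) (at_right 0)" by simp
    have "((\<lambda>t. q t - p) \<longlongrightarrow> 0) (at_right 0)"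
      by (rule Lim_null_comparison[OF _ t0]) (use q in \<open>auto elim!: eventually_mono simp: dist_norm\<close>)
    then have "(q \<longlongrightarrow> p) (at_right 0)" by (rule LIM_zero_cancel)
    then have "((\<lambda>t. dd w (dd v f) (q t)) \<longlongrightarrow> dd w (dd v f) p) (at_right 0)"
      using dd_tendsto[OF open_ball _ C1 _ tendsto_const, of p] e by auto
    then show ?thesis using q by (elim Lim_transform_eventually) (auto elim: eventually_mono)
  qed
  show ?thesis
    using tendsto_unique[OF _ lim[of v w] ] lim[of w v] by (simp add: algebra_simps)
qed

lemma Ck_on_2_dd: "Ck_on 2 U f \<Longrightarrow> Ck_on 1 U (dd v f)"
  using Ck_on_dd[of 1] by (simp add: numeral_2_eq_2)

lemma Ck_on_3_dd: "Ck_on 3 U f \<Longrightarrow> Ck_on 2 U (dd v f)"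
  using Ck_on_dd[of 2] by (simp add: numeral_3_eq_3 numeral_2_eq_2)

lemma Ck_on_3_2: "Ck_on 3 U f \<Longrightarrow> Ck_on 2 U f" by (rule Ck_on_le) auto

lemma Ck_on_2_1: "Ck_on 2 U f \<Longrightarrow> Ck_on 1 U f" by (rule Ck_on_le) auto

lemma Ck_on_1_diff: "Ck_on 1 U f \<Longrightarrow> x \<in> U \<Longrightarrow> f differentiable (at x)"
  by (rule Ck_on_imp_differentiable) auto

lemma Ck_on_2_diff: "Ck_on 2 U f \<Longrightarrow> x \<in> U \<Longrightarrow> f differentiable (at x)"
  by (rule Ck_on_imp_differentiable) auto

text \<open>At a single point only the outer direction enters linearly by construction; symmetry of
  the second derivative passes this on to the inner one.\<close>

lemma dd_dd_Basis:
  fixes f :: "'a::euclidean_space \<Rightarrow> real"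
  assumes "open U" "p \<in> U" "Ck_on 2 U f"
  shows "dd v (dd w f) p = (\<Sum>e\<in>Basis. (w \<bullet> e) * dd v (dd e f) p)"
  using dd_Basis[OF Ck_on_1_diff[OF Ck_on_2_dd[OF assms(3)] assms(2)], of w v] dd_commute[OF assms]
  by simp

lemma dd_dd_tendsto:
  fixes f :: "'a::euclidean_space \<Rightarrow> real"
  assumes "open U" "p \<in> U" "Ck_on 2 U f" "(a \<longlongrightarrow> p) F" "(v \<longlongrightarrow> v0) F" "(w \<longlongrightarrow> w0) F"
  shows "((\<lambda>n. dd (v n) (dd (w n) f) (a n)) \<longlongrightarrow> dd v0 (dd w0 f) p) F"
proof -
  have "((\<lambda>n. \<Sum>e\<in>Basis. (w n \<bullet> e) * dd (v n) (dd e f) (a n)) \<longlongrightarrow>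
      (\<Sum>e\<in>Basis. (w0 \<bullet> e) * dd v0 (dd e f) p)) F"
    by (intro tendsto_intros dd_tendsto[OF assms(1,2)] Ck_on_2_dd assms)
  moreover have "\<forall>\<^sub>F n in F. a n \<in> U" using topological_tendstoD assms(1,2,4) by metis
  then have "\<forall>\<^sub>F n in F. (\<Sum>e\<in>Basis. (w n \<bullet> e) * dd (v n) (dd e f) (a n)) = dd (v n) (dd (w n) f) (a n)"
    by eventually_elim (use dd_dd_Basis[OF assms(1) _ assms(3)] in simp)
  ultimately show ?thesis
    unfolding dd_dd_Basis[OF assms(1-3), of v0 w0] by (rule Lim_transform_eventually)
qed

section \<open>Difference quotients with moving base point and direction\<close>

lemma tendsto_line:
  fixes p :: "'a::real_normed_vector"
  assumes "(a \<longlongrightarrow> p) F" "(b \<longlongrightarrow> v) F" "(t \<longlongrightarrow> 0) F"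
  shows "((\<lambda>n. a n + t n *\<^sub>R b n) \<longlongrightarrow> p) F"
  using tendsto_add[OF assms(1) tendsto_scaleR[OF assms(3,2)]] by simp

lemma tendsto_intermediate:
  fixes p :: "'a::real_normed_vector"
  assumes "(a \<longlongrightarrow> p) F" "(b \<longlongrightarrow> v) F" "(t \<longlongrightarrow> 0) F" "\<forall>\<^sub>F n in F. 0 < s n \<and> s n < (1::real)"
  shows "((\<lambda>n. a n + (s n * t n) *\<^sub>R b n) \<longlongrightarrow> p) F"
proof (rule tendsto_line[OF assms(1,2)])
  show "((\<lambda>n. s n * t n) \<longlongrightarrow> 0) F"
  proof (rule Lim_null_comparison)
    show "\<forall>\<^sub>F n in F. norm (s n * t n) \<le> \<bar>t n\<bar>"
      using assms(4) by eventually_elim (auto simp: abs_mult mult_left_le_one_le)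
    show "((\<lambda>n. \<bar>t n\<bar>) \<longlongrightarrow> 0) F" using tendsto_rabs[OF assms(3)] by simp
  qed
qed

text \<open>A function of class C1 is strictly differentiable: the intermediate point of the mean
  value theorem still tends to p. The base point has to move because the compactness arguments
  produce sequences of boundary points.\<close>

lemma strict_derivative_tendsto:
  fixes f :: "'a::euclidean_space \<Rightarrow> real"
  assumes "open U" "p \<in> U" "Ck_on 1 U f" "(a \<longlongrightarrow> p) F" "(b \<longlongrightarrow> v) F" "(t \<longlongrightarrow> 0) F"
    "\<forall>\<^sub>F n in F. t n \<noteq> 0"
  shows "((\<lambda>n. (f (a n + t n *\<^sub>R b n) - f (a n)) / t n) \<longlongrightarrow> dd v f p) F"
proof -
  obtain e where e: "e > 0" "ball p e \<subseteq> U" using assms open_contains_ball by blast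
  have C1: "Ck_on 1 (ball p e) f" using Ck_on_subset assms(3) e by blast
  have ev: "\<forall>\<^sub>F n in F. a n \<in> ball p e" "\<forall>\<^sub>F n in F. a n + t n *\<^sub>R b n \<in> ball p e"
    using topological_tendstoD[OF assms(4) open_ball] e
      topological_tendstoD[OF tendsto_line[OF assms(4,5,6)] open_ball] by auto
  then have "\<forall>\<^sub>F n in F. \<exists>s. 0 < s \<and> s < 1 \<and>
      f (a n + t n *\<^sub>R b n) = f (a n) + dd (t n *\<^sub>R b n) f (a n + s *\<^sub>R (t n *\<^sub>R b n)) \<and>
      a n + s *\<^sub>R (t n *\<^sub>R b n) \<in> ball p e"
  proof eventually_elim
    case (elim n)
    show ?case
      by (rule mvt_line[OF convex_ball elim C1])
        (use convex_line_mem[OF convex_ball elim] in \<open>auto intro!: exI\<close>)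
  qed
  then obtain s where s: "\<forall>\<^sub>F n in F. 0 < s n \<and> s n < 1 \<and>
      f (a n + t n *\<^sub>R b n) = f (a n) + dd (t n *\<^sub>R b n) f (a n + s n *\<^sub>R (t n *\<^sub>R b n)) \<and>
      a n + s n *\<^sub>R (t n *\<^sub>R b n) \<in> ball p e"
    unfolding eventually_ex by blast
  have "((\<lambda>n. dd (b n) f (a n + (s n * t n) *\<^sub>R b n)) \<longlongrightarrow> dd v f p) F"
    by (rule dd_tendsto[OF assms(1-3) tendsto_intermediate[OF assms(4-6)] assms(5)])
      (use s in \<open>auto elim: eventually_mono\<close>)
  moreover have "\<forall>\<^sub>F n in F. dd (b n) f (a n + (s n * t n) *\<^sub>R b n) = (f (a n + t n *\<^sub>R b n) - f (a n)) / t n"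
    using s assms(7)
  proof eventually_elim
    case (elim n)
    then show ?case using dd_scaleR[OF Ck_on_1_diff[OF C1], of "a n + s n *\<^sub>R (t n *\<^sub>R b n)" "t n" "b n"]
      by simp
  qed
  ultimately show ?thesis by (rule Lim_transform_eventually)
qed

lemma taylor2_tendsto:
  fixes f :: "'a::euclidean_space \<Rightarrow> real"
  assumes "open U" "p \<in> U" "Ck_on 2 U f" "(a \<longlongrightarrow> p) F" "(b \<longlongrightarrow> v) F" "(t \<longlongrightarrow> 0) F"
    "\<forall>\<^sub>F n in F. t n \<noteq> 0"
  shows "((\<lambda>n. (f (a n + t n *\<^sub>R b n) - f (a n) - t n * dd (b n) f (a n)) / (t n)\<^sup>2)
      \<longlongrightarrow> dd v (dd v f) p / 2) F"
proof -
  obtain e where e: "e > 0" "ball p e \<subseteq> U" using assms open_contains_ball by blast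
  have C2: "Ck_on 2 (ball p e) f" using Ck_on_subset assms(3) e by blast
  have ev: "\<forall>\<^sub>F n in F. a n \<in> ball p e" "\<forall>\<^sub>F n in F. a n + t n *\<^sub>R b n \<in> ball p e"
    using topological_tendstoD[OF assms(4) open_ball] e
      topological_tendstoD[OF tendsto_line[OF assms(4,5,6)] open_ball] by auto
  then have "\<forall>\<^sub>F n in F. \<exists>s. 0 < s \<and> s < 1 \<and> f (a n + t n *\<^sub>R b n) = f (a n) + dd (t n *\<^sub>R b n) f (a n)
        + dd (t n *\<^sub>R b n) (dd (t n *\<^sub>R b n) f) (a n + s *\<^sub>R (t n *\<^sub>R b n)) / 2 \<and>
      a n + s *\<^sub>R (t n *\<^sub>R b n) \<in> ball p e"
  proof eventually_elim
    case (elim n)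
    show ?case
      by (rule taylor2_line[OF convex_ball elim C2])
        (use convex_line_mem[OF convex_ball elim] in \<open>auto intro!: exI\<close>)
  qed
  then obtain s where s: "\<forall>\<^sub>F n in F. 0 < s n \<and> s n < 1 \<and> f (a n + t n *\<^sub>R b n) = f (a n) + dd (t n *\<^sub>R b n) f (a n)
        + dd (t n *\<^sub>R b n) (dd (t n *\<^sub>R b n) f) (a n + s n *\<^sub>R (t n *\<^sub>R b n)) / 2 \<and>
      a n + s n *\<^sub>R (t n *\<^sub>R b n) \<in> ball p e"
    unfolding eventually_ex by blast
  have "((\<lambda>n. dd (b n) (dd (b n) f) (a n + (s n * t n) *\<^sub>R b n) / 2) \<longlongrightarrow> dd v (dd v f) p / 2) F"
    by (intro tendsto_divide tendsto_const dd_dd_tendsto[OF assms(1-3) tendsto_intermediate[OF assms(4-6)] assms(5)] assms(5))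
      (use s in \<open>auto elim: eventually_mono\<close>)
  moreover have "\<forall>\<^sub>F n in F. dd (b n) (dd (b n) f) (a n + (s n * t n) *\<^sub>R b n) / 2
      = (f (a n + t n *\<^sub>R b n) - f (a n) - t n * dd (b n) f (a n)) / (t n)\<^sup>2"
    using s assms(7) ev(1)
  proof eventually_elim
    case (elim n)
    define q where "q = a n + s n *\<^sub>R (t n *\<^sub>R b n)"
    have q: "q \<in> ball p e" using elim by (simp add: q_def)
    have "dd (t n *\<^sub>R b n) (dd (t n *\<^sub>R b n) f) q = t n * dd (b n) (dd (t n *\<^sub>R b n) f) q"
      using dd_scaleR[OF Ck_on_1_diff[OF Ck_on_2_dd[OF C2] q]] by simp
    also have "\<dots> = t n * dd (t n *\<^sub>R b n) (dd (b n) f) q"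
      by (simp add: dd_commute[OF open_ball q C2])
    also have "\<dots> = t n * (t n * dd (b n) (dd (b n) f) q)"
      using dd_scaleR[OF Ck_on_1_diff[OF Ck_on_2_dd[OF C2] q]] by simp
    finally have "dd (t n *\<^sub>R b n) (dd (t n *\<^sub>R b n) f) q = (t n)\<^sup>2 * dd (b n) (dd (b n) f) q"
      by (simp add: power2_eq_square)
    moreover have "dd (t n *\<^sub>R b n) f (a n) = t n * dd (b n) f (a n)"
      using dd_scaleR[OF Ck_on_2_diff[OF C2 elim(3)]] by simp
    moreover have "q = a n + (s n * t n) *\<^sub>R b n" by (simp add: q_def)
    ultimately show ?case using elim by (simp add: q_def field_simps)
  qed
  ultimately show ?thesis by (rule Lim_transform_eventually)
qed

text \<open>The point moves with velocity v and the vector with velocity \<open>W0\<close>; the two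
  summands of the limit are these two contributions.\<close>

lemma strict_derivative_dd_tendsto:
  fixes f :: "'a::euclidean_space \<Rightarrow> real"
  assumes "open U" "p \<in> U" "Ck_on 2 U f" "(a \<longlongrightarrow> p) F" "(b \<longlongrightarrow> v) F" "(t \<longlongrightarrow> 0) F"
    "\<forall>\<^sub>F n in F. t n \<noteq> 0" "(X \<longlongrightarrow> X0) F" "(W \<longlongrightarrow> W0) F"
  shows "((\<lambda>n. (dd (X n + t n *\<^sub>R W n) f (a n + t n *\<^sub>R b n) - dd (X n) f (a n)) / t n)
      \<longlongrightarrow> dd v (dd X0 f) p + dd W0 f p) F"
proof -
  have a': "((\<lambda>n. a n + t n *\<^sub>R b n) \<longlongrightarrow> p) F" by (rule tendsto_line) fact+
  have ev: "\<forall>\<^sub>F n in F. a n \<in> U" "\<forall>\<^sub>F n in F. a n + t n *\<^sub>R b n \<in> U"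
    using topological_tendstoD assms(1,2,4) a' by metis+
  have "((\<lambda>n. (\<Sum>e\<in>Basis. (X n \<bullet> e) * ((dd e f (a n + t n *\<^sub>R b n) - dd e f (a n)) / t n))
        + dd (W n) f (a n + t n *\<^sub>R b n)) \<longlongrightarrow> (\<Sum>e\<in>Basis. (X0 \<bullet> e) * dd v (dd e f) p) + dd W0 f p) F"
    by (intro tendsto_intros dd_tendsto[OF assms(1,2)] strict_derivative_tendsto[OF assms(1,2)]
        Ck_on_2_dd Ck_on_2_1 assms a')
  moreover have "\<forall>\<^sub>F n in F. (\<Sum>e\<in>Basis. (X n \<bullet> e) * ((dd e f (a n + t n *\<^sub>R b n) - dd e f (a n)) / t n))
        + dd (W n) f (a n + t n *\<^sub>R b n)
      = (dd (X n + t n *\<^sub>R W n) f (a n + t n *\<^sub>R b n) - dd (X n) f (a n)) / t n"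
    using ev assms(7)
  proof eventually_elim
    case (elim n)
    have d: "f differentiable at (a n)" "f differentiable at (a n + t n *\<^sub>R b n)"
      using Ck_on_2_diff assms(3) elim by auto
    have "(\<Sum>e\<in>Basis. (X n \<bullet> e) * ((dd e f (a n + t n *\<^sub>R b n) - dd e f (a n)) / t n))
        = (\<Sum>e\<in>Basis. (X n \<bullet> e) * dd e f (a n + t n *\<^sub>R b n) - (X n \<bullet> e) * dd e f (a n)) / t n"
      by (simp add: sum_divide_distrib algebra_simps)
    also have "\<dots> = (dd (X n) f (a n + t n *\<^sub>R b n) - dd (X n) f (a n)) / t n"
      using dd_Basis[OF d(1), of "X n"] dd_Basis[OF d(2), of "X n"] by (simp add: sum_subtractf)
    finally show ?case using elim
      by (simp add: dd_add dd_scaleR d add_divide_distrib diff_divide_distrib)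
  qed
  ultimately show ?thesis
    unfolding dd_dd_Basis[OF assms(1-3), of v X0] by (rule Lim_transform_eventually)
qed

lemma dd_sum_cmult:
  fixes g :: "'i \<Rightarrow> 'a::real_normed_vector \<Rightarrow> real"
  assumes "\<And>i. i \<in> I \<Longrightarrow> g i differentiable (at p)"
  shows "dd v (\<lambda>q. \<Sum>i\<in>I. c i * g i q) p = (\<Sum>i\<in>I. c i * dd v (g i) p)"
  by (rule dd_eqI[of _ "\<lambda>v. \<Sum>i\<in>I. c i * dd v (g i) p"])
    (intro has_derivative_sum has_derivative_mult_right has_derivative_dd assms)

lemma dd_dd_dd_Basis:
  fixes f :: "'a::euclidean_space \<Rightarrow> real"
  assumes "open U" "p \<in> U" "Ck_on 3 U f"
  shows "dd u (dd v (dd w f)) p = (\<Sum>e\<in>Basis. (w \<bullet> e) * dd u (dd v (dd e f)) p)"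
proof -
  have "dd u (dd v (dd w f)) p = dd u (\<lambda>q. \<Sum>e\<in>Basis. (w \<bullet> e) * dd v (dd e f) q) p"
    by (rule dd_cong_open[OF assms(1,2)]) (rule dd_dd_Basis[OF assms(1) _ Ck_on_3_2[OF assms(3)]])
  then show ?thesis
    using dd_sum_cmult[of Basis "\<lambda>e. dd v (dd e f)" p u "\<lambda>e. w \<bullet> e"]
      Ck_on_1_diff[OF Ck_on_2_dd[OF Ck_on_3_dd[OF assms(3)]] assms(2)] by simp
qed

text \<open>The origin of the third-order term in the hypersurface form: the point and both vectors
  move to first order, and each contributes one summand.\<close>

lemma strict_derivative_dd_dd_tendsto:
  fixes f :: "'a::euclidean_space \<Rightarrow> real"
  assumes "open U" "p \<in> U" "Ck_on 3 U f" "(a \<longlongrightarrow> p) F" "(b \<longlongrightarrow> v) F" "(t \<longlongrightarrow> 0) F"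
    "\<forall>\<^sub>F n in F. t n \<noteq> 0" "(X \<longlongrightarrow> X0) F" "(W \<longlongrightarrow> W0) F" "(Y \<longlongrightarrow> Y0) F" "(V \<longlongrightarrow> V0) F"
  shows "((\<lambda>n. (dd (Y n + t n *\<^sub>R V n) (dd (X n + t n *\<^sub>R W n) f) (a n + t n *\<^sub>R b n)
        - dd (Y n) (dd (X n) f) (a n)) / t n)
      \<longlongrightarrow> dd v (dd Y0 (dd X0 f)) p + dd V0 (dd X0 f) p + dd Y0 (dd W0 f) p) F"
proof -
  have a': "((\<lambda>n. a n + t n *\<^sub>R b n) \<longlongrightarrow> p) F" by (rule tendsto_line) fact+
  have Y': "((\<lambda>n. Y n + t n *\<^sub>R V n) \<longlongrightarrow> Y0) F" by (rule tendsto_line) fact+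
  have ev: "\<forall>\<^sub>F n in F. a n \<in> U" "\<forall>\<^sub>F n in F. a n + t n *\<^sub>R b n \<in> U"
    using topological_tendstoD assms(1,2,4) a' by metis+
  have C2: "Ck_on 2 U f" by (rule Ck_on_3_2) fact
  have lim: "((\<lambda>n. (\<Sum>e\<in>Basis. (X n \<bullet> e) * ((dd (Y n + t n *\<^sub>R V n) (dd e f) (a n + t n *\<^sub>R b n) - dd (Y n) (dd e f) (a n)) / t n))
        + dd (Y n + t n *\<^sub>R V n) (dd (W n) f) (a n + t n *\<^sub>R b n))
      \<longlongrightarrow> (\<Sum>e\<in>Basis. (X0 \<bullet> e) * (dd v (dd Y0 (dd e f)) p + dd V0 (dd e f) p)) + dd Y0 (dd W0 f) p) F"
    by (intro tendsto_intros dd_dd_tendsto[OF assms(1,2)] strict_derivative_dd_tendsto[OF assms(1,2)]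
        Ck_on_3_dd C2 assms a' Y')
  have eq: "\<forall>\<^sub>F n in F. (\<Sum>e\<in>Basis. (X n \<bullet> e) * ((dd (Y n + t n *\<^sub>R V n) (dd e f) (a n + t n *\<^sub>R b n) - dd (Y n) (dd e f) (a n)) / t n))
        + dd (Y n + t n *\<^sub>R V n) (dd (W n) f) (a n + t n *\<^sub>R b n)
      = (dd (Y n + t n *\<^sub>R V n) (dd (X n + t n *\<^sub>R W n) f) (a n + t n *\<^sub>R b n) - dd (Y n) (dd (X n) f) (a n)) / t n"
    using ev assms(7)
  proof eventually_elim
    case (elim n)
    have "(\<Sum>e\<in>Basis. (X n \<bullet> e) * ((dd (Y n + t n *\<^sub>R V n) (dd e f) (a n + t n *\<^sub>R b n) - dd (Y n) (dd e f) (a n)) / t n))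
        = (\<Sum>e\<in>Basis. (X n \<bullet> e) * dd (Y n + t n *\<^sub>R V n) (dd e f) (a n + t n *\<^sub>R b n) - (X n \<bullet> e) * dd (Y n) (dd e f) (a n)) / t n"
      by (simp add: sum_divide_distrib algebra_simps)
    also have "\<dots> = (dd (Y n + t n *\<^sub>R V n) (dd (X n) f) (a n + t n *\<^sub>R b n) - dd (Y n) (dd (X n) f) (a n)) / t n"
      using dd_dd_Basis[OF assms(1) elim(1) C2, of "Y n" "X n"]
        dd_dd_Basis[OF assms(1) elim(2) C2, of "Y n + t n *\<^sub>R V n" "X n"] by (simp add: sum_subtractf)
    moreover have "dd (Y n + t n *\<^sub>R V n) (dd (X n + t n *\<^sub>R W n) f) (a n + t n *\<^sub>R b n)
       = dd (Y n + t n *\<^sub>R V n) (dd (X n) f) (a n + t n *\<^sub>R b n) + t n * dd (Y n + t n *\<^sub>R V n) (dd (W n) f) (a n + t n *\<^sub>R b n)"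
      unfolding dd_commute[OF assms(1) elim(2) C2, of "Y n + t n *\<^sub>R V n"]
      using Ck_on_1_diff[OF Ck_on_2_dd[OF C2] elim(2)] by (simp add: dd_add dd_scaleR)
    ultimately show ?case using elim
      by (simp add: add_divide_distrib diff_divide_distrib)
  qed
  have "(\<Sum>e\<in>Basis. (X0 \<bullet> e) * (dd v (dd Y0 (dd e f)) p + dd V0 (dd e f) p))
      = dd v (dd Y0 (dd X0 f)) p + dd V0 (dd X0 f) p"
    unfolding dd_dd_dd_Basis[OF assms(1-3), of v Y0 X0] dd_dd_Basis[OF assms(1,2) C2, of V0 X0]
    by (simp add: sum.distrib algebra_simps)
  then show ?thesis using Lim_transform_eventually[OF lim eq] by simp
qed

lemma has_derivative_dd_compose:
  fixes f :: "'b::euclidean_space \<Rightarrow> real" and g :: "'a::real_normed_vector \<Rightarrow> 'b"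
  assumes "open U" "Ck_on 2 U f" "open V" "x \<in> V" "g ` V \<subseteq> U"
    "(A has_derivative dA) (at x)" "(g has_derivative dg) (at x)"
  shows "((\<lambda>q. dd (A q) f (g q)) has_derivative
      (\<lambda>w. dd (dA w) f (g x) + dd (dg w) (dd (A x) f) (g x))) (at x)"
proof -
  have gx: "g x \<in> U" using assms by auto
  have "((\<lambda>q. \<Sum>e\<in>Basis. (A q \<bullet> e) * dd e f (g q)) has_derivative
      (\<lambda>w. \<Sum>e\<in>Basis. (A x \<bullet> e) * dd (dg w) (dd e f) (g x) + (dA w \<bullet> e) * dd e f (g x))) (at x)"
    by (intro has_derivative_sum has_derivative_mult has_derivative_inner_left assms(6)
        has_derivative_compose[OF assms(7) has_derivative_dd]
        Ck_on_1_diff[OF Ck_on_2_dd[OF assms(2)] gx])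
  moreover have "(\<lambda>w. \<Sum>e\<in>Basis. (A x \<bullet> e) * dd (dg w) (dd e f) (g x) + (dA w \<bullet> e) * dd e f (g x))
      = (\<lambda>w. dd (dA w) f (g x) + dd (dg w) (dd (A x) f) (g x))"
    (is "?l = ?r")
  proof
    fix w
    show "?l w = ?r w"
      unfolding dd_Basis[OF Ck_on_2_diff[OF assms(2) gx], of "dA w"]
        dd_dd_Basis[OF assms(1) gx assms(2), of "dg w" "A x"]
      by (simp add: sum.distrib)
  qed
  ultimately have *: "((\<lambda>q. \<Sum>e\<in>Basis. (A q \<bullet> e) * dd e f (g q)) has_derivative
      (\<lambda>w. dd (dA w) f (g x) + dd (dg w) (dd (A x) f) (g x))) (at x)" by simp
  show ?thesis
  proof (rule has_derivative_transform_within_open[OF * assms(3,4)])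
    fix q assume "q \<in> V"
    then have "f differentiable at (g q)" using Ck_on_2_diff[OF assms(2)] assms(5) by auto
    then show "(\<Sum>e\<in>Basis. (A q \<bullet> e) * dd e f (g q)) = dd (A q) f (g q)" by (simp add: dd_Basis[of f])
  qed
qed

section \<open>The complex Hessian in terms of real derivatives\<close>

text \<open>Multiplication by \<i> as a real-linear map. The (1,0) vector with coefficients X is
  identified with the real vector X, and its action on functions is read off from the real
  derivatives along \<open>X\<close> and \<open>J X\<close>.\<close>

definition J :: "complex ^ 'n \<Rightarrow> complex ^ 'n" where "J X = \<i> *s X"

lemma linear_J: "linear J"
  by (rule linearI) (simp_all add: J_def vec_eq_iff vector_scalar_mult_def distrib_left)

lemma bounded_linear_J: "bounded_linear J"
  using linear_J linear_conv_bounded_linear by blast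

lemmas J_add = linear_add[OF linear_J]
lemmas J_diff = linear_diff[OF linear_J]
lemmas J_scaleR = linear_scale[OF linear_J]
lemmas J_minus = linear_neg[OF linear_J]

lemma J_J [simp]: "J (J X) = - X"
  by (simp add: J_def vec_eq_iff)

lemma inner_J_J [simp]: "J X \<bullet> J Y = X \<bullet> Y"
  by (simp add: J_def inner_vec_def inner_complex_def algebra_simps)

lemma inner_J_self [simp]: "X \<bullet> J X = 0" "J X \<bullet> X = 0"
  by (simp_all add: J_def inner_vec_def inner_complex_def algebra_simps)

lemma norm_J [simp]: "norm (J X) = norm X"
  by (simp add: norm_eq_sqrt_inner)

lemma vector_smult_eq: "z *s X = Re z *\<^sub>R X + Im z *\<^sub>R J X"
  by (simp add: J_def vec_eq_iff complex_eq_iff)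

lemma vec_axis_expansion:
  fixes X :: "complex ^ 'n"
  shows "X = (\<Sum>j\<in>UNIV. Re (X $ j) *\<^sub>R axis j 1 + Im (X $ j) *\<^sub>R axis j \<i>)"
  by (simp add: vec_eq_iff axis_def sum.distrib complex_eq_iff if_distrib[of "\<lambda>x. _ *\<^sub>R x"] sum.delta' cong: if_cong)

lemma vec10_dd:
  assumes "f differentiable (at p)"
  shows "vec10 X f p = (dd X f p - \<i> * dd (J X) f p) / 2"
proof -
  have "dd X f p = (\<Sum>j\<in>UNIV. Re (X $ j) *\<^sub>R dd (axis j 1) f p + Im (X $ j) *\<^sub>R dd (axis j \<i>) f p)"
    by (subst vec_axis_expansion[of X]) (simp add: dd_sum dd_add dd_scaleR assms)
  moreover have "dd (J X) f p = (\<Sum>j\<in>UNIV. - Im (X $ j) *\<^sub>R dd (axis j 1) f p + Re (X $ j) *\<^sub>R dd (axis j \<i>) f p)"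
    by (subst vec_axis_expansion[of "J X"]) (simp add: dd_sum dd_add dd_diff dd_scaleR dd_minus assms J_def)
  ultimately show ?thesis
    unfolding vec10_def d_z_def dd_def[symmetric]
    by (simp add: sum_divide_distrib sum_distrib_left sum_subtractf[symmetric])
      (rule sum.cong, auto simp: complex_eq_iff algebra_simps add_divide_distrib diff_divide_distrib)
qed

lemma vec01_dd:
  assumes "f differentiable (at p)"
  shows "vec01 X f p = (dd X f p + \<i> * dd (J X) f p) / 2"
proof -
  have "dd X f p = (\<Sum>j\<in>UNIV. Re (X $ j) *\<^sub>R dd (axis j 1) f p + Im (X $ j) *\<^sub>R dd (axis j \<i>) f p)"
    by (subst vec_axis_expansion[of X]) (simp add: dd_sum dd_add dd_scaleR assms)
  moreover have "dd (J X) f p = (\<Sum>j\<in>UNIV. - Im (X $ j) *\<^sub>R dd (axis j 1) f p + Re (X $ j) *\<^sub>R dd (axis j \<i>) f p)"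
    by (subst vec_axis_expansion[of "J X"]) (simp add: dd_sum dd_add dd_diff dd_scaleR dd_minus assms J_def)
  ultimately show ?thesis
    unfolding vec01_def d_zbar_def dd_def[symmetric]
    by (simp add: sum_divide_distrib sum_distrib_left sum.distrib[symmetric])
      (rule sum.cong, auto simp: complex_eq_iff algebra_simps add_divide_distrib diff_divide_distrib)
qed

lemma has_derivative_cplx:
  assumes "f differentiable (at p)"
  shows "(cplx f has_derivative (\<lambda>v. of_real (dd v f p))) (at p)"
  by (rule has_derivative_of_real[OF has_derivative_dd[OF assms]])

lemma differentiable_cplx: "f differentiable (at p) \<Longrightarrow> cplx f differentiable (at p)"
  using has_derivative_cplx differentiable_def by blast

lemma dd_cplx: "f differentiable (at p) \<Longrightarrow> dd v (cplx f) p = of_real (dd v f p)"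
  by (rule dd_eqI[OF has_derivative_cplx])

lemma vec10_cplx: "f differentiable (at p) \<Longrightarrow> vec10 X (cplx f) p = Complex (dd X f p / 2) (- dd (J X) f p / 2)"
  by (simp add: vec10_dd differentiable_cplx dd_cplx complex_eq_iff)

lemma vec01_cplx: "f differentiable (at p) \<Longrightarrow> vec01 X (cplx f) p = Complex (dd X f p / 2) (dd (J X) f p / 2)"
  by (simp add: vec01_dd differentiable_cplx dd_cplx complex_eq_iff)

lemma d_zbar_cplx:
  "f differentiable (at p) \<Longrightarrow> d_zbar k (cplx f) p = Complex (dd (axis k 1) f p / 2) (dd (axis k \<i>) f p / 2)"
  by (simp add: d_zbar_def dd_def[symmetric] dd_cplx complex_eq_iff)

lemma d_z_cplx:
  "f differentiable (at p) \<Longrightarrow> d_z k (cplx f) p = Complex (dd (axis k 1) f p / 2) (- dd (axis k \<i>) f p / 2)"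
  by (simp add: d_z_def dd_def[symmetric] dd_cplx complex_eq_iff)

lemma dd_sum_cmult_complex:
  fixes g :: "'i \<Rightarrow> 'a::real_normed_vector \<Rightarrow> complex"
  assumes "\<And>i. i \<in> I \<Longrightarrow> g i differentiable (at p)"
  shows "dd v (\<lambda>q. \<Sum>i\<in>I. c i * g i q) p = (\<Sum>i\<in>I. c i * dd v (g i) p)"
  by (rule dd_eqI[of _ "\<lambda>v. \<Sum>i\<in>I. c i * dd v (g i) p"])
    (intro has_derivative_sum has_derivative_mult_right has_derivative_dd assms)

lemma d_z_sum_cmult:
  assumes "\<And>i. i \<in> I \<Longrightarrow> g i differentiable (at p)"
  shows "d_z j (\<lambda>q. \<Sum>i\<in>I. c i * g i q) p = (\<Sum>i\<in>I. c i * d_z j (g i) p)"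
  unfolding d_z_def dd_def[symmetric] using assms
  by (simp add: dd_sum_cmult_complex sum_divide_distrib sum_distrib_left sum_subtractf[symmetric])
    (rule sum.cong, auto simp: algebra_simps diff_divide_distrib)

lemma Complex_has_derivative:
  assumes "(f has_derivative f') F" "(g has_derivative g') F"
  shows "((\<lambda>x. Complex (f x) (g x)) has_derivative (\<lambda>v. Complex (f' v) (g' v))) F"
proof -
  have "((\<lambda>x. of_real (f x) + \<i> * of_real (g x)) has_derivative (\<lambda>v. of_real (f' v) + \<i> * of_real (g' v))) F"
    by (intro has_derivative_add has_derivative_mult_right has_derivative_of_real assms)
  then show ?thesis by (simp add: Complex_eq)
qed

lemma Complex_differentiable:
  "f differentiable (at p) \<Longrightarrow> g differentiable (at p) \<Longrightarrow> (\<lambda>x. Complex (f x) (g x)) differentiable (at p)"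
  unfolding differentiable_def using Complex_has_derivative by blast

lemma dd_Complex:
  "f differentiable (at p) \<Longrightarrow> g differentiable (at p) \<Longrightarrow>
    dd v (\<lambda>x. Complex (f x) (g x)) p = Complex (dd v f p) (dd v g p)"
  by (rule dd_eqI[OF Complex_has_derivative[OF has_derivative_dd has_derivative_dd]])

lemma d_zbar_cplx_differentiable:
  assumes "open U" "p \<in> U" "Ck_on 2 U f"
  shows "d_zbar k (cplx f) differentiable (at p)"
proof (rule differentiable_cong_open[OF assms(1,2)])
  show "(\<lambda>q. Complex (dd (axis k 1) f q * (1/2)) (dd (axis k \<i>) f q * (1/2))) differentiable at p"
    by (intro Complex_differentiable differentiable_mult differentiable_const
        Ck_on_1_diff[OF Ck_on_2_dd[OF assms(3)] assms(2)])
qed (simp add: d_zbar_cplx Ck_on_2_diff[OF assms(3)])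

lemma Hess_eq_vec10_vec01:
  assumes "open U" "p \<in> U" "Ck_on 2 U f"
  shows "Hess f p X Y = vec10 X (\<lambda>q. vec01 Y (cplx f) q) p"
  unfolding Hess_def vec10_def vec01_def
  by (subst d_z_sum_cmult[OF d_zbar_cplx_differentiable[OF assms]])
    (simp add: sum_distrib_left mult_ac)

lemma Hess_eq:
  assumes "open U" "p \<in> U" "Ck_on 2 U f"
  shows "Hess f p X Y = Complex ((dd X (dd Y f) p + dd (J X) (dd (J Y) f) p) / 4)
      ((dd X (dd (J Y) f) p - dd (J X) (dd Y f) p) / 4)"
proof -
  have d: "dd v f differentiable at p" for v
    by (rule Ck_on_1_diff[OF Ck_on_2_dd[OF assms(3)] assms(2)])
  have eq: "Complex (1/2 * dd Y f q) (1/2 * dd (J Y) f q) = vec01 Y (cplx f) q" if "q \<in> U" for q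
    by (simp add: vec01_cplx[OF Ck_on_2_diff[OF assms(3) that]])
  have d': "(\<lambda>q. 1/2 * dd v f q) differentiable at p" for v
    by (intro differentiable_mult differentiable_const d)
  have dd': "dd w (\<lambda>q. 1/2 * dd v f q) p = 1/2 * dd w (dd v f) p" for v w
    by (rule dd_eqI[OF has_derivative_mult_right[OF has_derivative_dd[OF d]]])
  have e: "dd w (vec01 Y (cplx f)) p = Complex (dd w (dd Y f) p / 2) (dd w (dd (J Y) f) p / 2)" for w
    using dd_cong_open[OF assms(1,2) eq, where v=w] dd_Complex[OF d' d', of w Y "J Y"] unfolding dd' by simp
  have "vec01 Y (cplx f) differentiable at p"
    by (rule differentiable_cong_open[OF assms(1,2) eq Complex_differentiable[OF d' d']])
  then have "Hess f p X Y = (dd X (vec01 Y (cplx f)) p - \<i> * dd (J X) (vec01 Y (cplx f)) p) / 2"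
    unfolding Hess_eq_vec10_vec01[OF assms] by (rule vec10_dd)
  then show ?thesis unfolding e by (simp add: complex_eq_iff field_simps)
qed

text \<open>One quarter of the Laplacian along the complex line spanned by X: the complex Hessian on
  the diagonal, as a real number.\<close>

definition hess :: "(complex ^ 'n \<Rightarrow> real) \<Rightarrow> complex ^ 'n \<Rightarrow> complex ^ 'n \<Rightarrow> real" where
  "hess f q X = (dd X (dd X f) q + dd (J X) (dd (J X) f) q) / 4"

lemma Hess_self:
  assumes "open U" "p \<in> U" "Ck_on 2 U f"
  shows "Hess f p X X = of_real (hess f p X)"
  unfolding Hess_eq[OF assms] hess_def
  using dd_commute[OF assms, of X "J X"] by (simp add: complex_eq_iff)

lemma Hess_add_left: "Hess f p (X + X') Y = Hess f p X Y + Hess f p X' Y"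
  by (simp add: Hess_def algebra_simps sum.distrib)

lemma Hess_smult_left: "Hess f p (c *s X) Y = c * Hess f p X Y"
  by (simp add: Hess_def algebra_simps sum_distrib_left)

lemma Hess_scaleR_left: "Hess f p (c *\<^sub>R X) Y = of_real c * Hess f p X Y"
  using Hess_smult_left[of f p "of_real c"] by (simp add: vector_smult_eq)

lemma Hess_add_right: "Hess f p X (Y + Y') = Hess f p X Y + Hess f p X Y'"
  by (simp add: Hess_def algebra_simps sum.distrib)

lemma Hess_smult_right: "Hess f p X (c *s Y) = cnj c * Hess f p X Y"
  by (simp add: Hess_def algebra_simps sum_distrib_left)

lemma Hess_cnj:
  assumes "open U" "p \<in> U" "Ck_on 2 U f"
  shows "cnj (Hess f p X Y) = Hess f p Y X"
  unfolding Hess_eq[OF assms]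
  by (simp add: complex_eq_iff dd_commute[OF assms, of X Y] dd_commute[OF assms, of "J X" "J Y"]
      dd_commute[OF assms, of X "J Y"] dd_commute[OF assms, of "J X" Y] diff_divide_distrib)

lemma hess_add:
  assumes "open U" "p \<in> U" "Ck_on 2 U f"
  shows "hess f p (X + Y) = hess f p X + 2 * Re (Hess f p X Y) + hess f p Y"
proof -
  have "of_real (hess f p (X + Y)) = of_real (hess f p X) + (Hess f p X Y + cnj (Hess f p X Y)) + of_real (hess f p Y)"
    unfolding Hess_cnj[OF assms] Hess_self[OF assms, symmetric] Hess_add_left Hess_add_right by simp
  then have "Re (of_real (hess f p (X + Y))) = Re (of_real (hess f p X) + (Hess f p X Y + cnj (Hess f p X Y)) + of_real (hess f p Y))"
    by (rule arg_cong)
  then show ?thesis by simp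
qed

lemma hess_smult:
  assumes "open U" "p \<in> U" "Ck_on 2 U f"
  shows "hess f p (c *s X) = (cmod c)\<^sup>2 * hess f p X"
proof -
  have "complex_of_real (hess f p (c *s X)) = of_real ((cmod c)\<^sup>2 * hess f p X)"
    unfolding Hess_self[OF assms, symmetric] Hess_smult_left Hess_smult_right of_real_mult
    using complex_norm_square[of c] by simp
  then show ?thesis using of_real_eq_iff by blast
qed

lemma hess_scaleR:
  assumes "open U" "p \<in> U" "Ck_on 2 U f"
  shows "hess f p (c *\<^sub>R X) = c\<^sup>2 * hess f p X"
  using hess_smult[OF assms, of "of_real c" X] by (simp add: vector_smult_eq power2_eq_square)

lemma vec10_smult: "vec10 (c *s X) f p = c * vec10 X f p"
  by (simp add: vec10_def sum_distrib_left mult_ac)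

lemma vec10_add: "vec10 (X + Y) f p = vec10 X f p + vec10 Y f p"
  by (simp add: vec10_def sum.distrib algebra_simps)

lemma vec10_diff: "vec10 (X - Y) f p = vec10 X f p - vec10 Y f p"
  by (simp add: vec10_def sum_subtractf algebra_simps)

lemma vec10_scaleR: "vec10 (c *\<^sub>R X) f p = of_real c * vec10 X f p"
  using vec10_smult[of "of_real c"] by (simp add: vector_smult_eq)

lemma vec01_vec10:
  "f differentiable (at p) \<Longrightarrow> vec01 X (cplx f) p = cnj (vec10 X (cplx f) p)"
  by (simp add: vec10_cplx vec01_cplx complex_eq_iff)

lemma hess_tendsto:
  assumes "open U" "p \<in> U" "Ck_on 2 U f" "(a \<longlongrightarrow> p) F" "(X \<longlongrightarrow> X0) F"
  shows "((\<lambda>n. hess f (a n) (X n)) \<longlongrightarrow> hess f p X0) F"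
  unfolding hess_def
  by (intro tendsto_intros dd_dd_tendsto[OF assms(1-4)] assms bounded_linear.tendsto[OF bounded_linear_J]) auto

lemma Hess_tendsto:
  assumes "open U" "p \<in> U" "Ck_on 2 U f" "(a \<longlongrightarrow> p) F" "(X \<longlongrightarrow> X0) F" "(Y \<longlongrightarrow> Y0) F"
  shows "((\<lambda>n. Hess f (a n) (X n) (Y n)) \<longlongrightarrow> Hess f p X0 Y0) F"
proof -
  have ev: "\<forall>\<^sub>F n in F. a n \<in> U" using topological_tendstoD assms(1,2,4) by metis
  have "((\<lambda>n. Complex ((dd (X n) (dd (Y n) f) (a n) + dd (J (X n)) (dd (J (Y n)) f) (a n)) / 4)
      ((dd (X n) (dd (J (Y n)) f) (a n) - dd (J (X n)) (dd (Y n) f) (a n)) / 4)) \<longlongrightarrow> Hess f p X0 Y0) F"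
    unfolding Hess_eq[OF assms(1-3)]
    by (intro tendsto_intros dd_dd_tendsto[OF assms(1-4)] assms bounded_linear.tendsto[OF bounded_linear_J]) auto
  moreover have "\<forall>\<^sub>F n in F. Complex ((dd (X n) (dd (Y n) f) (a n) + dd (J (X n)) (dd (J (Y n)) f) (a n)) / 4)
      ((dd (X n) (dd (J (Y n)) f) (a n) - dd (J (X n)) (dd (Y n) f) (a n)) / 4) = Hess f (a n) (X n) (Y n)"
    using ev by eventually_elim (simp add: Hess_eq[OF assms(1) _ assms(3)])
  ultimately show ?thesis by (rule Lim_transform_eventually)
qed

lemma vec10_tendsto:
  fixes f :: "complex ^ 'n \<Rightarrow> real"
  assumes "open U" "p \<in> U" "Ck_on 1 U f" "(a \<longlongrightarrow> p) F" "(X \<longlongrightarrow> X0) F"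
  shows "((\<lambda>n. vec10 (X n) (cplx f) (a n)) \<longlongrightarrow> vec10 X0 (cplx f) p) F"
proof -
  have ev: "\<forall>\<^sub>F n in F. a n \<in> U" using topological_tendstoD assms(1,2,4) by metis
  have "((\<lambda>n. Complex (dd (X n) f (a n) / 2) (- dd (J (X n)) f (a n) / 2)) \<longlongrightarrow> vec10 X0 (cplx f) p) F"
    unfolding vec10_cplx[OF Ck_on_1_diff[OF assms(3,2)]]
    by (intro tendsto_intros dd_tendsto[OF assms(1-4)] assms bounded_linear.tendsto[OF bounded_linear_J]) auto
  moreover have "\<forall>\<^sub>F n in F. Complex (dd (X n) f (a n) / 2) (- dd (J (X n)) f (a n) / 2) = vec10 (X n) (cplx f) (a n)"
    using ev by eventually_elim (simp add: vec10_cplx[OF Ck_on_1_diff[OF assms(3)]])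
  ultimately show ?thesis by (rule Lim_transform_eventually)
qed

text \<open>The \<open>Complex\<close> term in the limit is the derivative of
  \<open>vec10 X0 (cplx f)\<close> in the real direction v, not along its (1,0) part.\<close>

lemma strict_derivative_vec10_tendsto:
  fixes f :: "complex ^ 'n \<Rightarrow> real"
  assumes "open U" "p \<in> U" "Ck_on 2 U f" "(a \<longlongrightarrow> p) F" "(b \<longlongrightarrow> v) F" "(t \<longlongrightarrow> 0) F"
    "\<forall>\<^sub>F n in F. t n \<noteq> 0" "(X \<longlongrightarrow> X0) F" "(W \<longlongrightarrow> W0) F"
  shows "((\<lambda>n. (vec10 (X n + t n *\<^sub>R W n) (cplx f) (a n + t n *\<^sub>R b n) - vec10 (X n) (cplx f) (a n)) / of_real (t n))
      \<longlongrightarrow> Complex (dd v (dd X0 f) p / 2) (- dd v (dd (J X0) f) p / 2) + vec10 W0 (cplx f) p) F"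
proof -
  have ev: "\<forall>\<^sub>F n in F. a n \<in> U" "\<forall>\<^sub>F n in F. a n + t n *\<^sub>R b n \<in> U"
    using topological_tendstoD[OF assms(4,1,2)] topological_tendstoD[OF tendsto_line[OF assms(4,5,6)] assms(1,2)]
    by auto
  let ?A = "\<lambda>n. (dd (X n + t n *\<^sub>R W n) f (a n + t n *\<^sub>R b n) - dd (X n) f (a n)) / t n"
  let ?B = "\<lambda>n. (dd (J (X n) + t n *\<^sub>R J (W n)) f (a n + t n *\<^sub>R b n) - dd (J (X n)) f (a n)) / t n"
  have "((\<lambda>n. Complex (?A n / 2) (- ?B n / 2)) \<longlongrightarrow>
      Complex ((dd v (dd X0 f) p + dd W0 f p) / 2) (- (dd v (dd (J X0) f) p + dd (J W0) f p) / 2)) F"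
    by (intro tendsto_intros strict_derivative_dd_tendsto[OF assms(1-7)] assms
        bounded_linear.tendsto[OF bounded_linear_J]) auto
  moreover have "Complex ((dd v (dd X0 f) p + dd W0 f p) / 2) (- (dd v (dd (J X0) f) p + dd (J W0) f p) / 2)
      = Complex (dd v (dd X0 f) p / 2) (- dd v (dd (J X0) f) p / 2) + vec10 W0 (cplx f) p"
    by (simp add: vec10_cplx[OF Ck_on_2_diff[OF assms(3,2)]] complex_eq_iff field_simps)
  ultimately have "((\<lambda>n. Complex (?A n / 2) (- ?B n / 2)) \<longlongrightarrow>
      Complex (dd v (dd X0 f) p / 2) (- dd v (dd (J X0) f) p / 2) + vec10 W0 (cplx f) p) F" by simp
  moreover have "\<forall>\<^sub>F n in F. Complex (?A n / 2) (- ?B n / 2)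
     = (vec10 (X n + t n *\<^sub>R W n) (cplx f) (a n + t n *\<^sub>R b n) - vec10 (X n) (cplx f) (a n)) / of_real (t n)"
    using ev assms(7)
  proof eventually_elim
    case (elim n)
    show ?case
      unfolding vec10_cplx[OF Ck_on_2_diff[OF assms(3) elim(1)]] vec10_cplx[OF Ck_on_2_diff[OF assms(3) elim(2)]]
        J_add J_scaleR
      by (simp add: complex_eq_iff Re_divide_of_real Im_divide_of_real diff_divide_distrib)
  qed
  ultimately show ?thesis by (rule Lim_transform_eventually)
qed

lemma strict_derivative_hess_tendsto:
  assumes "open U" "p \<in> U" "Ck_on 3 U f" "(a \<longlongrightarrow> p) F" "(b \<longlongrightarrow> v) F" "(t \<longlongrightarrow> 0) F"
    "\<forall>\<^sub>F n in F. t n \<noteq> 0" "(X \<longlongrightarrow> X0) F" "(W \<longlongrightarrow> W0) F"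
  shows "((\<lambda>n. (hess f (a n + t n *\<^sub>R b n) (X n + t n *\<^sub>R W n) - hess f (a n) (X n)) / t n)
      \<longlongrightarrow> dd v (\<lambda>q. hess f q X0) p + 2 * Re (Hess f p W0 X0)) F"
proof -
  have C2: "Ck_on 2 U f" by (rule Ck_on_3_2) fact
  have JX: "((\<lambda>n. J (X n)) \<longlongrightarrow> J X0) F" "((\<lambda>n. J (W n)) \<longlongrightarrow> J W0) F"
    by (intro bounded_linear.tendsto[OF bounded_linear_J] assms)+
  have d: "dd u (dd u' f) differentiable at p" for u u'
    by (rule Ck_on_1_diff[OF Ck_on_2_dd[OF Ck_on_3_dd[OF assms(3)]] assms(2)])
  have hd: "dd v (\<lambda>q. hess f q X0) p = (dd v (dd X0 (dd X0 f)) p + dd v (dd (J X0) (dd (J X0) f)) p) / 4"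
    unfolding hess_def
    by (rule dd_eqI[where f'="\<lambda>v. (dd v (dd X0 (dd X0 f)) p + dd v (dd (J X0) (dd (J X0) f)) p) / 4"])
      (intro bounded_linear.has_derivative[OF bounded_linear_divide] has_derivative_add has_derivative_dd d)
  have Re: "Re (Hess f p W0 X0) = (dd W0 (dd X0 f) p + dd (J W0) (dd (J X0) f) p) / 4"
    by (simp add: Hess_eq[OF assms(1,2) C2])
  let ?T = "\<lambda>X0 W0. dd v (dd X0 (dd X0 f)) p + dd W0 (dd X0 f) p + dd X0 (dd W0 f) p"
  let ?D = "\<lambda>X W n. (dd (X n + t n *\<^sub>R W n) (dd (X n + t n *\<^sub>R W n) f) (a n + t n *\<^sub>R b n)
        - dd (X n) (dd (X n) f) (a n)) / t n"
  have "((\<lambda>n. (?D X W n + ?D (\<lambda>n. J (X n)) (\<lambda>n. J (W n)) n) / 4) \<longlongrightarrow> (?T X0 W0 + ?T (J X0) (J W0)) / 4) F"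
    by (intro tendsto_intros strict_derivative_dd_dd_tendsto[OF assms(1-7)] assms JX) auto
  moreover have "(\<lambda>n. (?D X W n + ?D (\<lambda>n. J (X n)) (\<lambda>n. J (W n)) n) / 4)
     = (\<lambda>n. (hess f (a n + t n *\<^sub>R b n) (X n + t n *\<^sub>R W n) - hess f (a n) (X n)) / t n)"
    by (simp add: hess_def J_add J_scaleR diff_divide_distrib add_divide_distrib fun_eq_iff)
  moreover have "(?T X0 W0 + ?T (J X0) (J W0)) / 4 = dd v (\<lambda>q. hess f q X0) p + 2 * Re (Hess f p W0 X0)"
    unfolding hd Re dd_commute[OF assms(1,2) C2, of X0 W0] dd_commute[OF assms(1,2) C2, of "J X0" "J W0"]
    by (simp add: field_simps)
  ultimately show ?thesis by simp
qed

lemma Ck_on_inverse: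
  fixes f :: "'a::real_normed_vector \<Rightarrow> real"
  assumes "open U" "Ck_on k U f" "\<And>x. x \<in> U \<Longrightarrow> f x \<noteq> 0"
  shows "Ck_on k U (\<lambda>x. inverse (f x))"
  using assms(2)
proof (induction k)
  case 0
  then show ?case using assms(3) by (auto intro: continuous_on_inverse)
next
  case (Suc k)
  have IH: "Ck_on k U (\<lambda>x. inverse (f x))" by (rule Suc.IH[OF Ck_on_SucD[OF Suc.prems]])
  show ?case
  proof (rule Ck_on_compose_real[OF assms(1) _ Suc.prems])
    show "(inverse has_real_derivative - (inverse (f x) * inverse (f x))) (at (f x))" if "x \<in> U" for x
      using DERIV_inverse[OF assms(3)[OF that]] by (simp add: power2_eq_square)
    show "Ck_on k U (\<lambda>x. - (inverse (f x) * inverse (f x)))"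
      by (intro Ck_on_minus Ck_on_mult assms(1) IH)
  qed
qed

lemma gradient_eq: "gradient f p = (\<Sum>b\<in>Basis. dd b f p *\<^sub>R b)"
  by (simp add: gradient_def dd_def)

lemma inner_gradient:
  "f differentiable (at p) \<Longrightarrow> gradient f p \<bullet> v = dd v f p" for f :: "'a::euclidean_space \<Rightarrow> real"
  using dd_Basis[of f p v] by (simp add: gradient_eq inner_sum_left inner_sum_right inner_commute[of _ v] mult.commute)

lemma Ck_on_gradient:
  fixes f :: "'a::euclidean_space \<Rightarrow> real"
  assumes "open U" "Ck_on (Suc k) U f"
  shows "Ck_on k U (gradient f)"
  unfolding gradient_eq[abs_def]
  by (intro Ck_on_sum Ck_on_scaleR Ck_on_const assms Ck_on_dd)

section \<open>The normal field and the third-order term\<close>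

text \<open>As a \<open>(1,0)\<close> vector this is \<open>N\<^sub>r / (N\<^sub>r r)\<close>; as a real vector it satisfies \<open>dd (nrm r q) r q = 2\<close>.\<close>

definition nrm :: "(complex ^ 'n \<Rightarrow> real) \<Rightarrow> complex ^ 'n \<Rightarrow> complex ^ 'n" where
  "nrm r q = (2 / (norm (gradient r q))\<^sup>2) *\<^sub>R gradient r q"

lemma Ck_on_nrm:
  assumes "open U" "Ck_on (Suc k) U r" "\<And>q. q \<in> U \<Longrightarrow> gradient r q \<noteq> 0"
  shows "Ck_on k U (nrm r)"
proof -
  have "Ck_on k U (\<lambda>q. (2 * inverse (gradient r q \<bullet> gradient r q)) *\<^sub>R gradient r q)"
    using assms by (intro Ck_on_scaleR Ck_on_cmult Ck_on_inverse Ck_on_inner Ck_on_gradient) auto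
  then show ?thesis
    by (simp add: nrm_def[abs_def] power2_norm_eq_inner divide_inverse)
qed

lemma dd_nrm:
  assumes "r differentiable (at q)" "gradient r q \<noteq> 0"
  shows "dd (nrm r q) r q = 2" "dd (J (nrm r q)) r q = 0"
  using assms
  by (simp_all add: nrm_def inner_gradient[symmetric] J_scaleR power2_norm_eq_inner)

lemma vec10_nrm:
  assumes "r differentiable (at q)" "gradient r q \<noteq> 0"
  shows "vec10 (nrm r q) (cplx r) q = 1"
  using assms by (simp add: vec10_cplx dd_nrm complex_eq_iff)

lemma gradient_component:
  assumes "r differentiable (at q)"
  shows "gradient r q $ k = 2 * d_zbar k (cplx r) q"
proof -
  have "Re (gradient r q $ k) = gradient r q \<bullet> axis k 1" "Im (gradient r q $ k) = gradient r q \<bullet> axis k \<i>"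
    by (simp_all add: inner_axis inner_complex_def)
  then show ?thesis using assms by (simp add: inner_gradient d_zbar_cplx complex_eq_iff)
qed

lemma sum_d_z_gradient:
  assumes "r differentiable (at q)"
  shows "sqrt (\<Sum>j\<in>UNIV. (cmod (d_z j (cplx r) q))\<^sup>2) = norm (gradient r q) / 2"
proof -
  have e: "cmod (d_z j (cplx r) q) = cmod (gradient r q $ j) / 2" for j
  proof -
    have "d_z j (cplx r) q = cnj (d_zbar j (cplx r) q)"
      by (simp add: d_z_cplx d_zbar_cplx assms complex_eq_iff)
    then show ?thesis by (simp add: gradient_component[OF assms] norm_mult)
  qed
  have "(cmod (d_z j (cplx r) q))\<^sup>2 = (cmod (gradient r q $ j))\<^sup>2 / 2\<^sup>2" for j
    by (simp only: e power_divide)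
  then have "(\<Sum>j\<in>UNIV. (cmod (d_z j (cplx r) q))\<^sup>2) = (\<Sum>j\<in>UNIV. (cmod (gradient r q $ j))\<^sup>2) / 2\<^sup>2"
    by (simp only: sum_divide_distrib)
  then show ?thesis by (simp only: real_sqrt_divide norm_vec_def L2_set_def) simp
qed

lemma normal_field_eq:
  assumes "r differentiable (at q)"
  shows "normal_field r q = (norm (gradient r q) / 2) *\<^sub>R nrm r q"
proof (cases "gradient r q = 0")
  case True
  then have "sqrt (\<Sum>j\<in>UNIV. (cmod (d_z j (cplx r) q))\<^sup>2) = 0" using sum_d_z_gradient[OF assms] by simp
  then show ?thesis unfolding normal_field_def vec_eq_iff using True by simp
next
  case False
  then have "(norm (gradient r q) / 2) *\<^sub>R nrm r q = (1 / norm (gradient r q)) *\<^sub>R gradient r q"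
    by (simp add: nrm_def power2_eq_square)
  then show ?thesis
    using False unfolding normal_field_def sum_d_z_gradient[OF assms]
    by (simp add: vec_eq_iff gradient_component[OF assms]) (simp add: scaleR_conv_of_real)
qed

lemma vec10_sum_cmult:
  assumes "\<And>i. i \<in> I \<Longrightarrow> g i differentiable (at p)"
  shows "vec10 X (\<lambda>q. \<Sum>i\<in>I. c i * g i q) p = (\<Sum>i\<in>I. c i * vec10 X (g i) p)"
proof -
  have "d_z j (\<lambda>q. \<Sum>i\<in>I. c i * g i q) p = (\<Sum>i\<in>I. c i * d_z j (g i) p)" for j
    by (rule d_z_sum_cmult[OF assms])
  then have "vec10 X (\<lambda>q. \<Sum>i\<in>I. c i * g i q) p = (\<Sum>j\<in>UNIV. \<Sum>i\<in>I. X $ j * (c i * d_z j (g i) p))"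
    by (simp add: vec10_def sum_distrib_left)
  also have "\<dots> = (\<Sum>i\<in>I. \<Sum>j\<in>UNIV. X $ j * (c i * d_z j (g i) p))" by (rule sum.swap)
  finally show ?thesis by (simp add: vec10_def sum_distrib_left mult_ac)
qed

text \<open>The vector paired with the derivative is constant, so its coefficients
  \<open>cnj (X $ j)\<close> may be moved under the derivative, and the double sum becomes X applied
  to one Hermitian pairing.\<close>

lemma third_order_term_eq:
  assumes "\<And>j. (\<lambda>w. \<Sum>k\<in>UNIV. normal_field r w $ k * d_z k (d_zbar j (cplx r)) w) differentiable (at p)"
  shows "third_order_term r p X = vec10 X (\<lambda>w. Hess r w (normal_field r w) X) p"
proof -
  have "(\<lambda>w. Hess r w (normal_field r w) X)
     = (\<lambda>w. \<Sum>j\<in>UNIV. cnj (X $ j) * (\<Sum>k\<in>UNIV. normal_field r w $ k * d_z k (d_zbar j (cplx r)) w))"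
    unfolding Hess_def by (subst sum.swap) (simp add: sum_distrib_left mult_ac)
  then show ?thesis
    using vec10_sum_cmult[of UNIV "\<lambda>j w. \<Sum>k\<in>UNIV. normal_field r w $ k * d_z k (d_zbar j (cplx r)) w" p X "\<lambda>j. cnj (X $ j)"]
    assms unfolding third_order_term_def
    by (simp add: vec10_def sum_distrib_left mult_ac) (subst sum.swap, simp add: mult_ac)
qed

text \<open>The third-order term with \<open>nrm r\<close> in place of
  \<open>normal_field r\<close>. Rescaling the normal removes the derivatives of
  \<open>norm (gradient r w)\<close> from the inequality.\<close>

definition nrm_term :: "(complex ^ 'n \<Rightarrow> real) \<Rightarrow> complex ^ 'n \<Rightarrow> complex ^ 'n \<Rightarrow> real" where
  "nrm_term r p X = Re (vec10 X (\<lambda>w. Hess r w (nrm r w) X) p)"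

text \<open>The (1,0) vector X applied to the coefficients of \<open>nrm r\<close>, i.e. the
  covariant derivative of the normal along X.\<close>

definition dC_nrm :: "(complex ^ 'n \<Rightarrow> real) \<Rightarrow> complex ^ 'n \<Rightarrow> complex ^ 'n \<Rightarrow> complex ^ 'n" where
  "dC_nrm r p X = (1/2) *\<^sub>R (dd X (nrm r) p - J (dd (J X) (nrm r) p))"

context
  fixes U :: "(complex ^ 'n) set" and r :: "complex ^ 'n \<Rightarrow> real"
  assumes U: "open U" and r3: "Ck_on 3 U r" and gr: "\<And>q. q \<in> U \<Longrightarrow> gradient r q \<noteq> 0"
begin

lemma r_differentiable: "p \<in> U \<Longrightarrow> r differentiable (at p)" by (rule Ck_on_2_diff[OF Ck_on_3_2[OF r3]])

lemma nrm_C2: "Ck_on 2 U (nrm r)"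
  using Ck_on_nrm[OF U, of 2 r] r3 gr by (simp add: numeral_3_eq_3 numeral_2_eq_2)

lemma nrm_differentiable: "p \<in> U \<Longrightarrow> nrm r differentiable (at p)" by (rule Ck_on_2_diff[OF nrm_C2])

lemma has_derivative_dd_dd_along:
  assumes "p \<in> U" "A differentiable (at p)"
  shows "((\<lambda>w. dd (A w) (dd X r) w) has_derivative
     (\<lambda>v. dd (dd v A p) (dd X r) p + dd v (dd (A p) (dd X r)) p)) (at p)"
  using has_derivative_dd_compose[OF U Ck_on_3_dd[OF r3] U assms(1) _ has_derivative_dd[OF assms(2)] has_derivative_ident]
  by auto

lemma J_nrm_derivative:
  assumes "p \<in> U"
  shows "(\<lambda>w. J (nrm r w)) differentiable (at p)" "dd v (\<lambda>w. J (nrm r w)) p = J (dd v (nrm r) p)"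
proof -
  have d: "((\<lambda>w. J (nrm r w)) has_derivative (\<lambda>v. J (dd v (nrm r) p))) (at p)"
    by (rule bounded_linear.has_derivative[OF bounded_linear_J has_derivative_dd[OF nrm_differentiable[OF assms]]])
  show "(\<lambda>w. J (nrm r w)) differentiable (at p)" using d differentiable_def by blast
  show "dd v (\<lambda>w. J (nrm r w)) p = J (dd v (nrm r) p)" by (rule dd_eqI[OF d])
qed

lemma Hess_nrm_derivative:
  fixes X :: "complex ^ 'n" and p
  defines "N \<equiv> nrm r p"
  assumes p: "p \<in> U"
  shows "((\<lambda>w. Hess r w (nrm r w) X) has_derivative (\<lambda>v.
     Complex ((dd (dd v (nrm r) p) (dd X r) p + dd v (dd N (dd X r)) p
        + (dd (J (dd v (nrm r) p)) (dd (J X) r) p + dd v (dd (J N) (dd (J X) r)) p)) / 4)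
      ((dd (dd v (nrm r) p) (dd (J X) r) p + dd v (dd N (dd (J X) r)) p
        - (dd (J (dd v (nrm r) p)) (dd X r) p + dd v (dd (J N) (dd X r)) p)) / 4))) (at p)" (is "(_ has_derivative ?D) _")
proof -
  note A = has_derivative_dd_dd_along[OF p nrm_differentiable[OF p], folded N_def]
  note B = has_derivative_dd_dd_along[OF p J_nrm_derivative(1)[OF p], unfolded J_nrm_derivative(2)[OF p], folded N_def]
  have "((\<lambda>w. Complex ((dd (nrm r w) (dd X r) w + dd (J (nrm r w)) (dd (J X) r) w) / 4)
      ((dd (nrm r w) (dd (J X) r) w - dd (J (nrm r w)) (dd X r) w) / 4)) has_derivative ?D) (at p)"
    by (intro Complex_has_derivative bounded_linear.has_derivative[OF bounded_linear_divide]
        has_derivative_add has_derivative_diff A B)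
  then show ?thesis
    by (rule has_derivative_transform_within_open[OF _ U p]) (simp add: Hess_eq[OF U _ Ck_on_3_2[OF r3]])
qed

text \<open>By the product rule X falls either on the normal, which gives the \<open>dC_nrm\<close>
  term, or on the second derivatives of r. In the latter case derivatives commute, so the normal may
  act last on \<open>hess r q X\<close>; and the real part of a (1,0) vector acting on a real
  function is half the real derivative.\<close>

lemma nrm_term_eq:
  fixes X :: "complex ^ 'n" and p
  assumes p: "p \<in> U"
  shows "nrm_term r p X = dd (nrm r p) (\<lambda>q. hess r q X) p / 2 + Re (Hess r p (dC_nrm r p X) X)"
proof -
  let ?N = "nrm r p"
  note d = Hess_nrm_derivative[OF p, of X]
  have "(\<lambda>w. Hess r w (nrm r w) X) differentiable (at p)" using d differentiable_def by blast
  then have 1: "nrm_term r p X = (Re (dd X (\<lambda>w. Hess r w (nrm r w) X) p) + Im (dd (J X) (\<lambda>w. Hess r w (nrm r w) X) p)) / 2"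
    unfolding nrm_term_def by (simp add: vec10_dd)
  have C2: "Ck_on 2 U (dd v r)" for v by (rule Ck_on_3_dd[OF r3])
  have dif: "dd u (dd u' r) differentiable at p" for u u'
    by (rule Ck_on_1_diff[OF Ck_on_2_dd[OF C2] p])
  have hd: "dd v (\<lambda>q. hess r q X) p = (dd v (dd X (dd X r)) p + dd v (dd (J X) (dd (J X) r)) p) / 4" for v
    unfolding hess_def
    by (rule dd_eqI[where f'="\<lambda>v. (dd v (dd X (dd X r)) p + dd v (dd (J X) (dd (J X) r)) p) / 4"])
      (intro bounded_linear.has_derivative[OF bounded_linear_divide] has_derivative_add has_derivative_dd dif)
  \<comment> \<open>The two third derivatives that involve \<open>J ?N\<close> enter with opposite
    signs and cancel by this equality.\<close>
  have c: "dd (J X) (dd (J ?N) (dd X r)) p = dd X (dd (J ?N) (dd (J X) r)) p"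
  proof -
    have "dd (J X) (dd (J ?N) (dd X r)) p = dd (J ?N) (dd (J X) (dd X r)) p"
      by (rule dd_commute[OF U p C2])
    also have "\<dots> = dd (J ?N) (dd X (dd (J X) r)) p"
      by (rule dd_cong_open[OF U p dd_commute[OF U _ Ck_on_3_2[OF r3]]])
    also have "\<dots> = dd X (dd (J ?N) (dd (J X) r)) p"
      by (rule dd_commute[OF U p C2])
    finally show ?thesis .
  qed
  have r: "dd v r differentiable at p" for v by (rule Ck_on_1_diff[OF Ck_on_2_dd[OF Ck_on_3_2[OF r3]] p])
  show ?thesis
    unfolding 1 dd_eqI[OF d] hd Hess_eq[OF U p Ck_on_3_2[OF r3]] dC_nrm_def
    using c dd_commute[OF U p C2, of X ?N X] dd_commute[OF U p C2, of "J X" ?N "J X"]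
    by (simp add: J_scaleR J_diff dd_scaleR dd_diff dd_add dd_minus r field_simps)
qed

text \<open>Since \<open>normal_field r\<close> is \<open>nrm r\<close> scaled by
  \<open>G / 2\<close>, the third-order term contains derivatives of G. The summand with
  \<open>1 / norm (gradient r w)\<close> cancels exactly these, and a common factor
  \<open>(G / 2)\<^sup>2\<close> divides out.\<close>

lemma DF_inequality_iff:
  fixes X :: "complex ^ 'n" and p
  assumes p: "p \<in> U" and \<eta>: "0 < \<eta>" "\<eta> < 1" and W: "open W" "p \<in> W" "Ck_on 2 W \<psi>"
  shows "DF_inequality_at r \<psi> \<eta> p X \<longleftrightarrow>
    \<eta> / (1 - \<eta>) * (cmod (vec01 X (cplx \<psi>) p + Hess r p (nrm r p) X))\<^sup>2 + hess \<psi> p X + nrm_term r p X \<le> 0"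
proof -
  define G where "G w = norm (gradient r w)" for w
  define H where "H w = Hess r w (nrm r w) X" for w
  have G0: "G q > 0" if "q \<in> U" for q using gr[OF that] by (simp add: G_def)
  have gd: "gradient r differentiable (at p)"
    using Ck_on_gradient[OF U, of 2 r] r3 Ck_on_2_diff[OF _ p] by (simp add: numeral_3_eq_3 numeral_2_eq_2)
  have Gd: "G differentiable (at p)"
    unfolding G_def[abs_def]
    using differentiable_compose[OF differentiable_norm_at[OF gr[OF p]] gd] by (simp add: o_def)
  have iGd: "(\<lambda>w. 1 / G w) differentiable (at p)"
    using Gd G0[OF p] by (intro differentiable_divide) auto
  have Hd: "H differentiable (at p)" for X
    unfolding H_def[abs_def] using Hess_nrm_derivative[OF p] differentiable_def by blast
  have N: "normal_field r q = (G q / 2) *\<^sub>R nrm r q" if "q \<in> U" for q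
    using normal_field_eq[OF r_differentiable[OF that]] by (simp add: G_def)
  have HN: "Hess r q (normal_field r q) X = of_real (G q / 2) * H q" if "q \<in> U" for q
    by (simp add: N[OF that] Hess_scaleR_left H_def)
  \<comment> \<open>Pairing with \<open>axis j 1\<close> extracts the j-th coefficient, whose
    differentiability \<open>third_order_term_eq\<close> asks for.\<close>
  have ax: "d * n * cnj (axis j 1 $ k) = (if k = j then n * d else 0)" for d n :: complex and j k
    by (simp add: axis_def)
  have "(\<lambda>w. \<Sum>k\<in>UNIV. normal_field r w $ k * d_z k (d_zbar j (cplx r)) w) differentiable (at p)" for j
  proof (rule differentiable_cong_open[OF U p])
    show "(\<lambda>q. of_real (G q / 2) * Hess r q (nrm r q) (axis j 1)) differentiable at p"
    proof (intro differentiable_mult)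
      show "(\<lambda>x. complex_of_real (G x / 2)) differentiable at p"
        using differentiable_cplx[OF differentiable_divide[OF Gd differentiable_const[of 2]]] by simp
      show "(\<lambda>q. Hess r q (nrm r q) (axis j 1)) differentiable at p"
        using Hess_nrm_derivative[OF p] differentiable_def by blast
    qed
    fix q assume q: "q \<in> U"
    have "of_real (G q / 2) * Hess r q (nrm r q) (axis j 1) = Hess r q (normal_field r q) (axis j 1)"
      by (simp add: N[OF q] Hess_scaleR_left)
    also have "\<dots> = (\<Sum>k\<in>UNIV. normal_field r q $ k * d_z k (d_zbar j (cplx r)) q)"
      by (simp add: Hess_def ax)
    finally show "of_real (G q / 2) * Hess r q (nrm r q) (axis j 1) = (\<Sum>k\<in>UNIV. normal_field r q $ k * d_z k (d_zbar j (cplx r)) q)" .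
  qed
  then have "third_order_term r p X = vec10 X (\<lambda>w. Hess r w (normal_field r w) X) p"
    by (rule third_order_term_eq)
  also have "\<dots> = vec10 X (\<lambda>w. of_real (G w / 2) * H w) p"
    unfolding vec10_def d_z_def
    using frechet_derivative_cong_open[OF U p HN] by simp
  finally have T: "third_order_term r p X = vec10 X (\<lambda>w. of_real (G w / 2) * H w) p" .
  have dG: "((\<lambda>w. complex_of_real (G w / 2) * H w) has_derivative
      (\<lambda>v. of_real (G p / 2) * dd v H p + of_real (dd v G p / 2) * H p)) (at p)"
    using Hd Gd
    by (intro has_derivative_mult has_derivative_of_real bounded_linear.has_derivative[OF bounded_linear_divide] has_derivative_dd)
  have diG: "((\<lambda>w. 1 / G w) has_derivative (\<lambda>v. - dd v G p / (G p)\<^sup>2)) (at p)"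
    using has_derivative_divide'[OF has_derivative_const has_derivative_dd[OF Gd], of 1] G0[OF p]
    by (simp add: power2_eq_square)
  have "(\<lambda>w. complex_of_real (G w / 2) * H w) differentiable at p"
    using dG differentiable_def by blast
  then have GH: "vec10 X (\<lambda>w. complex_of_real (G w / 2) * H w) p
     = (of_real (G p / 2) * dd X H p + of_real (dd X G p / 2) * H p
       - \<i> * (of_real (G p / 2) * dd (J X) H p + of_real (dd (J X) G p / 2) * H p)) / 2"
    by (simp only: vec10_dd dd_eqI[OF dG])
  have S: "third_order_term r p X + complex_of_real (G p) * vec10 X (cplx (\<lambda>w. 1 / G w)) p * Hess r p (normal_field r p) X
     = of_real (G p / 2) * vec10 X H p"
    unfolding T GH vec10_dd[OF Hd] vec10_cplx[OF iGd] dd_eqI[OF diG] HN[OF p]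
    using G0[OF p] by (simp add: Complex_eq field_simps power2_eq_square)
  have V: "vec10 (normal_field r p) (cplx r) p = of_real (G p / 2)"
    by (simp add: N[OF p] vec10_scaleR vec10_nrm[OF r_differentiable[OF p] gr[OF p]])
  have e: "1 / (1 - \<eta>) - 1 = \<eta> / (1 - \<eta>)" using \<eta> by (simp add: field_simps)
  let ?A = "cmod (vec01 X (cplx \<psi>) p + H p)"
  have "DF_inequality_at r \<psi> \<eta> p X \<longleftrightarrow>
      \<eta> / (1 - \<eta>) * (cmod (vec01 X (cplx \<psi>) p * of_real (G p / 2) + of_real (G p / 2) * H p))\<^sup>2
      + G p / 2 * Re (of_real (G p / 2) * of_real (hess \<psi> p X) + of_real (G p / 2) * vec10 X H p) \<le> 0"
    unfolding DF_inequality_at_def Let_def G_def[symmetric] V HN[OF p] Hess_self[OF W] e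
    by (simp only: add.assoc S[unfolded HN[OF p]])
  also have "vec01 X (cplx \<psi>) p * of_real (G p / 2) + of_real (G p / 2) * H p = of_real (G p / 2) * (vec01 X (cplx \<psi>) p + H p)"
    by (simp add: algebra_simps)
  also have "\<eta> / (1 - \<eta>) * (cmod (of_real (G p / 2) * (vec01 X (cplx \<psi>) p + H p)))\<^sup>2
      + G p / 2 * Re (of_real (G p / 2) * of_real (hess \<psi> p X) + of_real (G p / 2) * vec10 X H p)
     = (G p / 2)\<^sup>2 * (\<eta> / (1 - \<eta>) * ?A\<^sup>2 + hess \<psi> p X + nrm_term r p X)"
    using G0[OF p] unfolding norm_mult by (simp add: H_def[abs_def] nrm_term_def power_mult_distrib power2_eq_square algebra_simps)
  also have "(G p / 2)\<^sup>2 * (\<eta> / (1 - \<eta>) * ?A\<^sup>2 + hess \<psi> p X + nrm_term r p X) \<le> 0 \<longleftrightarrow>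
      \<eta> / (1 - \<eta>) * ?A\<^sup>2 + hess \<psi> p X + nrm_term r p X \<le> 0"
    using G0[OF p] by (simp add: mult_le_0_iff)
  finally show ?thesis by (simp add: H_def)
qed

end

lemma dd_lincomb:
  fixes f g :: "'a::real_normed_vector \<Rightarrow> real"
  assumes "f differentiable (at q)" "g differentiable (at q)"
  shows "dd v (\<lambda>q. a * f q + b * g q) q = a * dd v f q + b * dd v g q"
  by (rule dd_eqI[of _ "\<lambda>v. a * dd v f q + b * dd v g q"])
    (intro has_derivative_add has_derivative_mult_right has_derivative_dd assms)

lemma Ck_on_lincomb:
  fixes f g :: "'a::real_normed_vector \<Rightarrow> real"
  assumes "open U" "Ck_on k U f" "Ck_on k U g"
  shows "Ck_on k U (\<lambda>q. a * f q + b * g q)"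
  by (intro Ck_on_add Ck_on_cmult assms)

lemma dd_dd_lincomb:
  fixes f g :: "'a::real_normed_vector \<Rightarrow> real"
  assumes "open U" "q \<in> U" "Ck_on 2 U f" "Ck_on 2 U g"
  shows "dd w (dd v (\<lambda>q. a * f q + b * g q)) q = a * dd w (dd v f) q + b * dd w (dd v g) q"
proof -
  have "dd w (dd v (\<lambda>q. a * f q + b * g q)) q = dd w (\<lambda>q. a * dd v f q + b * dd v g q) q"
    by (rule dd_cong_open[OF assms(1,2)]) (simp add: dd_lincomb Ck_on_2_diff[OF assms(3)] Ck_on_2_diff[OF assms(4)])
  then show ?thesis
    using Ck_on_1_diff[OF Ck_on_2_dd[OF assms(3)] assms(2)] Ck_on_1_diff[OF Ck_on_2_dd[OF assms(4)] assms(2)]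
    by (simp add: dd_lincomb)
qed

lemma hess_lincomb:
  assumes "open U" "q \<in> U" "Ck_on 2 U f" "Ck_on 2 U g"
  shows "hess (\<lambda>q. a * f q + b * g q) q X = a * hess f q X + b * hess g q X"
  unfolding hess_def dd_dd_lincomb[OF assms] by (simp add: field_simps)

section \<open>Plurisubharmonic functions of class \<open>C\<^sup>2\<close>\<close>

definition sqdist :: "'a::real_inner \<Rightarrow> 'a \<Rightarrow> real" where "sqdist p q = (q - p) \<bullet> (q - p)"

lemma dd_sqdist: "dd v (sqdist p) = (\<lambda>q. 2 * (v \<bullet> (q - p)))"
proof
  fix q
  have "(sqdist p has_derivative (\<lambda>v. 2 * (v \<bullet> (q - p)))) (at q)"
    unfolding sqdist_def[abs_def]
    by (auto intro!: derivative_eq_intros simp: inner_commute)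
  then show "dd v (sqdist p) q = 2 * (v \<bullet> (q - p))" by (rule dd_eqI)
qed

lemma dd_dd_sqdist: "dd w (dd v (sqdist p)) q = 2 * (v \<bullet> w)"
  unfolding dd_sqdist
  by (rule dd_eqI[where f'="\<lambda>w. 2 * (v \<bullet> w)"]) (auto intro!: derivative_eq_intros)

lemma Ck_on_sqdist: "Ck_on k UNIV (sqdist p)"
  unfolding sqdist_def[abs_def] by (intro Ck_on_inner Ck_on_diff Ck_on_ident Ck_on_const open_UNIV)

lemma hess_sqdist: "hess (sqdist p) q X = (norm X)\<^sup>2"
  by (simp add: hess_def dd_dd_sqdist power2_norm_eq_inner)

lemma continuous_on_dd_compose:
  fixes f :: "'a::euclidean_space \<Rightarrow> 'b::real_normed_vector"
  assumes "open U" "Ck_on 1 U f" "continuous_on S A" "continuous_on S g" "g ` S \<subseteq> U"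
  shows "continuous_on S (\<lambda>x. dd (A x) f (g x))"
  unfolding continuous_on_def
  by (intro ballI dd_tendsto[OF assms(1) _ assms(2)]) (use assms continuous_on_def in blast)+

lemma continuous_on_dd_dd_compose:
  fixes f :: "'a::euclidean_space \<Rightarrow> real"
  assumes "open U" "Ck_on 2 U f" "continuous_on S A" "continuous_on S B" "continuous_on S g" "g ` S \<subseteq> U"
  shows "continuous_on S (\<lambda>x. dd (A x) (dd (B x) f) (g x))"
  unfolding continuous_on_def
  by (intro ballI dd_dd_tendsto[OF assms(1) _ assms(2)]) (use assms continuous_on_def in blast)+

text \<open>Polar coordinates in the disc: \<open>t * k t \<theta>\<close> and
  \<open>B' \<theta>\<close> are the radial and the angular part of \<open>t\<^sup>2\<close> times
  the Laplacian. The angular part integrates to 0 by periodicity, so \<open>t * A t\<close>, which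
  starts at 0, has nonnegative derivative. Hence the derivative \<open>A\<close> of the circular
  mean \<open>m\<close> is nonnegative.\<close>

lemma submean_value:
  fixes w :: "complex ^ 'n"
  assumes "open U" "Ck_on 2 U u" and disc: "\<And>\<zeta>. cmod \<zeta> \<le> 1 \<Longrightarrow> a + \<zeta> *s w \<in> U"
    and pos: "\<And>\<zeta>. cmod \<zeta> \<le> 1 \<Longrightarrow> 0 \<le> hess u (a + \<zeta> *s w) w"
  shows "2 * pi * u a \<le> integral {0..2 * pi} (\<lambda>\<theta>. u (a + cis \<theta> *s w))"
proof -
  define e where "e \<theta> = cos \<theta> *\<^sub>R w + sin \<theta> *\<^sub>R J w" for \<theta>
  have e_cis: "cis \<theta> *s w = e \<theta>" for \<theta> by (simp add: e_def vector_smult_eq)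
  have te: "t *\<^sub>R e \<theta> = (of_real t * cis \<theta>) *s w" for t \<theta>
    by (simp add: e_def vector_smult_eq scaleR_add_right)
  have mem: "a + t *\<^sub>R e \<theta> \<in> U" if "0 \<le> t" "t \<le> 1" for t \<theta>
    unfolding te using that by (intro disc) (simp add: norm_mult)
  have C1: "Ck_on 1 U u" by (rule Ck_on_2_1) fact
  have pos': "0 \<le> hess u (a + t *\<^sub>R e \<theta>) (e \<theta>)" if "0 \<le> t" "t \<le> 1" for t \<theta>
    using pos[of "of_real t * cis \<theta>"] that hess_smult[OF assms(1) mem[OF that] assms(2), of \<theta> "cis \<theta>" w]
    by (simp add: te[symmetric] e_cis norm_mult)
  have cont_e [continuous_intros]: "continuous_on S (\<lambda>x. e (f x))" if "continuous_on S f" for f :: "'c::t2_space \<Rightarrow> real" and S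
    unfolding e_def by (intro continuous_intros that)
  have J_e: "J (e \<theta>) = - sin \<theta> *\<^sub>R w + cos \<theta> *\<^sub>R J w" for \<theta> by (simp add: e_def J_add J_scaleR)
  have de: "(e has_derivative (\<lambda>h. h *\<^sub>R J (e \<theta>))) (at \<theta>)" for \<theta>
    unfolding J_e unfolding e_def[abs_def]
    by (auto intro!: derivative_eq_intros simp: algebra_simps)
  have cJ [continuous_intros]: "continuous_on S (\<lambda>x. J (f x))" if "continuous_on S f"
    for f :: "'c::topological_space \<Rightarrow> complex ^ 'n" and S
    by (rule bounded_linear.continuous_on[OF bounded_linear_J that])
  define m where "m t = integral (cbox 0 (2 * pi)) (\<lambda>\<theta>. u (a + t *\<^sub>R e \<theta>))" for t
  define A where "A t = integral (cbox 0 (2 * pi)) (\<lambda>\<theta>. dd (e \<theta>) u (a + t *\<^sub>R e \<theta>))" for t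
  define k where "k t \<theta> = dd (e \<theta>) u (a + t *\<^sub>R e \<theta>) + t * dd (e \<theta>) (dd (e \<theta>) u) (a + t *\<^sub>R e \<theta>)" for t \<theta>
  have cu: "continuous_on (cbox 0 (2 * pi)) (\<lambda>\<theta>. u (a + t *\<^sub>R e \<theta>))" if "t \<in> {0..1}" for t
    using mem that
    by (intro continuous_on_compose2[OF Ck_on_imp_continuous_on[OF assms(2)]] continuous_intros) auto
  have cd: "continuous_on (cbox 0 (2 * pi)) (\<lambda>\<theta>. dd (e \<theta>) u (a + t *\<^sub>R e \<theta>))" if "t \<in> {0..1}" for t
    using mem that by (intro continuous_on_dd_compose[OF assms(1) C1] continuous_intros) auto
  have mA: "(m has_real_derivative A t) (at t within {0..1})" if "t \<in> {0..1}" for t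
    unfolding m_def[abs_def] A_def
  proof (rule leibniz_rule_field_derivative[OF _ _ _ that])
    fix x \<theta> :: real assume x: "x \<in> {0..1}" "\<theta> \<in> cbox 0 (2 * pi)"
    then have "a + x *\<^sub>R e \<theta> \<in> U" by (intro mem) auto
    then show "((\<lambda>t. u (a + t *\<^sub>R e \<theta>)) has_real_derivative dd (e \<theta>) u (a + x *\<^sub>R e \<theta>)) (at x within {0..1})"
      using line_has_real_derivative[OF Ck_on_2_diff[OF assms(2)]] has_field_derivative_at_within by blast
  next
    fix x :: real assume x: "x \<in> {0..1}"
    show "(\<lambda>\<theta>. u (a + x *\<^sub>R e \<theta>)) integrable_on cbox 0 (2 * pi)"
      using cu x by (intro integrable_continuous) auto
  next
    show "continuous_on ({0..1} \<times> cbox 0 (2 * pi)) (\<lambda>(t, \<theta>). dd (e \<theta>) u (a + t *\<^sub>R e \<theta>))"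
      unfolding split_beta using mem
      by (intro continuous_on_dd_compose[OF assms(1) C1] continuous_intros) auto
  qed auto
  have tA: "((\<lambda>t. t * A t) has_real_derivative integral (cbox 0 (2 * pi)) (k t)) (at t within {0..1})"
    if "t \<in> {0..1}" for t
  proof -
    have "((\<lambda>t. integral (cbox 0 (2 * pi)) (\<lambda>\<theta>. t * dd (e \<theta>) u (a + t *\<^sub>R e \<theta>))) has_real_derivative
        integral (cbox 0 (2 * pi)) (k t)) (at t within {0..1})"
    proof (rule leibniz_rule_field_derivative[OF _ _ _ that])
      fix x \<theta> :: real assume x: "x \<in> {0..1}" "\<theta> \<in> cbox 0 (2 * pi)"
      then have "a + x *\<^sub>R e \<theta> \<in> U" by (intro mem) auto
      then have "((\<lambda>t. dd (e \<theta>) u (a + t *\<^sub>R e \<theta>)) has_real_derivative dd (e \<theta>) (dd (e \<theta>) u) (a + x *\<^sub>R e \<theta>)) (at x)"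
        by (intro line_has_real_derivative Ck_on_1_diff[OF Ck_on_2_dd[OF assms(2)]])
      from DERIV_mult[OF DERIV_ident this]
      have "((\<lambda>t. t * dd (e \<theta>) u (a + t *\<^sub>R e \<theta>)) has_real_derivative k x \<theta>) (at x)"
        by (simp add: k_def algebra_simps)
      then show "((\<lambda>t. t * dd (e \<theta>) u (a + t *\<^sub>R e \<theta>)) has_real_derivative k x \<theta>) (at x within {0..1})"
        by (rule has_field_derivative_at_within)
    next
      fix x :: real assume x: "x \<in> {0..1}"
      show "(\<lambda>\<theta>. x * dd (e \<theta>) u (a + x *\<^sub>R e \<theta>)) integrable_on cbox 0 (2 * pi)"
        using cd x by (intro integrable_continuous continuous_intros) auto
    next
      show "continuous_on ({0..1} \<times> cbox 0 (2 * pi)) (\<lambda>(t, \<theta>). k t \<theta>)"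
        unfolding split_beta k_def using mem
        by (intro continuous_on_dd_compose[OF assms(1) C1] continuous_on_dd_dd_compose[OF assms(1,2)] continuous_intros) auto
    qed auto
    then show ?thesis unfolding A_def by simp
  qed
  have k_nonneg: "0 \<le> integral (cbox 0 (2 * pi)) (k t)" if t: "0 < t" "t \<le> 1" for t
  proof -
    define B where "B \<theta> = dd (t *\<^sub>R J (e \<theta>)) u (a + t *\<^sub>R e \<theta>)" for \<theta>
    define B' where "B' \<theta> = t\<^sup>2 * dd (J (e \<theta>)) (dd (J (e \<theta>)) u) (a + t *\<^sub>R e \<theta>) - t * dd (e \<theta>) u (a + t *\<^sub>R e \<theta>)" for \<theta>
    have q: "a + t *\<^sub>R e \<theta> \<in> U" for \<theta> using mem t by auto
    have "(B has_vector_derivative B' \<theta>) (at \<theta> within {0..2*pi})" for \<theta>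
    proof -
      have dJ: "((\<lambda>\<theta>. t *\<^sub>R J (e \<theta>)) has_derivative (\<lambda>h. t *\<^sub>R J (h *\<^sub>R J (e \<theta>)))) (at \<theta>)"
        by (intro has_derivative_scaleR_right bounded_linear.has_derivative[OF bounded_linear_J] de)
      have dq: "((\<lambda>\<theta>. a + t *\<^sub>R e \<theta>) has_derivative (\<lambda>h. t *\<^sub>R (h *\<^sub>R J (e \<theta>)))) (at \<theta>)"
        using has_derivative_add[OF has_derivative_const has_derivative_scaleR_right[OF de]] by simp
      have "(B has_derivative (\<lambda>h. dd (t *\<^sub>R J (h *\<^sub>R J (e \<theta>))) u (a + t *\<^sub>R e \<theta>)
          + dd (t *\<^sub>R (h *\<^sub>R J (e \<theta>))) (dd (t *\<^sub>R J (e \<theta>)) u) (a + t *\<^sub>R e \<theta>))) (at \<theta>)"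
        unfolding B_def[abs_def]
        by (rule has_derivative_dd_compose[OF assms(1,2) open_UNIV _ _ dJ dq]) (use q in auto)
      moreover have "dd (t *\<^sub>R J (h *\<^sub>R J (e \<theta>))) u (a + t *\<^sub>R e \<theta>) = - (h * (t * dd (e \<theta>) u (a + t *\<^sub>R e \<theta>)))" for h
        by (simp add: J_scaleR dd_scaleR dd_minus Ck_on_2_diff[OF assms(2) q])
      moreover have "dd (t *\<^sub>R (h *\<^sub>R J (e \<theta>))) (dd (t *\<^sub>R J (e \<theta>)) u) (a + t *\<^sub>R e \<theta>)
          = h * (t\<^sup>2 * dd (J (e \<theta>)) (dd (J (e \<theta>)) u) (a + t *\<^sub>R e \<theta>))" for h
      proof -
        have "dd (t *\<^sub>R (h *\<^sub>R J (e \<theta>))) (dd (t *\<^sub>R J (e \<theta>)) u) (a + t *\<^sub>R e \<theta>)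
           = t * h * dd (J (e \<theta>)) (dd (t *\<^sub>R J (e \<theta>)) u) (a + t *\<^sub>R e \<theta>)"
          by (simp add: dd_scaleR Ck_on_1_diff[OF Ck_on_2_dd[OF assms(2)] q])
        also have "dd (J (e \<theta>)) (dd (t *\<^sub>R J (e \<theta>)) u) (a + t *\<^sub>R e \<theta>) = t * dd (J (e \<theta>)) (dd (J (e \<theta>)) u) (a + t *\<^sub>R e \<theta>)"
          unfolding dd_commute[OF assms(1) q assms(2), of "J (e \<theta>)" "t *\<^sub>R J (e \<theta>)"]
          by (simp add: dd_scaleR Ck_on_1_diff[OF Ck_on_2_dd[OF assms(2)] q])
        finally show ?thesis by (simp add: power2_eq_square)
      qed
      ultimately have "(B has_derivative (\<lambda>h. h *\<^sub>R B' \<theta>)) (at \<theta>)"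
        by (simp add: B'_def algebra_simps)
      then show ?thesis
        unfolding has_vector_derivative_def by (rule has_derivative_at_withinI)
    qed
    then have "(B' has_integral (B (2 * pi) - B 0)) {0..2*pi}"
      by (intro fundamental_theorem_of_calculus) auto
    moreover have "B (2 * pi) = B 0" by (simp add: B_def e_def)
    ultimately have B'0: "(B' has_integral 0) (cbox 0 (2*pi))" by simp
    have ck: "continuous_on (cbox 0 (2*pi)) (k t)"
      unfolding k_def using q
      by (intro continuous_on_dd_compose[OF assms(1) C1] continuous_on_dd_dd_compose[OF assms(1,2)] continuous_intros) auto
    have I: "((\<lambda>\<theta>. t * k t \<theta> + B' \<theta>) has_integral (t * integral (cbox 0 (2 * pi)) (k t) + 0)) (cbox 0 (2 * pi))"
      by (intro has_integral_add has_integral_mult_right B'0 integrable_integral integrable_continuous ck)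
    have N: "0 \<le> t * k t \<theta> + B' \<theta>" for \<theta>
    proof -
      have "t * k t \<theta> + B' \<theta> = 4 * t\<^sup>2 * hess u (a + t *\<^sub>R e \<theta>) (e \<theta>)"
        by (simp add: k_def B'_def hess_def power2_eq_square algebra_simps)
      then show ?thesis using pos'[of t \<theta>] t by simp
    qed
    have "0 \<le> t * integral (cbox 0 (2 * pi)) (k t) + 0"
      by (rule has_integral_nonneg[OF I N])
    then show ?thesis using t by (simp add: zero_le_mult_iff)
  qed
  have A_nonneg: "0 \<le> A t" if t: "0 < t" "t \<le> 1" for t
  proof -
    have d: "((\<lambda>t. t * A t) has_derivative (\<lambda>h. integral (cbox 0 (2 * pi)) (k x) * h)) (at x within {0..t})"
      if "0 \<le> x" "x \<le> t" for x
      by (rule has_derivative_subset[where s="{0..1}"]) (use tA[of x] that t in \<open>auto simp: has_field_derivative_def\<close>)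
    have "\<exists>x\<in>{0<..<t}. t * A t - 0 * A 0 = integral (cbox 0 (2 * pi)) (k x) * (t - 0)"
      by (rule mvt_simple[OF t(1), where f="\<lambda>t. t * A t" and f'="\<lambda>x h. integral (cbox 0 (2 * pi)) (k x) * h"])
        (rule d)
    then obtain x where "x \<in> {0<..<t}" "t * A t = integral (cbox 0 (2 * pi)) (k x) * t" by auto
    then show ?thesis using k_nonneg[of x] t by (simp add: mult.commute)
  qed
  have "\<exists>x\<in>{0<..<1}. m 1 - m 0 = A x * (1 - 0)"
    by (rule mvt_simple[where f=m and f'="\<lambda>x h. A x * h"]) (use mA in \<open>auto simp: has_field_derivative_def\<close>)
  then have "m 0 \<le> m 1" using A_nonneg by force
  then show ?thesis by (simp add: m_def e_cis)
qed

lemma norm_vector_smult: "norm (z *s X) = cmod z * norm X" for X :: "complex ^ 'n"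
  by (simp add: norm_vec_def L2_set_right_distrib norm_mult)

lemma set_integrable_circle:
  fixes w :: "complex ^ 'n" and u :: "complex ^ 'n \<Rightarrow> real"
  assumes "continuous_on U u" "\<And>\<zeta>. cmod \<zeta> \<le> 1 \<Longrightarrow> a + \<zeta> *s w \<in> U"
  shows "set_integrable lborel {0..2 * pi} (\<lambda>\<theta>. u (a + cis \<theta> *s w))"
proof (rule borel_integrable_atLeastAtMost')
  show "continuous_on {0..2 * pi} (\<lambda>\<theta>. u (a + cis \<theta> *s w))"
    unfolding vector_smult_eq using assms(2)[of "cis _", unfolded vector_smult_eq]
    by (intro continuous_on_compose2[OF assms(1)] continuous_intros) auto
qed

lemma plurisubharmonic_onI:
  fixes u :: "complex ^ 'n \<Rightarrow> real"
  assumes "open U" "Ck_on 2 U u" "\<And>q X. q \<in> U \<Longrightarrow> 0 \<le> hess u q X"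
  shows "plurisubharmonic_on U u"
  unfolding plurisubharmonic_on_def
proof (intro conjI allI ballI impI)
  have c: "continuous_on U u" by (rule Ck_on_imp_continuous_on) fact
  show "\<forall>\<^sub>F z in at a within U. u z < c" if "a \<in> U" "u a < c" for a c
    using c that order_tendstoD(2) unfolding continuous_on_def by blast
  fix a w :: "complex ^ 'n" assume disc: "\<forall>\<zeta>. cmod \<zeta> \<le> 1 \<longrightarrow> a + \<zeta> *s w \<in> U"
  show si: "set_integrable lborel {0..2 * pi} (\<lambda>\<theta>. u (a + cis \<theta> *s w))"
    by (rule set_integrable_circle[OF c]) (use disc in auto)
  have "2 * pi * u a \<le> integral {0..2 * pi} (\<lambda>\<theta>. u (a + cis \<theta> *s w))"
    by (rule submean_value[OF assms(1,2)]) (use disc assms(3) in auto)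
  then show "u a \<le> 1 / (2 * pi) * (LINT \<theta>:{0..2 * pi}|lborel. u (a + cis \<theta> *s w))"
    unfolding set_borel_integral_eq_integral(2)[OF si] by (simp add: field_simps)
qed

text \<open>If the Hessian were negative at p along X, then \<open>- u\<close> minus a small
  multiple of the squared distance to p would satisfy the submean inequality on a small disc. Added
  to the inequality for u, this contradicts the positive distance on the circle.\<close>

lemma plurisubharmonic_onD:
  fixes u :: "complex ^ 'n \<Rightarrow> real"
  assumes "open U" "Ck_on 2 U u" "plurisubharmonic_on U u" "p \<in> U"
  shows "0 \<le> hess u p X"
proof (rule ccontr)
  assume "\<not> 0 \<le> hess u p X"
  then have neg: "hess u p X < 0" by simp
  then have X: "X \<noteq> 0"
    using hess_scaleR[OF assms(1,4,2), of 0 X] by auto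
  \<comment> \<open>Half of the negative value, so that the bound persists in a neighbourhood of
    p.\<close>
  define c where "c = - hess u p X / 2"
  have "((\<lambda>q. hess u q X) \<longlongrightarrow> hess u p X) (nhds p)"
    by (rule hess_tendsto[OF assms(1,4,2)]) (auto simp: filterlim_ident)
  then have "\<forall>\<^sub>F q in nhds p. hess u q X < - c"
    using order_tendstoD(2)[of _ _ "nhds p" "- c"] neg by (simp add: c_def)
  then have "\<forall>\<^sub>F q in nhds p. hess u q X < - c \<and> q \<in> U"
    using eventually_nhds_in_open[OF assms(1,4)] by (rule eventually_conj)
  then obtain R where R: "R > 0" "\<And>q. dist q p < R \<Longrightarrow> hess u q X < - c \<and> q \<in> U"
    unfolding eventually_nhds_metric by blast
  define s where "s = R / (2 * norm X)"
  have s: "s > 0" "s * norm X < R" using R X by (auto simp: s_def field_simps)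
  \<comment> \<open>As \<open>hess (sqdist p) q X\<close> is \<open>(norm X)\<^sup>2\<close>,
    subtracting \<open>k * sqdist p\<close> costs exactly c.\<close>
  define k where "k = c / (norm X)\<^sup>2"
  have k: "k > 0" using neg X unfolding k_def c_def by (intro divide_pos_pos) auto
  let ?w = "s *\<^sub>R X"
  let ?v = "\<lambda>q. (- 1) * u q + (- k) * sqdist p q"
  have disc: "p + \<zeta> *s ?w \<in> U \<and> hess u (p + \<zeta> *s ?w) X < - c" if "cmod \<zeta> \<le> 1" for \<zeta>
  proof -
    have "norm (\<zeta> *s ?w) = cmod \<zeta> * norm ?w"
      by (rule norm_vector_smult)
    also have "\<dots> \<le> 1 * norm ?w" using that by (intro mult_right_mono) auto
    finally have "norm (\<zeta> *s ?w) < R" using s by simp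
    then show ?thesis using R(2)[of "p + \<zeta> *s ?w"] by (simp add: dist_norm)
  qed
  have sC: "Ck_on 2 U (sqdist p)" by (rule Ck_on_subset[OF Ck_on_sqdist]) simp
  have "2 * pi * ?v p \<le> integral {0..2 * pi} (\<lambda>\<theta>. ?v (p + cis \<theta> *s ?w))"
  proof (rule submean_value[OF assms(1) Ck_on_lincomb[OF assms(1,2) sC]])
    fix \<zeta> assume z: "cmod \<zeta> \<le> 1"
    let ?q = "p + \<zeta> *s ?w"
    show qU: "?q \<in> U" using disc[OF z] by simp
    have "0 \<le> s\<^sup>2 * (- hess u ?q X - c)" using disc[OF z] s by simp
    also have "\<dots> = s\<^sup>2 * (- hess u ?q X - k * (norm X)\<^sup>2)" using X by (simp add: k_def)
    also have "\<dots> = hess ?v ?q ?w"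
      unfolding hess_lincomb[OF assms(1) qU assms(2) sC] hess_sqdist hess_scaleR[OF assms(1) qU assms(2)]
      by (simp add: power_mult_distrib algebra_simps)
    finally show "0 \<le> hess ?v ?q ?w" .
  qed
  moreover have sq: "sqdist p (p + cis \<theta> *s ?w) = (s * norm X)\<^sup>2" for \<theta>
    using s by (simp add: sqdist_def power2_norm_eq_inner[symmetric] norm_vector_smult)
  have disc': "\<forall>\<zeta>. cmod \<zeta> \<le> 1 \<longrightarrow> p + \<zeta> *s ?w \<in> U" using disc by auto
  have psh: "set_integrable lborel {0..2 * pi} (\<lambda>\<theta>. u (p + cis \<theta> *s ?w))"
    "u p \<le> 1 / (2 * pi) * (LINT \<theta>:{0..2 * pi}|lborel. u (p + cis \<theta> *s ?w))"
    using assms(3) disc' unfolding plurisubharmonic_on_def by blast+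
  have int: "(\<lambda>\<theta>. u (p + cis \<theta> *s ?w)) integrable_on {0..2*pi}"
    by (rule set_borel_integral_eq_integral(1)[OF psh(1)])
  have "((\<lambda>\<theta>. ?v (p + cis \<theta> *s ?w)) has_integral
     ((- 1) * integral {0..2*pi} (\<lambda>\<theta>. u (p + cis \<theta> *s ?w)) + (2 * pi - 0) *\<^sub>R ((- k) * (s * norm X)\<^sup>2))) {0..2*pi}"
    unfolding sq using has_integral_const_real[of "(- k) * (s * norm X)\<^sup>2" 0 "2*pi"]
    by (intro has_integral_add has_integral_mult_right integrable_integral int) auto
  then have "integral {0..2 * pi} (\<lambda>\<theta>. ?v (p + cis \<theta> *s ?w))
      = - integral {0..2*pi} (\<lambda>\<theta>. u (p + cis \<theta> *s ?w)) - 2 * pi * k * (s * norm X)\<^sup>2"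
    by (simp add: integral_unique)
  moreover have "2 * pi * u p \<le> integral {0..2*pi} (\<lambda>\<theta>. u (p + cis \<theta> *s ?w))"
    using psh(2) unfolding set_borel_integral_eq_integral(2)[OF psh(1)] by (simp add: field_simps)
  moreover have "0 < 2 * pi * k * (s * norm X)\<^sup>2" using k s X by simp
  ultimately show False by (simp add: sqdist_def)
qed

section \<open>Smooth approximation and gluing\<close>

text \<open>Convolving with a polynomial that approximates a bump function on a large box gives a polynomial;
  so no smooth bump functions are needed.\<close>

lemma Ck_on_real_polynomial_function: "real_polynomial_function f \<Longrightarrow> Ck_on k UNIV f"
  by (induction rule: real_polynomial_function.induct)
    (auto intro: Ck_on_bounded_linear Ck_on_const Ck_on_add Ck_on_mult)

text \<open>The weight \<open>A\<close> makes the induction on P work: in the product case the first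
  factor is absorbed into the weight seen by the second. A linear factor splits as
  \<open>f (z - y) = f z - f y\<close>.\<close>

lemma real_polynomial_function_convolution_aux:
  fixes a b :: "'a::euclidean_space" and A :: "'a \<Rightarrow> 'a \<Rightarrow> real"
  assumes "real_polynomial_function P" "\<And>z. continuous_on UNIV (A z)"
    "\<And>\<phi>. continuous_on UNIV \<phi> \<Longrightarrow> real_polynomial_function (\<lambda>z. integral (cbox a b) (\<lambda>y. \<phi> y * A z y))"
  shows "(\<forall>z. continuous_on UNIV (\<lambda>y. A z y * P (z - y))) \<and>
    (\<forall>\<phi>. continuous_on UNIV \<phi> \<longrightarrow>
      real_polynomial_function (\<lambda>z. integral (cbox a b) (\<lambda>y. \<phi> y * (A z y * P (z - y)))))"
  using assms
proof (induction arbitrary: A rule: real_polynomial_function.induct)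
  case (linear f)
  have cf: "continuous_on S f" for S using linear.hyps by (rule linear_continuous_on)
  have "real_polynomial_function (\<lambda>z. integral (cbox a b) (\<lambda>y. \<phi> y * (A z y * f (z - y))))"
    if \<phi>: "continuous_on UNIV \<phi>" for \<phi>
  proof -
    have c: "continuous_on (cbox a b) \<phi>" "continuous_on (cbox a b) (A z)" for z
      using \<phi> linear.prems(1) continuous_on_subset by blast+
    have "integral (cbox a b) (\<lambda>y. \<phi> y * (A z y * f (z - y)))
        = f z * integral (cbox a b) (\<lambda>y. \<phi> y * A z y) - integral (cbox a b) (\<lambda>y. (\<phi> y * f y) * A z y)" for z
    proof -
      have "integral (cbox a b) (\<lambda>y. \<phi> y * (A z y * f (z - y)))
         = integral (cbox a b) (\<lambda>y. f z * (\<phi> y * A z y) - (\<phi> y * f y) * A z y)"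
        by (simp add: linear_diff[OF bounded_linear.linear[OF linear.hyps]] algebra_simps)
      also have "\<dots> = integral (cbox a b) (\<lambda>y. f z * (\<phi> y * A z y)) - integral (cbox a b) (\<lambda>y. (\<phi> y * f y) * A z y)"
        by (intro integral_diff integrable_continuous continuous_intros c cf)
      finally show ?thesis by simp
    qed
    moreover have "real_polynomial_function (\<lambda>z. f z * integral (cbox a b) (\<lambda>y. \<phi> y * A z y)
        - integral (cbox a b) (\<lambda>y. (\<phi> y * f y) * A z y))"
      by (intro real_polynomial_function_diff real_polynomial_function.intros(4) real_polynomial_function.intros(1)
          linear.hyps linear.prems(2) continuous_intros \<phi> cf)
    ultimately show ?thesis by simp
  qed
  moreover have "continuous_on UNIV (\<lambda>y. A z y * f (z - y))" for z
    by (intro continuous_intros linear.prems(1) continuous_on_compose2[OF cf[of UNIV]]) auto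
  ultimately show ?case by blast
next
  case (const c)
  have "real_polynomial_function (\<lambda>z. integral (cbox a b) (\<lambda>y. \<phi> y * (A z y * c)))"
    if "continuous_on UNIV \<phi>" for \<phi>
    using const(2)[of "\<lambda>y. \<phi> y * c"] that by (simp add: mult_ac continuous_intros)
  then show ?case using const(1) by (auto intro!: continuous_intros)
next
  case (add f g)
  note F = add.IH(1)[OF add.prems] and G = add.IH(2)[OF add.prems]
  have "real_polynomial_function (\<lambda>z. integral (cbox a b) (\<lambda>y. \<phi> y * (A z y * (f (z - y) + g (z - y)))))"
    if \<phi>: "continuous_on UNIV \<phi>" for \<phi>
  proof -
    have c: "continuous_on (cbox a b) \<phi>" "continuous_on (cbox a b) (\<lambda>y. A z y * f (z - y))"
      "continuous_on (cbox a b) (\<lambda>y. A z y * g (z - y))" for z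
      using \<phi> F G by (auto intro: continuous_on_subset)
    have "integral (cbox a b) (\<lambda>y. \<phi> y * (A z y * (f (z - y) + g (z - y))))
       = integral (cbox a b) (\<lambda>y. \<phi> y * (A z y * f (z - y))) + integral (cbox a b) (\<lambda>y. \<phi> y * (A z y * g (z - y)))" for z
      by (subst integral_add[symmetric])
        (auto intro!: integrable_continuous continuous_on_mult c simp: distrib_left)
    then show ?thesis using F G \<phi> by auto
  qed
  moreover have "continuous_on UNIV (\<lambda>y. A z y * (f (z - y) + g (z - y)))" for z
    using continuous_on_add[of UNIV "\<lambda>y. A z y * f (z - y)" "\<lambda>y. A z y * g (z - y)"] F G
    by (simp add: distrib_left)
  ultimately show ?case by blast
next
  case (mult f g)
  note F = mult.IH(1)[OF mult.prems]
  then show ?case using mult.IH(2)[of "\<lambda>z y. A z y * f (z - y)"] by (simp add: mult.assoc)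
qed

lemma real_polynomial_function_convolution:
  fixes a b :: "'a::euclidean_space"
  assumes "real_polynomial_function P" "continuous_on UNIV f"
  shows "real_polynomial_function (\<lambda>z. integral (cbox a b) (\<lambda>y. f y * P (z - y)))"
  using real_polynomial_function_convolution_aux[OF assms(1), of "\<lambda>z y. 1" a b] assms(2)
  by (auto simp: real_polynomial_function.intros(2))

text \<open>Two sources of error: the oscillation of g on the support of the kernel K, at most
  \<epsilon>, and the replacement of K by P on the box, at most \<open>C * \<delta>\<close> times
  the volume.\<close>

lemma mollifier_error:
  fixes g :: "'a::euclidean_space \<Rightarrow> real"
  assumes g: "continuous_on UNIV g" "\<And>x. \<bar>g x\<bar> \<le> C" "\<And>y. norm y \<le> h \<Longrightarrow> \<bar>g (z - y) - g z\<bar> \<le> \<epsilon>"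
    and K: "continuous_on UNIV K" "\<And>y. 0 \<le> K y" "\<And>y. norm y > h \<Longrightarrow> K y = 0" "integral (cbox a b) K = 1"
    and P: "continuous_on UNIV P" "\<And>y. y \<in> cbox a b \<Longrightarrow> \<bar>K y - P y\<bar> \<le> \<delta>" and "0 \<le> C" "0 \<le> \<delta>"
  shows "\<bar>integral (cbox a b) (\<lambda>y. g (z - y) * P y) - g z\<bar> \<le> \<epsilon> + C * \<delta> * measure lborel (cbox a b)"
proof -
  have c: "continuous_on (cbox a b) (\<lambda>y. g (z - y))" "continuous_on (cbox a b) K" "continuous_on (cbox a b) P"
    using K P by (auto intro!: continuous_on_compose2[OF g(1)] continuous_intros intro: continuous_on_subset)
  have Ki: "(K has_integral 1) (cbox a b)"
    using integrable_integral[OF integrable_continuous[OF c(2)]] K by simp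
  have "((\<lambda>y. (g (z - y) - g z) * K y + g (z - y) * (P y - K y) + g z * K y) has_integral
     integral (cbox a b) (\<lambda>y. (g (z - y) - g z) * K y) + integral (cbox a b) (\<lambda>y. g (z - y) * (P y - K y)) + g z * 1) (cbox a b)"
    by (intro has_integral_add has_integral_mult_right Ki integrable_integral integrable_continuous continuous_intros c)
  moreover have "(\<lambda>y. (g (z - y) - g z) * K y + g (z - y) * (P y - K y) + g z * K y) = (\<lambda>y. g (z - y) * P y)"
    by (auto simp: algebra_simps)
  ultimately have "integral (cbox a b) (\<lambda>y. g (z - y) * P y) - g z
     = integral (cbox a b) (\<lambda>y. (g (z - y) - g z) * K y) + integral (cbox a b) (\<lambda>y. g (z - y) * (P y - K y))"
    by (simp add: integral_unique)
  moreover have "norm (integral (cbox a b) (\<lambda>y. (g (z - y) - g z) * K y)) \<le> integral (cbox a b) (\<lambda>y. \<epsilon> * K y)"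
  proof (rule integral_norm_bound_integral)
    fix y
    show "norm ((g (z - y) - g z) * K y) \<le> \<epsilon> * K y"
      using g(3)[of y] K(2)[of y] K(3)[of y] by (cases "norm y \<le> h") (auto simp: abs_mult intro: mult_right_mono)
  qed (intro integrable_continuous continuous_intros c)+
  moreover have "integral (cbox a b) (\<lambda>y. \<epsilon> * K y) = \<epsilon>" using K by simp
  moreover have "norm (integral (cbox a b) (\<lambda>y. g (z - y) * (P y - K y))) \<le> C * \<delta> * measure lborel (cbox a b)"
  proof (rule has_integral_bound)
    show "((\<lambda>y. g (z - y) * (P y - K y)) has_integral integral (cbox a b) (\<lambda>y. g (z - y) * (P y - K y))) (cbox a b)"
      by (intro integrable_integral integrable_continuous continuous_intros c)
    show "norm (g (z - y) * (P y - K y)) \<le> C * \<delta>" if "y \<in> cbox a b" for y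
      using P(2)[OF that] g(2)[of "z - y"] assms by (auto simp: abs_mult abs_minus_commute intro!: mult_mono)
  qed (use assms in auto)
  ultimately show ?thesis by (simp only: real_norm_def)
qed

text \<open>The derivative falls on g and not on P, so that derivatives of the mollified function
  are again mollifications, of derivatives of g.\<close>

lemma convolution_shift_derivative:
  fixes g :: "'a::euclidean_space \<Rightarrow> real"
  assumes "Ck_on 1 UNIV g" "continuous_on UNIV P"
  shows "((\<lambda>s. integral (cbox a b) (\<lambda>y. g (z + s *\<^sub>R v - y) * P y)) has_real_derivative
     integral (cbox a b) (\<lambda>y. dd v g (z - y) * P y)) (at 0)"
proof -
  have cg: "continuous_on UNIV g" by (rule Ck_on_imp_continuous_on[OF assms(1)])
  have "((\<lambda>s. integral (cbox a b) (\<lambda>y. g (z + s *\<^sub>R v - y) * P y)) has_real_derivative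
     integral (cbox a b) (\<lambda>y. dd v g (z + 0 *\<^sub>R v - y) * P y)) (at 0 within UNIV)"
  proof (rule leibniz_rule_field_derivative)
    fix s :: real and y
    have "((\<lambda>s. g ((z - y) + s *\<^sub>R v)) has_real_derivative dd v g ((z - y) + s *\<^sub>R v)) (at s)"
      by (rule line_has_real_derivative) (rule Ck_on_1_diff[OF assms(1)], simp)
    then have "((\<lambda>s. g (z + s *\<^sub>R v - y)) has_real_derivative dd v g (z + s *\<^sub>R v - y)) (at s)"
      by (simp add: algebra_simps)
    then show "((\<lambda>s. g (z + s *\<^sub>R v - y) * P y) has_real_derivative dd v g (z + s *\<^sub>R v - y) * P y) (at s within UNIV)"
      by (auto intro: DERIV_cmult_right)
  next
    fix s :: real
    show "(\<lambda>y. g (z + s *\<^sub>R v - y) * P y) integrable_on cbox a b"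
      by (intro integrable_continuous continuous_intros continuous_on_compose2[OF cg] continuous_on_subset[OF assms(2)]) auto
  next
    show "continuous_on (UNIV \<times> cbox a b) (\<lambda>(s, y). dd v g (z + s *\<^sub>R v - y) * P y)"
      unfolding split_beta
      by (intro continuous_intros continuous_on_dd_compose[OF open_UNIV assms(1)] continuous_on_compose2[OF assms(2)]) auto
  qed auto
  then show ?thesis by simp
qed

text \<open>With both supports inside the box, both sides are integrals over the whole space and the
  substitution \<open>y \<mapsto> z - y\<close> applies. One side lets derivatives fall on f, the
  other shows that the result is a polynomial in z.\<close>

lemma integral_reflect:
  fixes f P :: "'a::euclidean_space \<Rightarrow> real"
  assumes "continuous_on UNIV f" "continuous_on UNIV P" "\<And>x. x \<notin> cbox a b \<Longrightarrow> f x = 0"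
    "\<And>y. y \<notin> cbox a b \<Longrightarrow> f (z - y) = 0"
  shows "integral (cbox a b) (\<lambda>y. f (z - y) * P y) = integral (cbox a b) (\<lambda>y. f y * P (z - y))"
proof -
  let ?i = "integral (cbox a b) (\<lambda>y. f (z - y) * P y)"
  have c: "continuous_on S (\<lambda>y. f (z - y) * P y)" "continuous_on S (\<lambda>y. f y * P (z - y))" for S
    by (auto intro!: continuous_intros continuous_on_compose2[OF assms(1)] continuous_on_compose2[OF assms(2)])
  have "((\<lambda>y. f (z - y) * P y) has_integral ?i) (cbox a b)"
    by (intro integrable_integral integrable_continuous c)
  from has_integral_affinity[OF this, of "-1" z]
  have "((\<lambda>x. f x * P (z - x)) has_integral ?i) ((\<lambda>x. z - x) ` cbox a b)"
    by (simp add: algebra_simps)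
  then have "((\<lambda>x. f x * P (z - x)) has_integral ?i) UNIV"
  proof (rule has_integral_on_superset)
    fix x assume "x \<notin> (\<lambda>x. z - x) ` cbox a b"
    then have "z - x \<notin> cbox a b" by (metis add_diff_cancel_right' diff_add_cancel imageI diff_diff_eq2 add.commute)
    then show "f x * P (z - x) = 0" using assms(4)[of "z - x"] by simp
  qed auto
  moreover have "((\<lambda>x. f x * P (z - x)) has_integral integral (cbox a b) (\<lambda>y. f y * P (z - y))) UNIV"
    by (rule has_integral_on_superset[OF integrable_integral[OF integrable_continuous[OF c(2)]]]) (use assms(3) in auto)
  ultimately show ?thesis by (rule has_integral_unique)
qed

lemma bounded_support_bound:
  fixes g :: "'a::euclidean_space \<Rightarrow> real"
  assumes "continuous_on UNIV g" "\<And>x. norm x > S \<Longrightarrow> g x = 0"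
  obtains C where "0 \<le> C" "\<And>x. \<bar>g x\<bar> \<le> C"
proof -
  have "bounded (g ` cball 0 S)"
    by (intro compact_imp_bounded compact_continuous_image continuous_on_subset[OF assms(1)]) auto
  then obtain C where C: "\<forall>x\<in>cball 0 S. \<bar>g x\<bar> \<le> C" by (auto simp: bounded_iff)
  have "\<bar>g x\<bar> \<le> max C 0" for x using C[rule_format, of x] assms(2)[of x] by (cases "norm x \<le> S") auto
  then show ?thesis using that[of "max C 0"] by simp
qed

lemma dd_bounded_support:
  assumes "\<And>x. norm x > S \<Longrightarrow> f x = (0::real)" "norm x > S"
  shows "dd v f x = 0"
proof -
  have "open {x. norm x > S}" by (intro open_Collect_less continuous_intros)
  then have "dd v f x = dd v (\<lambda>x. 0) x" by (rule dd_cong_open) (use assms in auto)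
  then show ?thesis by (simp add: dd_def)
qed

lemma smooth_approximation_Basis:
  fixes f :: "'a::euclidean_space \<Rightarrow> real"
  assumes f: "Ck_on 2 UNIV f" "bounded {x. f x \<noteq> 0}" and e: "e > 0" and R: "R > 0"
  obtains F where "smooth_on UNIV F"
    "\<And>z b. norm z \<le> R \<Longrightarrow> b \<in> Basis \<Longrightarrow> \<bar>dd b F z - dd b f z\<bar> \<le> e"
    "\<And>z b c. norm z \<le> R \<Longrightarrow> b \<in> Basis \<Longrightarrow> c \<in> Basis \<Longrightarrow> \<bar>dd c (dd b F) z - dd c (dd b f) z\<bar> \<le> e"
proof -
  obtain S where S: "S > 0" "\<And>x. norm x > S \<Longrightarrow> f x = 0"
    using f(2) unfolding bounded_pos by (metis linorder_not_less mem_Collect_eq)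
  \<comment> \<open>All derivatives to be approximated are collected, so that one kernel and one
    polynomial serve for all of them.\<close>
  define G where "G = (\<lambda>b. dd b f) ` Basis \<union> (\<lambda>(b, c). dd c (dd b f)) ` (Basis \<times> Basis)"
  have fG: "finite G" by (auto simp: G_def)
  have C1: "Ck_on 1 UNIV (dd b f)" for b by (rule Ck_on_2_dd[OF f(1)])
  have cf: "continuous_on UNIV f" by (rule Ck_on_imp_continuous_on[OF f(1)])
  have cG: "continuous_on UNIV g" if "g \<in> G" for g
    using that Ck_on_imp_continuous_on[OF C1] Ck_on_dd[of 0 UNIV "dd b f" for b] C1
    by (auto simp: G_def)
  have sG: "g x = 0" if "g \<in> G" "norm x > S" for g x
    using that by (auto simp: G_def intro!: dd_bounded_support[of S] S)
  \<comment> \<open>Large enough that for \<open>norm z < R + 1\<close> the box contains the support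
    of f and every y with \<open>z - y\<close> in that support.\<close>
  define \<rho> where "\<rho> = R + S + 3"
  define a where "a = (- \<rho>) *\<^sub>R (One::'a)"
  define b where "b = \<rho> *\<^sub>R (One::'a)"
  have box: "x \<in> cbox a b" if "norm x \<le> \<rho>" for x
    using that Basis_le_norm[of _ x] by (force simp: mem_box a_def b_def abs_le_iff)
  define m where "m = measure lborel (cbox a b)"
  have m: "0 \<le> m" by (simp add: m_def)
  obtain C where C: "C \<ge> 0" "\<And>g x. g \<in> G \<Longrightarrow> \<bar>g x\<bar> \<le> C"
  proof -
    have "\<forall>g\<in>G. \<exists>C. 0 \<le> C \<and> (\<forall>x. \<bar>g x\<bar> \<le> C)"
    proof
      fix g assume g: "g \<in> G"
      show "\<exists>C. 0 \<le> C \<and> (\<forall>x. \<bar>g x\<bar> \<le> C)"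
        by (rule bounded_support_bound[OF cG[OF g] sG[OF g]]) auto
    qed
    then obtain Cg where Cg: "\<And>g. g \<in> G \<Longrightarrow> 0 \<le> Cg g \<and> (\<forall>x. \<bar>g x\<bar> \<le> Cg g)" by metis
    show ?thesis
    proof (rule that)
      show "0 \<le> sum Cg G" using Cg by (auto intro: sum_nonneg)
      show "\<bar>g x\<bar> \<le> sum Cg G" if "g \<in> G" for g x
        using member_le_sum[of g G Cg] Cg fG that by (meson DiffD1 order_trans)
    qed
  qed
  obtain h where h: "0 < h" "h \<le> 1" "\<And>g z y. g \<in> G \<Longrightarrow> norm z \<le> R \<Longrightarrow> norm y \<le> h \<Longrightarrow> \<bar>g (z - y) - g z\<bar> \<le> e / 2"
  proof -
    have "\<exists>h>0. \<forall>z y. norm z \<le> R \<longrightarrow> norm y \<le> h \<longrightarrow> norm y \<le> 1 \<longrightarrow> \<bar>g (z - y) - g z\<bar> \<le> e / 2" if "g \<in> G" for g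
    proof -
      have "uniformly_continuous_on (cball 0 (R + 1)) g"
        by (intro compact_uniformly_continuous continuous_on_subset[OF cG[OF that]]) auto
      then obtain d where d: "d > 0" "\<And>x y. x \<in> cball 0 (R+1) \<Longrightarrow> y \<in> cball 0 (R+1) \<Longrightarrow> dist y x < d \<Longrightarrow> dist (g y) (g x) < e / 2"
        unfolding uniformly_continuous_on_def using e by (meson half_gt_zero)
      have "\<bar>g (z - y) - g z\<bar> \<le> e / 2" if "norm z \<le> R" "norm y \<le> d / 2" "norm y \<le> 1" for z y
        using d(2)[of z "z - y"] norm_minus_commute[of y z] that d(1) norm_triangle_ineq4[of z y] by (auto simp: dist_norm)
      then show ?thesis using d(1) by (intro exI[of _ "d/2"]) auto
    qed
    then obtain hg where hg: "\<And>g. g \<in> G \<Longrightarrow> hg g > 0 \<and> (\<forall>z y. norm z \<le> R \<longrightarrow> norm y \<le> hg g \<longrightarrow> norm y \<le> 1 \<longrightarrow> \<bar>g (z - y) - g z\<bar> \<le> e / 2)"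
      by metis
    define h where "h = Min (insert 1 (hg ` G))"
    have "0 < h" using hg fG by (auto simp: h_def)
    moreover have "h \<le> 1" "\<And>g. g \<in> G \<Longrightarrow> h \<le> hg g" using fG by (auto simp: h_def)
    ultimately show ?thesis using that hg by (meson order_trans)
  qed
  \<comment> \<open>A tent. Continuity of the kernel is enough for the approximation by a
    polynomial; the smoothness of the result comes from the polynomial.\<close>
  define k0 where "k0 y = max 0 (h - norm y)" for y :: 'a
  have k0: "continuous_on T k0" "\<And>y. 0 \<le> k0 y" for T unfolding k0_def by (auto intro!: continuous_intros)
  define I where "I = integral (cbox a b) k0"
  have "box a b \<noteq> {}" using R S by (auto simp: box_ne_empty a_def b_def \<rho>_def)
  moreover have "k0 0 \<noteq> 0" "0 \<in> cbox a b" using h box[of 0] R S by (auto simp: k0_def \<rho>_def)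
  ultimately have "I \<noteq> 0"
    using integral_cbox_eq_0_iff[OF k0(1), of a b] k0(2) by (auto simp: I_def)
  moreover have "I \<ge> 0" unfolding I_def by (intro integral_nonneg integrable_continuous k0)
  ultimately have I: "I > 0" by simp
  define K where "K y = k0 y / I" for y
  have K: "continuous_on T K" "\<And>y. 0 \<le> K y" "\<And>y. norm y > h \<Longrightarrow> K y = 0" "integral (cbox a b) K = 1" for T
  proof -
    show "continuous_on T K" "\<And>y. 0 \<le> K y" using I k0 by (auto simp: K_def[abs_def] intro!: continuous_intros)
    show "K y = 0" if "norm y > h" for y using that by (simp add: K_def k0_def)
    show "integral (cbox a b) K = 1" using I by (simp add: K_def[abs_def] I_def[symmetric])
  qed
  define \<delta> where "\<delta> = e / (2 * (C * m + 1))"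
  have Cm: "0 \<le> C * m" using C m by simp
  have \<delta>: "\<delta> > 0" "C * \<delta> * m \<le> e / 2"
    using e Cm by (auto simp: \<delta>_def field_simps)
  obtain P where P: "real_polynomial_function P" "\<And>y. y \<in> cbox a b \<Longrightarrow> \<bar>K y - P y\<bar> < \<delta>"
    using Stone_Weierstrass_real_polynomial_function[OF compact_cbox K(1) \<delta>(1)] by metis
  have cP: "continuous_on UNIV P" by (rule Ck_on_imp_continuous_on[OF Ck_on_real_polynomial_function[OF P(1)]])
  have err: "\<bar>integral (cbox a b) (\<lambda>y. g (z - y) * P y) - g z\<bar> \<le> e" if "g \<in> G" "norm z \<le> R" for g z
  proof -
    have "\<bar>integral (cbox a b) (\<lambda>y. g (z - y) * P y) - g z\<bar> \<le> e / 2 + C * \<delta> * measure lborel (cbox a b)"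
      by (rule mollifier_error[OF cG[OF that(1)] C(2)[OF that(1)] h(3)[OF that] K cP _ C(1)])
        (use P(2) \<delta>(1) in \<open>auto intro: less_imp_le\<close>)
    then show ?thesis using \<delta>(2) by (simp add: m_def)
  qed
  define F where "F z = integral (cbox a b) (\<lambda>y. f y * P (z - y))" for z
  have Fk: "Ck_on k UNIV F" for k
    unfolding F_def by (intro Ck_on_real_polynomial_function real_polynomial_function_convolution P cf)
  have F1: "F z = integral (cbox a b) (\<lambda>y. f (z - y) * P y)" if "norm z < R + 1" for z
    unfolding F_def
  proof (rule integral_reflect[symmetric, OF cf cP])
    fix x assume "x \<notin> cbox a b"
    then have x: "norm x > \<rho>" using box by force
    then show "f x = 0" using R S by (auto simp: \<rho>_def)
    have "norm (z - x) > S" using x norm_triangle_ineq2[of x z] that by (auto simp: \<rho>_def norm_minus_commute)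
    then show "f (z - x) = 0" by (rule S(2))
  qed
  have opR: "open {z::'a. norm z < R + 1}" by (intro open_Collect_less continuous_intros)
  have dF: "dd v F z = integral (cbox a b) (\<lambda>y. dd v f (z - y) * P y)" if z: "norm z < R + 1" for v z
  proof -
    have d1: "((\<lambda>s. integral (cbox a b) (\<lambda>y. f (z + s *\<^sub>R v - y) * P y)) has_real_derivative
       integral (cbox a b) (\<lambda>y. dd v f (z - y) * P y)) (at 0)"
      by (rule convolution_shift_derivative[OF Ck_on_2_1[OF f(1)] cP])
    have ev: "\<forall>\<^sub>F s in nhds 0. F (z + s *\<^sub>R v) = integral (cbox a b) (\<lambda>y. f (z + s *\<^sub>R v - y) * P y)"
    proof -
      have "((\<lambda>s. norm (z + s *\<^sub>R v)) \<longlongrightarrow> norm (z + 0 *\<^sub>R v)) (nhds 0)"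
        by (intro tendsto_intros filterlim_ident)
      then have "\<forall>\<^sub>F s in nhds 0. norm (z + s *\<^sub>R v) < R + 1"
        by (rule order_tendstoD) (use z in simp)
      then show ?thesis by eventually_elim (rule F1)
    qed
    have d2: "((\<lambda>s. F (z + s *\<^sub>R v)) has_real_derivative
       integral (cbox a b) (\<lambda>y. dd v f (z - y) * P y)) (at 0)"
      by (rule iffD2[OF DERIV_cong_ev[OF refl ev refl] d1])
    have d3: "((\<lambda>s. F (z + s *\<^sub>R v)) has_real_derivative dd v F (z + 0 *\<^sub>R v)) (at 0)"
      by (rule line_has_real_derivative) (rule Ck_on_1_diff[OF Fk], simp)
    show ?thesis using DERIV_unique[OF d3 d2] by simp
  qed
  have ddF: "dd w (dd v F) z = integral (cbox a b) (\<lambda>y. dd w (dd v f) (z - y) * P y)" if z: "norm z < R + 1" for v w z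
  proof -
    have d1: "((\<lambda>s. integral (cbox a b) (\<lambda>y. dd v f (z + s *\<^sub>R w - y) * P y)) has_real_derivative
       integral (cbox a b) (\<lambda>y. dd w (dd v f) (z - y) * P y)) (at 0)"
      by (rule convolution_shift_derivative[OF C1 cP])
    have ev: "\<forall>\<^sub>F s in nhds 0. dd v F (z + s *\<^sub>R w) = integral (cbox a b) (\<lambda>y. dd v f (z + s *\<^sub>R w - y) * P y)"
    proof -
      have "((\<lambda>s. norm (z + s *\<^sub>R w)) \<longlongrightarrow> norm (z + 0 *\<^sub>R w)) (nhds 0)"
        by (intro tendsto_intros filterlim_ident)
      then have "\<forall>\<^sub>F s in nhds 0. norm (z + s *\<^sub>R w) < R + 1"
        by (rule order_tendstoD) (use z in simp)
      then show ?thesis by eventually_elim (rule dF)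
    qed
    have d2: "((\<lambda>s. dd v F (z + s *\<^sub>R w)) has_real_derivative
       integral (cbox a b) (\<lambda>y. dd w (dd v f) (z - y) * P y)) (at 0)"
      by (rule iffD2[OF DERIV_cong_ev[OF refl ev refl] d1])
    have d3: "((\<lambda>s. dd v F (z + s *\<^sub>R w)) has_real_derivative dd w (dd v F) (z + 0 *\<^sub>R w)) (at 0)"
      by (rule line_has_real_derivative) (rule Ck_on_1_diff[OF Ck_on_2_dd[OF Fk]], simp)
    show ?thesis using DERIV_unique[OF d3 d2] by simp
  qed
  show ?thesis
  proof (rule that)
    show "smooth_on UNIV F" using Fk by (simp add: smooth_on_def)
    show "\<bar>dd b F z - dd b f z\<bar> \<le> e" if "norm z \<le> R" "b \<in> Basis" for z b
      using err[of "dd b f" z] dF[of z b] that by (auto simp: G_def)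
    show "\<bar>dd c (dd b F) z - dd c (dd b f) z\<bar> \<le> e" if "norm z \<le> R" "b \<in> Basis" "c \<in> Basis" for z b c
    proof -
      have "dd c (dd b f) \<in> (\<lambda>(b, c). dd c (dd b f)) ` (Basis \<times> Basis)"
        using that by (intro image_eqI[of _ _ "(b, c)"]) auto
      then show ?thesis using err[of "dd c (dd b f)" z] ddF[of z c b] that by (auto simp: G_def)
    qed
  qed
qed

lemma abs_sum_Basis_le:
  fixes v :: "'a::euclidean_space" and k :: real
  assumes "\<And>b. b \<in> Basis \<Longrightarrow> \<bar>x b\<bar> \<le> k"
  shows "\<bar>\<Sum>b\<in>Basis. (v \<bullet> b) * x b\<bar> \<le> real DIM('a) * k * norm v"
proof -
  have "\<bar>\<Sum>b\<in>Basis. (v \<bullet> b) * x b\<bar> \<le> (\<Sum>b\<in>Basis. \<bar>(v \<bullet> b) * x b\<bar>)" by (rule sum_abs)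
  also have "\<dots> \<le> (\<Sum>b\<in>(Basis::'a set). norm v * k)"
    using assms Basis_le_norm[of _ v] by (intro sum_mono) (auto simp: abs_mult intro!: mult_mono)
  finally show ?thesis by (simp add: mult_ac)
qed

lemma smooth_approximation:
  fixes f :: "'a::euclidean_space \<Rightarrow> real"
  assumes f: "Ck_on 2 UNIV f" "bounded {x. f x \<noteq> 0}" and e: "e > 0" and R: "R > 0"
  obtains F where "smooth_on UNIV F"
    "\<And>z v. norm z \<le> R \<Longrightarrow> \<bar>dd v F z - dd v f z\<bar> \<le> e * norm v"
    "\<And>z v w. norm z \<le> R \<Longrightarrow> \<bar>dd w (dd v F) z - dd w (dd v f) z\<bar> \<le> e * norm v * norm w"
proof -
  let ?n = "real DIM('a)"
  \<comment> \<open>One factor \<open>DIM('a)\<close> is lost for each direction that is expanded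
    over \<open>Basis\<close>.\<close>
  define e' where "e' = e / (?n * ?n)"
  have n: "?n \<ge> 1" by (simp add: DIM_positive Suc_leI)
  have e': "e' > 0" "?n * ?n * e' = e" "?n * e' \<le> e"
  proof -
    show "e' > 0" unfolding e'_def using e n by (intro divide_pos_pos mult_pos_pos) auto
    show *: "?n * ?n * e' = e" unfolding e'_def using n by simp
    then show "?n * e' \<le> e" using mult_right_mono[OF n, of "?n * e'"] \<open>e' > 0\<close> by (simp add: mult.assoc)
  qed
  obtain F where F: "smooth_on UNIV F"
    "\<And>z b. norm z \<le> R \<Longrightarrow> b \<in> Basis \<Longrightarrow> \<bar>dd b F z - dd b f z\<bar> \<le> e'"
    "\<And>z b c. norm z \<le> R \<Longrightarrow> b \<in> Basis \<Longrightarrow> c \<in> Basis \<Longrightarrow> \<bar>dd c (dd b F) z - dd c (dd b f) z\<bar> \<le> e'"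
    by (rule smooth_approximation_Basis[OF f e'(1) R]) (rule that)
  have F2: "Ck_on 2 UNIV F" using F(1) by (simp add: smooth_on_def)
  have dif: "F differentiable (at z)" "f differentiable (at z)"
    "dd v F differentiable (at z)" "dd v f differentiable (at z)" for v z
    using Ck_on_2_diff[OF F2] Ck_on_2_diff[OF f(1)] Ck_on_1_diff[OF Ck_on_2_dd[OF F2]]
      Ck_on_1_diff[OF Ck_on_2_dd[OF f(1)]] by auto
  show ?thesis
  proof (rule that[OF F(1)])
    fix z v w :: 'a assume z: "norm z \<le> R"
    have "dd v F z - dd v f z = (\<Sum>b\<in>Basis. (v \<bullet> b) * (dd b F z - dd b f z))"
      unfolding dd_Basis[OF dif(1), of v] dd_Basis[OF dif(2), of v]
      by (simp add: sum_subtractf right_diff_distrib)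
    then have "\<bar>dd v F z - dd v f z\<bar> \<le> ?n * e' * norm v"
      using abs_sum_Basis_le[of "\<lambda>b. dd b F z - dd b f z" e' v] F(2)[OF z] by simp
    also have "\<dots> \<le> e * norm v" using e' by (intro mult_right_mono) auto
    finally show "\<bar>dd v F z - dd v f z\<bar> \<le> e * norm v" .
    have 1: "\<bar>dd w (dd b F) z - dd w (dd b f) z\<bar> \<le> ?n * e' * norm w" if b: "b \<in> Basis" for b
    proof -
      have "dd w (dd b F) z - dd w (dd b f) z = (\<Sum>c\<in>Basis. (w \<bullet> c) * (dd c (dd b F) z - dd c (dd b f) z))"
        unfolding dd_Basis[OF dif(3), of w] dd_Basis[OF dif(4), of w]
        by (simp add: sum_subtractf right_diff_distrib)
      then show ?thesis
        using abs_sum_Basis_le[of "\<lambda>c. dd c (dd b F) z - dd c (dd b f) z" e' w] F(3)[OF z b] by simp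
    qed
    have "dd w (dd v F) z - dd w (dd v f) z = (\<Sum>b\<in>Basis. (v \<bullet> b) * (dd w (dd b F) z - dd w (dd b f) z))"
      unfolding dd_dd_Basis[OF open_UNIV UNIV_I F2, of w v] dd_dd_Basis[OF open_UNIV UNIV_I f(1), of w v]
      by (simp add: sum_subtractf right_diff_distrib)
    then have "\<bar>dd w (dd v F) z - dd w (dd v f) z\<bar> \<le> ?n * (?n * e' * norm w) * norm v"
      using abs_sum_Basis_le[of "\<lambda>b. dd w (dd b F) z - dd w (dd b f) z" _ v] 1 by simp
    also have "\<dots> = (?n * ?n * e') * norm v * norm w" by (simp only: mult_ac)
    finally show "\<bar>dd w (dd v F) z - dd w (dd v f) z\<bar> \<le> e * norm v * norm w" unfolding e'(2) .
  qed
qed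

text \<open>For gluing functions of class \<open>C\<^sup>2\<close> the cube of the positive part is a sufficiently regular bump.\<close>

lemma max_power_has_derivative:
  "((\<lambda>s::real. (max 0 s) ^ Suc (Suc n)) has_real_derivative (real (Suc (Suc n)) * (max 0 s) ^ Suc n)) (at s)"
proof -
  consider "s < 0" | "s = 0" | "s > 0" by linarith
  then show ?thesis
  proof cases
    case 1
    have "((\<lambda>s. 0) has_real_derivative 0) (at s)" by simp
    then have "((\<lambda>s. (max 0 s) ^ Suc (Suc n)) has_real_derivative 0) (at s)"
      by (rule has_field_derivative_transform_within_open[of _ _ _ "{..<0}"]) (use 1 in auto)
    then show ?thesis using 1 by simp
  next
    case 2
    have "((\<lambda>h. \<bar>h\<bar> ^ Suc n) \<longlongrightarrow> \<bar>0::real\<bar> ^ Suc n) (at 0)" by (intro tendsto_intros)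
    then have 0: "((\<lambda>h::real. \<bar>h\<bar> ^ Suc n) \<longlongrightarrow> 0) (at 0)" by simp
    have "((\<lambda>h. (max 0 h) ^ Suc (Suc n) / h) \<longlongrightarrow> (0::real)) (at 0)"
    proof (rule Lim_null_comparison[OF _ 0])
      have "norm ((max 0 h) ^ Suc (Suc n) / h) \<le> \<bar>h\<bar> ^ Suc n" for h :: real
      proof (cases "h > 0")
        case False
        then have "max 0 h = 0" by simp
        then show ?thesis using zero_le_power[of "\<bar>h\<bar>" "Suc n"] by (simp del: power_Suc)
      qed simp
      then show "\<forall>\<^sub>F h in at 0. norm ((max 0 h) ^ Suc (Suc n) / h) \<le> \<bar>h :: real\<bar> ^ Suc n" by simp
    qed
    then show ?thesis using 2 by (simp add: has_field_derivative_iff)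
  next
    case 3
    have "((\<lambda>s. s ^ Suc (Suc n)) has_real_derivative (real (Suc (Suc n)) * s ^ Suc n)) (at s)"
      using DERIV_pow[of "Suc (Suc n)" s] by simp
    then have "((\<lambda>s. (max 0 s) ^ Suc (Suc n)) has_real_derivative (real (Suc (Suc n)) * s ^ Suc n)) (at s)"
      by (rule has_field_derivative_transform_within_open[of _ _ _ "{0<..}"]) (use 3 in auto)
    then show ?thesis using 3 by simp
  qed
qed

lemma max_cube_derivative: "((\<lambda>s::real. (max 0 s)^3) has_real_derivative 3 * (max 0 s)^2) (at s)"
  using max_power_has_derivative[of 1 s] by (simp add: numeral_3_eq_3 numeral_2_eq_2)

lemma max_square_derivative: "((\<lambda>s::real. (max 0 s)^2) has_real_derivative 2 * max 0 s) (at s)"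
  using max_power_has_derivative[of 0 s] by (simp add: numeral_2_eq_2)

lemma Ck_on_max_cube:
  fixes f :: "'a::real_normed_vector \<Rightarrow> real"
  assumes "open U" "Ck_on 2 U f"
  shows "Ck_on 2 U (\<lambda>x. (max 0 (f x))^3)"
proof -
  have "Ck_on (Suc 1) U (\<lambda>x. (max 0 (f x))^3)"
  proof (rule Ck_on_compose_real[where g="\<lambda>s. (max 0 s)^3" and g'="\<lambda>s. 3 * (max 0 s)^2", OF assms(1) max_cube_derivative])
    show "Ck_on (Suc 1) U f" using assms(2) by (simp add: numeral_2_eq_2)
    have "Ck_on (Suc 0) U (\<lambda>x. (max 0 (f x))^2)"
      using assms Ck_on_imp_continuous_on[OF assms(2)]
      by (intro Ck_on_compose_real[where g="\<lambda>s. (max 0 s)^2" and g'="\<lambda>s. 2 * max 0 s", OF assms(1) max_square_derivative]) (auto intro!: continuous_intros dest: Ck_on_2_1)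
    from Ck_on_cmult[OF assms(1) this] show "Ck_on 1 U (\<lambda>x. 3 * (max 0 (f x))^2)" by simp
  qed
  then show ?thesis by (simp add: numeral_2_eq_2)
qed

lemma C2_extension_by_zero:
  fixes F b :: "'a::euclidean_space \<Rightarrow> real"
  assumes "open U" "Ck_on 2 U F" "Ck_on 2 UNIV b" "closed C" "C \<subseteq> U" "\<And>z. z \<notin> C \<Longrightarrow> b z = 0"
  shows "Ck_on 2 UNIV (\<lambda>z. if z \<in> U then b z * F z else 0)"
proof (rule Ck_on_local)
  fix x
  let ?f = "\<lambda>z. if z \<in> U then b z * F z else 0"
  show "\<exists>V. open V \<and> x \<in> V \<and> Ck_on 2 V ?f"
  proof (cases "x \<in> U")
    case True
    have "Ck_on 2 U ?f"
      by (rule Ck_on_cong_open[OF assms(1) _ Ck_on_mult[OF assms(1) Ck_on_subset[OF assms(3)] assms(2)]]) auto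
    then show ?thesis using True assms(1) by blast
  next
    case False
    have "Ck_on 2 (- C) ?f"
      by (rule Ck_on_cong_open[OF _ _ Ck_on_const[of 2 "- C" 0]]) (use assms in auto)
    then show ?thesis using False assms(4,5) by (intro exI[of _ "- C"]) auto
  qed
qed

text \<open>A weighted mean of the local functions, with cubes of positive parts on balls as
  weights. It agrees with \<psi> wherever all contributing local functions do, that is on S. In one
  application S is a piece of the hypersurface, in the other the whole space.\<close>

lemma C2_glue:
  fixes K :: "'a::euclidean_space set" and \<psi> :: "'a \<Rightarrow> real"
  assumes K: "compact K"
    and loc: "\<And>p. p \<in> K \<Longrightarrow> \<exists>U F. open U \<and> p \<in> U \<and> Ck_on 2 U F \<and> (\<forall>q\<in>U \<inter> S. F q = \<psi> q)"
  obtains F W where "Ck_on 2 UNIV F" "open W" "K \<subseteq> W" "\<And>q. q \<in> W \<inter> S \<Longrightarrow> F q = \<psi> q" "bounded {x. F x \<noteq> 0}"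
proof -
  have "\<forall>p\<in>K. \<exists>U F R. open U \<and> cball p R \<subseteq> U \<and> 0 < R \<and> Ck_on 2 U F \<and> (\<forall>q\<in>U \<inter> S. F q = \<psi> q)"
  proof
    fix p assume "p \<in> K"
    from loc[OF this] obtain U F where UF: "open U" "p \<in> U" "Ck_on 2 U F" "\<forall>q\<in>U \<inter> S. F q = \<psi> q" by blast
    then obtain R where "R > 0" "cball p R \<subseteq> U" using open_contains_cball by blast
    then show "\<exists>U F R. open U \<and> cball p R \<subseteq> U \<and> 0 < R \<and> Ck_on 2 U F \<and> (\<forall>q\<in>U \<inter> S. F q = \<psi> q)"
      using UF by blast
  qed
  then obtain U F R where UF: "\<And>p. p \<in> K \<Longrightarrow> open (U p) \<and> cball p (R p) \<subseteq> U p \<and> 0 < R p \<and> Ck_on 2 (U p) (F p)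
      \<and> (\<forall>q\<in>U p \<inter> S. F p q = \<psi> q)" by metis
  have "K \<subseteq> (\<Union>p\<in>K. ball p (R p))" using UF by auto
  then obtain T where T: "T \<subseteq> K" "finite T" "K \<subseteq> (\<Union>p\<in>T. ball p (R p))"
    using compactE_image[OF K, of K "\<lambda>p. ball p (R p)"] by auto
  define b where "b p z = (max 0 ((R p)\<^sup>2 - sqdist p z))^3" for p z
  have b2: "Ck_on 2 UNIV (b p)" for p
    unfolding b_def[abs_def]
    by (intro Ck_on_max_cube Ck_on_diff Ck_on_const Ck_on_sqdist open_UNIV)
  have b0: "b p z \<ge> 0" for p z by (simp add: b_def)
  have bs: "b p z = 0" if "p \<in> K" "z \<notin> cball p (R p)" for p z
  proof -
    have "(R p)\<^sup>2 \<le> (dist p z)\<^sup>2" using that UF[OF that(1)] by (intro power_mono) auto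
    then show ?thesis by (simp add: b_def sqdist_def dist_norm power2_norm_eq_inner[symmetric] norm_minus_commute)
  qed
  have bp: "b p z > 0" if "p \<in> K" "z \<in> ball p (R p)" for p z
  proof -
    have "(dist p z)\<^sup>2 < (R p)\<^sup>2" using that UF[OF that(1)] by (intro power_strict_mono) auto
    then show ?thesis by (simp add: b_def sqdist_def dist_norm power2_norm_eq_inner[symmetric] norm_minus_commute)
  qed
  define B where "B z = (\<Sum>p\<in>T. b p z)" for z
  define A where "A z = (\<Sum>p\<in>T. if z \<in> U p then b p z * F p z else 0)" for z
  have B2: "Ck_on 2 UNIV B" unfolding B_def[abs_def] by (intro Ck_on_sum open_UNIV b2)
  have A2: "Ck_on 2 UNIV A" unfolding A_def[abs_def]
    using UF T by (intro Ck_on_sum open_UNIV C2_extension_by_zero[OF _ _ b2 closed_cball] bs) auto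
  have B0: "B z \<ge> 0" for z unfolding B_def by (intro sum_nonneg b0)
  have Bpos: "B z > 0" if "z \<in> K" for z
  proof -
    have "z \<in> (\<Union>p\<in>T. ball p (R p))" using T(3) that by (rule subsetD)
    then obtain p where p: "p \<in> T" "z \<in> ball p (R p)" by (rule UN_E)
    then show ?thesis unfolding B_def using T bp[of p z] b0 by (intro sum_pos2[of T p]) auto
  qed
  obtain s where s: "s > 0" "\<And>z. z \<in> K \<Longrightarrow> B z > s"
  proof (cases "K = {}")
    case True then show ?thesis using that[of 1] by simp
  next
    case False
    obtain z0 where "z0 \<in> K" "\<And>z. z \<in> K \<Longrightarrow> B z0 \<le> B z"
      using continuous_attains_inf[OF K False, of B] continuous_on_subset[OF Ck_on_imp_continuous_on[OF B2]] by auto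
    then show ?thesis using that[of "B z0 / 2"] Bpos[of z0] by force
  qed
  \<comment> \<open>The denominator is \<open>B z\<close> where \<open>B z > s\<close>, and the
    added cube keeps it positive where all weights vanish; thus the quotient is of class C2 on the
    whole space.\<close>
  define G where "G z = A z * inverse (B z + (max 0 (s - B z))^3)" for z
  have den: "B z + (max 0 (s - B z))^3 > 0" for z
    using B0[of z] s(1) by (cases "B z = 0") (auto intro: add_pos_nonneg)
  have cB: "continuous_on UNIV B" by (rule Ck_on_imp_continuous_on[OF B2])
  show ?thesis
  proof (rule that[of G "{z. B z > s}"])
    show "Ck_on 2 UNIV G" unfolding G_def[abs_def]
      by (intro Ck_on_mult A2 Ck_on_inverse Ck_on_add B2 Ck_on_max_cube Ck_on_diff Ck_on_const open_UNIV)
        (use den in \<open>simp add: less_imp_neq[symmetric]\<close>)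
    show "open {z. B z > s}" by (intro open_Collect_less continuous_intros cB)
    show "K \<subseteq> {z. B z > s}" using s by auto
    fix q assume q: "q \<in> {z. B z > s} \<inter> S"
    have "A q = (\<Sum>p\<in>T. b p q * \<psi> q)" unfolding A_def
    proof (rule sum.cong)
      fix p assume p: "p \<in> T"
      show "(if q \<in> U p then b p q * F p q else 0) = b p q * \<psi> q"
      proof (cases "q \<in> U p")
        case True
        then show ?thesis using UF[of p] T p q by auto
      next
        case False
        have "p \<in> K" using T(1) p by blast
        moreover from this have "q \<notin> cball p (R p)" using UF False by blast
        ultimately have "b p q = 0" by (rule bs)
        then show ?thesis by simp
      qed
    qed simp
    then have "A q = B q * \<psi> q" by (simp add: B_def sum_distrib_right)
    then show "G q = \<psi> q" using q s(1) by (auto simp: G_def)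
  next
    have "{x. G x \<noteq> 0} \<subseteq> (\<Union>p\<in>T. cball p (R p))"
    proof
      fix x assume "x \<in> {x. G x \<noteq> 0}"
      then have Ax: "A x \<noteq> 0" by (simp add: G_def)
      obtain p where "p \<in> T" "(if x \<in> U p then b p x * F p x else 0) \<noteq> 0"
        by (rule sum.not_neutral_contains_not_neutral[OF Ax[unfolded A_def]])
      then show "x \<in> (\<Union>p\<in>T. cball p (R p))" using bs[of p x] T by (auto split: if_splits)
    qed
    moreover have "bounded (\<Union>p\<in>T. cball p (R p))" using T(2) by (intro bounded_UN) auto
    ultimately show "bounded {x. G x \<noteq> 0}" by (metis bounded_subset)
  qed
qed

section \<open>Composition with real functions\<close>

lemma Ck_on_ln:
  fixes f :: "'a::real_normed_vector \<Rightarrow> real"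
  assumes "open U" "Ck_on k U f" "\<And>x. x \<in> U \<Longrightarrow> 0 < f x"
  shows "Ck_on k U (\<lambda>x. ln (f x))"
proof (cases k)
  case 0
  have "continuous_on U (\<lambda>x. ln (f x))"
    by (intro continuous_intros Ck_on_imp_continuous_on[OF assms(2)]) (use assms(3) in fastforce)
  then show ?thesis using 0 by simp
next
  case (Suc j)
  have "Ck_on (Suc j) U (\<lambda>x. ln (f x))"
  proof (rule Ck_on_compose_real[where g=ln and g'=inverse, OF assms(1)])
    show "(ln has_real_derivative inverse (f x)) (at (f x))" if "x \<in> U" for x
      by (rule DERIV_ln[OF assms(3)[OF that]])
    show "Ck_on j U (\<lambda>x. inverse (f x))"
      using assms Suc Ck_on_SucD by (intro Ck_on_inverse) (auto dest!: assms(3))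
  qed (use assms Suc in simp)
  then show ?thesis using Suc by simp
qed

lemma Ck_on_exp:
  fixes f :: "'a::real_normed_vector \<Rightarrow> real"
  assumes "open U" "Ck_on k U f"
  shows "Ck_on k U (\<lambda>x. exp (f x))"
  using assms(2)
proof (induction k)
  case 0
  then show ?case by (auto intro: continuous_intros)
next
  case (Suc k)
  show ?case
    by (rule Ck_on_compose_real[where g=exp and g'=exp, OF assms(1) _ Suc.prems]) (auto intro: Suc.IH Ck_on_SucD Suc.prems)
qed

lemma norm_vec10_cplx:
  "f differentiable (at q) \<Longrightarrow> (cmod (vec10 X (cplx f) q))\<^sup>2 = ((dd X f q)\<^sup>2 + (dd (J X) f q)\<^sup>2) / 4"
  by (simp add: vec10_cplx cmod_power2 power_divide add_divide_distrib)

lemma has_derivative_compose_real: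
  fixes f :: "'a::real_normed_vector \<Rightarrow> real"
  assumes "f differentiable (at x)" "(g has_real_derivative g') (at (f x))"
  shows "((\<lambda>x. g (f x)) has_derivative (\<lambda>v. g' * dd v f x)) (at x)"
  using has_derivative_compose[OF has_derivative_dd[OF assms(1)]] assms(2)
  by (simp add: has_field_derivative_def)

lemma dd_compose_real:
  fixes f :: "'a::real_normed_vector \<Rightarrow> real"
  assumes "f differentiable (at x)" "(g has_real_derivative g') (at (f x))"
  shows "dd v (\<lambda>x. g (f x)) x = g' * dd v f x"
  by (rule dd_eqI[OF has_derivative_compose_real[OF assms]])

lemma dd_dd_compose_real:
  fixes f :: "'a::euclidean_space \<Rightarrow> real"
  assumes "open U" "q \<in> U" "Ck_on 2 U f"
    "\<And>x. x \<in> U \<Longrightarrow> (g has_real_derivative g' (f x)) (at (f x))"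
    "(g' has_real_derivative g'') (at (f q))"
  shows "dd w (dd v (\<lambda>x. g (f x))) q = g' (f q) * dd w (dd v f) q + g'' * dd w f q * dd v f q"
proof -
  have d: "f differentiable (at x)" if "x \<in> U" for x by (rule Ck_on_2_diff[OF assms(3) that])
  have "dd w (dd v (\<lambda>x. g (f x))) q = dd w (\<lambda>x. g' (f x) * dd v f x) q"
    by (rule dd_cong_open[OF assms(1,2) dd_compose_real[OF d assms(4)]])
  also have "\<dots> = g' (f q) * dd w (dd v f) q + g'' * dd w f q * dd v f q"
    by (rule dd_eqI[of _ "\<lambda>w. g' (f q) * dd w (dd v f) q + g'' * dd w f q * dd v f q"])
      (intro has_derivative_mult has_derivative_compose_real d assms has_derivative_dd
        Ck_on_1_diff[OF Ck_on_2_dd[OF assms(3)] assms(2)])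
  finally show ?thesis .
qed

lemma hess_compose_real:
  assumes "open U" "q \<in> U" "Ck_on 2 U f"
    "\<And>x. x \<in> U \<Longrightarrow> (g has_real_derivative g' (f x)) (at (f x))"
    "(g' has_real_derivative g'') (at (f q))"
  shows "hess (\<lambda>x. g (f x)) q X = g' (f q) * hess f q X + g'' * (cmod (vec10 X (cplx f) q))\<^sup>2"
proof -
  have "dd w (dd v (\<lambda>x. g (f x))) q = g' (f q) * dd w (dd v f) q + g'' * dd w f q * dd v f q" for v w
    by (rule dd_dd_compose_real[OF assms])
  then show ?thesis
    unfolding hess_def norm_vec10_cplx[OF Ck_on_2_diff[OF assms(3,2)]]
    by (simp add: power2_eq_square field_simps)
qed

lemma vec10_compose_real:
  assumes "f differentiable (at x)" "(g has_real_derivative g') (at (f x))"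
  shows "vec10 X (cplx (\<lambda>x. g (f x))) x = of_real g' * vec10 X (cplx f) x"
proof -
  have "(\<lambda>x. g (f x)) differentiable (at x)"
    using has_derivative_compose_real[OF assms] differentiable_def by blast
  then show ?thesis
    unfolding vec10_cplx[OF assms(1)]
    by (simp only: vec10_cplx dd_compose_real[OF assms]) (simp add: complex_eq_iff)
qed

lemma hess_cong_open:
  assumes "open U" "x \<in> U" "\<And>y. y \<in> U \<Longrightarrow> f y = g y"
  shows "hess f x X = hess g x X"
proof -
  have "dd v (dd v f) x = dd v (dd v g) x" for v
    by (rule dd_cong_open[OF assms(1,2)]) (rule dd_cong_open[OF assms(1) _ assms(3)])
  then show ?thesis by (simp add: hess_def)
qed

lemma vec10_lincomb:
  assumes "f differentiable (at q)" "g differentiable (at q)"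
  shows "vec10 X (cplx (\<lambda>q. a * f q + b * g q)) q = of_real a * vec10 X (cplx f) q + of_real b * vec10 X (cplx g) q"
proof -
  have "(\<lambda>q. a * f q + b * g q) differentiable (at q)"
    by (intro differentiable_add differentiable_mult differentiable_const assms)
  then show ?thesis
    unfolding vec10_cplx[OF assms(1)] vec10_cplx[OF assms(2)]
    by (simp only: vec10_cplx dd_lincomb[OF assms]) (simp add: complex_eq_iff add_divide_distrib)
qed

lemma tangent10_iff:
  "r differentiable (at p) \<Longrightarrow> X \<in> tangent10 r p \<longleftrightarrow> dd X r p = 0 \<and> dd (J X) r p = 0"
  by (simp add: tangent10_def vec10_cplx complex_eq_iff)

text \<open>Composition of \<open>- exp (\<tau> * x)\<close> with
  \<open>ln (- r z) + \<psi> z\<close>: the second derivative of the exponential gives the square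
  with factor \<tau>, that of the logarithm the square without it.\<close>

lemma hess_neg_exp:
  fixes r \<psi> :: "complex ^ 'n \<Rightarrow> real"
  assumes U: "open U" "z \<in> U" and r: "Ck_on 2 U r" "\<And>q. q \<in> U \<Longrightarrow> r q < 0" and psi: "Ck_on 2 U \<psi>"
  shows "hess (\<lambda>z. - exp (\<tau> * (ln (- r z) + \<psi> z))) z Y = \<tau> * exp (\<tau> * (ln (- r z) + \<psi> z)) *
    (hess r z Y / (- r z) + (cmod (vec10 Y (cplx r) z / of_real (- r z)))\<^sup>2 - hess \<psi> z Y
      - \<tau> * (cmod (vec10 Y (cplx r) z / of_real (- r z) - vec10 Y (cplx \<psi>) z))\<^sup>2)"
proof -
  let ?l = "\<lambda>z. ln (- r z)"
  let ?g = "\<lambda>z. 1 * ln (- r z) + 1 * \<psi> z"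
  have dl: "((\<lambda>x. ln (- x)) has_real_derivative 1 / x) (at x)" if "x < 0" for x :: real
    using that by (auto intro!: derivative_eq_intros simp: field_simps)
  have dl': "((\<lambda>x. 1 / x) has_real_derivative - (1 / x\<^sup>2)) (at x)" if "x < 0" for x :: real
    using that by (auto intro!: derivative_eq_intros simp: power2_eq_square)
  have rz: "r z < 0" by (rule r(2)[OF U(2)])
  have rd: "r differentiable (at z)" by (rule Ck_on_2_diff[OF r(1) U(2)])
  have l2: "Ck_on 2 U ?l" by (intro Ck_on_ln Ck_on_minus U r(1)) (use r(2) in auto)
  have g2: "Ck_on 2 U ?g" by (rule Ck_on_lincomb[OF U(1) l2 psi])
  have hl: "hess ?l z Y = 1 / r z * hess r z Y + - (1 / (r z)\<^sup>2) * (cmod (vec10 Y (cplx r) z))\<^sup>2"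
    by (rule hess_compose_real[OF U r(1), where g="\<lambda>x. ln (- x)"]) (use dl dl' r(2) rz in auto)
  have vl: "vec10 Y (cplx ?l) z = of_real (1 / r z) * vec10 Y (cplx r) z"
    by (rule vec10_compose_real[OF rd dl[OF rz]])
  have vg: "vec10 Y (cplx ?g) z = of_real 1 * vec10 Y (cplx ?l) z + of_real 1 * vec10 Y (cplx \<psi>) z"
    by (rule vec10_lincomb[OF Ck_on_2_diff[OF l2 U(2)] Ck_on_2_diff[OF psi U(2)]])
  have hg: "hess ?g z Y = 1 * hess ?l z Y + 1 * hess \<psi> z Y"
    by (rule hess_lincomb[OF U l2 psi])
  have he: "hess (\<lambda>z. - exp (\<tau> * ?g z)) z Y = (- \<tau> * exp (\<tau> * ?g z)) * hess ?g z Y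
      + (- \<tau>\<^sup>2 * exp (\<tau> * ?g z)) * (cmod (vec10 Y (cplx ?g) z))\<^sup>2"
    by (rule hess_compose_real[OF U g2, where g="\<lambda>x. - exp (\<tau> * x)" and g'="\<lambda>x. - \<tau> * exp (\<tau> * x)"])
      (auto intro!: derivative_eq_intros simp: power2_eq_square)
  have neg: "vec10 Y (cplx r) z / of_real (- r z) - vec10 Y (cplx \<psi>) z = - vec10 Y (cplx ?g) z"
    unfolding vg vl by (simp add: field_simps)
  have n1: "(cmod (vec10 Y (cplx r) z / of_real (- r z)))\<^sup>2 = 1 / (r z)\<^sup>2 * (cmod (vec10 Y (cplx r) z))\<^sup>2"
    by (simp add: norm_divide power_divide)
  have "hess (\<lambda>z. - exp (\<tau> * ?g z)) z Y = \<tau> * exp (\<tau> * ?g z) * (- hess ?g z Y - \<tau> * (cmod (vec10 Y (cplx ?g) z))\<^sup>2)"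
    unfolding he by (simp add: power2_eq_square algebra_simps)
  then show ?thesis unfolding neg n1 norm_minus_cancel hg hl using rz by simp
qed

lemma dd_dd_diff_scaleR:
  fixes f :: "'a::euclidean_space \<Rightarrow> real"
  assumes "open U" "p \<in> U" "Ck_on 2 U f"
  shows "dd (w - b *\<^sub>R n) (dd (v - a *\<^sub>R n) f) p
    = dd w (dd v f) p - b * dd n (dd v f) p - a * dd w (dd n f) p + a * b * dd n (dd n f) p"
proof -
  have d: "dd u f differentiable (at p)" for u by (rule Ck_on_1_diff[OF Ck_on_2_dd[OF assms(3)] assms(2)])
  have e: "dd u (dd (v - a *\<^sub>R n) f) p = dd u (dd v f) p - a * dd u (dd n f) p" for u
    unfolding dd_commute[OF assms, of u] by (simp add: dd_diff dd_scaleR d)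
  show ?thesis by (simp add: dd_diff dd_scaleR d e algebra_simps)
qed

lemma dd_dd_square_add:
  fixes f :: "'a::euclidean_space \<Rightarrow> real"
  assumes "open U" "p \<in> U" "Ck_on 2 U f"
  shows "dd (v + w) (dd (v + w) f) p = dd v (dd v f) p + 2 * dd w (dd v f) p + dd w (dd w f) p"
proof -
  have d: "dd u f differentiable (at p)" for u by (rule Ck_on_1_diff[OF Ck_on_2_dd[OF assms(3)] assms(2)])
  have "dd u (dd (v + w) f) p = dd u (dd v f) p + dd u (dd w f) p" for u
    unfolding dd_commute[OF assms, of u] by (simp add: dd_add d)
  then show ?thesis using dd_commute[OF assms, of v w] by (simp add: dd_add d algebra_simps)
qed

text \<open>The difference of two values of a quadratic form is linear in the difference of the
  arguments. As that difference is of order t, second derivatives of size \<open>o(1/t)\<close>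
  still give a vanishing contribution.\<close>

lemma dd_dd_square_diff:
  fixes f :: "'a::euclidean_space \<Rightarrow> real"
  assumes "open U" "p \<in> U" "Ck_on 2 U f" "a - b = (- t) *\<^sub>R c"
  shows "dd a (dd a f) p - dd b (dd b f) p = - (t * dd c (dd a f) p) - t * dd c (dd b f) p"
proof -
  have d: "dd u f differentiable (at p)" for u by (rule Ck_on_1_diff[OF Ck_on_2_dd[OF assms(3)] assms(2)])
  have "dd a (dd a f) p - dd b (dd b f) p = dd (a - b) (dd a f) p + (dd a (dd b f) p - dd b (dd b f) p)"
    using dd_commute[OF assms(1-3), of a b] by (simp add: dd_diff d)
  also have "dd a (dd b f) p - dd b (dd b f) p = dd (a - b) (dd b f) p" by (simp add: dd_diff d)
  finally show ?thesis unfolding assms(4) by (simp only: dd_scaleR d) simp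
qed

lemma dd_dd_compose:
  fixes f :: "'b::euclidean_space \<Rightarrow> real" and g :: "'a::euclidean_space \<Rightarrow> 'b"
  assumes "open U" "Ck_on 2 U f" "open V" "x \<in> V" "g ` V \<subseteq> U" "Ck_on 2 V g"
  shows "dd w (dd v (\<lambda>x. f (g x))) x = dd (dd w (dd v g) x) f (g x) + dd (dd w g x) (dd (dd v g x) f) (g x)"
proof -
  have gd: "g differentiable (at q)" if "q \<in> V" for q by (rule Ck_on_2_diff[OF assms(6) that])
  have "dd v (\<lambda>x. f (g x)) q = dd (dd v g q) f (g q)" if "q \<in> V" for q
  proof (rule dd_eqI)
    show "((\<lambda>x. f (g x)) has_derivative (\<lambda>v. dd (dd v g q) f (g q))) (at q)"
      using that assms(5)
      by (intro has_derivative_compose[of g _ q UNIV f] has_derivative_dd gd Ck_on_2_diff[OF assms(2)]) auto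
  qed
  then have "dd w (dd v (\<lambda>x. f (g x))) x = dd w (\<lambda>q. dd (dd v g q) f (g q)) x"
    by (intro dd_cong_open[OF assms(3,4)])
  also have "\<dots> = dd (dd w (dd v g) x) f (g x) + dd (dd w g x) (dd (dd v g x) f) (g x)"
    by (rule dd_eqI[OF has_derivative_dd_compose[OF assms(1-5)]])
      (intro has_derivative_dd gd assms Ck_on_1_diff[OF Ck_on_2_dd[OF assms(6)]])+
  finally show ?thesis .
qed

lemma dd_compose:
  fixes f :: "'b::euclidean_space \<Rightarrow> 'c::real_normed_vector" and g :: "'a::euclidean_space \<Rightarrow> 'b"
  assumes "g differentiable (at q)" "f differentiable (at (g q))"
  shows "dd v (\<lambda>x. f (g x)) q = dd (dd v g q) f (g q)"
  by (rule dd_eqI[OF has_derivative_compose[of g _ q UNIV f, OF has_derivative_dd[OF assms(1)] has_derivative_dd[OF assms(2)]]])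

section \<open>Smooth bounded pseudoconvex domains\<close>

locale smooth_domain =
  fixes \<Omega> :: "(complex ^ 'n) set" and r :: "complex ^ 'n \<Rightarrow> real" and U0 :: "(complex ^ 'n) set"
  assumes open_\<Omega>: "open \<Omega>" and bounded_\<Omega>: "bounded \<Omega>" and open_U0: "open U0" and closure_U0: "closure \<Omega> \<subseteq> U0"
    and smooth_r: "smooth_on U0 r" and \<Omega>_eq: "\<Omega> = {z \<in> U0. r z < 0}"
    and gradient_nz: "\<And>p. p \<in> frontier \<Omega> \<Longrightarrow> gradient r p \<noteq> 0"
    and pseudoconvex: "levi_pseudoconvex (frontier \<Omega>) r"
begin

abbreviation "M \<equiv> frontier \<Omega>"
definition "U = {q \<in> U0. gradient r q \<noteq> 0}"

lemma C_r: "Ck_on k U0 r" using smooth_r by (simp add: smooth_on_def)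

lemma open_U: "open U"
proof -
  have "Ck_on 0 U0 (gradient r)" by (rule Ck_on_gradient[OF open_U0 C_r])
  then have "open (U0 \<inter> gradient r -` (- {0}))"
    by (intro continuous_open_preimage) (use open_U0 in auto)
  then show ?thesis by (simp add: U_def Int_def)
qed

lemma U_U0: "U \<subseteq> U0" by (auto simp: U_def)

lemma r3: "Ck_on 3 U r" by (rule Ck_on_subset[OF C_r U_U0])
lemma r2: "Ck_on 2 U r" by (rule Ck_on_3_2[OF r3])
lemma r1: "Ck_on 1 U r" by (rule Ck_on_2_1[OF r2])

lemma U_gradient: "q \<in> U \<Longrightarrow> gradient r q \<noteq> 0" by (simp add: U_def)

lemma rd: "q \<in> U \<Longrightarrow> r differentiable (at q)" by (rule Ck_on_2_diff[OF r2])

lemma nu2: "Ck_on 2 U (nrm r)" by (rule nrm_C2[OF open_U r3 U_gradient])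

lemma nu_diff: "q \<in> U \<Longrightarrow> nrm r differentiable (at q)" by (rule Ck_on_2_diff[OF nu2])

lemma nu_term: "q \<in> U \<Longrightarrow>
    nrm_term r q X = dd (nrm r q) (\<lambda>q. hess r q X) q / 2 + Re (Hess r q (dC_nrm r q X) X)"
  by (rule nrm_term_eq[OF open_U r3 U_gradient])

lemma M_sub: "M \<subseteq> U" "M \<subseteq> U0" "M \<subseteq> closure \<Omega>"
  using closure_U0 gradient_nz by (auto simp: U_def frontier_def)

lemma compact_M: "compact M"
  using bounded_\<Omega> by (simp add: compact_frontier_bounded)

lemma M_not_\<Omega>: "p \<in> M \<Longrightarrow> p \<notin> \<Omega>"
  using open_\<Omega> by (simp add: frontier_def interior_open)

lemma r_le: "p \<in> closure \<Omega> \<Longrightarrow> r p \<le> 0"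
  by (rule continuous_le_on_closure[of \<Omega> r p 0])
    (use \<Omega>_eq continuous_on_subset[OF Ck_on_imp_continuous_on[OF C_r[of 0]] closure_U0] in auto)

lemma r_M: "p \<in> M \<Longrightarrow> r p = 0"
proof -
  assume p: "p \<in> M"
  then have "r p \<le> 0" using r_le M_sub(3) by blast
  moreover have "\<not> r p < 0" using M_not_\<Omega>[OF p] M_sub(2) p \<Omega>_eq by blast
  ultimately show ?thesis by simp
qed

lemma closure_r0_M: "p \<in> closure \<Omega> \<Longrightarrow> r p = 0 \<Longrightarrow> p \<in> M"
  using \<Omega>_eq open_\<Omega> by (simp add: frontier_def interior_open)

lemma dd_nu: "q \<in> U \<Longrightarrow> dd (nrm r q) r q = 2" "q \<in> U \<Longrightarrow> dd (J (nrm r q)) r q = 0"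
  using dd_nrm[OF rd U_gradient] by auto

lemma vec10_nu: "q \<in> U \<Longrightarrow> vec10 (nrm r q) (cplx r) q = 1"
  using vec10_nrm[OF rd U_gradient] by auto

lemma tangent_iff: "q \<in> U \<Longrightarrow> X \<in> tangent10 r q \<longleftrightarrow> dd X r q = 0 \<and> dd (J X) r q = 0"
  by (rule tangent10_iff[OF rd])

lemma hess_nonneg: "p \<in> M \<Longrightarrow> X \<in> tangent10 r p \<Longrightarrow> 0 \<le> hess r p X"
  using pseudoconvex Hess_self[OF open_U _ r2, of p X] M_sub(1)
  unfolding levi_pseudoconvex_def by fastforce

text \<open>Tilting v slightly along the normal, in either sense, makes r grow or fall to first
  order, so one of the two tilted points lies outside \<Omega> and the other inside. The segment
  between them meets \<open>M\<close>; this takes the place of a chart.\<close>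

lemma approach_tangent:
  assumes p: "p \<in> M" and v: "dd v r p = 0" and e: "e > 0"
  shows "\<exists>t b. 0 < t \<and> t < e \<and> norm (b - v) \<le> e \<and> p + t *\<^sub>R b \<in> M"
proof -
  have pU: "p \<in> U" using p M_sub by blast
  define N where "N = nrm r p"
  \<comment> \<open>Keeps the tilt \<open>s * norm N\<close> below e; the summand 1 makes the
    quotient meaningful for every N.\<close>
  define s where "s = e / (norm N + 1)"
  have s: "s > 0" "s * norm N \<le> e"
    using e by (auto simp: s_def field_simps add_pos_nonneg)
  have dif: "r differentiable (at p)" by (rule rd[OF pU])
  have lim: "((\<lambda>t. (r (p + t *\<^sub>R (v + c *\<^sub>R N)) - r p) / t) \<longlongrightarrow> 2 * c) (at_right 0)" for c
  proof -
    have "((\<lambda>t. (r (p + t *\<^sub>R (v + c *\<^sub>R N)) - r p) / t) \<longlongrightarrow> dd (v + c *\<^sub>R N) r p) (at_right 0)"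
      by (rule strict_derivative_tendsto[OF open_U pU r1]) (auto simp: eventually_at_filter tendsto_ident_at)
    moreover have "dd (v + c *\<^sub>R N) r p = 2 * c"
      using dd_nu[OF pU] v by (simp add: dd_add dd_scaleR dif N_def)
    ultimately show ?thesis by simp
  qed
  have ev1: "\<forall>\<^sub>F t in at_right 0. (r (p + t *\<^sub>R (v + s *\<^sub>R N)) - r p) / t > 0"
    by (rule order_tendstoD(1)[OF lim]) (use s in simp)
  have ev2: "\<forall>\<^sub>F t in at_right 0. (r (p + t *\<^sub>R (v + (- s) *\<^sub>R N)) - r p) / t < 0"
    by (rule order_tendstoD(2)[OF lim]) (use s in simp)
  have ev3: "\<forall>\<^sub>F t in at_right 0. p + t *\<^sub>R (v + c *\<^sub>R N) \<in> U0" for c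
  proof -
    have "((\<lambda>t. p + t *\<^sub>R (v + c *\<^sub>R N)) \<longlongrightarrow> p) (at_right 0)"
      by (rule tendsto_line) (auto simp: tendsto_ident_at)
    then show ?thesis using topological_tendstoD open_U0 U_U0 pU by blast
  qed
  have "\<forall>\<^sub>F t in at_right (0::real). 0 < t \<and> t < e"
    using eventually_at_right_real[OF e] by (auto elim: eventually_mono)
  then have "\<forall>\<^sub>F t in at_right 0. 0 < t \<and> t < e \<and> (r (p + t *\<^sub>R (v + s *\<^sub>R N)) - r p) / t > 0 \<and>
     (r (p + t *\<^sub>R (v + (- s) *\<^sub>R N)) - r p) / t < 0 \<and> p + t *\<^sub>R (v + s *\<^sub>R N) \<in> U0 \<and> p + t *\<^sub>R (v + (- s) *\<^sub>R N) \<in> U0"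
    using ev1 ev2 ev3[of s] ev3[of "- s"] by eventually_elim auto
  then obtain t where t: "0 < t" "t < e" "(r (p + t *\<^sub>R (v + s *\<^sub>R N)) - r p) / t > 0"
     "(r (p + t *\<^sub>R (v + (- s) *\<^sub>R N)) - r p) / t < 0" "p + t *\<^sub>R (v + s *\<^sub>R N) \<in> U0" "p + t *\<^sub>R (v + (- s) *\<^sub>R N) \<in> U0"
    using eventually_happens'[OF trivial_limit_at_right_real] by blast
  define x y where "x = p + t *\<^sub>R (v + (- s) *\<^sub>R N)" and "y = p + t *\<^sub>R (v + s *\<^sub>R N)"
  have "x \<in> \<Omega>" "y \<notin> \<Omega>"
    using t r_M[OF p] \<Omega>_eq by (auto simp: x_def y_def zero_less_divide_iff divide_less_0_iff)
  then have "closed_segment x y \<inter> M \<noteq> {}"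
    by (intro connected_Int_frontier connected_segment) auto
  then obtain u where u: "0 \<le> u" "u \<le> 1" "(1 - u) *\<^sub>R x + u *\<^sub>R y \<in> M"
    unfolding closed_segment_def by auto
  define b where "b = v + ((2 * u - 1) * s) *\<^sub>R N"
  have "(1 - u) *\<^sub>R x + u *\<^sub>R y = p + t *\<^sub>R b"
    by (simp add: x_def y_def b_def vec_eq_iff scaleR_conv_of_real algebra_simps)
  moreover have "norm (b - v) \<le> e"
  proof -
    have "norm (b - v) = \<bar>2 * u - 1\<bar> * (s * norm N)" using s by (simp add: b_def abs_mult)
    also have "\<dots> \<le> 1 * (s * norm N)" using u s by (intro mult_right_mono) auto
    finally show ?thesis using s by simp
  qed
  ultimately show ?thesis using t u by metis
qed

lemma tangent_sequence:
  assumes p: "p \<in> M" and v: "dd v r p = 0"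
  obtains t b where "t \<longlonglongrightarrow> (0::real)" "\<And>n. t n > 0" "b \<longlonglongrightarrow> v" "\<And>n. p + t n *\<^sub>R b n \<in> M"
proof -
  have "\<forall>n. \<exists>t b. 0 < t \<and> t < 1 / Suc n \<and> norm (b - v) \<le> 1 / Suc n \<and> p + t *\<^sub>R b \<in> M"
    using approach_tangent[OF p v] by simp
  then obtain t b where tb: "\<And>n. 0 < t n \<and> t n < 1 / Suc n \<and> norm (b n - v) \<le> 1 / Suc n \<and> p + t n *\<^sub>R b n \<in> M"
    by metis
  have z: "(\<lambda>n. 1 / real (Suc n)) \<longlonglongrightarrow> 0" using LIMSEQ_inverse_real_of_nat by (simp add: inverse_eq_divide)
  show ?thesis
  proof (rule that)
    have "norm (t n) \<le> 1 / real (Suc n)" for n using tb[of n] by simp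
    then show "t \<longlonglongrightarrow> 0" by (intro Lim_null_comparison[OF _ z]) simp
    have "(\<lambda>n. b n - v) \<longlonglongrightarrow> 0" by (rule Lim_null_comparison[OF _ z]) (use tb in \<open>auto intro!: always_eventually\<close>)
    then show "b \<longlonglongrightarrow> v" by (rule LIM_zero_cancel)
  qed (use tb in auto)
qed

section \<open>Functions that vanish on the hypersurface\<close>

context
  fixes W and k :: "complex ^ 'n \<Rightarrow> real" and p
  assumes W: "open W" "p \<in> W" "p \<in> M" and k2: "Ck_on 2 W k" and k0: "\<And>q. q \<in> W \<inter> M \<Longrightarrow> k q = 0"
begin

lemma vanishing_dd:
  assumes "dd v r p = 0"
  shows "dd v k p = 0"
proof -
  obtain t b where tb: "t \<longlonglongrightarrow> (0::real)" "\<And>n. t n > 0" "b \<longlonglongrightarrow> v" "\<And>n. p + t n *\<^sub>R b n \<in> M"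
    using tangent_sequence[OF W(3) assms] by metis
  have "(\<lambda>n. (k (p + t n *\<^sub>R b n) - k p) / t n) \<longlonglongrightarrow> dd v k p"
    by (rule strict_derivative_tendsto[OF W(1,2) Ck_on_2_1[OF k2] tendsto_const tb(3,1)])
      (use tb(2) less_imp_neq in \<open>auto intro!: always_eventually simp: less_imp_neq[symmetric]\<close>)
  moreover have "\<forall>\<^sub>F n in sequentially. p + t n *\<^sub>R b n \<in> W"
    using topological_tendstoD[OF tendsto_line[OF tendsto_const tb(3,1)] W(1,2)] .
  then have "\<forall>\<^sub>F n in sequentially. (k (p + t n *\<^sub>R b n) - k p) / t n = 0"
    by eventually_elim (use k0 W tb(4) in auto)
  ultimately have "(\<lambda>n. 0) \<longlonglongrightarrow> dd v k p" by (rule Lim_transform_eventually)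
  then show ?thesis by (simp add: LIMSEQ_const_iff)
qed

lemma vanishing_normal: "dd v k p = dd (nrm r p) k p / 2 * dd v r p"
proof -
  have pU: "p \<in> U" using W M_sub by blast
  have kd: "k differentiable (at p)" by (rule Ck_on_2_diff[OF k2 W(2)])
  define v0 where "v0 = v - (dd v r p / 2) *\<^sub>R nrm r p"
  have "dd v0 r p = 0" using dd_nu[OF pU] by (simp add: v0_def dd_diff dd_scaleR rd[OF pU])
  then have "dd v0 k p = 0" by (rule vanishing_dd)
  then show ?thesis by (simp add: v0_def dd_diff dd_scaleR kd)
qed

text \<open>At points \<open>p + t n *\<^sub>R b n\<close> of \<open>M\<close> both k and its
  first-order part vanish, so the second-order Taylor quotient is identically 0.\<close>

lemma vanishing_dd_dd:
  assumes "\<And>v. dd v k p = 0" "dd v r p = 0"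
  shows "dd v (dd v k) p = 0"
proof -
  obtain t b where tb: "t \<longlonglongrightarrow> (0::real)" "\<And>n. t n > 0" "b \<longlonglongrightarrow> v" "\<And>n. p + t n *\<^sub>R b n \<in> M"
    using tangent_sequence[OF W(3) assms(2)] by metis
  have "(\<lambda>n. (k (p + t n *\<^sub>R b n) - k p - t n * dd (b n) k p) / (t n)\<^sup>2) \<longlonglongrightarrow> dd v (dd v k) p / 2"
    by (rule taylor2_tendsto[OF W(1,2) k2 tendsto_const tb(3,1)])
      (use tb(2) in \<open>auto intro!: always_eventually simp: less_imp_neq[symmetric]\<close>)
  moreover have "\<forall>\<^sub>F n in sequentially. p + t n *\<^sub>R b n \<in> W"
    using topological_tendstoD[OF tendsto_line[OF tendsto_const tb(3,1)] W(1,2)] .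
  then have "\<forall>\<^sub>F n in sequentially. (k (p + t n *\<^sub>R b n) - k p - t n * dd (b n) k p) / (t n)\<^sup>2 = 0"
    by eventually_elim (use k0 W tb(4) assms in auto)
  ultimately have "(\<lambda>n. 0) \<longlonglongrightarrow> dd v (dd v k) p / 2" by (rule Lim_transform_eventually)
  then show ?thesis by (simp add: LIMSEQ_const_iff)
qed

end

text \<open>Subtracting \<open>c * r\<close>, with c the ratio of the normal derivatives, removes
  the first derivative at p without changing the values on \<open>M\<close>. The right-hand side
  reflects the curvature of \<open>M\<close>: a tangent line leaves \<open>M\<close> to second
  order.\<close>

lemma vanishing_second_order:
  assumes W: "open W" "p \<in> W" "p \<in> M" and k2: "Ck_on 2 W k" and k0: "\<And>q. q \<in> W \<inter> M \<Longrightarrow> k q = 0"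
    and v: "dd v r p = 0"
  shows "dd v (dd v k) p = dd (nrm r p) k p / 2 * dd v (dd v r) p"
proof -
  define c where "c = dd (nrm r p) k p / 2"
  have pW: "p \<in> W \<inter> U" "open (W \<inter> U)" using W M_sub open_U by auto
  have C: "Ck_on 2 (W \<inter> U) k" "Ck_on 2 (W \<inter> U) r" using Ck_on_subset k2 r2 by blast+
  let ?k = "\<lambda>q. 1 * k q + (- c) * r q"
  have d: "dd w ?k p = 0" for w
    using vanishing_normal[OF W k2 k0, of w] Ck_on_2_diff[OF C(1)] Ck_on_2_diff[OF C(2)] pW
    unfolding c_def by (subst dd_lincomb) auto
  have "dd v (dd v ?k) p = 0"
    by (rule vanishing_dd_dd[OF pW(2,1) W(3) Ck_on_lincomb[OF pW(2) C] _ d v]) (use k0 r_M in auto)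
  then show ?thesis unfolding dd_dd_lincomb[OF pW(2,1) C] c_def by simp
qed

text \<open>The difference of two extensions vanishes on \<open>M\<close>, so its Hessian at a
  tangent X is a multiple of \<open>hess r p X\<close>, and this is 0 for null vectors. Hence one
  may pass freely between extensions in the form.\<close>

lemma extension_independent:
  assumes W: "open W" "p \<in> W" "p \<in> M" and F: "Ck_on 2 W F" and G: "Ck_on 2 W G"
    and eq: "\<And>q. q \<in> W \<inter> M \<Longrightarrow> F q = G q" and X: "X \<in> tangent10 r p" "hess r p X = 0"
  shows "vec01 X (cplx F) p = vec01 X (cplx G) p" "hess F p X = hess G p X"
proof -
  have pU: "p \<in> U" using W M_sub by blast
  have t: "dd X r p = 0" "dd (J X) r p = 0" using X(1) tangent_iff[OF pU] by auto
  let ?k = "\<lambda>q. 1 * F q + (- 1) * G q"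
  have k2: "Ck_on 2 W ?k" by (rule Ck_on_lincomb[OF W(1) F G])
  have k0: "?k q = 0" if "q \<in> W \<inter> M" for q using eq[OF that] by simp
  have d: "F differentiable (at p)" "G differentiable (at p)"
    using Ck_on_2_diff[OF F W(2)] Ck_on_2_diff[OF G W(2)] .
  have "dd v F p = dd v G p" if "dd v r p = 0" for v
    using vanishing_dd[OF W k2 k0 that] unfolding dd_lincomb[OF d] by simp
  then have "dd X F p = dd X G p" "dd (J X) F p = dd (J X) G p"
    using t by auto
  then show "vec01 X (cplx F) p = vec01 X (cplx G) p" by (simp add: vec01_cplx d)
  have "dd v (dd v ?k) p = dd (nrm r p) ?k p / 2 * dd v (dd v r) p" if "dd v r p = 0" for v
    by (rule vanishing_second_order[OF W k2 k0 that])
  from this[OF t(1)] this[OF t(2)] have "hess ?k p X = dd (nrm r p) ?k p / 2 * hess r p X"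
    unfolding hess_def by (simp only: add_divide_distrib distrib_left times_divide_eq_right)
  then show "hess F p X = hess G p X"
    using X(2) unfolding hess_lincomb[OF W(1,2) F G] by simp
qed

text \<open>The left-hand side of the inequality defining the exponents of \<open>M\<close>, divided by
  \<open>(\<parallel>\<nabla>r\<parallel> / 2)\<^sup>2\<close>.\<close>

definition DF_form :: "real \<Rightarrow> (complex ^ 'n \<Rightarrow> real) \<Rightarrow> complex ^ 'n \<Rightarrow> complex ^ 'n \<Rightarrow> real" where
  "DF_form \<eta> f p X = \<eta> / (1 - \<eta>) * (cmod (vec01 X (cplx f) p + Hess r p (nrm r p) X))\<^sup>2 + hess f p X + nrm_term r p X"

lemma DF_inequality_DF_form:
  assumes "p \<in> M" "0 < \<eta>" "\<eta> < 1" "open W" "p \<in> W" "Ck_on 2 W \<psi>"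
  shows "DF_inequality_at r \<psi> \<eta> p X \<longleftrightarrow> DF_form \<eta> \<psi> p X \<le> 0"
  unfolding DF_form_def
  by (rule DF_inequality_iff[OF open_U r3 U_gradient _ assms(2-6)]) (use assms M_sub in auto)

text \<open>Obtained by differentiating the identities \<open>dd_nu\<close>: what X does to the
  normal is compensated by second derivatives of r. The \<open>Complex\<close> term is the
  derivative of \<open>vec10 X (cplx r)\<close> in the real direction \<open>nrm r p\<close>, which
  combines a (1,0) and a (0,1) derivative; the \<open>Hess\<close> term takes the latter out
  again.\<close>

lemma vec10_dC_nrm:
  assumes p: "p \<in> U"
  shows "vec10 (dC_nrm r p X) (cplx r) p = Hess r p X (nrm r p)
     - Complex (dd (nrm r p) (dd X r) p / 2) (- dd (nrm r p) (dd (J X) r) p / 2)"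
proof -
  let ?N = "nrm r p"
  have dif: "r differentiable (at p)" by (rule rd[OF p])
  have Nd: "nrm r differentiable (at p)" by (rule nu_diff[OF p])
  have JNd: "((\<lambda>w. J (nrm r w)) has_derivative (\<lambda>v. J (dd v (nrm r) p))) (at p)"
    by (rule bounded_linear.has_derivative[OF bounded_linear_J has_derivative_dd[OF Nd]])
  have 1: "dd (dd v (nrm r) p) r p = - dd v (dd ?N r) p" for v
  proof -
    have "((\<lambda>q. dd (nrm r q) r q) has_derivative (\<lambda>v. dd (dd v (nrm r) p) r p + dd v (dd ?N r) p)) (at p)"
      by (rule has_derivative_dd_compose[OF open_U r2 open_U p _ has_derivative_dd[OF Nd] has_derivative_ident]) auto
    from dd_eqI[OF this] have "dd v (\<lambda>q. dd (nrm r q) r q) p = dd (dd v (nrm r) p) r p + dd v (dd ?N r) p" .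
    moreover have "dd v (\<lambda>q. dd (nrm r q) r q) p = dd v (\<lambda>q. 2) p"
      by (rule dd_cong_open[OF open_U p]) (rule dd_nu)
    ultimately show ?thesis by (simp add: dd_def)
  qed
  have 2: "dd (J (dd v (nrm r) p)) r p = - dd v (dd (J ?N) r) p" for v
  proof -
    have "((\<lambda>q. dd (J (nrm r q)) r q) has_derivative (\<lambda>v. dd (J (dd v (nrm r) p)) r p + dd v (dd (J ?N) r) p)) (at p)"
      by (rule has_derivative_dd_compose[OF open_U r2 open_U p _ JNd has_derivative_ident]) auto
    from dd_eqI[OF this] have "dd v (\<lambda>q. dd (J (nrm r q)) r q) p = dd (J (dd v (nrm r) p)) r p + dd v (dd (J ?N) r) p" .
    moreover have "dd v (\<lambda>q. dd (J (nrm r q)) r q) p = dd v (\<lambda>q. 0) p"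
      by (rule dd_cong_open[OF open_U p]) (rule dd_nu)
    ultimately show ?thesis by (simp add: dd_def)
  qed
  note comm = dd_commute[OF open_U p r2]
  show ?thesis
    unfolding vec10_cplx[OF dif] Hess_eq[OF open_U p r2] dC_nrm_def J_scaleR J_diff J_J dd_scaleR[OF dif] dd_diff[OF dif]
      dd_minus[OF dif] 1 2
    using comm[of X ?N] comm[of "J X" ?N] comm[of "J X" "J ?N"] comm[of X "J ?N"]
    by (simp add: complex_eq_iff field_simps)
qed

section \<open>Continuity and homogeneity of the forms\<close>

lemma dC_nrm_tendsto:
  assumes "p \<in> U" "(a \<longlongrightarrow> p) F" "(X \<longlongrightarrow> X0) F"
  shows "((\<lambda>n. dC_nrm r (a n) (X n)) \<longlongrightarrow> dC_nrm r p X0) F"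
  unfolding dC_nrm_def
  by (intro tendsto_intros bounded_linear.tendsto[OF bounded_linear_J] dd_tendsto[OF open_U assms(1) Ck_on_2_1[OF nu2]] assms)

lemma nu_tendsto:
  assumes "p \<in> U" "(a \<longlongrightarrow> p) F"
  shows "((\<lambda>n. nrm r (a n)) \<longlongrightarrow> nrm r p) F"
  using Ck_on_imp_continuous_on[OF nu2] assms open_U continuous_on_eq_continuous_at isCont_tendsto_compose by blast

lemma dC_nrm_scaleR: "p \<in> U \<Longrightarrow> dC_nrm r p (c *\<^sub>R X) = c *\<^sub>R dC_nrm r p X"
  by (simp add: dC_nrm_def J_scaleR dd_scaleR nu_diff scaleR_right_diff_distrib)

lemma dd_hess_eq:
  assumes p: "p \<in> U"
  shows "dd v (\<lambda>q. hess r q X) p = (dd v (dd X (dd X r)) p + dd v (dd (J X) (dd (J X) r)) p) / 4"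
    "(\<lambda>q. hess r q X) differentiable (at p)"
proof -
  have dif: "dd u (dd u' r) differentiable at p" for u u'
    by (rule Ck_on_1_diff[OF Ck_on_2_dd[OF Ck_on_3_dd[OF r3]] p])
  have d: "((\<lambda>q. hess r q X) has_derivative (\<lambda>v. (dd v (dd X (dd X r)) p + dd v (dd (J X) (dd (J X) r)) p) / 4)) (at p)"
    unfolding hess_def
    by (intro bounded_linear.has_derivative[OF bounded_linear_divide] has_derivative_add has_derivative_dd dif)
  show "dd v (\<lambda>q. hess r q X) p = (dd v (dd X (dd X r)) p + dd v (dd (J X) (dd (J X) r)) p) / 4"
    by (rule dd_eqI[OF d])
  show "(\<lambda>q. hess r q X) differentiable (at p)" using d differentiable_def by blast
qed

lemma dd_hess_tendsto:
  assumes p: "p \<in> U" and "(a \<longlongrightarrow> p) F" "(v \<longlongrightarrow> v0) F" "(X \<longlongrightarrow> X0) F"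
  shows "((\<lambda>n. dd (v n) (\<lambda>q. hess r q (X n)) (a n)) \<longlongrightarrow> dd v0 (\<lambda>q. hess r q X0) p) F"
proof -
  have ev: "\<forall>\<^sub>F n in F. a n \<in> U" using topological_tendstoD[OF assms(2) open_U p] .
  have T: "((\<lambda>n. dd (v n) (dd (Y n) (dd (Y n) r)) (a n)) \<longlongrightarrow> dd v0 (dd Y0 (dd Y0 r)) p) F"
    if Y: "(Y \<longlongrightarrow> Y0) F" for Y Y0
  proof -
    have "((\<lambda>n. \<Sum>e\<in>Basis. (Y n \<bullet> e) * dd (v n) (dd (Y n) (dd e r)) (a n)) \<longlongrightarrow>
       (\<Sum>e\<in>Basis. (Y0 \<bullet> e) * dd v0 (dd Y0 (dd e r)) p)) F"
      by (intro tendsto_intros dd_dd_tendsto[OF open_U p Ck_on_3_dd[OF r3]] assms Y)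
    moreover have "\<forall>\<^sub>F n in F. (\<Sum>e\<in>Basis. (Y n \<bullet> e) * dd (v n) (dd (Y n) (dd e r)) (a n))
       = dd (v n) (dd (Y n) (dd (Y n) r)) (a n)"
      using ev by eventually_elim (rule dd_dd_dd_Basis[OF open_U _ r3, symmetric])
    ultimately show ?thesis
      unfolding dd_dd_dd_Basis[OF open_U p r3, of v0 Y0 Y0] by (rule Lim_transform_eventually)
  qed
  have "((\<lambda>n. (dd (v n) (dd (X n) (dd (X n) r)) (a n) + dd (v n) (dd (J (X n)) (dd (J (X n)) r)) (a n)) / 4)
     \<longlongrightarrow> dd v0 (\<lambda>q. hess r q X0) p) F"
    unfolding dd_hess_eq(1)[OF p]
    by (intro tendsto_intros T assms bounded_linear.tendsto[OF bounded_linear_J]) auto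
  moreover have "\<forall>\<^sub>F n in F. (dd (v n) (dd (X n) (dd (X n) r)) (a n) + dd (v n) (dd (J (X n)) (dd (J (X n)) r)) (a n)) / 4
     = dd (v n) (\<lambda>q. hess r q (X n)) (a n)"
    using ev by eventually_elim (simp add: dd_hess_eq)
  ultimately show ?thesis by (rule Lim_transform_eventually)
qed

lemma nrm_term_tendsto:
  assumes p: "p \<in> U" and "(a \<longlongrightarrow> p) F" "(X \<longlongrightarrow> X0) F"
  shows "((\<lambda>n. nrm_term r (a n) (X n)) \<longlongrightarrow> nrm_term r p X0) F"
proof -
  have ev: "\<forall>\<^sub>F n in F. a n \<in> U" using topological_tendstoD[OF assms(2) open_U p] .
  have "((\<lambda>n. dd (nrm r (a n)) (\<lambda>q. hess r q (X n)) (a n) / 2 + Re (Hess r (a n) (dC_nrm r (a n) (X n)) (X n)))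
     \<longlongrightarrow> nrm_term r p X0) F"
    unfolding nu_term[OF p]
    by (intro tendsto_intros dd_hess_tendsto[OF p] nu_tendsto[OF p] Hess_tendsto[OF open_U p r2] dC_nrm_tendsto[OF p] assms) auto
  moreover have "\<forall>\<^sub>F n in F. dd (nrm r (a n)) (\<lambda>q. hess r q (X n)) (a n) / 2 + Re (Hess r (a n) (dC_nrm r (a n) (X n)) (X n))
     = nrm_term r (a n) (X n)"
    using ev by eventually_elim (simp add: nu_term)
  ultimately show ?thesis by (rule Lim_transform_eventually)
qed

lemma DF_form_scaleR:
  assumes p: "p \<in> U" and f: "open W" "p \<in> W" "Ck_on 2 W f"
  shows "DF_form \<eta> f p (c *\<^sub>R X) = c\<^sup>2 * DF_form \<eta> f p X"
proof -
  have v: "vec01 (c *\<^sub>R X) (cplx f) p = of_real c * vec01 X (cplx f) p"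
    by (simp add: vec01_vec10[OF Ck_on_2_diff[OF f(3,2)]] vec10_scaleR)
  have H: "Hess r p (nrm r p) (c *\<^sub>R X) = of_real c * Hess r p (nrm r p) X"
    using Hess_smult_right[of r p _ "of_real c" X] by (simp add: vector_smult_eq)
  have sc: "dd v (\<lambda>q. hess r q (c *\<^sub>R X)) p = c\<^sup>2 * dd v (\<lambda>q. hess r q X) p" for v
  proof -
    have "dd v (\<lambda>q. hess r q (c *\<^sub>R X)) p = dd v (\<lambda>q. c\<^sup>2 * hess r q X) p"
      by (rule dd_cong_open[OF open_U p]) (rule hess_scaleR[OF open_U _ r2])
    also have "\<dots> = c\<^sup>2 * dd v (\<lambda>q. hess r q X) p"
      by (rule dd_eqI[OF has_derivative_mult_right[OF has_derivative_dd[OF dd_hess_eq(2)[OF p]]]])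
    finally show ?thesis .
  qed
  have N: "nrm_term r p (c *\<^sub>R X) = c\<^sup>2 * nrm_term r p X"
    using Hess_smult_right[of r p "dC_nrm r p X" "of_real c" X]
    by (simp add: nu_term[OF p] sc dC_nrm_scaleR[OF p] Hess_scaleR_left vector_smult_eq power2_eq_square algebra_simps)
  show ?thesis
    unfolding DF_form_def v H N hess_scaleR[OF f] distrib_left[symmetric] norm_mult
    by (simp add: power_mult_distrib algebra_simps)
qed

end

text \<open>A strict drop of the weight from t to s leaves room for a perturbation b; after the
  triangle inequality the gap is a perfect square divided by \<open>t - s\<close>. As
  \<open>\<eta> / (1 - \<eta>)\<close> increases with \<eta>, this is how lowering the exponent
  absorbs errors.\<close>

lemma weighted_square_bound:
  fixes a b :: complex
  assumes "0 \<le> s" "s < t"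
  shows "s * (cmod (a + b))\<^sup>2 \<le> t * (cmod a)\<^sup>2 + s * t / (t - s) * (cmod b)\<^sup>2"
proof -
  let ?x = "cmod a" and ?y = "cmod b"
  have "(cmod (a + b))\<^sup>2 \<le> (?x + ?y)\<^sup>2" by (intro power_mono norm_triangle_ineq) auto
  then have "s * (cmod (a + b))\<^sup>2 \<le> s * (?x + ?y)\<^sup>2" using assms by (intro mult_left_mono) auto
  moreover have "t * ?x\<^sup>2 + s * t / (t - s) * ?y\<^sup>2 - s * (?x + ?y)\<^sup>2 = ((t - s) * ?x - s * ?y)\<^sup>2 / (t - s)"
    using assms by (simp add: field_simps power2_eq_square)
  moreover have "((t - s) * ?x - s * ?y)\<^sup>2 / (t - s) \<ge> 0" using assms by simp
  ultimately show ?thesis by linarith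
qed

text \<open>Subtracting \<open>\<kappa> |z|\<^sup>2\<close> from \<psi> gains an amount linear in
  \<kappa> in the Hessian and costs an amount quadratic in \<kappa> in the square; here the cost is
  kept below a quarter of the gain.\<close>

lemma exists_small_perturbation:
  fixes C B :: real
  assumes "0 \<le> C"
  obtains \<kappa> where "\<kappa> > 0" "C * (\<kappa> * B)\<^sup>2 \<le> \<kappa> / 4"
proof -
  define \<kappa> where "\<kappa> = 1 / (4 * (C * B\<^sup>2 + 1))"
  have CB: "0 \<le> C * B\<^sup>2" using assms by simp
  have "\<kappa> > 0" unfolding \<kappa>_def using CB by (intro divide_pos_pos mult_pos_pos) auto
  moreover have "C * B\<^sup>2 * \<kappa> \<le> 1 / 4" using CB by (simp add: \<kappa>_def field_simps)
  then have "(C * B\<^sup>2 * \<kappa>) * \<kappa> \<le> 1 / 4 * \<kappa>" using \<open>\<kappa> > 0\<close> by (intro mult_right_mono) auto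
  then have "C * (\<kappa> * B)\<^sup>2 \<le> \<kappa> / 4" by (simp add: power2_eq_square mult_ac)
  ultimately show ?thesis by (rule that)
qed

text \<open>Minimising the quadratic polynomial on the left over \<open>\<omega>\<close>; this is where
  \<open>1 / (1 - \<tau>) - 1\<close> comes from.\<close>

lemma quadratic_minimum:
  fixes H e :: complex
  assumes "\<tau> < 1" and \<omega>: "\<omega> = - cnj (H + of_real \<tau> * e) / of_real (1 - \<tau>)"
  shows "2 * Re (\<omega> * H) + (cmod H)\<^sup>2 + (cmod \<omega>)\<^sup>2 - \<tau> * (cmod (\<omega> - cnj e))\<^sup>2 = - \<tau> / (1 - \<tau>) * (cmod (H + e))\<^sup>2"
proof -
  obtain h1 h2 where H: "H = Complex h1 h2" by (cases H)
  obtain e1 e2 where e: "e = Complex e1 e2" by (cases e)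
  define d where "d = 1 - \<tau>"
  have d: "d > 0" "\<tau> = 1 - d" using assms by (auto simp: d_def)
  define w1 w2 where "w1 = (h1 + \<tau> * e1) / d" and "w2 = (h2 + \<tau> * e2) / d"
  have w: "\<omega> = Complex (- w1) w2"
    unfolding \<omega> d_def[symmetric] by (simp add: complex_eq_iff H e w1_def w2_def Re_divide_of_real Im_divide_of_real add_divide_distrib diff_divide_distrib)
  have h: "h1 = d * w1 - \<tau> * e1" "h2 = d * w2 - \<tau> * e2"
    using d(1) by (auto simp: w1_def w2_def)
  have "2 * Re (\<omega> * H) + (cmod H)\<^sup>2 + (cmod \<omega>)\<^sup>2 - \<tau> * (cmod (\<omega> - cnj e))\<^sup>2
     = 2 * (- w1 * h1 - w2 * h2) + (h1\<^sup>2 + h2\<^sup>2) + (w1\<^sup>2 + w2\<^sup>2) - \<tau> * ((w1 + e1)\<^sup>2 + (w2 + e2)\<^sup>2)"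
    by (simp add: w H e cmod_power2) (simp add: power2_eq_square algebra_simps)
  also have "\<dots> = - \<tau> / d * ((h1 + e1)\<^sup>2 + (h2 + e2)\<^sup>2)"
  proof -
    have "h1 + e1 = d * (w1 + e1)" "h2 + e2 = d * (w2 + e2)" unfolding h d(2) by (simp_all add: algebra_simps)
    then have "- \<tau> / d * ((h1 + e1)\<^sup>2 + (h2 + e2)\<^sup>2) = - \<tau> * d * ((w1 + e1)\<^sup>2 + (w2 + e2)\<^sup>2)"
      using d(1) by (simp add: power_mult_distrib power2_eq_square field_simps)
    then show ?thesis unfolding h d(2) by (simp add: power2_eq_square algebra_simps)
  qed
  finally show ?thesis by (simp add: H e d_def cmod_power2)
qed

context smooth_domain begin

text \<open>The complex Hessian of \<open>-((- r) exp \<psi>)\<^sup>\<tau>\<close>, divided by \<open>\<tau> ((- r) exp \<psi>)\<^sup>\<tau>\<close>.\<close>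

definition log_form :: "real \<Rightarrow> (complex ^ 'n \<Rightarrow> real) \<Rightarrow> complex ^ 'n \<Rightarrow> complex ^ 'n \<Rightarrow> real" where
  "log_form \<tau> \<psi> z Y = hess r z Y / (- r z) + (cmod (vec10 Y (cplx r) z / of_real (- r z)))\<^sup>2 - hess \<psi> z Y
      - \<tau> * (cmod (vec10 Y (cplx r) z / of_real (- r z) - vec10 Y (cplx \<psi>) z))\<^sup>2"

section \<open>Points of \<open>M\<close> shifted into the domain\<close>

context
  fixes pn :: "nat \<Rightarrow> complex ^ 'n" and p tn
  assumes pn: "\<And>n. pn n \<in> M" "pn \<longlonglongrightarrow> p" and tn: "\<And>n. tn n > 0" "tn \<longlonglongrightarrow> (0::real)"
begin

definition "zn n = pn n + tn n *\<^sub>R (- nrm r (pn n))"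

lemma p_M: "p \<in> M"
  using closed_sequentially[OF compact_imp_closed[OF compact_M]] pn by blast

lemma p_U: "p \<in> U" using p_M M_sub by blast

lemma tn_nz: "\<forall>\<^sub>F n in sequentially. tn n \<noteq> 0"
  using tn(1) by (simp add: less_imp_neq[symmetric])

lemma nun: "(\<lambda>n. - nrm r (pn n)) \<longlonglongrightarrow> - nrm r p"
  by (intro tendsto_intros nu_tendsto[OF p_U pn(2)])

lemma zn_lim: "zn \<longlonglongrightarrow> p"
  unfolding zn_def[abs_def] by (rule tendsto_line[OF pn(2) nun tn(2)])

text \<open>The 2 is the derivative of r along \<open>nrm r p\<close>: the depth \<open>- r\<close>
  of a shifted point is asymptotically twice the step.\<close>

lemma r_zn: "(\<lambda>n. r (zn n) / tn n) \<longlonglongrightarrow> - 2"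
proof -
  have "(\<lambda>n. (r (pn n + tn n *\<^sub>R (- nrm r (pn n))) - r (pn n)) / tn n) \<longlonglongrightarrow> dd (- nrm r p) r p"
    by (rule strict_derivative_tendsto[OF open_U p_U r1 pn(2) nun tn(2) tn_nz])
  then show ?thesis
    using dd_nu[OF p_U] by (simp add: zn_def r_M pn dd_minus rd p_U)
qed

lemma zn_in: "open V \<Longrightarrow> p \<in> V \<Longrightarrow> \<forall>\<^sub>F n in sequentially. zn n \<in> V"
  using topological_tendstoD[OF zn_lim] by blast

lemma zn_\<Omega>: "\<forall>\<^sub>F n in sequentially. zn n \<in> \<Omega>"
proof -
  have "\<forall>\<^sub>F n in sequentially. r (zn n) / tn n < 0"
    by (rule order_tendstoD(2)[OF r_zn]) simp
  moreover have "\<forall>\<^sub>F n in sequentially. zn n \<in> U0" using zn_in open_U0 p_U U_U0 by blast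
  ultimately show ?thesis
  proof eventually_elim
    case (elim n)
    then show ?case using tn(1)[of n] by (simp add: \<Omega>_eq divide_less_0_iff)
  qed
qed

end

text \<open>Uniform in q by compactness: counterexamples with steps tending to 0 would accumulate at
  a point of \<open>M\<close>, against \<open>zn_\<Omega>\<close>.\<close>

lemma shift_into_\<Omega>:
  obtains \<epsilon> where "\<epsilon> > 0" "\<And>t q. 0 < t \<Longrightarrow> t < \<epsilon> \<Longrightarrow> q \<in> M \<Longrightarrow> q + t *\<^sub>R (- nrm r q) \<in> \<Omega>"
proof (rule ccontr)
  assume neg: "\<not> thesis"
  have "\<forall>n. \<exists>t q. 0 < t \<and> t < 1 / Suc n \<and> q \<in> M \<and> q + t *\<^sub>R (- nrm r q) \<notin> \<Omega>"
  proof
    fix n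
    show "\<exists>t q. 0 < t \<and> t < 1 / Suc n \<and> q \<in> M \<and> q + t *\<^sub>R (- nrm r q) \<notin> \<Omega>"
    proof (rule ccontr)
      assume "\<not> ?thesis"
      then show False using neg that[of "1 / Suc n"] by auto
    qed
  qed
  then obtain t q where tq: "\<And>n. 0 < t n" "\<And>n. t n < 1 / Suc n" "\<And>n. q n \<in> M" "\<And>n. q n + t n *\<^sub>R (- nrm r (q n)) \<notin> \<Omega>"
    by metis
  obtain p \<phi> where \<phi>: "strict_mono (\<phi> :: nat \<Rightarrow> nat)" "(q \<circ> \<phi>) \<longlonglongrightarrow> p"
    using compact_M tq(3) unfolding compact_def by metis
  have z: "(\<lambda>n. 1 / real (Suc n)) \<longlonglongrightarrow> 0" using LIMSEQ_inverse_real_of_nat by (simp add: inverse_eq_divide)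
  have "norm (t n) \<le> 1 / real (Suc n)" for n using tq(1,2)[of n] by simp
  then have "t \<longlonglongrightarrow> 0" by (intro Lim_null_comparison[OF _ z]) simp
  then have t0: "(t \<circ> \<phi>) \<longlonglongrightarrow> 0" using \<phi>(1) LIMSEQ_subseq_LIMSEQ by blast
  have "\<forall>\<^sub>F n in sequentially. zn (q \<circ> \<phi>) (t \<circ> \<phi>) n \<in> \<Omega>"
    by (rule zn_\<Omega>[OF _ \<phi>(2) _ t0]) (use tq in auto)
  then have "\<forall>\<^sub>F n in sequentially. False"
    by eventually_elim (use tq(4) \<phi>(2) t0 tq(1,3) zn_def[of "q \<circ> \<phi>" p "t \<circ> \<phi>"] in auto)
  then show False by simp
qed

end

section \<open>From the domain to the hypersurface\<close>

locale DF_domain = smooth_domain \<Omega> r U0 for \<Omega> :: "(complex ^ 'n) set" and r U0 +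
  fixes \<rho> :: "complex ^ 'n \<Rightarrow> real" and V0 and \<tau>
  assumes open_V0: "open V0" and closure_V0: "closure \<Omega> \<subseteq> V0" and \<rho>2: "Ck_on 2 V0 \<rho>"
    and \<Omega>_eq': "\<Omega> = {z \<in> V0. \<rho> z < 0}" and \<rho>_gradient: "\<And>p. p \<in> M \<Longrightarrow> gradient \<rho> p \<noteq> 0"
    and \<tau>: "0 < \<tau>" "\<tau> < 1"
    and psh: "plurisubharmonic_on \<Omega> (\<lambda>z. - ((- \<rho> z) powr \<tau>))"
begin

definition "\<psi> z = ln (- \<rho> z) - ln (- r z)"

lemma r_neg: "z \<in> \<Omega> \<Longrightarrow> r z < 0" using \<Omega>_eq by blast
lemma \<rho>_neg: "z \<in> \<Omega> \<Longrightarrow> \<rho> z < 0" using \<Omega>_eq' by blast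

lemma \<Omega>_sub: "\<Omega> \<subseteq> U0" "\<Omega> \<subseteq> V0" using closure_U0 closure_V0 closure_subset by blast+

lemma r2_\<Omega>: "Ck_on 2 \<Omega> r" by (rule Ck_on_subset[OF C_r \<Omega>_sub(1)])
lemma \<rho>2_\<Omega>: "Ck_on 2 \<Omega> \<rho>" by (rule Ck_on_subset[OF \<rho>2 \<Omega>_sub(2)])

lemma \<psi>2: "Ck_on 2 \<Omega> \<psi>"
  unfolding \<psi>_def[abs_def]
  by (intro Ck_on_diff Ck_on_ln Ck_on_minus open_\<Omega> r2_\<Omega> \<rho>2_\<Omega>) (use r_neg \<rho>_neg in auto)

lemma log_form_nonneg:
  assumes z: "z \<in> \<Omega>"
  shows "0 \<le> log_form \<tau> \<psi> z Y"
proof -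
  let ?u = "\<lambda>z. - ((- \<rho> z) powr \<tau>)" and ?w = "\<lambda>z. - exp (\<tau> * (ln (- r z) + \<psi> z))"
  have eq: "?w q = ?u q" if "q \<in> \<Omega>" for q
    using \<rho>_neg[OF that] by (simp add: \<psi>_def powr_def)
  have w2: "Ck_on 2 \<Omega> ?w"
    by (intro Ck_on_minus Ck_on_exp Ck_on_cmult Ck_on_add Ck_on_ln r2_\<Omega> \<psi>2 open_\<Omega>) (use r_neg in auto)
  have "Ck_on 2 \<Omega> ?u" by (rule Ck_on_cong_open[OF open_\<Omega> eq w2])
  then have "0 \<le> hess ?u z Y" by (rule plurisubharmonic_onD[OF open_\<Omega> _ psh z])
  also have "hess ?u z Y = hess ?w z Y" by (rule hess_cong_open[OF open_\<Omega> z]) (simp only: eq)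
  also have "\<dots> = \<tau> * exp (\<tau> * (ln (- r z) + \<psi> z)) * log_form \<tau> \<psi> z Y"
    unfolding log_form_def by (rule hess_neg_exp[OF open_\<Omega> z r2_\<Omega> r_neg \<psi>2])
  finally have "0 \<le> \<tau> * exp (\<tau> * (ln (- r z) + \<psi> z)) * log_form \<tau> \<psi> z Y" .
  moreover have "0 < \<tau> * exp (\<tau> * (ln (- r z) + \<psi> z))" using \<tau> by simp
  ultimately show ?thesis by (metis mult_le_cancel_left_pos mult_zero_right)
qed

section \<open>Comparison of \<rho> with r on the boundary\<close>

lemma \<rho>_M: "p \<in> M \<Longrightarrow> \<rho> p = 0"
proof -
  assume p: "p \<in> M"
  have "\<rho> p \<le> 0"
    by (rule continuous_le_on_closure[of \<Omega> \<rho> p 0])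
      (use \<Omega>_eq' p M_sub(3) continuous_on_subset[OF Ck_on_imp_continuous_on[OF \<rho>2] closure_V0] in auto)
  moreover have "\<not> \<rho> p < 0" using M_not_\<Omega>[OF p] M_sub(3) closure_V0 p \<Omega>_eq' by blast
  ultimately show ?thesis by simp
qed

lemma M_V0: "M \<subseteq> V0" using M_sub(3) closure_V0 by blast

text \<open>The ratio of the gradients of \<rho> and r on \<open>M\<close>; the 2 is the normal
  derivative of r.\<close>

definition "lam q = dd (nrm r q) \<rho> q / 2"

lemma dd_\<rho>: "q \<in> M \<Longrightarrow> dd v \<rho> q = lam q * dd v r q"
  unfolding lam_def
  by (rule vanishing_normal[OF open_V0 _ _ \<rho>2]) (use M_V0 \<rho>_M in auto)

lemma lam_nz: "q \<in> M \<Longrightarrow> lam q \<noteq> 0"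
  using dd_\<rho>[of q] \<rho>_gradient[of q] by (auto simp: gradient_eq)

text \<open>The real Hessian at \<open>p\<close> of \<open>\<rho> - lam p \<sqdot> r\<close>, a function that vanishes on \<open>M\<close> and whose derivative
  vanishes at \<open>p\<close>.\<close>

definition "E p v w = dd w (dd v \<rho>) p - lam p * dd w (dd v r) p"

lemma C2_VU: "open (V0 \<inter> U)" "Ck_on 2 (V0 \<inter> U) \<rho>" "Ck_on 2 (V0 \<inter> U) r"
  using open_V0 open_U Ck_on_subset[OF \<rho>2] Ck_on_subset[OF r2] by auto

lemma M_VU: "p \<in> M \<Longrightarrow> p \<in> V0 \<inter> U" using M_V0 M_sub by blast

lemma E_tangent_square:
  assumes "p \<in> M" "dd v r p = 0"
  shows "E p v v = 0"
  unfolding E_def lam_def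
  using vanishing_second_order[OF open_V0 _ assms(1) \<rho>2 _ assms(2)] \<rho>_M M_V0 assms(1) by auto

text \<open>Polarisation of \<open>E_tangent_square\<close>.\<close>

lemma E_tangent:
  assumes "p \<in> M" "dd v r p = 0" "dd w r p = 0"
  shows "E p v w = 0"
proof -
  have "dd (v + w) r p = 0" using assms M_sub by (subst dd_add[OF rd]) auto
  then have "E p (v + w) (v + w) = 0" by (rule E_tangent_square[OF assms(1)])
  moreover have "E p (v + w) (v + w) = E p v v + 2 * E p v w + E p w w"
    unfolding E_def dd_dd_square_add[OF C2_VU(1) M_VU[OF assms(1)] C2_VU(2)]
      dd_dd_square_add[OF C2_VU(1) M_VU[OF assms(1)] C2_VU(3)] by (simp add: algebra_simps)
  ultimately show ?thesis using E_tangent_square assms by simp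
qed

text \<open>Removing the normal parts of v and w leaves tangent vectors, where \<open>E\<close>
  vanishes; so \<open>E\<close> is determined by its values with one normal argument. The expression
  on the left reappears as the limit in \<open>dd_dd_\<psi>_lim\<close>.\<close>

lemma E_decomposition:
  assumes "p \<in> M"
  defines "N \<equiv> nrm r p"
  shows "E p v w - dd w r p / 2 * E p v N - dd v r p / 2 * E p N w + dd v r p / 2 * (dd w r p / 2) * E p N N = 0"
proof -
  have pU: "p \<in> U" using assms M_sub by blast
  let ?a = "dd v r p / 2" and ?b = "dd w r p / 2"
  have "E p (v - ?a *\<^sub>R N) (w - ?b *\<^sub>R N) = 0"
    by (rule E_tangent[OF assms(1)]) (simp_all add: N_def dd_diff dd_scaleR rd[OF pU] dd_nu[OF pU])
  then show ?thesis
    unfolding E_def dd_dd_diff_scaleR[OF C2_VU(1) M_VU[OF assms(1)] C2_VU(2)]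
      dd_dd_diff_scaleR[OF C2_VU(1) M_VU[OF assms(1)] C2_VU(3)] by (simp add: algebra_simps)
qed

lemma E_commute: "p \<in> M \<Longrightarrow> E p v w = E p w v"
  unfolding E_def
  using dd_commute[OF C2_VU(1) M_VU C2_VU(2), of p v w] dd_commute[OF C2_VU(1) M_VU C2_VU(3), of p v w] by simp

lemma dd_\<psi>:
  assumes z: "z \<in> \<Omega>"
  shows "dd v \<psi> z = dd v \<rho> z / \<rho> z - dd v r z / r z"
    "dd w (dd v \<psi>) z = dd w (dd v \<rho>) z / \<rho> z - dd w \<rho> z * dd v \<rho> z / (\<rho> z)\<^sup>2
       - (dd w (dd v r) z / r z - dd w r z * dd v r z / (r z)\<^sup>2)"
proof -
  have dl: "((\<lambda>x. ln (- x)) has_real_derivative 1 / x) (at x)" if "x < 0" for x :: real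
    using that by (auto intro!: derivative_eq_intros simp: field_simps)
  have dl': "((\<lambda>x. 1 / x) has_real_derivative - (1 / x\<^sup>2)) (at x)" if "x < 0" for x :: real
    using that by (auto intro!: derivative_eq_intros simp: power2_eq_square)
  have L: "dd v (\<lambda>x. ln (- f x)) z = 1 / f z * dd v f z \<and> Ck_on 2 \<Omega> (\<lambda>x. ln (- f x)) \<and>
     dd w (dd v (\<lambda>x. ln (- f x))) z = 1 / f z * dd w (dd v f) z + - (1 / (f z)\<^sup>2) * dd w f z * dd v f z"
    if f: "Ck_on 2 \<Omega> f" "\<And>x. x \<in> \<Omega> \<Longrightarrow> f x < 0" for f :: "complex ^ 'n \<Rightarrow> real"
  proof (intro conjI)
    show "dd v (\<lambda>x. ln (- f x)) z = 1 / f z * dd v f z"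
      by (rule dd_compose_real[where g="\<lambda>x. ln (- x)", OF Ck_on_2_diff[OF f(1) z] dl[OF f(2)[OF z]]])
    show "Ck_on 2 \<Omega> (\<lambda>x. ln (- f x))" by (intro Ck_on_ln Ck_on_minus open_\<Omega> f(1)) (use f in auto)
    show "dd w (dd v (\<lambda>x. ln (- f x))) z = 1 / f z * dd w (dd v f) z + - (1 / (f z)\<^sup>2) * dd w f z * dd v f z"
      by (rule dd_dd_compose_real[where g="\<lambda>x. ln (- x)", OF open_\<Omega> z f(1)]) (use dl dl' f(2) z in auto)
  qed
  note R = L[OF r2_\<Omega> r_neg] and P = L[OF \<rho>2_\<Omega> \<rho>_neg]
  have \<psi>: "\<psi> = (\<lambda>z. 1 * ln (- \<rho> z) + (- 1) * ln (- r z))" by (simp add: \<psi>_def fun_eq_iff)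
  have d: "dd v \<psi> z = 1 * dd v (\<lambda>z. ln (- \<rho> z)) z + (- 1) * dd v (\<lambda>z. ln (- r z)) z"
    unfolding \<psi> by (rule dd_lincomb) (use R P Ck_on_2_diff z in blast)+
  have d2: "dd w (dd v \<psi>) z = 1 * dd w (dd v (\<lambda>z. ln (- \<rho> z))) z + (- 1) * dd w (dd v (\<lambda>z. ln (- r z))) z"
    unfolding \<psi> by (rule dd_dd_lincomb[OF open_\<Omega> z]) (use R P in blast)+
  show "dd v \<psi> z = dd v \<rho> z / \<rho> z - dd v r z / r z" unfolding d using R P by simp
  show "dd w (dd v \<psi>) z = dd w (dd v \<rho>) z / \<rho> z - dd w \<rho> z * dd v \<rho> z / (\<rho> z)\<^sup>2
       - (dd w (dd v r) z / r z - dd w r z * dd v r z / (r z)\<^sup>2)"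
    unfolding d2 using R P by (simp add: power2_eq_square)
qed

text \<open>The limit of \<open>d\<psi>\<close> at \<open>p\<close> along points shifted from \<open>M\<close> into \<open>\<Omega>\<close> along \<open>- nrm r\<close>.\<close>

definition "\<Psi> p v = (2 * E p v (nrm r p) - dd v r p * (E p (nrm r p) (nrm r p) / 2)) / (4 * lam p)"

section \<open>Limits of the derivatives of \<psi> at the boundary\<close>

context
  fixes pn :: "nat \<Rightarrow> complex ^ 'n" and p tn
  assumes pn: "\<And>n. pn n \<in> M" "pn \<longlonglongrightarrow> p" and tn: "\<And>n. tn n > 0" "tn \<longlonglongrightarrow> (0::real)"
begin

abbreviation "Z n \<equiv> pn n + tn n *\<^sub>R (- nrm r (pn n))"

lemma Z_zn: "Z = zn pn tn" by (simp add: zn_def[OF pn tn] fun_eq_iff)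
lemma p_M': "p \<in> M" by (rule p_M[OF pn tn])
lemma p_U': "p \<in> U" by (rule p_U[OF pn tn])
lemma Z_lim: "Z \<longlonglongrightarrow> p" unfolding Z_zn by (rule zn_lim[OF pn tn])
lemma Z_\<Omega>: "\<forall>\<^sub>F n in sequentially. Z n \<in> \<Omega>" unfolding fun_cong[OF Z_zn] by (rule zn_\<Omega>[OF pn tn])
lemma r_Z: "(\<lambda>n. r (Z n) / tn n) \<longlonglongrightarrow> - 2" unfolding fun_cong[OF Z_zn] by (rule r_zn[OF pn tn])

lemmas nzt = tn_nz[OF pn tn]
lemmas nun' = nun[OF pn tn]

lemma lam_lim: "(\<lambda>n. lam (pn n)) \<longlonglongrightarrow> lam p"
  unfolding lam_def
  by (intro tendsto_intros dd_tendsto[OF C2_VU(1) M_VU[OF p_M'] Ck_on_2_1[OF C2_VU(2)] pn(2)] nu_tendsto[OF p_U'] pn) auto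

lemma \<rho>_Z: "(\<lambda>n. \<rho> (Z n) / tn n) \<longlonglongrightarrow> - 2 * lam p"
proof -
  have "(\<lambda>n. (\<rho> (Z n) - \<rho> (pn n)) / tn n) \<longlonglongrightarrow> dd (- nrm r p) \<rho> p"
    by (rule strict_derivative_tendsto[OF C2_VU(1) M_VU[OF p_M'] Ck_on_2_1[OF C2_VU(2)] pn(2) nun' tn(2) nzt])
  moreover have "dd (- nrm r p) \<rho> p = - 2 * lam p"
    by (simp add: dd_minus Ck_on_2_diff[OF C2_VU(2) M_VU[OF p_M']] lam_def)
  ultimately show ?thesis by (simp add: \<rho>_M pn)
qed

text \<open>\<open>lam\<close> is taken at the base point on \<open>M\<close>, where
  \<open>dd v \<rho>\<close> and \<open>lam * dd v r\<close> agree; hence their difference at the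
  shifted point is of order t.\<close>

lemma alpha_lim:
  assumes "v \<longlonglongrightarrow> v0"
  shows "(\<lambda>n. (dd (v n) \<rho> (Z n) - lam (pn n) * dd (v n) r (Z n)) / tn n) \<longlonglongrightarrow> - E p v0 (nrm r p)"
proof -
  note S = strict_derivative_dd_tendsto[OF C2_VU(1) M_VU[OF p_M'] _ pn(2) nun' tn(2) nzt assms tendsto_const[of 0]]
  have "(\<lambda>n. (dd (v n + tn n *\<^sub>R 0) \<rho> (Z n) - dd (v n) \<rho> (pn n)) / tn n
     - lam (pn n) * ((dd (v n + tn n *\<^sub>R 0) r (Z n) - dd (v n) r (pn n)) / tn n))
    \<longlonglongrightarrow> (dd (- nrm r p) (dd v0 \<rho>) p + dd 0 \<rho> p) - lam p * (dd (- nrm r p) (dd v0 r) p + dd 0 r p)"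
    by (intro tendsto_intros S[OF C2_VU(2)] S[OF C2_VU(3)] lam_lim)
  moreover have "(\<lambda>n. (dd (v n + tn n *\<^sub>R 0) \<rho> (Z n) - dd (v n) \<rho> (pn n)) / tn n
     - lam (pn n) * ((dd (v n + tn n *\<^sub>R 0) r (Z n) - dd (v n) r (pn n)) / tn n))
    = (\<lambda>n. (dd (v n) \<rho> (Z n) - lam (pn n) * dd (v n) r (Z n)) / tn n)"
    using dd_\<rho>[OF pn(1)] by (simp add: fun_eq_iff diff_divide_distrib right_diff_distrib)
  moreover have "(dd (- nrm r p) (dd v0 \<rho>) p + dd 0 \<rho> p) - lam p * (dd (- nrm r p) (dd v0 r) p + dd 0 r p) = - E p v0 (nrm r p)"
    using Ck_on_1_diff[OF Ck_on_2_dd[OF C2_VU(2)] M_VU[OF p_M']] Ck_on_1_diff[OF Ck_on_2_dd[OF C2_VU(3)] M_VU[OF p_M']]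
      Ck_on_2_diff[OF C2_VU(2) M_VU[OF p_M']] Ck_on_2_diff[OF C2_VU(3) M_VU[OF p_M']]
    by (simp add: dd_minus dd_zero E_def)
  ultimately show ?thesis by simp
qed

text \<open>Values and first derivatives agree at the base point, so the difference is of second
  order in the step; the sign of the shift drops out of the quadratic term.\<close>

lemma kappa_lim: "(\<lambda>n. (\<rho> (Z n) - lam (pn n) * r (Z n)) / (tn n)\<^sup>2) \<longlonglongrightarrow> E p (nrm r p) (nrm r p) / 2"
proof -
  let ?N = "\<lambda>n. - nrm r (pn n)"
  note S = taylor2_tendsto[OF C2_VU(1) M_VU[OF p_M'] _ pn(2) nun' tn(2) nzt]
  have "(\<lambda>n. (\<rho> (Z n) - \<rho> (pn n) - tn n * dd (?N n) \<rho> (pn n)) / (tn n)\<^sup>2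
     - lam (pn n) * ((r (Z n) - r (pn n) - tn n * dd (?N n) r (pn n)) / (tn n)\<^sup>2))
    \<longlonglongrightarrow> dd (- nrm r p) (dd (- nrm r p) \<rho>) p / 2 - lam p * (dd (- nrm r p) (dd (- nrm r p) r) p / 2)"
    by (intro tendsto_intros S[OF C2_VU(2)] S[OF C2_VU(3)] lam_lim)
  moreover have "(\<lambda>n. (\<rho> (Z n) - \<rho> (pn n) - tn n * dd (?N n) \<rho> (pn n)) / (tn n)\<^sup>2
     - lam (pn n) * ((r (Z n) - r (pn n) - tn n * dd (?N n) r (pn n)) / (tn n)\<^sup>2))
    = (\<lambda>n. (\<rho> (Z n) - lam (pn n) * r (Z n)) / (tn n)\<^sup>2)"
    using dd_\<rho>[OF pn(1)] \<rho>_M[OF pn(1)] r_M[OF pn(1)] by (simp add: fun_eq_iff diff_divide_distrib right_diff_distrib)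
  moreover have "dd (- nrm r p) (dd (- nrm r p) f) p = dd (nrm r p) (dd (nrm r p) f) p" if "Ck_on 2 (V0 \<inter> U) f" for f :: "complex ^ 'n \<Rightarrow> real"
    using dd_dd_diff_scaleR[OF C2_VU(1) M_VU[OF p_M'] that, of "- nrm r p" 2 "- nrm r p" "- nrm r p" 2]
    by (simp add: scaleR_2)
  ultimately show ?thesis using C2_VU by (simp add: E_def field_simps)
qed

lemma r_dd_Z: "v \<longlonglongrightarrow> v0 \<Longrightarrow> (\<lambda>n. dd (v n) r (Z n)) \<longlonglongrightarrow> dd v0 r p"
  by (rule dd_tendsto[OF open_U p_U' r1 Z_lim])

text \<open>In \<open>d\<rho> / \<rho> - dr / r\<close> the parts of order 1/t cancel. With
  \<lambda> the value of \<open>lam\<close> at the base point, the numerator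
  \<open>r d\<rho> - \<rho> dr\<close> equals
  \<open>(d\<rho> - \<lambda> dr) r - dr (\<rho> - \<lambda> r)\<close>, and both products are of
  order \<open>t\<^sup>2\<close>, like the denominator \<open>\<rho> r\<close>.\<close>

lemma dd_\<psi>_lim:
  assumes v: "v \<longlonglongrightarrow> v0"
  shows "(\<lambda>n. dd (v n) \<psi> (Z n)) \<longlonglongrightarrow> \<Psi> p v0"
proof -
  let ?R = "\<lambda>n. r (Z n) / tn n" and ?P = "\<lambda>n. \<rho> (Z n) / tn n"
  let ?A = "\<lambda>n. (dd (v n) \<rho> (Z n) - lam (pn n) * dd (v n) r (Z n)) / tn n"
  let ?K = "\<lambda>n. (\<rho> (Z n) - lam (pn n) * r (Z n)) / (tn n)\<^sup>2"
  have lim: "(\<lambda>n. (?A n * ?R n - dd (v n) r (Z n) * ?K n) / (?P n * ?R n)) \<longlonglongrightarrow>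
     (- E p v0 (nrm r p) * - 2 - dd v0 r p * (E p (nrm r p) (nrm r p) / 2)) / (- 2 * lam p * - 2)"
    by (intro tendsto_intros alpha_lim r_Z r_dd_Z kappa_lim \<rho>_Z v) (use lam_nz[OF p_M'] in simp)
  have eq: "(- E p v0 (nrm r p) * - 2 - dd v0 r p * (E p (nrm r p) (nrm r p) / 2)) / (- 2 * lam p * - 2) = \<Psi> p v0"
    by (simp add: \<Psi>_def)
  have ev: "\<forall>\<^sub>F n in sequentially. (?A n * ?R n - dd (v n) r (Z n) * ?K n) / (?P n * ?R n) = dd (v n) \<psi> (Z n)"
    using Z_\<Omega> nzt
  proof eventually_elim
    case (elim n)
    have nz: "r (Z n) \<noteq> 0" "\<rho> (Z n) \<noteq> 0" using r_neg[OF elim(1)] \<rho>_neg[OF elim(1)] by auto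
    define R P D D' T where "R = r (Z n)" and "P = \<rho> (Z n)" and "D = dd (v n) \<rho> (Z n)" and "D' = dd (v n) r (Z n)" and "T = tn n"
    have nzR: "R \<noteq> 0" "P \<noteq> 0" "T \<noteq> 0" using nz elim(2) by (simp_all add: R_def P_def T_def)
    have "((D - lam (pn n) * D') / T * (R / T) - D' * ((P - lam (pn n) * R) / T\<^sup>2)) / (P / T * (R / T)) = D / P - D' / R"
      using nzR by (simp add: field_simps power2_eq_square)
    then show ?case unfolding dd_\<psi>[OF elim(1)] R_def P_def D_def D'_def T_def .
  qed
  show ?thesis using Lim_transform_eventually[OF lim ev] by (simp only: eq)
qed

text \<open>Substituting \<open>d\<psi> + dr / r\<close> for \<open>d\<rho> / \<rho>\<close> writes
  the second derivative of \<psi> with at most one division by \<rho> or r in each term, so every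
  term has a limit after multiplication by t. By \<open>E_decomposition\<close> the limits add up to
  0.\<close>

lemma dd_dd_\<psi>_lim:
  assumes v: "v \<longlonglongrightarrow> v0" and w: "w \<longlonglongrightarrow> w0"
  shows "(\<lambda>n. tn n * dd (w n) (dd (v n) \<psi>) (Z n)) \<longlonglongrightarrow> 0"
proof -
  let ?R = "\<lambda>n. r (Z n) / tn n" and ?P = "\<lambda>n. \<rho> (Z n) / tn n"
  let ?dr = "\<lambda>v n. dd (v n) r (Z n)" and ?d\<psi> = "\<lambda>v n. dd (v n) \<psi> (Z n)"
  let ?N = "nrm r p"
  have nz: "lam p \<noteq> 0" by (rule lam_nz[OF p_M'])
  have L2: "(\<lambda>n. dd (w n) (dd (v n) f) (Z n)) \<longlonglongrightarrow> dd w0 (dd v0 f) p" if "Ck_on 2 (V0 \<inter> U) f" for f :: "complex ^ 'n \<Rightarrow> real"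
    by (rule dd_dd_tendsto[OF C2_VU(1) M_VU[OF p_M'] that Z_lim w v])
  have lim: "(\<lambda>n. dd (w n) (dd (v n) \<rho>) (Z n) / ?P n - dd (w n) (dd (v n) r) (Z n) / ?R n
      - (?dr v n * ?d\<psi> w n + ?dr w n * ?d\<psi> v n) / ?R n - tn n * (?d\<psi> v n * ?d\<psi> w n))
    \<longlonglongrightarrow> dd w0 (dd v0 \<rho>) p / (- 2 * lam p) - dd w0 (dd v0 r) p / (- 2)
      - (dd v0 r p * \<Psi> p w0 + dd w0 r p * \<Psi> p v0) / (- 2) - 0 * (\<Psi> p v0 * \<Psi> p w0)"
    by (intro tendsto_intros L2 C2_VU r_Z r_dd_Z \<rho>_Z dd_\<psi>_lim v w tn) (use nz in auto)
  have eq: "dd w0 (dd v0 \<rho>) p / (- 2 * lam p) - dd w0 (dd v0 r) p / (- 2)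
      - (dd v0 r p * \<Psi> p w0 + dd w0 r p * \<Psi> p v0) / (- 2) - 0 * (\<Psi> p v0 * \<Psi> p w0) = 0"
  proof -
    have "dd w0 (dd v0 \<rho>) p / (- 2 * lam p) - dd w0 (dd v0 r) p / (- 2)
      - (dd v0 r p * \<Psi> p w0 + dd w0 r p * \<Psi> p v0) / (- 2) - 0 * (\<Psi> p v0 * \<Psi> p w0)
      = - (E p v0 w0 - dd w0 r p / 2 * E p v0 ?N - dd v0 r p / 2 * E p ?N w0
          + dd v0 r p / 2 * (dd w0 r p / 2) * E p ?N ?N) / (2 * lam p)"
      using nz unfolding \<Psi>_def E_commute[OF p_M', of w0 ?N] E_def[of p v0 w0] by (simp add: field_simps)
    then show ?thesis unfolding E_decomposition[OF p_M'] by simp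
  qed
  have ev: "\<forall>\<^sub>F n in sequentially. dd (w n) (dd (v n) \<rho>) (Z n) / ?P n - dd (w n) (dd (v n) r) (Z n) / ?R n
      - (?dr v n * ?d\<psi> w n + ?dr w n * ?d\<psi> v n) / ?R n - tn n * (?d\<psi> v n * ?d\<psi> w n) = tn n * dd (w n) (dd (v n) \<psi>) (Z n)"
    using Z_\<Omega> nzt
  proof eventually_elim
    case (elim n)
    have nz: "r (Z n) \<noteq> 0" "\<rho> (Z n) \<noteq> 0" using r_neg[OF elim(1)] \<rho>_neg[OF elim(1)] by auto
    define R P Dv Dw Dv' Dw' T D2 D2' where "R = r (Z n)" and "P = \<rho> (Z n)" and "Dv = dd (v n) \<rho> (Z n)" and "Dw = dd (w n) \<rho> (Z n)"
      and "Dv' = dd (v n) r (Z n)" and "Dw' = dd (w n) r (Z n)" and "T = tn n"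
      and "D2 = dd (w n) (dd (v n) \<rho>) (Z n)" and "D2' = dd (w n) (dd (v n) r) (Z n)"
    have nzR: "R \<noteq> 0" "P \<noteq> 0" "T \<noteq> 0" using nz elim(2) by (simp_all add: R_def P_def T_def)
    have "D2 / (P / T) - D2' / (R / T) - (Dv' * (Dw / P - Dw' / R) + Dw' * (Dv / P - Dv' / R)) / (R / T)
        - T * ((Dv / P - Dv' / R) * (Dw / P - Dw' / R))
       = T * (D2 / P - Dw * Dv / P\<^sup>2 - (D2' / R - Dw' * Dv' / R\<^sup>2))"
      using nzR by (simp add: field_simps power2_eq_square)
    then show ?case unfolding dd_\<psi>[OF elim(1)] R_def P_def Dv_def Dw_def Dv'_def Dw'_def D2_def D2'_def T_def .
  qed
  show ?thesis using Lim_transform_eventually[OF lim ev] by (simp only: eq)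
qed

end

end

section \<open>Pulling \<psi> back from the interior\<close>

lemma smult_tendsto:
  fixes X :: "'i \<Rightarrow> complex ^ 'n"
  assumes "(c \<longlongrightarrow> c0) F" "(X \<longlongrightarrow> X0) F"
  shows "((\<lambda>n. c n *s X n) \<longlongrightarrow> c0 *s X0) F"
  unfolding vector_smult_eq
  by (intro tendsto_intros assms bounded_linear.tendsto[OF bounded_linear_J])

lemma vec01_lincomb:
  fixes f g :: "complex ^ 'n \<Rightarrow> real"
  assumes "f differentiable (at q)" "g differentiable (at q)"
  shows "vec01 X (cplx (\<lambda>q. a * f q + b * g q)) q = of_real a * vec01 X (cplx f) q + of_real b * vec01 X (cplx g) q"
proof -
  have "(\<lambda>q. a * f q + b * g q) differentiable (at q)"
    by (intro differentiable_add differentiable_mult differentiable_const assms)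
  then show ?thesis
    unfolding vec01_vec10[OF assms(1)] vec01_vec10[OF assms(2)]
    by (simp only: vec01_vec10 vec10_lincomb[OF assms]) simp
qed

lemma vec01_sqdist: "vec01 X (cplx (sqdist 0)) p = Complex (X \<bullet> p) (J X \<bullet> p)"
  by (simp add: vec01_cplx Ck_on_1_diff[OF Ck_on_sqdist] dd_sqdist)

lemma norm_vec01_sqdist_le: "cmod (vec01 X (cplx (sqdist 0)) p) \<le> 2 * norm p * norm X"
proof -
  have "cmod (vec01 X (cplx (sqdist 0)) p) \<le> \<bar>X \<bullet> p\<bar> + \<bar>J X \<bullet> p\<bar>"
    unfolding vec01_sqdist using cmod_le by (metis complex.sel)
  also have "\<dots> \<le> norm X * norm p + norm (J X) * norm p" by (intro add_mono Cauchy_Schwarz_ineq2)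
  finally show ?thesis by (simp add: mult_ac)
qed

context smooth_domain begin

lemma DF_form_cong:
  assumes "vec01 X (cplx f) p = vec01 X (cplx g) p" "hess f p X = hess g p X"
  shows "DF_form \<eta> f p X = DF_form \<eta> g p X"
  unfolding DF_form_def assms ..

lemma DF_form_cong_open:
  assumes "open W" "p \<in> W" "\<And>q. q \<in> W \<Longrightarrow> f q = g q" "Ck_on 2 W f"
  shows "DF_form \<eta> f p X = DF_form \<eta> g p X"
proof (rule DF_form_cong)
  have g2: "Ck_on 2 W g" by (rule Ck_on_cong_open[OF assms(1,3,4)])
  have "dd v f p = dd v g p" for v by (rule dd_cong_open[OF assms(1,2,3)])
  then show "vec01 X (cplx f) p = vec01 X (cplx g) p"
    by (simp add: vec01_cplx Ck_on_2_diff[OF assms(4,2)] Ck_on_2_diff[OF g2 assms(2)])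
  show "hess f p X = hess g p X" by (rule hess_cong_open[OF assms(1,2,3)])
qed

definition "shift t q = q + t *\<^sub>R (- nrm r q)"

lemma shift2: "Ck_on 2 U (shift t)"
  unfolding shift_def[abs_def]
  by (intro Ck_on_add Ck_on_ident Ck_on_linear_compose[OF bounded_linear_scaleR_right] Ck_on_minus nu2 open_U)

lemma dd_shift:
  assumes "q \<in> U"
  shows "dd v (shift t) q = v + t *\<^sub>R (- dd v (nrm r) q)" "dd w (dd v (shift t)) q = t *\<^sub>R (- dd w (dd v (nrm r)) q)"
proof -
  have 1: "dd v (shift t) q = v + t *\<^sub>R (- dd v (nrm r) q)" if "q \<in> U" for q
    unfolding shift_def[abs_def]
    by (rule dd_eqI[of _ "\<lambda>v. v + t *\<^sub>R (- dd v (nrm r) q)"])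
      (intro has_derivative_add has_derivative_ident has_derivative_scaleR_right has_derivative_minus has_derivative_dd nu_diff that)
  show "dd v (shift t) q = v + t *\<^sub>R (- dd v (nrm r) q)" by (rule 1[OF assms])
  have "dd w (dd v (shift t)) q = dd w (\<lambda>q. v + t *\<^sub>R (- dd v (nrm r) q)) q"
    by (rule dd_cong_open[OF open_U assms 1])
  also have "\<dots> = 0 + t *\<^sub>R (- dd w (dd v (nrm r)) q)"
    by (rule dd_eqI[of _ "\<lambda>w. 0 + t *\<^sub>R (- dd w (dd v (nrm r)) q)"])
      (intro has_derivative_add has_derivative_const has_derivative_scaleR_right has_derivative_minus has_derivative_dd
        Ck_on_1_diff[OF Ck_on_2_dd[OF nu2]] assms)
  finally show "dd w (dd v (shift t)) q = t *\<^sub>R (- dd w (dd v (nrm r)) q)" by simp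
qed

text \<open>On this open set the pull-back of \<psi> is defined and of class C2; for small positive
  t it contains \<open>M\<close>.\<close>

definition "shift_dom t = U \<inter> shift t -` \<Omega>"

lemma open_shift_dom: "open (shift_dom t)"
  unfolding shift_dom_def
  by (rule continuous_open_preimage[OF Ck_on_imp_continuous_on[OF shift2] open_U open_\<Omega>])

end

context DF_domain begin

text \<open>The coefficients are spelled out to match the shape \<open>a * f q + b * g q\<close> of
  the \<open>lincomb\<close> lemmas.\<close>

definition "shifted \<kappa> t = (\<lambda>q. 1 * \<psi> (shift t q) + (- \<kappa>) * sqdist 0 q)"

lemma C2_parts:
  "Ck_on 2 (shift_dom t) (\<lambda>q. \<psi> (shift t q))" "Ck_on 2 (shift_dom t) (sqdist 0)"
  by (rule Ck_on_compose[OF open_shift_dom _ \<psi>2 Ck_on_subset[OF shift2]]) (auto simp: shift_dom_def intro: Ck_on_subset[OF Ck_on_sqdist])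

lemma C2_shifted: "Ck_on 2 (shift_dom t) (shifted \<kappa> t)"
  unfolding shifted_def by (rule Ck_on_lincomb[OF open_shift_dom C2_parts])

lemma dd_dd_\<psi>_shift:
  assumes "q \<in> shift_dom t"
  shows "dd w (dd v (\<lambda>q. \<psi> (shift t q))) q = dd (t *\<^sub>R (- dd w (dd v (nrm r)) q)) \<psi> (shift t q)
    + dd (w + t *\<^sub>R (- dd w (nrm r) q)) (dd (v + t *\<^sub>R (- dd v (nrm r) q)) \<psi>) (shift t q)"
proof -
  have q: "q \<in> U" using assms by (simp add: shift_dom_def)
  have sub: "shift_dom t \<subseteq> U" "shift t ` shift_dom t \<subseteq> \<Omega>" by (auto simp: shift_dom_def)
  show ?thesis
    unfolding dd_shift[OF q, symmetric]
    by (rule dd_dd_compose[OF open_\<Omega> \<psi>2 open_shift_dom assms sub(2) Ck_on_subset[OF shift2 sub(1)]])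
qed

context
  fixes pn :: "nat \<Rightarrow> complex ^ 'n" and p tn X X0
  assumes pn: "\<And>n. pn n \<in> M" "pn \<longlonglongrightarrow> p" and tn: "\<And>n. tn n > 0" "tn \<longlonglongrightarrow> (0::real)"
    and X: "X \<longlonglongrightarrow> X0" "\<And>n. X n \<in> tangent10 r (pn n)" "\<And>n. hess r (pn n) (X n) = 0"
begin

lemma pn_U: "pn n \<in> U" using pn(1) M_sub by blast
lemmas pU = p_U[OF pn tn]
lemmas pM = p_M[OF pn tn]

lemma Z_shift: "Z pn tn n = shift (tn n) (pn n)" by (simp add: shift_def)

lemma pn_shift_dom: "\<forall>\<^sub>F n in sequentially. pn n \<in> shift_dom (tn n)"
  using Z_\<Omega>[OF pn tn] unfolding Z_shift by eventually_elim (simp add: shift_dom_def pn_U)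

text \<open>The limit of the conjugate of X applied to \<psi>, in the form given by
  \<open>vec01_cplx\<close>.\<close>

definition "eX = Complex (\<Psi> p X0 / 2) (\<Psi> p (J X0) / 2)"

lemma JX: "(\<lambda>n. J (X n)) \<longlonglongrightarrow> J X0"
  by (rule bounded_linear.tendsto[OF bounded_linear_J X(1)])

lemma vec10_\<psi>_lim:
  assumes "Y \<longlonglongrightarrow> X0"
  shows "(\<lambda>n. vec10 (Y n) (cplx \<psi>) (Z pn tn n)) \<longlonglongrightarrow> cnj eX"
proof -
  have "(\<lambda>n. Complex (dd (Y n) \<psi> (Z pn tn n) / 2) (- dd (J (Y n)) \<psi> (Z pn tn n) / 2))
      \<longlonglongrightarrow> Complex (\<Psi> p X0 / 2) (- \<Psi> p (J X0) / 2)"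
    by (intro tendsto_intros dd_\<psi>_lim[OF pn tn] assms bounded_linear.tendsto[OF bounded_linear_J]) auto
  moreover have "\<forall>\<^sub>F n in sequentially. Complex (dd (Y n) \<psi> (Z pn tn n) / 2) (- dd (J (Y n)) \<psi> (Z pn tn n) / 2)
     = vec10 (Y n) (cplx \<psi>) (Z pn tn n)"
    using Z_\<Omega>[OF pn tn] by eventually_elim (simp only: vec10_cplx[OF Ck_on_2_diff[OF \<psi>2]])
  ultimately have "(\<lambda>n. vec10 (Y n) (cplx \<psi>) (Z pn tn n)) \<longlonglongrightarrow> Complex (\<Psi> p X0 / 2) (- \<Psi> p (J X0) / 2)"
    by (rule Lim_transform_eventually)
  moreover have "Complex (\<Psi> p X0 / 2) (- \<Psi> p (J X0) / 2) = cnj eX" by (simp add: eX_def complex_eq_iff)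
  ultimately show ?thesis by simp
qed

lemma vec01_shifted_lim:
  "(\<lambda>n. vec01 (X n) (cplx (shifted \<kappa> (tn n))) (pn n)) \<longlonglongrightarrow> eX - of_real \<kappa> * vec01 X0 (cplx (sqdist 0)) p"
proof -
  let ?a = "\<lambda>v n. v + tn n *\<^sub>R (- dd v (nrm r) (pn n))"
  have A: "(\<lambda>n. ?a (v n) n) \<longlonglongrightarrow> v0" if "v \<longlonglongrightarrow> v0" for v v0
    by (rule tendsto_line[OF that tendsto_minus[OF dd_tendsto[OF open_U pU Ck_on_2_1[OF nu2] pn(2) that]] tn(2)])
  have "(\<lambda>n. of_real 1 * Complex (dd (?a (X n) n) \<psi> (Z pn tn n) / 2) (dd (?a (J (X n)) n) \<psi> (Z pn tn n) / 2)
      + of_real (- \<kappa>) * Complex (X n \<bullet> pn n) (J (X n) \<bullet> pn n))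
    \<longlonglongrightarrow> of_real 1 * Complex (\<Psi> p X0 / 2) (\<Psi> p (J X0) / 2) + of_real (- \<kappa>) * Complex (X0 \<bullet> p) (J X0 \<bullet> p)"
    by (intro tendsto_intros dd_\<psi>_lim[OF pn tn] A X JX pn) auto
  moreover have "\<forall>\<^sub>F n in sequentially. of_real 1 * Complex (dd (?a (X n) n) \<psi> (Z pn tn n) / 2) (dd (?a (J (X n)) n) \<psi> (Z pn tn n) / 2)
      + of_real (- \<kappa>) * Complex (X n \<bullet> pn n) (J (X n) \<bullet> pn n) = vec01 (X n) (cplx (shifted \<kappa> (tn n))) (pn n)"
    using pn_shift_dom
  proof eventually_elim
    case (elim n)
    have d: "(\<lambda>q. \<psi> (shift (tn n) q)) differentiable (at (pn n))" "sqdist 0 differentiable (at (pn n))"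
      using Ck_on_2_diff[OF C2_parts(1) elim] Ck_on_2_diff[OF C2_parts(2) elim] .
    have "dd v (\<lambda>q. \<psi> (shift (tn n) q)) (pn n) = dd (?a v n) \<psi> (Z pn tn n)" for v
      unfolding Z_shift dd_shift(1)[OF pn_U, symmetric]
      by (rule dd_compose[OF Ck_on_2_diff[OF shift2 pn_U] Ck_on_2_diff[OF \<psi>2]]) (use elim in \<open>simp add: shift_dom_def\<close>)
    then show ?case
      unfolding shifted_def vec01_lincomb[OF d] vec01_sqdist vec01_cplx[OF d(1)] by simp
  qed
  ultimately show ?thesis unfolding vec01_sqdist eX_def
    using Lim_transform_eventually by (simp add: Lim_transform_eventually)
qed

text \<open>The derivative of the shift changes a vector by order t, and so does V; against second
  derivatives of size \<open>o(1/t)\<close> both disappear. The second derivative of the shift is of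
  order t and meets convergent first derivatives. What remains is the Hessian of
  \<open>- \<kappa> |z|\<^sup>2\<close>.\<close>

lemma hess_shifted_lim:
  assumes V: "V \<longlonglongrightarrow> Vl"
  shows "(\<lambda>n. hess (shifted \<kappa> (tn n)) (pn n) (X n) - hess \<psi> (Z pn tn n) (X n + tn n *\<^sub>R V n)) \<longlonglongrightarrow> - \<kappa> * (norm X0)\<^sup>2"
proof -
  let ?z = "Z pn tn"
  let ?A = "\<lambda>v n. dd (v n) (nrm r) (pn n)"
  let ?a = "\<lambda>v n. v n + tn n *\<^sub>R (- ?A v n)"
  \<comment> \<open>The difference of the second derivatives in one real direction: first the term
    from the second derivative of the shift, then the change of the vector, split by
    \<open>dd_dd_square_diff\<close>.\<close>
  let ?T = "\<lambda>v W n. - (tn n * dd (dd (v n) (dd (v n) (nrm r)) (pn n)) \<psi> (?z n))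
     + (- (tn n * dd (?A v n + W n) (dd (?a v n) \<psi>) (?z n)) - tn n * dd (?A v n + W n) (dd (v n + tn n *\<^sub>R W n) \<psi>) (?z n))"
  have AL: "?A v \<longlonglongrightarrow> dd v0 (nrm r) p" if "v \<longlonglongrightarrow> v0" for v v0
    by (rule dd_tendsto[OF open_U pU Ck_on_2_1[OF nu2] pn(2) that])
  have aL: "?a v \<longlonglongrightarrow> v0" if "v \<longlonglongrightarrow> v0" for v v0
    by (rule tendsto_line[OF that tendsto_minus[OF AL[OF that]] tn(2)])
  have TL: "?T v W \<longlonglongrightarrow> 0" if v: "v \<longlonglongrightarrow> v0" and W: "W \<longlonglongrightarrow> W0" for v v0 W W0
  proof -
    have N2: "(\<lambda>n. dd (v n) (dd (v n) (nrm r)) (pn n)) \<longlonglongrightarrow> (\<Sum>e\<in>Basis. (v0 \<bullet> e) *\<^sub>R dd v0 (dd e (nrm r)) p)"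
    proof -
      have "(\<lambda>n. \<Sum>e\<in>Basis. (v n \<bullet> e) *\<^sub>R dd (v n) (dd e (nrm r)) (pn n)) \<longlonglongrightarrow> (\<Sum>e\<in>Basis. (v0 \<bullet> e) *\<^sub>R dd v0 (dd e (nrm r)) p)"
        by (intro tendsto_intros dd_tendsto[OF open_U pU Ck_on_2_dd[OF nu2]] pn v)
      moreover have "(\<Sum>e\<in>Basis. (v n \<bullet> e) *\<^sub>R dd (v n) (dd e (nrm r)) (pn n)) = dd (v n) (dd (v n) (nrm r)) (pn n)" for n
      proof -
        have "dd (v n) (dd (v n) (nrm r)) (pn n) = dd (v n) (\<lambda>q. \<Sum>e\<in>Basis. (v n \<bullet> e) *\<^sub>R dd e (nrm r) q) (pn n)"
          by (rule dd_cong_open[OF open_U pn_U]) (rule dd_Basis[OF nu_diff])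
        also have "\<dots> = (\<Sum>e\<in>Basis. (v n \<bullet> e) *\<^sub>R dd (v n) (dd e (nrm r)) (pn n))"
          by (rule dd_eqI[of _ "\<lambda>w. \<Sum>e\<in>Basis. (v n \<bullet> e) *\<^sub>R dd w (dd e (nrm r)) (pn n)"])
            (intro has_derivative_sum has_derivative_scaleR_right has_derivative_dd Ck_on_1_diff[OF Ck_on_2_dd[OF nu2] pn_U])
        finally show ?thesis by simp
      qed
      ultimately show ?thesis by simp
    qed
    have d0: "(\<lambda>n. tn n * dd (dd (v n) (dd (v n) (nrm r)) (pn n)) \<psi> (?z n))
        \<longlonglongrightarrow> 0 * \<Psi> p (\<Sum>e\<in>Basis. (v0 \<bullet> e) *\<^sub>R dd v0 (dd e (nrm r)) p)"
      by (rule tendsto_mult[OF tn(2) dd_\<psi>_lim[OF pn tn N2]])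
    have d1: "(\<lambda>n. tn n * dd (?A v n + W n) (dd (?a v n) \<psi>) (?z n)) \<longlonglongrightarrow> 0"
      by (rule dd_dd_\<psi>_lim[OF pn tn aL[OF v] tendsto_add[OF AL[OF v] W]])
    have d2: "(\<lambda>n. tn n * dd (?A v n + W n) (dd (v n + tn n *\<^sub>R W n) \<psi>) (?z n)) \<longlonglongrightarrow> 0"
      by (rule dd_dd_\<psi>_lim[OF pn tn tendsto_line[OF v W tn(2)] tendsto_add[OF AL[OF v] W]])
    have "?T v W \<longlonglongrightarrow> - (0 * \<Psi> p (\<Sum>e\<in>Basis. (v0 \<bullet> e) *\<^sub>R dd v0 (dd e (nrm r)) p)) + (- 0 - 0)"
      by (intro tendsto_add tendsto_diff tendsto_minus d0 d1 d2)
    then show ?thesis by simp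
  qed
  have JV: "(\<lambda>n. J (V n)) \<longlonglongrightarrow> J Vl" by (rule bounded_linear.tendsto[OF bounded_linear_J V])
  have lim: "(\<lambda>n. (?T X V n + ?T (\<lambda>n. J (X n)) (\<lambda>n. J (V n)) n) / 4 + (- \<kappa>) * (norm (X n))\<^sup>2) \<longlonglongrightarrow> (0 + 0) / 4 + (- \<kappa>) * (norm X0)\<^sup>2"
    by (intro tendsto_intros TL[OF X(1) V] TL[OF JX JV] X) auto
  have ev: "\<forall>\<^sub>F n in sequentially. (?T X V n + ?T (\<lambda>n. J (X n)) (\<lambda>n. J (V n)) n) / 4 + (- \<kappa>) * (norm (X n))\<^sup>2
     = hess (shifted \<kappa> (tn n)) (pn n) (X n) - hess \<psi> (?z n) (X n + tn n *\<^sub>R V n)"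
    using pn_shift_dom
  proof eventually_elim
    case (elim n)
    have z: "?z n \<in> \<Omega>" using elim unfolding Z_shift by (simp add: shift_dom_def)
    have *: "dd (v n) (dd (v n) (\<lambda>q. \<psi> (shift (tn n) q))) (pn n)
        - dd (v n + tn n *\<^sub>R W n) (dd (v n + tn n *\<^sub>R W n) \<psi>) (?z n) = ?T v W n" for v W
    proof -
      have "dd (?a v n) (dd (?a v n) \<psi>) (?z n) - dd (v n + tn n *\<^sub>R W n) (dd (v n + tn n *\<^sub>R W n) \<psi>) (?z n)
         = - (tn n * dd (?A v n + W n) (dd (?a v n) \<psi>) (?z n)) - tn n * dd (?A v n + W n) (dd (v n + tn n *\<^sub>R W n) \<psi>) (?z n)"
        by (rule dd_dd_square_diff[OF open_\<Omega> z \<psi>2]) (simp add: scaleR_add_right)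
      moreover have "dd (tn n *\<^sub>R (- dd (v n) (dd (v n) (nrm r)) (pn n))) \<psi> (?z n)
         = - (tn n * dd (dd (v n) (dd (v n) (nrm r)) (pn n)) \<psi> (?z n))"
        using Ck_on_2_diff[OF \<psi>2 z] by (simp only: dd_scaleR dd_minus) simp
      ultimately show ?thesis unfolding dd_dd_\<psi>_shift[OF elim] Z_shift[symmetric] by simp
    qed
    have "hess (shifted \<kappa> (tn n)) (pn n) (X n) = 1 * hess (\<lambda>q. \<psi> (shift (tn n) q)) (pn n) (X n) + (- \<kappa>) * (norm (X n))\<^sup>2"
      unfolding shifted_def hess_lincomb[OF open_shift_dom elim C2_parts] hess_sqdist ..
    then show ?case
      unfolding *[of X V, symmetric] *[of "\<lambda>n. J (X n)" "\<lambda>n. J (V n)", symmetric]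
      by (simp add: hess_def J_add J_scaleR J_minus field_simps)
  qed
  show ?thesis using Lim_transform_eventually[OF lim ev] by simp
qed

text \<open>Nonnegativity of \<open>log_form\<close> at the shifted point bounds
  \<open>hess \<psi>\<close> from above, best for the vector whose normal part is the minimiser
  \<omega>. The limit of the bound contains \<open>- nrm_term r p X0\<close>, which cancels the
  third-order term of \<open>DF_form\<close>; a square with weight from \<tau> remains to dominate
  the one with weight from \<eta>.\<close>

lemma DF_form_shifted:
  obtains e G where "\<forall>\<^sub>F n in sequentially. DF_form \<eta> (shifted \<kappa> (tn n)) (pn n) (X n) \<le> G n"
    "G \<longlonglongrightarrow> \<eta> / (1 - \<eta>) * (cmod (e - of_real \<kappa> * vec01 X0 (cplx (sqdist 0)) p + Hess r p (nrm r p) X0))\<^sup>2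
       - \<tau> / (1 - \<tau>) * (cmod (e + Hess r p (nrm r p) X0))\<^sup>2 - \<kappa> * (norm X0)\<^sup>2"
proof -
  let ?z = "Z pn tn" and ?N = "nrm r p"
  define H where "H = Hess r p ?N X0"
  have HX: "Hess r p X0 ?N = cnj H" unfolding H_def using Hess_cnj[OF open_U pU r2] by simp
  define \<omega> where "\<omega> = - cnj (H + of_real \<tau> * eX) / of_real (1 - \<tau>)"
  \<comment> \<open>Moving the point and subtracting \<open>dC_nrm\<close> changes
    \<open>vec10 (X n) (cplx r)\<close> by about \<open>- tn n * cnj H\<close>. This \<sigma>
    compensates the change and adds \<open>2 * \<omega>\<close> per unit step; division by the
    depth, about \<open>2 * tn n\<close>, leaves \<omega>.\<close>
  define \<sigma> where "\<sigma> = 2 * \<omega> + cnj H"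
  define V where "V n = - dC_nrm r (pn n) (X n) + \<sigma> *s nrm r (pn n)" for n
  define Vl where "Vl = - dC_nrm r p X0 + \<sigma> *s ?N"
  have V: "V \<longlonglongrightarrow> Vl" unfolding V_def[abs_def] Vl_def
    by (intro tendsto_intros smult_tendsto dC_nrm_tendsto[OF pU] nu_tendsto[OF pU] pn X)
  define Y where "Y n = X n + tn n *\<^sub>R V n" for n
  have Y: "Y \<longlonglongrightarrow> X0" unfolding Y_def[abs_def] by (rule tendsto_line[OF X(1) V tn(2)])
  note nN = nun'[OF pn tn] and nz = nzt[OF pn tn]
  have L1: "(\<lambda>n. hess r (?z n) (Y n) / tn n) \<longlonglongrightarrow> - dd ?N (\<lambda>q. hess r q X0) p + 2 * Re (Hess r p Vl X0)"
  proof -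
    have "(\<lambda>n. (hess r (?z n) (X n + tn n *\<^sub>R V n) - hess r (pn n) (X n)) / tn n)
      \<longlonglongrightarrow> dd (- ?N) (\<lambda>q. hess r q X0) p + 2 * Re (Hess r p Vl X0)"
      by (rule strict_derivative_hess_tendsto[OF open_U pU r3 pn(2) nN tn(2) nz X(1) V])
    then show ?thesis unfolding dd_minus[OF dd_hess_eq(2)[OF pU]] by (simp add: X(3) Y_def)
  qed
  have L2: "(\<lambda>n. vec10 (Y n) (cplx r) (?z n) / of_real (tn n)) \<longlonglongrightarrow> 2 * \<omega>"
  proof -
    have "(\<lambda>n. (vec10 (X n + tn n *\<^sub>R V n) (cplx r) (?z n) - vec10 (X n) (cplx r) (pn n)) / of_real (tn n))
      \<longlonglongrightarrow> Complex (dd (- ?N) (dd X0 r) p / 2) (- dd (- ?N) (dd (J X0) r) p / 2) + vec10 Vl (cplx r) p"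
      by (rule strict_derivative_vec10_tendsto[OF open_U pU r2 pn(2) nN tn(2) nz X(1) V])
    moreover have "vec10 (X n) (cplx r) (pn n) = 0" for n using X(2)[of n] by (simp add: tangent10_def)
    moreover have "vec10 Vl (cplx r) p = \<sigma> - (cnj H - Complex (dd ?N (dd X0 r) p / 2) (- dd ?N (dd (J X0) r) p / 2))"
      using vec10_diff[of "\<sigma> *s ?N" "dC_nrm r p X0" "cplx r" p]
      unfolding Vl_def vec10_smult vec10_nu[OF pU] vec10_dC_nrm[OF pU] HX by simp
    moreover have "dd (- ?N) (dd v r) p = - dd ?N (dd v r) p" for v
      by (rule dd_minus[OF Ck_on_1_diff[OF Ck_on_2_dd[OF r2] pU]])
    ultimately show ?thesis by (simp add: Y_def \<sigma>_def Complex_eq)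
  qed
  have L3: "(\<lambda>n. - r (?z n) / tn n) \<longlonglongrightarrow> 2" using tendsto_minus[OF r_Z[OF pn tn]] by simp
  define P where "P n = vec10 (Y n) (cplx r) (?z n) / of_real (- r (?z n))" for n
  have P: "P \<longlonglongrightarrow> \<omega>"
  proof -
    have "(\<lambda>n. (vec10 (Y n) (cplx r) (?z n) / of_real (tn n)) / of_real (- r (?z n) / tn n)) \<longlonglongrightarrow> (2 * \<omega>) / of_real 2"
      by (intro tendsto_intros L2 L3) auto
    then show ?thesis unfolding P_def[abs_def] using tn(1) by (simp add: less_imp_neq[symmetric])
  qed
  define B where "B n = hess r (?z n) (Y n) / (- r (?z n)) + (cmod (P n))\<^sup>2 - \<tau> * (cmod (P n - vec10 (Y n) (cplx \<psi>) (?z n)))\<^sup>2" for n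
  have B: "B \<longlonglongrightarrow> - nrm_term r p X0 - \<tau> / (1 - \<tau>) * (cmod (eX + H))\<^sup>2"
  proof -
    have "(\<lambda>n. (hess r (?z n) (Y n) / tn n) / (- r (?z n) / tn n)) \<longlonglongrightarrow> (- dd ?N (\<lambda>q. hess r q X0) p + 2 * Re (Hess r p Vl X0)) / 2"
      by (intro tendsto_divide L1 L3) auto
    then have F1: "(\<lambda>n. hess r (?z n) (Y n) / (- r (?z n))) \<longlonglongrightarrow> (- dd ?N (\<lambda>q. hess r q X0) p + 2 * Re (Hess r p Vl X0)) / 2"
      using tn(1) by (simp add: less_imp_neq[symmetric])
    have BL: "B \<longlonglongrightarrow> (- dd ?N (\<lambda>q. hess r q X0) p + 2 * Re (Hess r p Vl X0)) / 2 + (cmod \<omega>)\<^sup>2 - \<tau> * (cmod (\<omega> - cnj eX))\<^sup>2"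
      unfolding B_def[abs_def]
      by (intro tendsto_add tendsto_diff tendsto_mult tendsto_power tendsto_norm tendsto_const F1 P vec10_\<psi>_lim Y)
    have RV: "Re (Hess r p Vl X0) = - Re (Hess r p (dC_nrm r p X0) X0) + (2 * Re (\<omega> * H) + (cmod H)\<^sup>2)"
    proof -
      have "Hess r p Vl X0 = - Hess r p (dC_nrm r p X0) X0 + \<sigma> * H"
        unfolding Vl_def Hess_add_left Hess_smult_left H_def
        using Hess_scaleR_left[of r p "-1" "dC_nrm r p X0" X0] by simp
      moreover have "Re (\<sigma> * H) = 2 * Re (\<omega> * H) + (cmod H)\<^sup>2"
        unfolding cmod_power2 by (simp add: \<sigma>_def power2_eq_square algebra_simps)
      ultimately show ?thesis by simp
    qed
    have lin: "2 * x + h + w - z = - q \<Longrightarrow> (- a + 2 * (- c + (2 * x + h))) / 2 + w - z = - (a / 2 + c) - q"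
      for a c x h w z q :: real by (simp add: field_simps)
    have "2 * Re (\<omega> * H) + (cmod H)\<^sup>2 + (cmod \<omega>)\<^sup>2 - \<tau> * (cmod (\<omega> - cnj eX))\<^sup>2 = - (\<tau> / (1 - \<tau>) * (cmod (eX + H))\<^sup>2)"
      using quadratic_minimum[OF \<tau>(2) \<omega>_def] by (simp add: add.commute[of H eX])
    then have "(- dd ?N (\<lambda>q. hess r q X0) p + 2 * Re (Hess r p Vl X0)) / 2 + (cmod \<omega>)\<^sup>2 - \<tau> * (cmod (\<omega> - cnj eX))\<^sup>2
       = - nrm_term r p X0 - \<tau> / (1 - \<tau>) * (cmod (eX + H))\<^sup>2"
      unfolding nu_term[OF pU] RV by (rule lin)
    then show ?thesis using BL by simp
  qed
  \<comment> \<open>Here plurisubharmonicity enters, with \<open>Y n\<close> as the test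
    vector.\<close>
  have le: "\<forall>\<^sub>F n in sequentially. hess \<psi> (?z n) (Y n) \<le> B n"
    using Z_\<Omega>[OF pn tn]
  proof eventually_elim
    case (elim n)
    show ?case using log_form_nonneg[OF elim, of "Y n"] unfolding log_form_def B_def P_def by linarith
  qed
  define G where "G n = \<eta> / (1 - \<eta>) * (cmod (vec01 (X n) (cplx (shifted \<kappa> (tn n))) (pn n) + Hess r (pn n) (nrm r (pn n)) (X n)))\<^sup>2
    + ((hess (shifted \<kappa> (tn n)) (pn n) (X n) - hess \<psi> (?z n) (X n + tn n *\<^sub>R V n)) + B n) + nrm_term r (pn n) (X n)" for n
  show ?thesis
  proof (rule that)
    show "\<forall>\<^sub>F n in sequentially. DF_form \<eta> (shifted \<kappa> (tn n)) (pn n) (X n) \<le> G n"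
      using le by eventually_elim (simp add: DF_form_def G_def Y_def)
    have "G \<longlonglongrightarrow> \<eta> / (1 - \<eta>) * (cmod ((eX - of_real \<kappa> * vec01 X0 (cplx (sqdist 0)) p) + Hess r p ?N X0))\<^sup>2
      + ((- \<kappa> * (norm X0)\<^sup>2) + (- nrm_term r p X0 - \<tau> / (1 - \<tau>) * (cmod (eX + H))\<^sup>2)) + nrm_term r p X0"
      unfolding G_def[abs_def]
      by (intro tendsto_intros vec01_shifted_lim hess_shifted_lim[OF V] B nrm_term_tendsto[OF pU] Hess_tendsto[OF open_U pU r2] nu_tendsto[OF pU] pn X)
    then show "G \<longlonglongrightarrow> \<eta> / (1 - \<eta>) * (cmod (eX - of_real \<kappa> * vec01 X0 (cplx (sqdist 0)) p + Hess r p (nrm r p) X0))\<^sup>2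
       - \<tau> / (1 - \<tau>) * (cmod (eX + Hess r p (nrm r p) X0))\<^sup>2 - \<kappa> * (norm X0)\<^sup>2"
      by (simp add: H_def algebra_simps)
  qed
qed

end

text \<open>Counterexamples for steps tending to 0 would have a limit at which
  \<open>DF_form_shifted\<close> bounds the form by a difference of two squares minus \<kappa>.
  Since \<open>\<eta> < \<tau>\<close>, that difference is at most \<kappa> / 4, which contradicts
  the lower bound \<open>- \<kappa> / 2\<close>.\<close>

lemma strict_shifted_form:
  assumes "0 < \<eta>" "\<eta> < \<tau>"
  obtains \<kappa> t where "\<kappa> > 0" "M \<subseteq> shift_dom t"
    "\<And>p X. p \<in> M \<Longrightarrow> X \<in> tangent10 r p \<Longrightarrow> hess r p X = 0 \<Longrightarrow> norm X = 1 \<Longrightarrow> DF_form \<eta> (shifted \<kappa> t) p X < - \<kappa> / 2"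
proof -
  define s where "s = \<eta> / (1 - \<eta>)"
  define u where "u = \<tau> / (1 - \<tau>)"
  have su: "0 \<le> s" "s < u" using assms \<tau> by (auto simp: s_def u_def field_simps)
  obtain B where B: "B > 0" "\<And>p. p \<in> M \<Longrightarrow> norm p \<le> B"
    using compact_imp_bounded[OF compact_M] unfolding bounded_pos by blast
  define C where "C = s * u / (u - s)"
  have C: "C \<ge> 0" using su by (simp add: C_def)
  \<comment> \<open>\<open>2 * B\<close> bounds \<open>vec01 X (cplx (sqdist 0)) p\<close> for unit
    vectors X and points p of \<open>M\<close>.\<close>
  obtain \<kappa> where \<kappa>: "\<kappa> > 0" "C * (\<kappa> * (2 * B))\<^sup>2 \<le> \<kappa> / 4"
    by (rule exists_small_perturbation[OF C]) (rule that)
  obtain \<epsilon> where \<epsilon>: "\<epsilon> > 0" "\<And>t q. 0 < t \<Longrightarrow> t < \<epsilon> \<Longrightarrow> q \<in> M \<Longrightarrow> q + t *\<^sub>R (- nrm r q) \<in> \<Omega>"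
    by (rule shift_into_\<Omega>) (rule that)
  \<comment> \<open>All steps stay below \<epsilon>, so that every shifted copy of \<open>M\<close>
    lies in \<Omega>, not just those late in the sequence.\<close>
  define t where "t n = \<epsilon> / 2 * (1 / real (Suc n))" for n
  have t: "t n > 0" "t n < \<epsilon>" for n using \<epsilon>(1) by (auto simp: t_def field_simps add_pos_nonneg)
  have "t \<longlonglongrightarrow> \<epsilon> / 2 * 0"
    unfolding t_def[abs_def] using LIMSEQ_inverse_real_of_nat
    by (intro tendsto_mult tendsto_const) (simp add: inverse_eq_divide)
  then have t0: "t \<longlonglongrightarrow> 0" by simp
  have dom: "M \<subseteq> shift_dom (t n)" for n
    using \<epsilon>(2)[OF t] M_sub(1) by (auto simp: shift_dom_def shift_def)
  have "\<exists>n. \<forall>p X. p \<in> M \<longrightarrow> X \<in> tangent10 r p \<longrightarrow> hess r p X = 0 \<longrightarrow> norm X = 1 \<longrightarrow> DF_form \<eta> (shifted \<kappa> (t n)) p X < - \<kappa> / 2"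
  proof (rule ccontr)
    assume "\<not> ?thesis"
    then obtain q Y where qY: "\<And>n. q n \<in> M" "\<And>n. Y n \<in> tangent10 r (q n)" "\<And>n. hess r (q n) (Y n) = 0" "\<And>n. norm (Y n) = 1"
      "\<And>n. - \<kappa> / 2 \<le> DF_form \<eta> (shifted \<kappa> (t n)) (q n) (Y n)" by (metis linorder_not_less)
    have "compact (M \<times> sphere (0 :: complex ^ 'n) 1)" by (intro compact_Times compact_M compact_sphere)
    moreover have "\<And>n. (q n, Y n) \<in> M \<times> sphere 0 1" using qY by auto
    ultimately obtain l \<phi> where \<phi>: "strict_mono (\<phi> :: nat \<Rightarrow> nat)" "((\<lambda>n. (q n, Y n)) \<circ> \<phi>) \<longlonglongrightarrow> l"
      unfolding compact_def by metis
    obtain p X0 where l: "l = (p, X0)" by (cases l)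
    have q: "(\<lambda>n. q (\<phi> n)) \<longlonglongrightarrow> p" and Y: "(\<lambda>n. Y (\<phi> n)) \<longlonglongrightarrow> X0"
      using tendsto_fst[OF \<phi>(2)] tendsto_snd[OF \<phi>(2)] by (auto simp: l o_def)
    have tn: "(\<lambda>n. t (\<phi> n)) \<longlonglongrightarrow> 0" using LIMSEQ_subseq_LIMSEQ[OF t0 \<phi>(1)] by (simp add: o_def)
    obtain e G where G: "\<forall>\<^sub>F n in sequentially. DF_form \<eta> (shifted \<kappa> (t (\<phi> n))) (q (\<phi> n)) (Y (\<phi> n)) \<le> G n"
      "G \<longlonglongrightarrow> \<eta> / (1 - \<eta>) * (cmod (e - of_real \<kappa> * vec01 X0 (cplx (sqdist 0)) p + Hess r p (nrm r p) X0))\<^sup>2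
       - \<tau> / (1 - \<tau>) * (cmod (e + Hess r p (nrm r p) X0))\<^sup>2 - \<kappa> * (norm X0)\<^sup>2"
      by (rule DF_form_shifted[where pn="\<lambda>n. q (\<phi> n)" and p=p and tn="\<lambda>n. t (\<phi> n)" and X="\<lambda>n. Y (\<phi> n)" and ?X0.0=X0 and \<eta>=\<eta> and \<kappa>=\<kappa>])
        (use qY q t tn Y in auto)
    define y H where "y = vec01 X0 (cplx (sqdist 0)) p" and "H = Hess r p (nrm r p) X0"
    have X1: "norm X0 = 1" using LIMSEQ_unique[OF tendsto_norm[OF Y]] qY(4) by simp
    have pM: "p \<in> M" using closed_sequentially[OF compact_imp_closed[OF compact_M] _ q] qY(1) by blast
    have "\<forall>\<^sub>F n in sequentially. - \<kappa> / 2 \<le> G n"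
      using G(1) by eventually_elim (use qY(5) order_trans in blast)
    then have "- \<kappa> / 2 \<le> s * (cmod (e - of_real \<kappa> * y + H))\<^sup>2 - u * (cmod (e + H))\<^sup>2 - \<kappa> * (norm X0)\<^sup>2"
      unfolding s_def u_def y_def H_def by (intro tendsto_lowerbound[OF G(2)]) auto
    also have "s * (cmod (e - of_real \<kappa> * y + H))\<^sup>2 \<le> u * (cmod (e + H))\<^sup>2 + C * (cmod (- (of_real \<kappa> * y)))\<^sup>2"
      using weighted_square_bound[OF su, of "e + H" "- (of_real \<kappa> * y)"] by (simp add: C_def algebra_simps)
    also have "C * (cmod (- (of_real \<kappa> * y)))\<^sup>2 \<le> C * (\<kappa> * (2 * B))\<^sup>2"
    proof (intro mult_left_mono power_mono C)
      have "cmod y \<le> 2 * norm p * norm X0" unfolding y_def by (rule norm_vec01_sqdist_le)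
      then have "cmod y \<le> 2 * B" using B(2)[OF pM] X1 by simp
      then show "cmod (- (of_real \<kappa> * y)) \<le> \<kappa> * (2 * B)" using \<kappa>(1) by (simp add: norm_mult)
    qed auto
    finally show False using \<kappa> X1 by simp
  qed
  then show ?thesis using that \<kappa>(1) dom by metis
qed

text \<open>The pulled-back function is of class C2 only. A second loss of exponent, from
  \<open>\<eta>'\<close> to \<eta>, and the slack \<kappa> / 2 pay for its replacement by a smooth
  one; vectors of other lengths follow by homogeneity.\<close>

lemma exists_smooth_form:
  assumes "0 < \<eta>" "\<eta> < \<tau>"
  obtains F where "smooth_on UNIV F"
    "\<And>p X. p \<in> M \<Longrightarrow> X \<in> tangent10 r p \<Longrightarrow> hess r p X = 0 \<Longrightarrow> DF_form \<eta> F p X \<le> 0"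
proof -
  define \<eta>' where "\<eta>' = (\<eta> + \<tau>) / 2"
  have \<eta>': "0 < \<eta>'" "\<eta> < \<eta>'" "\<eta>' < \<tau>" using assms by (auto simp: \<eta>'_def)
  obtain \<kappa> t where kt: "\<kappa> > 0" "M \<subseteq> shift_dom t"
    "\<And>p X. p \<in> M \<Longrightarrow> X \<in> tangent10 r p \<Longrightarrow> hess r p X = 0 \<Longrightarrow> norm X = 1 \<Longrightarrow> DF_form \<eta>' (shifted \<kappa> t) p X < - \<kappa> / 2"
    by (rule strict_shifted_form[OF \<eta>'(1,3)]) (rule that)
  define s where "s = \<eta> / (1 - \<eta>)"
  define u where "u = \<eta>' / (1 - \<eta>')"
  have su: "0 \<le> s" "s < u" using assms \<eta>' \<tau> by (auto simp: s_def u_def field_simps)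
  define C where "C = s * u / (u - s)"
  have C: "C \<ge> 0" using su by (simp add: C_def)
  obtain f W where f: "Ck_on 2 UNIV f" "open W" "M \<subseteq> W" "\<And>q. q \<in> W \<inter> UNIV \<Longrightarrow> f q = shifted \<kappa> t q" "bounded {x. f x \<noteq> 0}"
  proof (rule C2_glue[OF compact_M, of UNIV "shifted \<kappa> t"])
    fix p assume "p \<in> M"
    then show "\<exists>U F. open U \<and> p \<in> U \<and> Ck_on 2 U F \<and> (\<forall>q\<in>U \<inter> UNIV. F q = shifted \<kappa> t q)"
      using kt(2) open_shift_dom C2_shifted by (intro exI[of _ "shift_dom t"] exI[of _ "shifted \<kappa> t"]) auto
  qed (rule that)
  obtain B where B: "B > 0" "\<And>p. p \<in> M \<Longrightarrow> norm p \<le> B"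
    using compact_imp_bounded[OF compact_M] unfolding bounded_pos by blast
  \<comment> \<open>With \<open>e \<le> 1\<close> the squared first-order error is at most e. It
    costs \<open>C * e\<close>, the second-order error costs e, and together they use at most
    \<kappa> / 2.\<close>
  define e where "e = min 1 (\<kappa> / 2 / (C + 1))"
  have e: "e > 0" "e \<le> 1" "(C + 1) * e \<le> \<kappa> / 2"
  proof -
    show "e > 0" "e \<le> 1" using kt(1) C by (auto simp: e_def)
    have "(C + 1) * e \<le> (C + 1) * (\<kappa> / 2 / (C + 1))" using C by (intro mult_left_mono) (auto simp: e_def)
    also have "\<dots> = \<kappa> / 2"
    proof -
      have "a * (b / 2 / a) = b / 2" if "a \<noteq> 0" for a b :: real using that by simp
      from this[of "C + 1" \<kappa>] show ?thesis using C by linarith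
    qed
    finally show "(C + 1) * e \<le> \<kappa> / 2" .
  qed
  obtain F where F: "smooth_on UNIV F"
    "\<And>z v. norm z \<le> B \<Longrightarrow> \<bar>dd v F z - dd v f z\<bar> \<le> e * norm v"
    "\<And>z v w. norm z \<le> B \<Longrightarrow> \<bar>dd w (dd v F) z - dd w (dd v f) z\<bar> \<le> e * norm v * norm w"
    by (rule smooth_approximation[OF f(1,5) e(1) B(1)]) (rule that)
  have F2: "Ck_on 2 UNIV F" using F(1) by (simp add: smooth_on_def)
  have unit: "DF_form \<eta> F p X \<le> 0" if p: "p \<in> M" and X: "X \<in> tangent10 r p" "hess r p X = 0" "norm X = 1" for p X
  proof -
    let ?a = "vec01 X (cplx f) p + Hess r p (nrm r p) X" and ?b = "vec01 X (cplx F) p - vec01 X (cplx f) p"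
    note pB = B(2)[OF p]
    have b: "cmod ?b \<le> e"
    proof -
      have R: "Re ?b = (dd X F p - dd X f p) / 2" "Im ?b = (dd (J X) F p - dd (J X) f p) / 2"
        by (simp_all add: vec01_cplx Ck_on_2_diff[OF F2] Ck_on_2_diff[OF f(1)] diff_divide_distrib)
      have "cmod ?b \<le> \<bar>(dd X F p - dd X f p) / 2\<bar> + \<bar>(dd (J X) F p - dd (J X) f p) / 2\<bar>"
        using cmod_le[of ?b] unfolding R .
      also have "\<bar>(dd X F p - dd X f p) / 2\<bar> + \<bar>(dd (J X) F p - dd (J X) f p) / 2\<bar> \<le> e"
        using F(2)[OF pB, of X] F(2)[OF pB, of "J X"] X(3) by simp
      finally show ?thesis .
    qed
    have "s * (cmod (?a + ?b))\<^sup>2 \<le> u * (cmod ?a)\<^sup>2 + C * (cmod ?b)\<^sup>2"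
      unfolding C_def by (rule weighted_square_bound[OF su])
    also have "C * (cmod ?b)\<^sup>2 \<le> C * e"
    proof -
      have "(cmod ?b)\<^sup>2 \<le> e\<^sup>2" using b by (intro power_mono) auto
      also have "\<dots> \<le> e" using e by (simp add: power2_eq_square mult_left_le)
      finally show ?thesis using C by (rule mult_left_mono)
    qed
    finally have 1: "s * (cmod (vec01 X (cplx F) p + Hess r p (nrm r p) X))\<^sup>2 \<le> u * (cmod ?a)\<^sup>2 + C * e"
      by (simp add: algebra_simps)
    have 2: "hess F p X \<le> hess f p X + e"
    proof -
      have "\<bar>dd X (dd X F) p - dd X (dd X f) p\<bar> \<le> e" "\<bar>dd (J X) (dd (J X) F) p - dd (J X) (dd (J X) f) p\<bar> \<le> e"
        using F(3)[OF pB, of X X] F(3)[OF pB, of "J X" "J X"] X(3) by simp_all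
      moreover have "(A + B) / 4 \<le> (a + b) / 4 + e" if "\<bar>A - a\<bar> \<le> e" "\<bar>B - b\<bar> \<le> e" for A B a b :: real
        using that e(1) by (simp add: field_simps abs_le_iff)
      ultimately show ?thesis unfolding hess_def by blast
    qed
    have "DF_form \<eta> F p X \<le> DF_form \<eta>' f p X + (C + 1) * e"
      using 1 2 unfolding DF_form_def s_def[symmetric] u_def[symmetric] by (simp add: algebra_simps)
    also have "DF_form \<eta>' f p X = DF_form \<eta>' (shifted \<kappa> t) p X"
      by (rule DF_form_cong_open[OF f(2) _ _ Ck_on_subset[OF f(1)]]) (use f p in auto)
    finally show ?thesis using kt(3)[OF p X] e(3) by simp
  qed
  show ?thesis
  proof (rule that[OF F(1)])
    fix p X assume p: "p \<in> M" and X: "X \<in> tangent10 r p" "hess r p X = 0"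
    have pU: "p \<in> U" using p M_sub by blast
    define Y where "Y = (1 / norm X) *\<^sub>R X"
    have XY: "X = norm X *\<^sub>R Y" by (cases "X = 0") (auto simp: Y_def)
    show "DF_form \<eta> F p X \<le> 0"
    proof (cases "X = 0")
      case True
      then show ?thesis using DF_form_scaleR[OF pU open_UNIV UNIV_I F2, of \<eta> 0 X] by simp
    next
      case False
      have "DF_form \<eta> F p Y \<le> 0"
      proof (rule unit[OF p])
        show "Y \<in> tangent10 r p" using X(1) by (simp add: Y_def tangent10_def vec10_scaleR)
        show "hess r p Y = 0" using X(2) by (simp add: Y_def hess_scaleR[OF open_U pU r2])
        show "norm Y = 1" using False by (simp add: Y_def)
      qed
      then show ?thesis
        using DF_form_scaleR[OF pU open_UNIV UNIV_I F2, of \<eta> "norm X" Y] XY by (simp add: mult_nonneg_nonpos)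
    qed
  qed
qed

text \<open>The smooth function lives on the whole space, so V can be taken as \<open>M\<close>;
  \<open>extension_independent\<close> carries the inequality over to every other extension of its
  restriction.\<close>

lemma hypersurface_exponent:
  assumes "0 < \<eta>" "\<eta> < \<tau>"
  shows "\<eta> \<in> hypersurface_DF_exponents M r"
proof -
  obtain F where F: "smooth_on UNIV F"
    "\<And>p X. p \<in> M \<Longrightarrow> X \<in> tangent10 r p \<Longrightarrow> hess r p X = 0 \<Longrightarrow> DF_form \<eta> F p X \<le> 0"
    by (rule exists_smooth_form[OF assms]) (rule that)
  have F2: "Ck_on 2 V F" for V using F(1) Ck_on_subset[of 2 UNIV F V] by (simp add: smooth_on_def)
  have \<eta>1: "\<eta> < 1" using assms \<tau> by simp
  have "DF_inequality_at r F' \<eta> p (L p)"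
    if L: "tangent_field M r L" and p: "p \<in> null_set M r L" and ext: "smooth_extension_at M F p U' F'" for L p U' F'
  proof -
    have pM: "p \<in> M" and pU: "p \<in> U" using p M_sub by (auto simp: null_set_def)
    have X: "L p \<in> tangent10 r p" using L pM by (simp add: tangent_field_def)
    have h: "hess r p (L p) = 0" using p Hess_self[OF open_U pU r2, of "L p"] by (simp add: null_set_def)
    have U': "open U'" "p \<in> U'" "Ck_on 2 U' F'" "\<And>q. q \<in> U' \<inter> M \<Longrightarrow> F' q = F q"
      using ext by (auto simp: smooth_extension_at_def smooth_on_def)
    have "DF_form \<eta> F' p (L p) = DF_form \<eta> F p (L p)"
      by (rule DF_form_cong; rule extension_independent[OF U'(1,2) pM U'(3) F2 U'(4) X h])
    then show ?thesis
      using DF_inequality_DF_form[OF pM assms(1) \<eta>1 U'(1-3), of "L p"] F(2)[OF pM X h] by simp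
  qed
  moreover have "smooth_on_subset M F"
    unfolding smooth_on_subset_def smooth_extension_at_def using F(1) by blast
  moreover have "levi_degenerate_set M r \<subseteq> M" by (auto simp: levi_degenerate_set_def)
  ultimately show ?thesis
    unfolding hypersurface_DF_exponents_def using assms(1) \<eta>1
    by (auto intro!: exI[of _ M] exI[of _ F])
qed

end

section \<open>From the hypersurface to the domain\<close>

context smooth_domain begin

text \<open>A null vector of a nonnegative Hermitian form lies in its kernel: otherwise adding a
  large multiple of X to Y would make the form negative.\<close>

lemma Levi_Cauchy_Schwarz:
  assumes p: "p \<in> M" and X: "X \<in> tangent10 r p" "hess r p X = 0" and Y: "Y \<in> tangent10 r p"
  shows "Hess r p X Y = 0"
proof -
  have pU: "p \<in> U" using p M_sub by blast
  define H where "H = Hess r p Y X"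
  have "0 \<le> hess r p Y - 2 * t * (cmod H)\<^sup>2" for t
  proof -
    obtain z where z: "z = - of_real t * H" by simp
    have "Y + z *s X \<in> tangent10 r p" using X Y by (simp add: tangent10_def vec10_add vec10_smult)
    then have "0 \<le> hess r p (Y + z *s X)" by (rule hess_nonneg[OF p])
    also have "\<dots> = hess r p Y + 2 * Re (cnj z * H)"
      unfolding hess_add[OF open_U pU r2] hess_smult[OF open_U pU r2] Hess_smult_right X(2) H_def by simp
    also have "Re (cnj z * H) = - t * (cmod H)\<^sup>2"
      unfolding cmod_power2 z by (simp add: power2_eq_square algebra_simps)
    finally show ?thesis by (simp add: mult.assoc)
  qed
  \<comment> \<open>For \<open>H \<noteq> 0\<close> this value of t turns the right-hand side into
    -1.\<close>
  from this[of "(hess r p Y + 1) / (2 * (cmod H)\<^sup>2)"] have "H = 0"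
    by (cases "H = 0") auto
  then show ?thesis using Hess_cnj[OF open_U pU r2, of Y X] by (simp add: H_def)
qed

text \<open>Normalised null vectors can be passed to the limit, so this set is compact; the gluing
  of \<psi> takes place around it.\<close>

definition "null_points = {p \<in> M. \<exists>X. X \<in> tangent10 r p \<and> norm X = 1 \<and> hess r p X = 0}"

lemma null_points_degenerate: "null_points \<subseteq> levi_degenerate_set M r"
proof
  fix p assume "p \<in> null_points"
  then obtain X where p: "p \<in> M" and X: "X \<in> tangent10 r p" "norm X = 1" "hess r p X = 0"
    by (auto simp: null_points_def)
  have "X \<noteq> 0" using X(2) by auto
  moreover have "\<forall>Y\<in>tangent10 r p. Hess r p X Y = 0" using Levi_Cauchy_Schwarz[OF p X(1,3)] by blast
  ultimately show "p \<in> levi_degenerate_set M r" using p X(1) by (auto simp: levi_degenerate_set_def)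
qed

lemma null_limit:
  assumes "\<And>n. p n \<in> M" "\<And>n. X n \<in> tangent10 r (p n)" "\<And>n. hess r (p n) (X n) = 0" "p \<longlonglongrightarrow> p0" "X \<longlonglongrightarrow> X0"
  shows "p0 \<in> M" "X0 \<in> tangent10 r p0" "hess r p0 X0 = 0"
proof -
  show p: "p0 \<in> M" using closed_sequentially[OF compact_imp_closed[OF compact_M] _ assms(4)] assms(1) by blast
  then have pU: "p0 \<in> U" using M_sub by blast
  have "(\<lambda>n. vec10 (X n) (cplx r) (p n)) \<longlonglongrightarrow> vec10 X0 (cplx r) p0"
    by (rule vec10_tendsto[OF open_U pU r1 assms(4,5)])
  then show "X0 \<in> tangent10 r p0" using assms(2) by (simp add: tangent10_def LIMSEQ_const_iff)
  have "(\<lambda>n. hess r (p n) (X n)) \<longlonglongrightarrow> hess r p0 X0"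
    by (rule hess_tendsto[OF open_U pU r2 assms(4,5)])
  then show "hess r p0 X0 = 0" using assms(3) by (simp add: LIMSEQ_const_iff)
qed

lemma compact_null_points: "compact null_points"
proof -
  have "closed null_points"
  proof (rule closed_sequential_limits[THEN iffD2], intro allI impI)
    fix q l assume "(\<forall>n. q n \<in> null_points) \<and> q \<longlonglongrightarrow> l"
    then have q: "\<And>n. q n \<in> null_points" "q \<longlonglongrightarrow> l" by auto
    then obtain X where X: "\<And>n. X n \<in> tangent10 r (q n) \<and> norm (X n) = 1 \<and> hess r (q n) (X n) = 0"
      unfolding null_points_def by simp metis
    have "\<And>n. X n \<in> sphere 0 1" using X by simp
    then obtain X0 \<phi> where \<phi>: "strict_mono (\<phi> :: nat \<Rightarrow> nat)" "(X \<circ> \<phi>) \<longlonglongrightarrow> X0"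
      using compact_sphere[of "0 :: complex ^ 'n" 1] unfolding compact_def by metis
    have q\<phi>: "(q \<circ> \<phi>) \<longlonglongrightarrow> l" by (rule LIMSEQ_subseq_LIMSEQ[OF q(2) \<phi>(1)])
    have "l \<in> M" "X0 \<in> tangent10 r l" "hess r l X0 = 0"
      using null_limit[OF _ _ _ q\<phi> \<phi>(2)] X q(1) by (auto simp: null_points_def)
    moreover have "norm X0 = 1" using LIMSEQ_unique[OF tendsto_norm[OF \<phi>(2)]] X by simp
    ultimately show "l \<in> null_points" by (auto simp: null_points_def)
  qed
  moreover have "null_points \<subseteq> M" by (auto simp: null_points_def)
  ultimately show ?thesis using compact_M by (metis closed_Int_compact inf.absorb_iff1)
qed

text \<open>The exponents of the hypersurface test vector fields, not single vectors. The constant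
  field X is projected off the normal and multiplied by the squared gradient to avoid a division:
  the result is tangent along all of \<open>M\<close> and a positive multiple of X wherever X is
  tangent.\<close>

lemma exists_tangent_field:
  fixes X :: "complex ^ 'n"
  obtains L where "tangent_field M r L" "\<And>p. p \<in> M \<Longrightarrow> X \<in> tangent10 r p \<Longrightarrow> \<exists>c>0. L p = c *\<^sub>R X"
proof -
  define L where "L q = (gradient r q \<bullet> gradient r q) *\<^sub>R X - dd X r q *\<^sub>R gradient r q + dd (J X) r q *\<^sub>R J (gradient r q)" for q
  have g: "Ck_on k U0 (gradient r)" for k by (rule Ck_on_gradient[OF open_U0 C_r])
  have "Ck_on k U0 L" for k
    unfolding L_def[abs_def]
    by (intro Ck_on_add Ck_on_diff Ck_on_scaleR Ck_on_inner Ck_on_const Ck_on_dd C_r g Ck_on_linear_compose[OF bounded_linear_J] open_U0)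
  then have "smooth_on_subset M L"
    unfolding smooth_on_subset_def smooth_extension_at_def smooth_on_def using open_U0 M_sub(2) by blast
  moreover have "L p \<in> tangent10 r p" if "p \<in> M" for p
  proof -
    have pU: "p \<in> U" using that M_sub by blast
    have "gradient r p \<bullet> J (gradient r p) = 0" by simp
    then have "2 * vec10 (gradient r p) (cplx r) p = of_real (gradient r p \<bullet> gradient r p)"
      unfolding vec10_cplx[OF rd[OF pU]] inner_gradient[OF rd[OF pU], symmetric] by (simp add: complex_eq_iff)
    moreover have "L p = (gradient r p \<bullet> gradient r p) *\<^sub>R X - (2 * vec10 X (cplx r) p) *s gradient r p"
      unfolding L_def vec10_cplx[OF rd[OF pU]] vector_smult_eq by simp
    ultimately show ?thesis by (simp add: tangent10_def vec10_diff vec10_scaleR vec10_smult)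
  qed
  moreover have "\<exists>c>0. L p = c *\<^sub>R X" if "p \<in> M" "X \<in> tangent10 r p" for p
    using that tangent_iff[of p X] M_sub gradient_nz[of p]
    by (intro exI[of _ "gradient r p \<bullet> gradient r p"]) (auto simp: L_def)
  ultimately show ?thesis using that[of L] by (simp add: tangent_field_def)
qed

text \<open>\<psi> is known only through local extensions around points of V. They are glued around
  the compact set \<open>null_points\<close>, and on null vectors the form of the glued function
  agrees with that of any local extension.\<close>

lemma exists_C2_form:
  assumes \<eta>: "\<eta> \<in> hypersurface_DF_exponents M r"
  obtains f where "Ck_on 2 UNIV f"
    "\<And>p X. p \<in> M \<Longrightarrow> X \<in> tangent10 r p \<Longrightarrow> hess r p X = 0 \<Longrightarrow> norm X = 1 \<Longrightarrow> DF_form \<eta> f p X \<le> 0"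
proof -
  obtain V \<psi> where V: "openin (top_of_set M) V" "levi_degenerate_set M r \<subseteq> V" "smooth_on_subset V \<psi>"
    and ineq: "\<And>L p U F. tangent_field M r L \<Longrightarrow> p \<in> null_set M r L \<Longrightarrow> smooth_extension_at V \<psi> p U F \<Longrightarrow> DF_inequality_at r F \<eta> p (L p)"
    and \<eta>01: "0 < \<eta>" "\<eta> < 1"
    using \<eta> unfolding hypersurface_DF_exponents_def by blast
  obtain O' where O': "open O'" "V = M \<inter> O'" using V(1) by (auto simp: openin_open)
  have KV: "null_points \<subseteq> V" using null_points_degenerate V(2) by blast
  obtain f W where f: "Ck_on 2 UNIV f" "open W" "null_points \<subseteq> W" "\<And>q. q \<in> W \<inter> V \<Longrightarrow> f q = \<psi> q" "bounded {x. f x \<noteq> 0}"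
  proof (rule C2_glue[OF compact_null_points, of V \<psi>])
    fix p assume "p \<in> null_points"
    then have "p \<in> V" using KV by blast
    then obtain U' F where "smooth_extension_at V \<psi> p U' F" using V(3) unfolding smooth_on_subset_def by blast
    then show "\<exists>U F. open U \<and> p \<in> U \<and> Ck_on 2 U F \<and> (\<forall>q\<in>U \<inter> V. F q = \<psi> q)"
      unfolding smooth_extension_at_def smooth_on_def by blast
  qed (rule that)
  show ?thesis
  proof (rule that[OF f(1)])
    fix p X assume p: "p \<in> M" and X: "X \<in> tangent10 r p" "hess r p X = 0" "norm X = 1"
    have pU: "p \<in> U" using p M_sub by blast
    have pK: "p \<in> null_points" using p X by (auto simp: null_points_def)
    have pV: "p \<in> V" using pK KV by blast
    obtain U' F where ext: "smooth_extension_at V \<psi> p U' F" using V(3) pV unfolding smooth_on_subset_def by blast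
    have F: "open U'" "p \<in> U'" "Ck_on 2 U' F" "\<And>q. q \<in> U' \<inter> V \<Longrightarrow> F q = \<psi> q"
      using ext by (auto simp: smooth_extension_at_def smooth_on_def)
    obtain L where L: "tangent_field M r L" "\<And>p. p \<in> M \<Longrightarrow> X \<in> tangent10 r p \<Longrightarrow> \<exists>c>0. L p = c *\<^sub>R X"
      by (rule exists_tangent_field[of X]) (rule that)
    obtain c where c: "c > 0" "L p = c *\<^sub>R X" using L(2)[OF p X(1)] by blast
    have "Hess r p (L p) (L p) = 0"
      unfolding Hess_self[OF open_U pU r2] c(2) hess_scaleR[OF open_U pU r2] X(2) by simp
    then have "p \<in> null_set M r L" using p by (simp add: null_set_def)
    then have "DF_inequality_at r F \<eta> p (L p)" by (rule ineq[OF L(1) _ ext])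
    then have "DF_form \<eta> F p (L p) \<le> 0" using DF_inequality_DF_form[OF p \<eta>01 F(1-3)] by simp
    then have le: "DF_form \<eta> F p X \<le> 0"
      unfolding c(2) DF_form_scaleR[OF pU F(1-3)] using c(1) by (simp add: mult_le_0_iff)
    \<comment> \<open>Intersecting with \<open>O'\<close> ensures that the points of
      \<open>M\<close> under comparison lie in V, where both functions equal \<psi>.\<close>
    have W': "open (U' \<inter> W \<inter> O')" "p \<in> U' \<inter> W \<inter> O'" using F f O' pV pK by auto
    have "F q = f q" if "q \<in> (U' \<inter> W \<inter> O') \<inter> M" for q using F(4)[of q] f(4)[of q] that O'(2) by simp
    then have "DF_form \<eta> F p X = DF_form \<eta> f p X"
      by (intro DF_form_cong; intro extension_independent[OF W' p Ck_on_subset[OF F(3)] Ck_on_subset[OF f(1)] _ X(1,2)]) auto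
    then show "DF_form \<eta> f p X \<le> 0" using le by simp
  qed
qed

text \<open>As for the shifted functions: the lower exponent admits the perturbation
  \<open>- \<kappa> |z|\<^sup>2\<close>, and that makes the form strictly negative on unit null
  vectors.\<close>

lemma exists_strict_form:
  assumes \<eta>: "\<eta> \<in> hypersurface_DF_exponents M r" and \<tau>: "0 < \<tau>" "\<tau> < \<eta>"
  obtains f where "Ck_on 2 UNIV f"
    "\<And>p X. p \<in> M \<Longrightarrow> X \<in> tangent10 r p \<Longrightarrow> hess r p X = 0 \<Longrightarrow> norm X = 1 \<Longrightarrow> DF_form \<tau> f p X < 0"
proof -
  have "\<eta> < 1" using \<eta> by (simp add: hypersurface_DF_exponents_def)
  obtain f where f: "Ck_on 2 UNIV f"
    "\<And>p X. p \<in> M \<Longrightarrow> X \<in> tangent10 r p \<Longrightarrow> hess r p X = 0 \<Longrightarrow> norm X = 1 \<Longrightarrow> DF_form \<eta> f p X \<le> 0"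
    by (rule exists_C2_form[OF \<eta>]) (rule that)
  define s where "s = \<tau> / (1 - \<tau>)"
  define u where "u = \<eta> / (1 - \<eta>)"
  have su: "0 \<le> s" "s < u" using \<tau> \<open>\<eta> < 1\<close> by (auto simp: s_def u_def field_simps)
  define C where "C = s * u / (u - s)"
  have C: "C \<ge> 0" using su by (simp add: C_def)
  obtain B where B: "B > 0" "\<And>p. p \<in> M \<Longrightarrow> norm p \<le> B"
    using compact_imp_bounded[OF compact_M] unfolding bounded_pos by blast
  obtain \<kappa> where \<kappa>: "\<kappa> > 0" "C * (\<kappa> * (2 * B))\<^sup>2 \<le> \<kappa> / 4"
    by (rule exists_small_perturbation[OF C]) (rule that)
  define g where "g = (\<lambda>q. 1 * f q + (- \<kappa>) * sqdist 0 q)"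
  have g2: "Ck_on 2 UNIV g" unfolding g_def by (intro Ck_on_lincomb f Ck_on_sqdist open_UNIV)
  show ?thesis
  proof (rule that[OF g2])
    fix p X assume p: "p \<in> M" and X: "X \<in> tangent10 r p" "hess r p X = 0" "norm X = 1"
    define y where "y = vec01 X (cplx (sqdist 0)) p"
    define a where "a = vec01 X (cplx f) p + Hess r p (nrm r p) X"
    have v: "vec01 X (cplx g) p + Hess r p (nrm r p) X = a + - (of_real \<kappa> * y)"
      unfolding g_def vec01_lincomb[OF Ck_on_2_diff[OF f(1) UNIV_I] Ck_on_2_diff[OF Ck_on_sqdist UNIV_I]]
      by (simp add: a_def y_def)
    have h: "hess g p X = hess f p X - \<kappa>"
      unfolding g_def hess_lincomb[OF open_UNIV UNIV_I f(1) Ck_on_sqdist] hess_sqdist X(3) by simp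
    have "s * (cmod (a + - (of_real \<kappa> * y)))\<^sup>2 \<le> u * (cmod a)\<^sup>2 + C * (cmod (- (of_real \<kappa> * y)))\<^sup>2"
      unfolding C_def by (rule weighted_square_bound[OF su])
    also have "C * (cmod (- (of_real \<kappa> * y)))\<^sup>2 \<le> C * (\<kappa> * (2 * B))\<^sup>2"
    proof (intro mult_left_mono power_mono C)
      have "cmod y \<le> 2 * norm p * norm X" unfolding y_def by (rule norm_vec01_sqdist_le)
      then have "cmod y \<le> 2 * B" using B(2)[OF p] X(3) by simp
      then show "cmod (- (of_real \<kappa> * y)) \<le> \<kappa> * (2 * B)" using \<kappa>(1) by (simp add: norm_mult)
    qed auto
    also note \<kappa>(2)
    finally have "DF_form \<tau> g p X \<le> DF_form \<eta> f p X + \<kappa> / 4 - \<kappa>"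
      unfolding DF_form_def v h s_def[symmetric] u_def[symmetric] a_def[symmetric] by simp
    also have "\<dots> < 0" using f(2)[OF p X] \<kappa>(1) by simp
    finally show "DF_form \<tau> g p X < 0" .
  qed
qed

section \<open>Nonnegativity of \<open>log_form\<close> in a collar\<close>

lemma log_form_scaleR:
  assumes z: "z \<in> U0" and \<psi>: "Ck_on 2 UNIV \<psi>"
  shows "log_form \<tau> \<psi> z (c *\<^sub>R Y) = c\<^sup>2 * log_form \<tau> \<psi> z Y"
proof -
  have "vec10 (c *\<^sub>R Y) (cplx r) z / of_real (- r z) - vec10 (c *\<^sub>R Y) (cplx \<psi>) z
     = of_real c * (vec10 Y (cplx r) z / of_real (- r z) - vec10 Y (cplx \<psi>) z)"
    by (simp add: vec10_scaleR algebra_simps)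
  moreover have "vec10 (c *\<^sub>R Y) (cplx r) z / of_real (- r z) = of_real c * (vec10 Y (cplx r) z / of_real (- r z))"
    by (simp add: vec10_scaleR)
  ultimately show ?thesis
    unfolding log_form_def hess_scaleR[OF open_U0 z C_r] hess_scaleR[OF open_UNIV UNIV_I \<psi>]
    by (simp only: norm_mult power_mult_distrib) (simp add: algebra_simps)
qed

text \<open>The expansion of the form at \<open>L + \<delta> \<omega> \<nu>\<close> as a Hermitian quadratic polynomial in \<open>\<omega>\<close>.\<close>

lemma log_form_expansion:
  assumes z: "z \<in> U" "r z < 0" and \<psi>: "Ck_on 2 UNIV \<psi>" and L: "vec10 L (cplx r) z = 0"
  defines "\<delta> \<equiv> - r z" and "N \<equiv> nrm r z"
  defines "m \<equiv> vec10 N (cplx \<psi>) z" and "l \<equiv> vec10 L (cplx \<psi>) z"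
  shows "log_form \<tau> \<psi> z (L + (of_real \<delta> * \<omega>) *s N) = (hess r z L / \<delta> - hess \<psi> z L - \<tau> * (cmod l)\<^sup>2)
    + 2 * Re (\<omega> * (Hess r z N L - of_real \<delta> * Hess \<psi> z N L + of_real \<tau> * (1 - of_real \<delta> * m) * cnj l))
    + (1 + \<delta> * hess r z N - \<delta>\<^sup>2 * hess \<psi> z N - \<tau> * (cmod (1 - of_real \<delta> * m))\<^sup>2) * (cmod \<omega>)\<^sup>2"
proof -
  let ?c = "of_real \<delta> * \<omega>"
  have \<delta>: "\<delta> > 0" using z by (simp add: \<delta>_def)
  have expand: "hess f z (L + ?c *s N) = hess f z L + 2 * \<delta> * Re (\<omega> * Hess f z N L) + \<delta>\<^sup>2 * (cmod \<omega>)\<^sup>2 * hess f z N"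
    if f: "open W" "z \<in> W" "Ck_on 2 W f" for f W
  proof -
    have "Re (Hess f z L (?c *s N)) = Re (cnj (Hess f z L (?c *s N)))" by simp
    also have "cnj (Hess f z L (?c *s N)) = ?c * Hess f z N L"
      unfolding Hess_cnj[OF f] Hess_smult_left ..
    finally have R: "Re (Hess f z L (?c *s N)) = \<delta> * Re (\<omega> * Hess f z N L)" by (simp add: algebra_simps)
    show ?thesis unfolding hess_add[OF f] R hess_smult[OF f]
      by (simp add: norm_mult power_mult_distrib)
  qed
  have vr: "vec10 (L + ?c *s N) (cplx r) z = ?c"
    using L vec10_nu[OF z(1)] by (simp add: vec10_add vec10_smult N_def)
  have v\<psi>: "vec10 (L + ?c *s N) (cplx \<psi>) z = l + ?c * m"
    by (simp add: vec10_add vec10_smult l_def m_def)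
  have q: "?c / of_real \<delta> = \<omega>" using \<delta> by simp
  have sq: "(cmod (\<omega> - (l + ?c * m)))\<^sup>2 = (cmod \<omega>)\<^sup>2 * (cmod (1 - of_real \<delta> * m))\<^sup>2
      - 2 * Re (\<omega> * ((1 - of_real \<delta> * m) * cnj l)) + (cmod l)\<^sup>2"
  proof -
    have gen: "(cmod (a - b))\<^sup>2 = (cmod a)\<^sup>2 - 2 * Re (a * cnj b) + (cmod b)\<^sup>2" for a b
      unfolding cmod_power2 by (simp add: power2_eq_square algebra_simps)
    have e: "\<omega> - (l + ?c * m) = \<omega> * (1 - of_real \<delta> * m) - l" by (simp add: algebra_simps)
    show ?thesis unfolding e gen[of "\<omega> * (1 - of_real \<delta> * m)" l] by (simp only: norm_mult power_mult_distrib mult.assoc)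
  qed
  have fr: "- r z = \<delta>" by (simp add: \<delta>_def)
  have "log_form \<tau> \<psi> z (L + ?c *s N) = (hess r z L + 2 * \<delta> * Re (\<omega> * Hess r z N L) + \<delta>\<^sup>2 * (cmod \<omega>)\<^sup>2 * hess r z N) / \<delta>
     + (cmod \<omega>)\<^sup>2 - (hess \<psi> z L + 2 * \<delta> * Re (\<omega> * Hess \<psi> z N L) + \<delta>\<^sup>2 * (cmod \<omega>)\<^sup>2 * hess \<psi> z N)
     - \<tau> * ((cmod \<omega>)\<^sup>2 * (cmod (1 - of_real \<delta> * m))\<^sup>2 - 2 * Re (\<omega> * ((1 - of_real \<delta> * m) * cnj l)) + (cmod l)\<^sup>2)"
    unfolding log_form_def vr v\<psi> fr q sq expand[OF open_U z(1) r2] expand[OF open_UNIV UNIV_I \<psi>] ..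
  also have "(hess r z L + 2 * \<delta> * Re (\<omega> * Hess r z N L) + \<delta>\<^sup>2 * (cmod \<omega>)\<^sup>2 * hess r z N) / \<delta>
     = hess r z L / \<delta> + 2 * Re (\<omega> * Hess r z N L) + \<delta> * (cmod \<omega>)\<^sup>2 * hess r z N"
    using \<delta> by (simp add: add_divide_distrib power2_eq_square)
  also have "Re (\<omega> * Hess r z N L) = Re (\<omega> * (Hess r z N L - of_real \<delta> * Hess \<psi> z N L + of_real \<tau> * (1 - of_real \<delta> * m) * cnj l))
      + \<delta> * Re (\<omega> * Hess \<psi> z N L) - \<tau> * Re (\<omega> * ((1 - of_real \<delta> * m) * cnj l))"
  proof -
    have "\<omega> * (Hess r z N L - of_real \<delta> * Hess \<psi> z N L + of_real \<tau> * (1 - of_real \<delta> * m) * cnj l)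
       = \<omega> * Hess r z N L - of_real \<delta> * (\<omega> * Hess \<psi> z N L) + of_real \<tau> * (\<omega> * ((1 - of_real \<delta> * m) * cnj l))"
      by (simp add: algebra_simps)
    then show ?thesis by simp
  qed
  finally show ?thesis by (simp add: algebra_simps)
qed

text \<open>Multiplied by c, the polynomial is a complete square plus the positive number
  \<open>a * c - (cmod b)\<^sup>2\<close>.\<close>

lemma quadratic_nonneg:
  fixes \<omega> b :: complex
  assumes "c > 0" "(cmod b)\<^sup>2 < a * c"
  shows "0 \<le> a + 2 * Re (\<omega> * b) + c * (cmod \<omega>)\<^sup>2"
proof -
  have "c * (a + 2 * Re (\<omega> * b) + c * (cmod \<omega>)\<^sup>2) = (cmod (of_real c * \<omega> + cnj b))\<^sup>2 + (a * c - (cmod b)\<^sup>2)"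
    unfolding cmod_power2 by (simp add: power2_eq_square algebra_simps)
  then have "0 \<le> c * (a + 2 * Re (\<omega> * b) + c * (cmod \<omega>)\<^sup>2)" using assms by simp
  then show ?thesis using assms(1) by (simp add: zero_le_mult_iff)
qed

text \<open>Along the normal r grows at a rate close to 2, so the path with parameter up to twice
  the depth has left \<Omega> and crosses \<open>M\<close> on the way. The strict derivative between
  start and crossing then gives the crossing time as about half the depth.\<close>

lemma exit_time:
  assumes z: "\<And>n. z n \<in> \<Omega>" "z \<longlonglongrightarrow> p" and p: "p \<in> M"
  obtains t where "t \<longlonglongrightarrow> 0" "\<forall>\<^sub>F n in sequentially. 0 < t n \<and> z n + t n *\<^sub>R nrm r (z n) \<in> M"
    "(\<lambda>n. t n / (- r (z n))) \<longlonglongrightarrow> 1 / 2"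
proof -
  have pU: "p \<in> U" using p M_sub by blast
  define \<delta> where "\<delta> n = - r (z n)" for n
  have \<delta>: "\<delta> n > 0" for n using z(1)[of n] \<Omega>_eq by (auto simp: \<delta>_def)
  have zU: "\<forall>\<^sub>F n in sequentially. z n \<in> U" by (rule topological_tendstoD[OF z(2) open_U pU])
  have rz: "(\<lambda>n. r (z n)) \<longlonglongrightarrow> 0"
    using isCont_tendsto_compose[OF _ z(2), of r] Ck_on_imp_continuous_on[OF r1] open_U pU r_M[OF p]
    by (simp add: continuous_on_eq_continuous_at)
  have \<delta>0: "\<delta> \<longlonglongrightarrow> 0" using tendsto_minus[OF rz] by (simp add: \<delta>_def[abs_def])
  then have \<delta>20: "(\<lambda>n. 2 * \<delta> n) \<longlonglongrightarrow> 0" using tendsto_mult[OF tendsto_const[of 2] \<delta>0] by simp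
  have nz: "\<forall>\<^sub>F n in sequentially. 2 * \<delta> n \<noteq> 0" using \<delta> by (simp add: less_imp_neq[symmetric])
  have nu: "(\<lambda>n. nrm r (z n)) \<longlonglongrightarrow> nrm r p" by (rule nu_tendsto[OF pU z(2)])
  have lim: "(\<lambda>n. (r (z n + (2 * \<delta> n) *\<^sub>R nrm r (z n)) - r (z n)) / (2 * \<delta> n)) \<longlonglongrightarrow> 2"
    using strict_derivative_tendsto[OF open_U pU r1 z(2) nu \<delta>20 nz] dd_nu(1)[OF pU] by simp
  have "\<forall>\<^sub>F n in sequentially. (r (z n + (2 * \<delta> n) *\<^sub>R nrm r (z n)) - r (z n)) / (2 * \<delta> n) > 1"
    by (rule order_tendstoD(1)[OF lim]) simp
  then have "\<forall>\<^sub>F n in sequentially. \<exists>t. 0 < t \<and> t \<le> 2 * \<delta> n \<and> z n + t *\<^sub>R nrm r (z n) \<in> M"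
  proof eventually_elim
    case (elim n)
    let ?y = "z n + (2 * \<delta> n) *\<^sub>R nrm r (z n)"
    have "2 * \<delta> n < r ?y - r (z n)" using elim \<delta>[of n] by (simp add: field_simps)
    then have "r ?y > 0" using \<delta>[of n] by (simp add: \<delta>_def)
    then have "?y \<notin> \<Omega>" using \<Omega>_eq by auto
    then have "closed_segment (z n) ?y \<inter> M \<noteq> {}"
      using z(1) by (intro connected_Int_frontier connected_segment) auto
    then obtain u where u: "0 \<le> u" "u \<le> 1" "(1 - u) *\<^sub>R z n + u *\<^sub>R ?y \<in> M"
      unfolding closed_segment_def by auto
    have e: "(1 - u) *\<^sub>R z n + u *\<^sub>R ?y = z n + (u * (2 * \<delta> n)) *\<^sub>R nrm r (z n)"
      by (simp add: vec_eq_iff scaleR_conv_of_real algebra_simps)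
    have "u \<noteq> 0" using u(3) M_not_\<Omega> z(1)[of n] by (auto simp: e)
    then have "0 < u * (2 * \<delta> n)" "u * (2 * \<delta> n) \<le> 2 * \<delta> n" using u \<delta>[of n] by (auto simp: mult_left_le_one_le)
    then show ?case using u(3) unfolding e by blast
  qed
  then obtain t where t: "\<forall>\<^sub>F n in sequentially. 0 < t n \<and> t n \<le> 2 * \<delta> n \<and> z n + t n *\<^sub>R nrm r (z n) \<in> M"
    unfolding eventually_ex by blast
  have t0: "t \<longlonglongrightarrow> 0"
    by (rule Lim_null_comparison[OF _ \<delta>20]) (use t in \<open>auto elim: eventually_mono\<close>)
  have tnz: "\<forall>\<^sub>F n in sequentially. t n \<noteq> 0" using t by (auto elim: eventually_mono)
  have "(\<lambda>n. (r (z n + t n *\<^sub>R nrm r (z n)) - r (z n)) / t n) \<longlonglongrightarrow> 2"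
    using strict_derivative_tendsto[OF open_U pU r1 z(2) nu t0 tnz] dd_nu(1)[OF pU] by simp
  then have "(\<lambda>n. 1 / ((r (z n + t n *\<^sub>R nrm r (z n)) - r (z n)) / t n)) \<longlonglongrightarrow> 1 / 2"
    by (intro tendsto_intros) auto
  moreover have "\<forall>\<^sub>F n in sequentially. 1 / ((r (z n + t n *\<^sub>R nrm r (z n)) - r (z n)) / t n) = t n / (- r (z n))"
    using t by eventually_elim (simp add: r_M)
  ultimately have "(\<lambda>n. t n / (- r (z n))) \<longlonglongrightarrow> 1 / 2" by (rule Lim_transform_eventually)
  moreover have "\<forall>\<^sub>F n in sequentially. 0 < t n \<and> z n + t n *\<^sub>R nrm r (z n) \<in> M"
    using t by (rule eventually_mono) simp
  ultimately show ?thesis using that[OF t0] by blast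
qed

text \<open>Clearing powers of the depth shows that the limit vector is tangent, then that it is
  null. Now the form is a quadratic polynomial in the normal component, and its limiting
  discriminant condition is the strict hypersurface inequality. The interior value of
  \<open>hess r\<close> is bounded below by comparison with the exit point on \<open>M\<close>,
  where the Levi form is nonnegative.\<close>

lemma log_form_eventually_nonneg:
  assumes \<tau>: "0 < \<tau>" "\<tau> < 1" and \<psi>: "Ck_on 2 UNIV \<psi>"
    and strict: "\<And>p X. p \<in> M \<Longrightarrow> X \<in> tangent10 r p \<Longrightarrow> hess r p X = 0 \<Longrightarrow> norm X = 1 \<Longrightarrow> DF_form \<tau> \<psi> p X < 0"
    and z: "\<And>n. z n \<in> \<Omega>" "z \<longlonglongrightarrow> p" and p: "p \<in> M" and Y: "Y \<longlonglongrightarrow> Y0" "norm Y0 = 1"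
    and neg: "\<And>n. log_form \<tau> \<psi> (z n) (Y n) < 0"
  shows False
proof -
  have pU: "p \<in> U" using p M_sub by blast
  define \<delta> where "\<delta> n = - r (z n)" for n
  have \<delta>: "\<delta> n > 0" for n using z(1)[of n] \<Omega>_eq by (auto simp: \<delta>_def)
  have zU: "\<forall>\<^sub>F n in sequentially. z n \<in> U" by (rule topological_tendstoD[OF z(2) open_U pU])
  have rz: "(\<lambda>n. r (z n)) \<longlonglongrightarrow> 0"
    using isCont_tendsto_compose[OF _ z(2), of r] Ck_on_imp_continuous_on[OF r1] open_U pU r_M[OF p]
    by (simp add: continuous_on_eq_continuous_at)
  have \<delta>0: "\<delta> \<longlonglongrightarrow> 0" using tendsto_minus[OF rz] by (simp add: \<delta>_def[abs_def])
  define N where "N n = nrm r (z n)" for n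
  define c where "c n = vec10 (Y n) (cplx r) (z n)" for n
  define w where "w n = vec10 (Y n) (cplx \<psi>) (z n)" for n
  have N: "N \<longlonglongrightarrow> nrm r p" unfolding N_def[abs_def] by (rule nu_tendsto[OF pU z(2)])
  have c: "c \<longlonglongrightarrow> vec10 Y0 (cplx r) p" unfolding c_def[abs_def] by (rule vec10_tendsto[OF open_U pU r1 z(2) Y(1)])
  have \<psi>v: "(\<lambda>n. vec10 (V n) (cplx \<psi>) (z n)) \<longlonglongrightarrow> vec10 V0 (cplx \<psi>) p" if "V \<longlonglongrightarrow> V0" for V V0
    by (rule vec10_tendsto[OF open_UNIV UNIV_I Ck_on_2_1[OF \<psi>] z(2) that])
  have \<psi>h: "(\<lambda>n. hess \<psi> (z n) (V n)) \<longlonglongrightarrow> hess \<psi> p V0" if "V \<longlonglongrightarrow> V0" for V V0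
    by (rule hess_tendsto[OF open_UNIV UNIV_I \<psi> z(2) that])
  have rh: "(\<lambda>n. hess r (z n) (V n)) \<longlonglongrightarrow> hess r p V0" if "V \<longlonglongrightarrow> V0" for V V0
    by (rule hess_tendsto[OF open_U pU r2 z(2) that])
  have w: "w \<longlonglongrightarrow> vec10 Y0 (cplx \<psi>) p" unfolding w_def[abs_def] by (rule \<psi>v[OF Y(1)])
  have lf: "log_form \<tau> \<psi> (z n) (Y n) = hess r (z n) (Y n) / \<delta> n + (cmod (c n))\<^sup>2 / (\<delta> n)\<^sup>2 - hess \<psi> (z n) (Y n)
      - \<tau> * ((cmod (c n - of_real (\<delta> n) * w n))\<^sup>2 / (\<delta> n)\<^sup>2)" for n
  proof -
    have "c n / of_real (\<delta> n) - w n = (c n - of_real (\<delta> n) * w n) / of_real (\<delta> n)"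
      using \<delta>[of n] by (simp add: diff_divide_distrib)
    then show ?thesis unfolding log_form_def \<delta>_def[symmetric] c_def[symmetric] w_def[symmetric]
      by (simp add: norm_divide power_divide)
  qed
  \<comment> \<open>The form times the squared depth tends to \<open>(1 - \<tau>)\<close> times the
    squared normal component, which must then be 0.\<close>
  have c0: "vec10 Y0 (cplx r) p = 0"
  proof -
    have "(\<lambda>n. hess r (z n) (Y n) * \<delta> n + (cmod (c n))\<^sup>2 - hess \<psi> (z n) (Y n) * (\<delta> n)\<^sup>2
        - \<tau> * (cmod (c n - of_real (\<delta> n) * w n))\<^sup>2) \<longlonglongrightarrow> hess r p Y0 * 0 + (cmod (vec10 Y0 (cplx r) p))\<^sup>2 - hess \<psi> p Y0 * 0\<^sup>2
        - \<tau> * (cmod (vec10 Y0 (cplx r) p - of_real 0 * vec10 Y0 (cplx \<psi>) p))\<^sup>2"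
      by (intro tendsto_intros rh \<psi>h \<delta>0 c w Y)
    moreover have "hess r (z n) (Y n) * \<delta> n + (cmod (c n))\<^sup>2 - hess \<psi> (z n) (Y n) * (\<delta> n)\<^sup>2
        - \<tau> * (cmod (c n - of_real (\<delta> n) * w n))\<^sup>2 \<le> 0" for n
    proof -
      have "hess r (z n) (Y n) * \<delta> n + (cmod (c n))\<^sup>2 - hess \<psi> (z n) (Y n) * (\<delta> n)\<^sup>2
        - \<tau> * (cmod (c n - of_real (\<delta> n) * w n))\<^sup>2 = (\<delta> n)\<^sup>2 * log_form \<tau> \<psi> (z n) (Y n)"
        using \<delta>[of n] unfolding lf by (simp add: power2_eq_square field_simps)
      then show ?thesis using neg[of n] by (simp add: mult_le_0_iff)
    qed
    ultimately have "hess r p Y0 * 0 + (cmod (vec10 Y0 (cplx r) p))\<^sup>2 - hess \<psi> p Y0 * 0\<^sup>2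
        - \<tau> * (cmod (vec10 Y0 (cplx r) p - of_real 0 * vec10 Y0 (cplx \<psi>) p))\<^sup>2 \<le> 0"
      by (intro tendsto_upperbound) auto
    then have "(1 - \<tau>) * (cmod (vec10 Y0 (cplx r) p))\<^sup>2 \<le> 0" by (simp add: algebra_simps)
    then show ?thesis using \<tau> by (simp add: mult_le_0_iff)
  qed
  then have T: "Y0 \<in> tangent10 r p" by (simp add: tangent10_def)
  define C where "C = \<tau> * 1 / (1 - \<tau>)"
  \<comment> \<open>\<open>weighted_square_bound\<close> with weights \<tau> and 1 disposes of the
    two squares at the price of an error that vanishes with the depth; the remaining limit is the
    Levi form, which is therefore at most 0.\<close>
  have h0: "hess r p Y0 = 0"
  proof -
    have "(\<lambda>n. hess r (z n) (Y n) - C * \<delta> n * (cmod (w n))\<^sup>2 - hess \<psi> (z n) (Y n) * \<delta> n)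
       \<longlonglongrightarrow> hess r p Y0 - C * 0 * (cmod (vec10 Y0 (cplx \<psi>) p))\<^sup>2 - hess \<psi> p Y0 * 0"
      by (intro tendsto_intros rh \<psi>h \<delta>0 w Y)
    moreover have "hess r (z n) (Y n) - C * \<delta> n * (cmod (w n))\<^sup>2 - hess \<psi> (z n) (Y n) * \<delta> n \<le> 0" for n
    proof -
      have "\<tau> * (cmod (c n + - (of_real (\<delta> n) * w n)))\<^sup>2 \<le> 1 * (cmod (c n))\<^sup>2 + C * (cmod (- (of_real (\<delta> n) * w n)))\<^sup>2"
        unfolding C_def using \<tau> by (intro weighted_square_bound) auto
      then have 1: "\<tau> * (cmod (c n - of_real (\<delta> n) * w n))\<^sup>2 \<le> (cmod (c n))\<^sup>2 + C * (\<delta> n)\<^sup>2 * (cmod (w n))\<^sup>2"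
        by (simp add: norm_mult power_mult_distrib mult.assoc)
      have "hess r (z n) (Y n) * \<delta> n + (cmod (c n))\<^sup>2 - hess \<psi> (z n) (Y n) * (\<delta> n)\<^sup>2
        - \<tau> * (cmod (c n - of_real (\<delta> n) * w n))\<^sup>2 = (\<delta> n)\<^sup>2 * log_form \<tau> \<psi> (z n) (Y n)"
        using \<delta>[of n] unfolding lf by (simp add: power2_eq_square field_simps)
      also have "\<dots> \<le> 0" using neg[of n] by (simp add: mult_le_0_iff)
      finally have "\<delta> n * (hess r (z n) (Y n) - C * \<delta> n * (cmod (w n))\<^sup>2 - hess \<psi> (z n) (Y n) * \<delta> n) \<le> 0"
        using 1 by (simp add: power2_eq_square algebra_simps)
      then show ?thesis using \<delta>[of n] by (simp add: mult_le_0_iff)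
    qed
    ultimately have "hess r p Y0 - C * 0 * (cmod (vec10 Y0 (cplx \<psi>) p))\<^sup>2 - hess \<psi> p Y0 * 0 \<le> 0"
      by (intro tendsto_upperbound) auto
    then show ?thesis using hess_nonneg[OF p T] by simp
  qed
  define e where "e = vec01 Y0 (cplx \<psi>) p"
  have e: "vec10 Y0 (cplx \<psi>) p = cnj e"
    unfolding e_def vec01_vec10[OF Ck_on_2_diff[OF \<psi> UNIV_I]] by simp
  define H where "H = Hess r p (nrm r p) Y0"
  have HY: "Hess r p Y0 (nrm r p) = cnj H" unfolding H_def using Hess_cnj[OF open_U pU r2] by simp
  have S: "\<tau> / (1 - \<tau>) * (cmod (e + H))\<^sup>2 + hess \<psi> p Y0 + nrm_term r p Y0 < 0"
    using strict[OF p T h0 Y(2)] by (simp add: DF_form_def e_def H_def)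
  obtain t where t: "t \<longlonglongrightarrow> 0" "\<forall>\<^sub>F n in sequentially. 0 < t n \<and> z n + t n *\<^sub>R nrm r (z n) \<in> M"
    "(\<lambda>n. t n / (- r (z n))) \<longlonglongrightarrow> 1 / 2"
    by (rule exit_time[OF z p]) (rule that)
  have tnz: "\<forall>\<^sub>F n in sequentially. t n \<noteq> 0" using t(2) by (auto elim: eventually_mono)
  define q where "q n = z n + t n *\<^sub>R N n" for n
  have q: "q \<longlonglongrightarrow> p" unfolding q_def[abs_def] by (rule tendsto_line[OF z(2) N t(1)])
  define L where "L n = Y n - c n *s N n" for n
  have L: "L \<longlonglongrightarrow> Y0"
    unfolding L_def[abs_def] using tendsto_diff[OF Y(1) smult_tendsto[OF c N]] by (simp add: c0)
  define D where "D n = dC_nrm r (z n) (L n)" for n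
  have D: "D \<longlonglongrightarrow> dC_nrm r p Y0" unfolding D_def[abs_def] by (rule dC_nrm_tendsto[OF pU z(2) L])
  have vL: "\<forall>\<^sub>F n in sequentially. vec10 (L n) (cplx r) (z n) = 0"
    using zU by eventually_elim (simp add: L_def vec10_diff vec10_smult N_def vec10_nu c_def)
  \<comment> \<open>Corrected by \<open>D n\<close>, the vector is not yet tangent at the exit
    point; \<open>x n\<close> is the defect per unit step, and \<open>W n\<close> removes it along
    the normal.\<close>
  define x where "x n = vec10 (L n + t n *\<^sub>R D n) (cplx r) (q n) / of_real (t n)" for n
  have x: "x \<longlonglongrightarrow> cnj H"
  proof -
    have "(\<lambda>n. (vec10 (L n + t n *\<^sub>R D n) (cplx r) (z n + t n *\<^sub>R N n) - vec10 (L n) (cplx r) (z n)) / of_real (t n))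
      \<longlonglongrightarrow> Complex (dd (nrm r p) (dd Y0 r) p / 2) (- dd (nrm r p) (dd (J Y0) r) p / 2) + vec10 (dC_nrm r p Y0) (cplx r) p"
      by (rule strict_derivative_vec10_tendsto[OF open_U pU r2 z(2) N t(1) tnz L D])
    then have "(\<lambda>n. (vec10 (L n + t n *\<^sub>R D n) (cplx r) (q n) - vec10 (L n) (cplx r) (z n)) / of_real (t n)) \<longlonglongrightarrow> cnj H"
      unfolding vec10_dC_nrm[OF pU] HY q_def by simp
    then show ?thesis
      by (rule Lim_transform_eventually) (use vL in \<open>auto elim: eventually_mono simp: x_def\<close>)
  qed
  define W where "W n = D n - x n *s nrm r (q n)" for n
  have W: "W \<longlonglongrightarrow> dC_nrm r p Y0 - cnj H *s nrm r p"
    unfolding W_def[abs_def] by (intro tendsto_diff D smult_tendsto x nu_tendsto[OF pU q])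
  define K where "K n = (hess r (q n) (L n + t n *\<^sub>R W n) - hess r (z n) (L n)) / t n" for n
  \<comment> \<open>The rate at which \<open>hess r\<close> changes from \<open>z n\<close> to the
    exit point. Removing the normal defect, with limit \<open>cnj H\<close>, lowers the rate by
    \<open>2 * (cmod H)\<^sup>2\<close>.\<close>
  have K: "K \<longlonglongrightarrow> 2 * (nrm_term r p Y0 - (cmod H)\<^sup>2)"
  proof -
    have KL: "K \<longlonglongrightarrow> dd (nrm r p) (\<lambda>q. hess r q Y0) p + 2 * Re (Hess r p (dC_nrm r p Y0 - cnj H *s nrm r p) Y0)"
      unfolding K_def[abs_def] q_def by (rule strict_derivative_hess_tendsto[OF open_U pU r3 z(2) N t(1) tnz L W])
    have E: "Hess r p (dC_nrm r p Y0 - cnj H *s nrm r p) Y0 = Hess r p (dC_nrm r p Y0) Y0 - cnj H * H"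
      using Hess_add_left[of r p "dC_nrm r p Y0" "(- cnj H) *s nrm r p" Y0] Hess_smult_left[of r p "- cnj H" "nrm r p" Y0]
      by (simp add: H_def)
    have "Re (cnj H * H) = (cmod H)\<^sup>2" unfolding cmod_power2 by (simp add: power2_eq_square)
    then have "Re (Hess r p (dC_nrm r p Y0 - cnj H *s nrm r p) Y0) = Re (Hess r p (dC_nrm r p Y0) Y0) - (cmod H)\<^sup>2"
      unfolding E by simp
    then have "dd (nrm r p) (\<lambda>q. hess r q Y0) p + 2 * Re (Hess r p (dC_nrm r p Y0 - cnj H *s nrm r p) Y0)
       = 2 * (nrm_term r p Y0 - (cmod H)\<^sup>2)"
      unfolding nu_term[OF pU] by simp
    then show ?thesis using KL by simp
  qed
  have tq: "\<forall>\<^sub>F n in sequentially. 0 < t n \<and> q n \<in> M"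
    using t(2) unfolding q_def N_def .
  \<comment> \<open>The coefficients of \<open>log_form_expansion\<close>, except that here
    \<open>hess r (z n) (L n) / \<delta> n\<close> is replaced by its lower bound obtained from
    \<open>M\<close>.\<close>
  define a where "a n = - K n * (t n / (- r (z n))) - hess \<psi> (z n) (L n) - \<tau> * (cmod (vec10 (L n) (cplx \<psi>) (z n)))\<^sup>2" for n
  define m where "m n = vec10 (N n) (cplx \<psi>) (z n)" for n
  define b where "b n = Hess r (z n) (N n) (L n) - of_real (\<delta> n) * Hess \<psi> (z n) (N n) (L n)
     + of_real \<tau> * (1 - of_real (\<delta> n) * m n) * cnj (vec10 (L n) (cplx \<psi>) (z n))" for n
  define k where "k n = 1 + \<delta> n * hess r (z n) (N n) - (\<delta> n)\<^sup>2 * hess \<psi> (z n) (N n) - \<tau> * (cmod (1 - of_real (\<delta> n) * m n))\<^sup>2" for n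
  have m: "m \<longlonglongrightarrow> vec10 (nrm r p) (cplx \<psi>) p" unfolding m_def[abs_def] by (rule \<psi>v[OF N])
  have aL: "a \<longlonglongrightarrow> - (2 * (nrm_term r p Y0 - (cmod H)\<^sup>2)) * (1 / 2) - hess \<psi> p Y0 - \<tau> * (cmod (vec10 Y0 (cplx \<psi>) p))\<^sup>2"
    unfolding a_def[abs_def] by (intro tendsto_diff tendsto_mult tendsto_minus tendsto_power tendsto_norm tendsto_const K t(3) \<psi>h \<psi>v L)
  have bL: "b \<longlonglongrightarrow> Hess r p (nrm r p) Y0 - of_real 0 * Hess \<psi> p (nrm r p) Y0
     + of_real \<tau> * (1 - of_real 0 * vec10 (nrm r p) (cplx \<psi>) p) * cnj (vec10 Y0 (cplx \<psi>) p)"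
    unfolding b_def[abs_def]
    by (intro tendsto_add tendsto_diff tendsto_mult tendsto_cnj tendsto_of_real tendsto_const Hess_tendsto[OF open_U pU r2 z(2)]
        Hess_tendsto[OF open_UNIV UNIV_I \<psi> z(2)] \<delta>0 m \<psi>v L N)
  have kL: "k \<longlonglongrightarrow> 1 + 0 * hess r p (nrm r p) - 0\<^sup>2 * hess \<psi> p (nrm r p) - \<tau> * (cmod (1 - of_real 0 * vec10 (nrm r p) (cplx \<psi>) p))\<^sup>2"
    unfolding k_def[abs_def] by (intro tendsto_intros rh \<psi>h \<delta>0 m N)
  have bL': "b \<longlonglongrightarrow> H + of_real \<tau> * e" using bL by (simp add: e H_def)
  have kL': "k \<longlonglongrightarrow> 1 - \<tau>" using kL by simp
  have aL': "a \<longlonglongrightarrow> (cmod H)\<^sup>2 - nrm_term r p Y0 - hess \<psi> p Y0 - \<tau> * (cmod e)\<^sup>2" using aL by (simp add: e diff_divide_distrib)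
  have "(\<lambda>n. a n * k n - (cmod (b n))\<^sup>2) \<longlonglongrightarrow> ((cmod H)\<^sup>2 - nrm_term r p Y0 - hess \<psi> p Y0 - \<tau> * (cmod e)\<^sup>2) * (1 - \<tau>) - (cmod (H + of_real \<tau> * e))\<^sup>2"
    by (intro tendsto_intros aL' kL' bL')
  \<comment> \<open>The limit is \<open>(1 - \<tau>)\<close> times the negative of the hypersurface
    form, which is the inequality assumed to be strict.\<close>
  moreover have "((cmod H)\<^sup>2 - nrm_term r p Y0 - hess \<psi> p Y0 - \<tau> * (cmod e)\<^sup>2) * (1 - \<tau>) - (cmod (H + of_real \<tau> * e))\<^sup>2 > 0"
  proof -
    have alg: "m = d * (h - b) + d * q \<Longrightarrow> (h - y - x - b) * d - m = d * (- (q + x + y))"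
      for m d h b q x y :: real by (simp add: algebra_simps)
    have "(cmod (H + of_real \<tau> * e))\<^sup>2 = (1 - \<tau>) * ((cmod H)\<^sup>2 - \<tau> * (cmod e)\<^sup>2) + \<tau> * (cmod (e + H))\<^sup>2"
      unfolding cmod_power2 by (simp add: power2_eq_square algebra_simps)
    also have "\<tau> * (cmod (e + H))\<^sup>2 = (1 - \<tau>) * (\<tau> / (1 - \<tau>) * (cmod (e + H))\<^sup>2)" using \<tau> by simp
    finally have "((cmod H)\<^sup>2 - nrm_term r p Y0 - hess \<psi> p Y0 - \<tau> * (cmod e)\<^sup>2) * (1 - \<tau>) - (cmod (H + of_real \<tau> * e))\<^sup>2
       = (1 - \<tau>) * (- (\<tau> / (1 - \<tau>) * (cmod (e + H))\<^sup>2 + hess \<psi> p Y0 + nrm_term r p Y0))"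
      by (rule alg)
    moreover have "(1 - \<tau>) * (- (\<tau> / (1 - \<tau>) * (cmod (e + H))\<^sup>2 + hess \<psi> p Y0 + nrm_term r p Y0)) > 0"
      using S \<tau> by (intro mult_pos_pos) auto
    ultimately show ?thesis by linarith
  qed
  ultimately have ev1: "\<forall>\<^sub>F n in sequentially. a n * k n - (cmod (b n))\<^sup>2 > 0" by (rule order_tendstoD(1))
  have ev2: "\<forall>\<^sub>F n in sequentially. k n > 0" using order_tendstoD(1)[OF kL', of 0] \<tau> by simp
  have "\<forall>\<^sub>F n in sequentially. False"
    using ev1 ev2 tq zU vL topological_tendstoD[OF q open_U pU]
  proof eventually_elim
    case (elim n)
    have tn: "0 < t n" "q n \<in> M" using elim by auto
    have eq: "L n + t n *\<^sub>R W n = (L n + t n *\<^sub>R D n) - (of_real (t n) * x n) *s nrm r (q n)"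
      by (simp add: W_def vec_eq_iff) (simp add: scaleR_conv_of_real algebra_simps)
    have "vec10 (L n + t n *\<^sub>R W n) (cplx r) (q n) = 0"
      unfolding eq vec10_diff vec10_smult using tn vec10_nu[OF elim(6)] by (simp add: x_def)
    \<comment> \<open>Pseudoconvexity speaks about \<open>q n\<close>, a point of \<open>M\<close>;
      at the interior point \<open>z n\<close> no sign of the Levi form is known.\<close>
    then have "0 \<le> hess r (q n) (L n + t n *\<^sub>R W n)"
      by (intro hess_nonneg[OF tn(2)]) (simp add: tangent10_def)
    moreover have "hess r (q n) (L n + t n *\<^sub>R W n) = hess r (z n) (L n) + K n * t n"
      using tn by (simp add: K_def)
    ultimately have "- K n * t n / \<delta> n \<le> hess r (z n) (L n) / \<delta> n"
      using \<delta>[of n] by (intro divide_right_mono) auto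
    then have le: "a n \<le> hess r (z n) (L n) / \<delta> n - hess \<psi> (z n) (L n) - \<tau> * (cmod (vec10 (L n) (cplx \<psi>) (z n)))\<^sup>2"
      by (simp add: a_def \<delta>_def)
    define \<omega> where "\<omega> = c n / of_real (\<delta> n)"
    have "Y n = L n + (of_real (\<delta> n) * \<omega>) *s N n" using \<delta>[of n] by (simp add: L_def \<omega>_def)
    moreover have "r (z n) < 0" using \<delta>[of n] by (simp add: \<delta>_def)
    ultimately have "log_form \<tau> \<psi> (z n) (Y n) = (hess r (z n) (L n) / \<delta> n - hess \<psi> (z n) (L n) - \<tau> * (cmod (vec10 (L n) (cplx \<psi>) (z n)))\<^sup>2)
       + 2 * Re (\<omega> * b n) + k n * (cmod \<omega>)\<^sup>2"
      using log_form_expansion[OF elim(4) _ \<psi> elim(5), of \<tau> \<omega>]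
      unfolding \<delta>_def[symmetric] N_def[symmetric] m_def[symmetric] b_def k_def by simp
    moreover have "0 \<le> a n + 2 * Re (\<omega> * b n) + k n * (cmod \<omega>)\<^sup>2"
      by (rule quadratic_nonneg[OF elim(2)]) (use elim(1) in simp)
    ultimately show False using le neg[of n] by linarith
  qed
  then show False by simp
qed

text \<open>Negative values at depths tending to 0 would, after normalising the vectors, accumulate
  at a point of the closure where r vanishes, hence on \<open>M\<close>, which
  \<open>log_form_eventually_nonneg\<close> excludes.\<close>

lemma collar:
  assumes \<tau>: "0 < \<tau>" "\<tau> < 1" and \<psi>: "Ck_on 2 UNIV \<psi>"
    and strict: "\<And>p X. p \<in> M \<Longrightarrow> X \<in> tangent10 r p \<Longrightarrow> hess r p X = 0 \<Longrightarrow> norm X = 1 \<Longrightarrow> DF_form \<tau> \<psi> p X < 0"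
  obtains d where "d > 0" "\<And>z Y. z \<in> \<Omega> \<Longrightarrow> - d < r z \<Longrightarrow> 0 \<le> log_form \<tau> \<psi> z Y"
proof (rule ccontr)
  assume neg: "\<not> thesis"
  have "\<exists>z Y. z \<in> \<Omega> \<and> - (1 / real (Suc n)) < r z \<and> norm Y = 1 \<and> log_form \<tau> \<psi> z Y < 0" for n
  proof (rule ccontr)
    assume no: "\<nexists>z Y. z \<in> \<Omega> \<and> - (1 / real (Suc n)) < r z \<and> norm Y = 1 \<and> log_form \<tau> \<psi> z Y < 0"
    have "0 \<le> log_form \<tau> \<psi> z Y" if z: "z \<in> \<Omega>" "- (1 / real (Suc n)) < r z" for z Y
    proof -
      have zU: "z \<in> U0" using z \<Omega>_eq by blast
      show ?thesis
      proof (cases "Y = 0")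
        case True
        then show ?thesis using log_form_scaleR[OF zU \<psi>, of \<tau> 0 Y] by simp
      next
        case False
        have "norm ((1 / norm Y) *\<^sub>R Y) = 1" using False by simp
        then have "0 \<le> log_form \<tau> \<psi> z ((1 / norm Y) *\<^sub>R Y)" using no z by (meson not_le)
        then show ?thesis unfolding log_form_scaleR[OF zU \<psi>] using False by (simp add: zero_le_mult_iff zero_le_divide_iff)
      qed
    qed
    then show False using neg that[of "1 / real (Suc n)"] by simp
  qed
  then obtain z Y where zY: "\<And>n. z n \<in> \<Omega>" "\<And>n. - (1 / real (Suc n)) < r (z n)" "\<And>n. norm (Y n) = 1" "\<And>n. log_form \<tau> \<psi> (z n) (Y n) < 0"
    by metis
  have "compact (closure \<Omega> \<times> sphere (0 :: complex ^ 'n) 1)"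
    using bounded_\<Omega> by (intro compact_Times compact_sphere) (simp add: compact_closure)
  then have sc: "seq_compact (closure \<Omega> \<times> sphere (0 :: complex ^ 'n) 1)" by (rule compact_imp_seq_compact)
  have mem: "\<forall>n. (z n, Y n) \<in> closure \<Omega> \<times> sphere 0 1" using zY(3) subsetD[OF closure_subset zY(1)] by auto
  obtain l \<phi> where \<phi>: "l \<in> closure \<Omega> \<times> sphere 0 1" "strict_mono (\<phi> :: nat \<Rightarrow> nat)" "((\<lambda>n. (z n, Y n)) \<circ> \<phi>) \<longlonglongrightarrow> l"
    by (rule seq_compactE[OF sc mem]) (rule that)
  obtain p Y0 where l: "l = (p, Y0)" by (cases l)
  have z: "(\<lambda>n. z (\<phi> n)) \<longlonglongrightarrow> p" and Y: "(\<lambda>n. Y (\<phi> n)) \<longlonglongrightarrow> Y0"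
    using tendsto_fst[OF \<phi>(3)] tendsto_snd[OF \<phi>(3)] by (auto simp: l o_def)
  have pc: "p \<in> closure \<Omega>" "norm Y0 = 1" using \<phi>(1) by (auto simp: l)
  have rp: "(\<lambda>n. r (z (\<phi> n))) \<longlonglongrightarrow> r p"
  proof (rule isCont_tendsto_compose[OF _ z])
    have "p \<in> U0" using pc(1) closure_U0 by blast
    then show "isCont r p"
      using Ck_on_imp_continuous_on[OF C_r[of 0]] unfolding continuous_on_eq_continuous_at[OF open_U0] by blast
  qed
  have "(\<lambda>n. - (1 / real (Suc (\<phi> n)))) \<longlonglongrightarrow> - 0"
    using LIMSEQ_subseq_LIMSEQ[OF LIMSEQ_inverse_real_of_nat \<phi>(2)] by (intro tendsto_minus) (simp add: inverse_eq_divide o_def)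
  then have "- 0 \<le> r p"
    by (rule LIMSEQ_le[OF _ rp]) (use zY(2) in \<open>auto intro: less_imp_le\<close>)
  then have "r p = 0" using r_le[OF pc(1)] by simp
  then have pM: "p \<in> M" by (rule closure_r0_M[OF pc(1)])
  show False
    by (rule log_form_eventually_nonneg[OF \<tau> \<psi> strict zY(1) z pM Y pc(2) zY(4)])
qed

end

text \<open>A convex \<open>C\<^sup>2\<close> function that is constant for \<open>s \<le> -2a\<close> and the identity for \<open>s \<ge> -a\<close>:
  its second derivative is the tent function on \<open>[-2a, -a]\<close> with integral 1.\<close>

definition flat :: "real \<Rightarrow> real \<Rightarrow> real" where
  "flat a s = 2 / (3 * a\<^sup>2) * ((max 0 (s + 2 * a))^3 - 2 * (max 0 (s + 3 / 2 * a))^3 + (max 0 (s + a))^3) - 3 / 2 * a"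

definition flat' :: "real \<Rightarrow> real \<Rightarrow> real" where
  "flat' a s = 2 / a\<^sup>2 * ((max 0 (s + 2 * a))^2 - 2 * (max 0 (s + 3 / 2 * a))^2 + (max 0 (s + a))^2)"

definition flat'' :: "real \<Rightarrow> real \<Rightarrow> real" where
  "flat'' a s = 4 / a\<^sup>2 * (max 0 (s + 2 * a) - 2 * max 0 (s + 3 / 2 * a) + max 0 (s + a))"

lemma DERIV_flat: "(flat a has_real_derivative flat' a s) (at s)"
proof -
  have d: "((\<lambda>s. (max 0 (s + c))^3) has_real_derivative 3 * (max 0 (s + c))^2) (at s)" for c
    using DERIV_chain2[OF max_cube_derivative DERIV_add[OF DERIV_ident DERIV_const]] by simp
  have alg: "2 / (3 * k) * (3 * x - 2 * (3 * y) + 3 * z) - 0 = 2 / k * (x - 2 * y + z)" for k x y z :: real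
    by (cases "k = 0") (simp_all add: field_simps)
  show ?thesis
    unfolding flat_def[abs_def] flat'_def
    by (rule DERIV_cong[OF DERIV_diff[OF DERIV_cmult[OF DERIV_add[OF DERIV_diff[OF d DERIV_cmult[OF d]] d]] DERIV_const]])
      (rule alg)
qed

lemma DERIV_flat': "(flat' a has_real_derivative flat'' a s) (at s)"
proof -
  have d: "((\<lambda>s. (max 0 (s + c))^2) has_real_derivative 2 * max 0 (s + c)) (at s)" for c
    using DERIV_chain2[OF max_square_derivative DERIV_add[OF DERIV_ident DERIV_const]] by simp
  show ?thesis
    unfolding flat'_def[abs_def] flat''_def
    by (rule DERIV_cong[OF DERIV_cmult[OF DERIV_add[OF DERIV_diff[OF d DERIV_cmult[OF d]] d]]])
      (simp add: field_simps)
qed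

context
  fixes a :: real
  assumes a: "a > 0"
begin

lemma flat_id: "- a \<le> s \<Longrightarrow> flat a s = s"
proof -
  assume s: "- a \<le> s"
  then have "flat a s = 2 / (3 * a\<^sup>2) * ((s + 2 * a)^3 - 2 * (s + 3 / 2 * a)^3 + (s + a)^3) - 3 / 2 * a"
    using a by (simp add: flat_def max_def)
  also have "(s + 2 * a)^3 - 2 * (s + 3 / 2 * a)^3 + (s + a)^3 = 3 / 2 * (s + 3 / 2 * a) * a\<^sup>2"
    by (simp add: power3_eq_cube power2_eq_square field_simps)
  also have "2 / (3 * a\<^sup>2) * (3 / 2 * (s + 3 / 2 * a) * a\<^sup>2) = s + 3 / 2 * a"
    using a by simp
  finally show ?thesis by simp
qed

lemma flat_left: "s \<le> - 2 * a \<Longrightarrow> flat' a s = 0 \<and> flat'' a s = 0"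
  using a by (simp add: flat'_def flat''_def max_def)

lemma flat''_nonneg: "0 \<le> flat'' a s"
proof -
  have "0 \<le> max 0 (s + 2 * a) - 2 * max 0 (s + 3 / 2 * a) + max 0 (s + a)" using a by (simp add: max_def)
  then show ?thesis unfolding flat''_def by (intro mult_nonneg_nonneg) auto
qed

lemma flat'_nonneg: "0 \<le> flat' a s"
proof (cases "s \<le> - 2 * a")
  case False
  then have "- 2 * a \<le> s" by simp
  from DERIV_nonneg_imp_nondecreasing[OF this, of "flat' a"] have "flat' a (- 2 * a) \<le> flat' a s"
    using DERIV_flat' flat''_nonneg by blast
  then show ?thesis using flat_left[of "- 2 * a"] by simp
qed (simp add: flat_left)

lemma flat_neg: "s < 0 \<Longrightarrow> flat a s < 0"
proof (cases "- a \<le> s")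
  case False
  then have "s \<le> - a" by simp
  from DERIV_nonneg_imp_nondecreasing[OF this, of "flat a"] have "flat a s \<le> flat a (- a)"
    using DERIV_flat flat'_nonneg by blast
  then show ?thesis using flat_id[of "- a"] a by simp
qed (simp add: flat_id)

end

lemma Ck_on_flat:
  fixes f :: "'a::real_normed_vector \<Rightarrow> real"
  assumes "open U" "Ck_on 2 U f"
  shows "Ck_on 2 U (\<lambda>x. flat a (f x))"
proof -
  have "continuous_on U (\<lambda>x. flat'' a (f x))"
    unfolding flat''_def by (intro continuous_intros Ck_on_imp_continuous_on[OF assms(2)])
  then have "Ck_on (Suc 0) U (\<lambda>x. flat' a (f x))"
    using assms by (intro Ck_on_compose_real[where g="flat' a" and g'="flat'' a", OF assms(1) DERIV_flat']) (auto dest: Ck_on_2_1)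
  then have "Ck_on (Suc 1) U (\<lambda>x. flat a (f x))"
    using assms by (intro Ck_on_compose_real[where g="flat a" and g'="flat' a", OF assms(1) DERIV_flat]) (auto simp: numeral_2_eq_2)
  then show ?thesis by (simp add: numeral_2_eq_2)
qed

context smooth_domain begin

text \<open>Besides plurisubharmonicity in all of \<Omega>, a defining function near the closure is
  required. As \<open>flat a\<close> is the identity on values close to 0, the modified function
  continues across \<open>M\<close> as r times \<open>exp \<psi>\<close>, with nonzero gradient
  there.\<close>

lemma DF_exponent:
  assumes \<eta>: "\<eta> \<in> hypersurface_DF_exponents M r" and \<tau>: "0 < \<tau>" "\<tau> < \<eta>"
  shows "\<tau> \<in> DF_exponents \<Omega>"
proof -
  have \<tau>1: "\<tau> < 1" using \<eta> \<tau> by (simp add: hypersurface_DF_exponents_def)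
  obtain \<psi> where \<psi>: "Ck_on 2 UNIV \<psi>"
    "\<And>p X. p \<in> M \<Longrightarrow> X \<in> tangent10 r p \<Longrightarrow> hess r p X = 0 \<Longrightarrow> norm X = 1 \<Longrightarrow> DF_form \<tau> \<psi> p X < 0"
    using exists_strict_form[OF \<eta> \<tau>] by metis
  obtain d where d: "d > 0" "\<And>z Y. z \<in> \<Omega> \<Longrightarrow> - d < r z \<Longrightarrow> 0 \<le> log_form \<tau> \<psi> z Y"
    by (rule collar[OF \<tau>(1) \<tau>1 \<psi>(1)]) (erule (3) \<psi>(2), rule that)
  have rneg: "r z < 0" if "z \<in> \<Omega>" for z using that \<Omega>_eq by blast
  have \<Omega>U0: "\<Omega> \<subseteq> U0" using \<Omega>_eq by blast
  have r\<Omega>: "Ck_on 2 \<Omega> r" by (rule Ck_on_subset[OF C_r \<Omega>U0])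
  have \<psi>\<Omega>: "Ck_on 2 V \<psi>" for V by (rule Ck_on_subset[OF \<psi>(1)]) simp
  define g where "g z = ln (- r z) + \<psi> z" for z
  define w where "w z = - exp (\<tau> * g z)" for z
  have g2: "Ck_on 2 \<Omega> g" unfolding g_def[abs_def]
    by (intro Ck_on_add Ck_on_ln Ck_on_minus r\<Omega> \<psi>\<Omega> open_\<Omega>) (use rneg in auto)
  have w2: "Ck_on 2 \<Omega> w" unfolding w_def[abs_def]
    by (intro Ck_on_minus Ck_on_exp Ck_on_cmult g2 open_\<Omega>)
  have hw: "0 \<le> hess w z Y" if "z \<in> \<Omega>" "- d < r z" for z Y
  proof -
    have "hess w z Y = \<tau> * exp (\<tau> * (ln (- r z) + \<psi> z)) * log_form \<tau> \<psi> z Y"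
      unfolding w_def[abs_def] g_def log_form_def by (rule hess_neg_exp[OF open_\<Omega> that(1) r\<Omega> rneg \<psi>\<Omega>])
    then show ?thesis using d(2)[OF that] \<tau> by simp
  qed
  \<comment> \<open>The part of \<Omega> outside the collar is compact, so the negative function w
    stays away from 0 on it; if that part is empty, any positive a will do.\<close>
  obtain a where a: "a > 0" "\<And>z. z \<in> \<Omega> \<Longrightarrow> r z \<le> - d \<Longrightarrow> w z \<le> - 2 * a"
  proof -
    define S where "S = closure \<Omega> \<inter> {z \<in> U0. r z \<le> - d}"
    have "closed S"
    proof -
      have "closedin (top_of_set (closure \<Omega>)) (closure \<Omega> \<inter> r -` {..- d})"
        by (rule continuous_closedin_preimage[OF continuous_on_subset[OF Ck_on_imp_continuous_on[OF C_r[of 0]] closure_U0]]) simp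
      moreover have "closure \<Omega> \<inter> r -` {..- d} = S" using closure_U0 by (auto simp: S_def)
      ultimately show ?thesis using closedin_closed_trans closed_closure by metis
    qed
    then have cS: "compact S"
      using bounded_\<Omega> by (auto simp: S_def compact_eq_bounded_closed intro: bounded_subset[OF bounded_closure])
    have S\<Omega>: "S \<subseteq> \<Omega>" using d(1) \<Omega>_eq by (auto simp: S_def)
    show ?thesis
    proof (cases "S = {}")
      case True
      then have "\<not> r z \<le> - d" if "z \<in> \<Omega>" for z using that \<Omega>U0 closure_subset by (auto simp: S_def)
      then show ?thesis using that[of 1] by auto
    next
      case False
      obtain z0 where z0: "z0 \<in> S" "\<And>z. z \<in> S \<Longrightarrow> w z \<le> w z0"
        using continuous_attains_sup[OF cS False continuous_on_subset[OF Ck_on_imp_continuous_on[OF w2] S\<Omega>]] by blast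
      show ?thesis
      proof (rule that[of "- w z0 / 2"])
        show "- w z0 / 2 > 0" by (simp add: w_def)
        fix z assume "z \<in> \<Omega>" "r z \<le> - d"
        then have "z \<in> S" using \<Omega>U0 closure_subset by (auto simp: S_def)
        then show "w z \<le> - 2 * (- w z0 / 2)" using z0(2) by simp
      qed
    qed
  qed
  define v where "v z = flat a (w z)" for z
  have v2: "Ck_on 2 \<Omega> v" unfolding v_def[abs_def] by (rule Ck_on_flat[OF open_\<Omega> w2])
  have vneg: "v z < 0" for z unfolding v_def by (rule flat_neg[OF a(1)]) (simp add: w_def)
  have hv: "0 \<le> hess v z Y" if z: "z \<in> \<Omega>" for z Y
  proof -
    have "hess v z Y = flat' a (w z) * hess w z Y + flat'' a (w z) * (cmod (vec10 Y (cplx w) z))\<^sup>2"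
      unfolding v_def[abs_def]
      by (rule hess_compose_real[OF open_\<Omega> z w2, where g="flat a" and g'="flat' a"]) (rule DERIV_flat DERIV_flat')+
    also have "\<dots> \<ge> 0"
    proof (cases "w z \<le> - 2 * a")
      case True
      then show ?thesis using flat_left[OF a(1)] by simp
    next
      case False
      then have "- d < r z" using a(2)[OF z] by force
      then show ?thesis
        using hw[OF z] flat'_nonneg[OF a(1)] flat''_nonneg[OF a(1)] by (intro add_nonneg_nonneg mult_nonneg_nonneg) auto
    qed
    finally show ?thesis .
  qed
  define \<rho>0 where "\<rho>0 z = r z * exp (\<psi> z)" for z
  \<comment> \<open>Inside \<Omega> the power is undone, so that
    \<open>- ((- \<rho> z) powr \<tau>)\<close> is exactly v; outside, \<rho> is given by the
    formula that is regular across \<open>M\<close>.\<close>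
  define \<rho> where "\<rho> z = (if z \<in> \<Omega> then - exp (1 / \<tau> * ln (- v z)) else \<rho>0 z)" for z
  have \<rho>02: "Ck_on 2 U0 \<rho>0" unfolding \<rho>0_def[abs_def] by (intro Ck_on_mult Ck_on_exp C_r \<psi>\<Omega> open_U0)
  \<comment> \<open>At points of Q inside \<Omega> one has \<open>w z > - a\<close>, where
    \<open>flat a\<close> is the identity, so both formulas for \<rho> agree; outside \<Omega> the
    function \<open>\<rho>0\<close> is nonnegative, so Q contains
    \<open>U0 - \<Omega>\<close>.\<close>
  define Q where "Q = U0 \<inter> \<rho>0 -` {- exp (ln a / \<tau>)<..}"
  have openQ: "open Q"
    unfolding Q_def by (rule continuous_open_preimage[OF Ck_on_imp_continuous_on[OF \<rho>02] open_U0 open_greaterThan])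
  have \<rho>Q: "\<rho> z = \<rho>0 z" if "z \<in> Q" for z
  proof (cases "z \<in> \<Omega>")
    case True
    have e: "\<rho>0 z = - exp (g z)"
      using rneg[OF True] by (simp add: \<rho>0_def g_def exp_add)
    then have "exp (g z) < exp (ln a / \<tau>)" using that by (simp add: Q_def)
    then have "\<tau> * g z < ln a" using \<tau> by (simp add: field_simps)
    then have "- a < w z" using a(1) unfolding w_def by (metis exp_less_mono exp_ln neg_less_iff_less)
    then have "v z = w z" unfolding v_def using flat_id[OF a(1)] by simp
    then show ?thesis using True \<tau> unfolding \<rho>_def e by (simp add: w_def)
  qed (simp add: \<rho>_def)
  have \<rho>2: "Ck_on 2 U0 \<rho>"
  proof (rule Ck_on_local)
    fix z assume z: "z \<in> U0"
    show "\<exists>V. open V \<and> z \<in> V \<and> Ck_on 2 V \<rho>"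
    proof (cases "z \<in> \<Omega>")
      case True
      have "Ck_on 2 \<Omega> (\<lambda>z. - exp (1 / \<tau> * ln (- v z)))"
        by (intro Ck_on_minus Ck_on_exp Ck_on_cmult Ck_on_ln v2 open_\<Omega>) (use vneg in auto)
      then have "Ck_on 2 \<Omega> \<rho>" by (rule Ck_on_cong_open[OF open_\<Omega>, rotated]) (simp add: \<rho>_def)
      then show ?thesis using True open_\<Omega> by blast
    next
      case False
      then have "r z \<ge> 0" using z \<Omega>_eq by auto
      then have "\<rho>0 z \<ge> 0" by (simp add: \<rho>0_def)
      then have "z \<in> Q"
        using z less_le_trans[of "- exp (ln a / \<tau>)" 0] by (simp add: Q_def)
      moreover have "Ck_on 2 Q \<rho>"
        by (rule Ck_on_cong_open[OF openQ _ Ck_on_subset[OF \<rho>02]]) (auto simp: \<rho>Q Q_def)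
      ultimately show ?thesis using openQ by blast
    qed
  qed
  have def: "defining_function \<Omega> \<rho>"
    unfolding defining_function_def
  proof (intro conjI exI[of _ U0] ballI)
    show "\<Omega> = {z \<in> U0. \<rho> z < 0}"
    proof (rule set_eqI)
      fix z show "z \<in> \<Omega> \<longleftrightarrow> z \<in> {z \<in> U0. \<rho> z < 0}"
        using \<Omega>U0 \<Omega>_eq by (cases "z \<in> \<Omega>") (auto simp: \<rho>_def \<rho>0_def mult_less_0_iff)
    qed
    fix p assume p: "p \<in> M"
    have pU: "p \<in> U" "p \<in> U0" using p M_sub by auto
    have pQ: "p \<in> Q" using pU exp_gt_zero[of "ln a / \<tau>"] by (simp add: Q_def \<rho>0_def r_M[OF p])
    have e: "(exp has_real_derivative exp (\<psi> p)) (at (\<psi> p))" by simp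
    have "dd u \<rho> p = exp (\<psi> p) * dd u r p" for u
    proof -
      have "dd u \<rho> p = dd u \<rho>0 p" by (rule dd_cong_open[OF openQ pQ \<rho>Q])
      also have "\<dots> = r p * (exp (\<psi> p) * dd u \<psi> p) + dd u r p * exp (\<psi> p)"
        unfolding \<rho>0_def[abs_def]
        by (rule dd_eqI[OF has_derivative_mult[OF has_derivative_dd[OF rd[OF pU(1)]]
              has_derivative_compose_real[OF Ck_on_2_diff[OF \<psi>(1) UNIV_I] e]]])
      finally show ?thesis by (simp add: r_M[OF p])
    qed
    then have "dd (nrm r p) \<rho> p \<noteq> 0" by (simp add: dd_nu[OF pU(1)])
    then show "gradient \<rho> p \<noteq> 0"
      using inner_gradient[OF Ck_on_2_diff[OF \<rho>2 pU(2)], of "nrm r p"] by auto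
  qed (use open_U0 closure_U0 \<rho>2 in auto)
  have "plurisubharmonic_on \<Omega> (\<lambda>z. - ((- \<rho> z) powr \<tau>))"
  proof (rule plurisubharmonic_onI[OF open_\<Omega>])
    have e: "v z = - ((- \<rho> z) powr \<tau>)" if "z \<in> \<Omega>" for z
      using that vneg[of z] \<tau> by (simp add: \<rho>_def powr_def)
    show "Ck_on 2 \<Omega> (\<lambda>z. - ((- \<rho> z) powr \<tau>))" by (rule Ck_on_cong_open[OF open_\<Omega> e v2])
    show "0 \<le> hess (\<lambda>z. - ((- \<rho> z) powr \<tau>)) q X" if "q \<in> \<Omega>" for q X
    proof -
      have "hess v q X = hess (\<lambda>z. - ((- \<rho> z) powr \<tau>)) q X" by (rule hess_cong_open[OF open_\<Omega> that e])
      then show ?thesis using hv[OF that, of X] by simp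
    qed
  qed
  then show ?thesis using def \<tau> \<tau>1 unfolding DF_exponents_def by blast
qed

end

text \<open>Transfer of exponents with an arbitrarily small loss in both directions leaves the
  supremum unchanged, although the sets themselves may differ at their upper end.\<close>

lemma Sup_eq_if_cofinal:
  fixes A B :: "real set"
  assumes "A \<subseteq> {0<..<1}" "B \<subseteq> {0<..<1}"
    and AB: "\<And>a b. a \<in> A \<Longrightarrow> 0 < b \<Longrightarrow> b < a \<Longrightarrow> b \<in> B"
    and BA: "\<And>a b. b \<in> B \<Longrightarrow> 0 < a \<Longrightarrow> a < b \<Longrightarrow> a \<in> A"
  shows "Sup A = Sup B"
proof -
  have le: "Sup A \<le> Sup B"
    if "A \<noteq> {}" "A \<subseteq> {0<..<1}" "B \<subseteq> {0<..<1}" "\<And>a b. a \<in> A \<Longrightarrow> 0 < b \<Longrightarrow> b < a \<Longrightarrow> b \<in> B" for A B :: "real set"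
  proof (rule cSup_least[OF that(1)])
    fix a assume a: "a \<in> A"
    have "bdd_above B" using that(3) by (intro bdd_aboveI[of _ 1]) (auto dest: subsetD)
    then have "b \<le> Sup B" if "0 < b" "b < a" for b using \<open>\<And>a b. a \<in> A \<Longrightarrow> 0 < b \<Longrightarrow> b < a \<Longrightarrow> b \<in> B\<close>[OF a that] by (rule cSup_upper[rotated])
    moreover have "0 < a" using a that(2) by auto
    ultimately show "a \<le> Sup B" by (intro dense_le_bounded[of 0 a]) auto
  qed
  \<comment> \<open>Settles the case without exponents: then both sides are the same unspecified
    value \<open>Sup {}\<close>.\<close>
  have "A = {} \<longleftrightarrow> B = {}"
  proof -
    have "B \<noteq> {}" if "a \<in> A" for a using AB[OF that, of "a / 2"] that assms(1) by (auto dest: subsetD)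
    moreover have "A \<noteq> {}" if "b \<in> B" for b using BA[OF that, of "b / 2"] that assms(2) by (auto dest: subsetD)
    ultimately show ?thesis by blast
  qed
  then show ?thesis
  proof (cases "A = {}")
    case False
    then have "B \<noteq> {}" using \<open>A = {} \<longleftrightarrow> B = {}\<close> by simp
    show ?thesis by (rule antisym[OF le[OF False assms(1,2) AB] le[OF \<open>B \<noteq> {}\<close> assms(2,1) BA]])
  qed simp
qed

theorem theorem3p9:
  fixes \<Omega> :: "(complex ^ 'n) set" and r :: "complex ^ 'n \<Rightarrow> real"
  assumes "open \<Omega>" and "connected \<Omega>" and "\<Omega> \<noteq> {}"
    and "bounded \<Omega>"
    and "smooth_defining_function \<Omega> r"
    and "levi_pseudoconvex (frontier \<Omega>) r"
  shows "DF_index \<Omega> = hypersurface_DF_index (frontier \<Omega>) r"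
proof -
  obtain U0 where U0: "open U0" "closure \<Omega> \<subseteq> U0" "smooth_on U0 r" "\<Omega> = {z \<in> U0. r z < 0}"
    "\<forall>p\<in>frontier \<Omega>. gradient r p \<noteq> 0"
    using assms(5) unfolding smooth_defining_function_def by blast
  interpret smooth_domain \<Omega> r U0
    using assms U0 by unfold_locales blast+
  show ?thesis
    unfolding DF_index_def hypersurface_DF_index_def
  proof (rule Sup_eq_if_cofinal)
    fix \<tau> \<eta> assume \<tau>: "\<tau> \<in> DF_exponents \<Omega>" and \<eta>: "0 < \<eta>" "\<eta> < \<tau>"
    obtain \<rho> where \<rho>: "0 < \<tau>" "\<tau> < 1" "defining_function \<Omega> \<rho>" "plurisubharmonic_on \<Omega> (\<lambda>z. - ((- \<rho> z) powr \<tau>))"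
      using \<tau> unfolding DF_exponents_def by blast
    obtain V0 where V0: "open V0" "closure \<Omega> \<subseteq> V0" "Ck_on 2 V0 \<rho>" "\<Omega> = {z \<in> V0. \<rho> z < 0}"
      "\<forall>p\<in>frontier \<Omega>. gradient \<rho> p \<noteq> 0"
      using \<rho>(3) unfolding defining_function_def by blast
    interpret DF_domain \<Omega> r U0 \<rho> V0 \<tau>
      using V0 \<rho> by unfold_locales blast+
    show "\<eta> \<in> hypersurface_DF_exponents (frontier \<Omega>) r" by (rule hypersurface_exponent[OF \<eta>])
  next
    fix \<tau> \<eta> assume "\<eta> \<in> hypersurface_DF_exponents (frontier \<Omega>) r" "0 < \<tau>" "\<tau> < \<eta>"
    then show "\<tau> \<in> DF_exponents \<Omega>" by (rule DF_exponent)
  qed (auto simp: DF_exponents_def hypersurface_DF_exponents_def)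
qed

end
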